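(* Let $T$ be a countable Dedekind domain such that $T/J$ is finite for every nonzero proper ideal $J\subset T$, equipped with the discrete $\sigma$-algebra. Let $\mathcal{I}$ be the set of all nonzero ideals $I$ of $T$ such that $T/I$ is an elementary abelian group, and let $\epsilon=(\epsilon_I)_{I\in\mathcal{I}}\in\mathbb{R}_{>0}^{\mathcal{I}}$. Let $P=\{\mathfrak{p}_1,\dots,\mathfrak{p}_k\}$ be a finite set of nonzero prime ideals of $T$ and let $T_{\mathfrak{p}_i}=\varprojlim_m T/\mathfrak{p}_i^m$. Let $N$ be a finite $T$-module annihilated by a product of powers of elements of $P$. Let $u$ be a positive integer and, for each $n$, let $M(n)$ be an $\epsilon$-balanced $n\times(n+u)$ random matrix with entries in $T$. Then \[\lim_{n\to\infty}\mathbb{P}\left(\mathrm{cok}(M(n))\otimes \prod_{i=1}^kT_{\mathfrak{p}_i}\simeq N\right)=\frac{1}{|\mathrm{Aut}(N)||N|^u}\prod_{i=1}^k\prod_{j=1}^\infty \left(1-|T/\mathfrak{p}_i|^{-u-j}\right).\]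
   Context: An abelian group is elementary abelian if it is isomorphic to $(\mathbb{Z}/p\mathbb{Z})^m$ for some prime $p$ and integer $m>0$. If $V$ is an $\mathbb{F}_p$-vector space, a random variable $y$ in $V$ is $\epsilon'$-balanced (for a real $\epsilon'>0$) if $\mathbb{P}(y\in H)\leq 1-\epsilon'$ for every proper affine $\mathbb{F}_p$-subspace $H\subset V$ (a set $a+H'$ with $H'\subsetneq V$ an $\mathbb{F}_p$-subspace). A random variable $y$ valued in $T$ is $\epsilon$-balanced if for every $I\in\mathcal{I}$ the image of $y$ in $T/I$ (an $\mathbb{F}_p$-vector space for the appropriate $p$) is $\epsilon_I$-balanced. A random matrix with entries in $T$ is $\epsilon$-balanced if its entries are independent and each is $\epsilon$-balanced. For a matrix $M$ with $n$ rows and $n+u$ columns, $\mathrm{cok}(M)=T^n/M(T^{n+u})$. *)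

theory Defs
  imports "HOL-Probability.Probability" "HOL-Library.Countable"
    "HOL-Computational_Algebra.Polynomial" "HOL-Computational_Algebra.Fraction_Field"
begin

definition ideal :: "'a::comm_ring_1 set \<Rightarrow> bool" where
  "ideal I \<longleftrightarrow> 0 \<in> I \<and> (\<forall>a\<in>I. \<forall>b\<in>I. a + b \<in> I) \<and> (\<forall>a\<in>I. \<forall>r. r * a \<in> I)"

definition ideal_gen :: "'a::comm_ring_1 set \<Rightarrow> 'a set" where
  "ideal_gen S = \<Inter>{I. ideal I \<and> S \<subseteq> I}"

definition ideal_prod :: "'a::comm_ring_1 set \<Rightarrow> 'a set \<Rightarrow> 'a set" where
  "ideal_prod I J = ideal_gen {a * b | a b. a \<in> I \<and> b \<in> J}"

definition ideal_pow :: "'a::comm_ring_1 set \<Rightarrow> nat \<Rightarrow> 'a set" where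
  "ideal_pow I m = (ideal_prod I ^^ m) UNIV"

definition prime_ideal :: "'a::comm_ring_1 set \<Rightarrow> bool" where
  "prime_ideal P \<longleftrightarrow> ideal P \<and> P \<noteq> UNIV \<and> (\<forall>a b. a * b \<in> P \<longrightarrow> a \<in> P \<or> b \<in> P)"

definition maximal_ideal :: "'a::comm_ring_1 set \<Rightarrow> bool" where
  "maximal_ideal P \<longleftrightarrow> ideal P \<and> P \<noteq> UNIV \<and> (\<forall>J. ideal J \<and> P \<subseteq> J \<longrightarrow> J = P \<or> J = UNIV)"

definition quotient_set :: "'a::comm_ring_1 set \<Rightarrow> 'a set set" where
  "quotient_set J = range (\<lambda>x. (\<lambda>j. x + j) ` J)"

definition noetherian_ring :: "'a::comm_ring_1 itself \<Rightarrow> bool" where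
  "noetherian_ring _ \<longleftrightarrow> (\<forall>I::'a set. ideal I \<longrightarrow> (\<exists>F. finite F \<and> I = ideal_gen F))"

definition integrally_closed :: "'a::idom itself \<Rightarrow> bool" where
  "integrally_closed _ \<longleftrightarrow>
     (\<forall>x :: 'a fract. (\<exists>q :: 'a poly. lead_coeff q = 1 \<and> poly (map_poly (\<lambda>a. Fract a 1) q) x = 0)
        \<longrightarrow> x \<in> range (\<lambda>a. Fract a 1))"

definition dedekind_domain :: "'a::idom itself \<Rightarrow> bool" where
  "dedekind_domain T \<longleftrightarrow> noetherian_ring T \<and> integrally_closed T \<and>
     (\<forall>P::'a set. prime_ideal P \<and> P \<noteq> {0} \<longrightarrow> maximal_ideal P)"

text \<open>\<open>T/I\<close> is elementary abelian: there are a prime \<open>p\<close>, \<open>m > 0\<close> and an additive surjection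
  \<open>T \<rightarrow> (\<int>/p\<int>)^m\<close> with kernel \<open>I\<close> (i.e. \<open>T/I \<cong> (\<int>/p\<int>)^m\<close>). Elements of \<open>(\<int>/p\<int>)^m\<close> are
  represented by extensional functions \<open>{..<m} \<rightarrow> {..<p}\<close> with coordinatewise addition mod \<open>p\<close>.\<close>
definition elem_abelian_quot :: "'a::comm_ring_1 set \<Rightarrow> bool" where
  "elem_abelian_quot I \<longleftrightarrow> (\<exists>(p::nat) (m::nat) (\<phi>::'a \<Rightarrow> nat \<Rightarrow> nat). prime p \<and> m > 0 \<and>
      \<phi> ` UNIV = ({..<m} \<rightarrow>\<^sub>E {..<p}) \<and>
      (\<forall>x y. \<phi> (x + y) = (\<lambda>i. if i < m then (\<phi> x i + \<phi> y i) mod p else undefined)) \<and>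
      (\<forall>x. \<phi> x = (\<lambda>i. if i < m then 0 else undefined) \<longleftrightarrow> x \<in> I))"

definition ideals_I :: "'a::comm_ring_1 set set" where
  "ideals_I = {I. ideal I \<and> I \<noteq> {0} \<and> elem_abelian_quot I}"

definition add_subgroup :: "'a::comm_ring_1 set \<Rightarrow> bool" where
  "add_subgroup H \<longleftrightarrow> 0 \<in> H \<and> (\<forall>a\<in>H. \<forall>b\<in>H. a + b \<in> H \<and> - a \<in> H)"

text \<open>A random element \<open>y\<close> of \<open>T\<close> (given by its law \<open>d\<close>) is \<open>\<epsilon>\<close>-balanced. For \<open>I \<in> \<I>\<close>, \<open>T/I\<close> is an
  \<open>\<bbbF>\<^sub>p\<close>-vector space whose \<open>\<bbbF>\<^sub>p\<close>-subspaces are exactly its additive subgroups; these correspond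
  to additive subgroups \<open>H\<close> of \<open>T\<close> containing \<open>I\<close>, and proper affine subspaces \<open>a + H'\<close> of \<open>T/I\<close>
  pull back to cosets \<open>a + H\<close> with \<open>I \<subseteq> H \<noteq> T\<close>.\<close>
definition balanced :: "('a::comm_ring_1 set \<Rightarrow> real) \<Rightarrow> 'a pmf \<Rightarrow> bool" where
  "balanced \<epsilon> d \<longleftrightarrow> (\<forall>I\<in>ideals_I. \<forall>H a. add_subgroup H \<and> I \<subseteq> H \<and> H \<noteq> UNIV \<longrightarrow>
      measure_pmf.prob d ((\<lambda>h. a + h) ` H) \<le> 1 - \<epsilon> I)"

text \<open>The ring \<open>R = \<Prod>\<^sub>{i<k} T\<^sub>p\<^sub>i\<close>, with \<open>T\<^sub>p = lim T/p^m\<close>: an element is represented by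
  \<open>r :: nat \<Rightarrow> nat \<Rightarrow> 'a\<close>, where \<open>r i m\<close> is a representative of the component in \<open>T/(p i)^m\<close>,
  subject to compatibility; two representatives give the same element iff their difference
  is \<open>null\<close>.\<close>
definition compat :: "(nat \<Rightarrow> 'a::comm_ring_1 set) \<Rightarrow> nat \<Rightarrow> (nat \<Rightarrow> nat \<Rightarrow> 'a) \<Rightarrow> bool" where
  "compat p k r \<longleftrightarrow> (\<forall>i<k. \<forall>m. r i (Suc m) - r i m \<in> ideal_pow (p i) m)"

definition null :: "(nat \<Rightarrow> 'a::comm_ring_1 set) \<Rightarrow> nat \<Rightarrow> (nat \<Rightarrow> nat \<Rightarrow> 'a) \<Rightarrow> bool" where
  "null p k r \<longleftrightarrow> (\<forall>i<k. \<forall>m. r i m \<in> ideal_pow (p i) m)"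

definition Rvec :: "(nat \<Rightarrow> 'a::comm_ring_1 set) \<Rightarrow> nat \<Rightarrow> nat \<Rightarrow> (nat \<Rightarrow> nat \<Rightarrow> nat \<Rightarrow> 'a) set" where
  "Rvec p k n = {v. (\<forall>j<n. compat p k (v j)) \<and> (\<forall>j\<ge>n. \<forall>i m. v j i m = 0)}"

definition cok_rel ::
  "(nat \<Rightarrow> 'a::comm_ring_1 set) \<Rightarrow> nat \<Rightarrow> nat \<Rightarrow> nat \<Rightarrow> (nat \<times> nat \<Rightarrow> 'a)
    \<Rightarrow> (nat \<Rightarrow> nat \<Rightarrow> nat \<Rightarrow> 'a) \<Rightarrow> (nat \<Rightarrow> nat \<Rightarrow> nat \<Rightarrow> 'a) \<Rightarrow> bool" where
  "cok_rel p k n u M v w \<longleftrightarrow> (\<exists>x\<in>Rvec p k (n + u). \<forall>j<n.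
      null p k (\<lambda>i m. v j i m - w j i m - (\<Sum>l<n + u. M (j, l) * x l i m)))"

text \<open>\<open>cok(M) \<otimes>\<^sub>T \<Prod>\<^sub>i T\<^sub>p\<^sub>i \<cong> N\<close> as \<open>T\<close>-modules. By right exactness of \<open>\<otimes>\<close>,
  \<open>cok(M) \<otimes> R = R^n / M R^(n+u)\<close>; an isomorphism with \<open>N\<close> is the same as a surjective \<open>T\<close>-linear
  map \<open>R^n \<rightarrow> N\<close> whose kernel is exactly \<open>M R^(n+u)\<close>.\<close>
definition cok_tensor_iso ::
  "(nat \<Rightarrow> 'a::comm_ring_1 set) \<Rightarrow> nat \<Rightarrow> nat \<Rightarrow> nat \<Rightarrow> ('a \<Rightarrow> 'n::ab_group_add \<Rightarrow> 'n)
    \<Rightarrow> (nat \<times> nat \<Rightarrow> 'a) \<Rightarrow> bool" where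
  "cok_tensor_iso p k n u smul M \<longleftrightarrow> (\<exists>f :: (nat \<Rightarrow> nat \<Rightarrow> nat \<Rightarrow> 'a) \<Rightarrow> 'n.
      f ` Rvec p k n = UNIV \<and>
      (\<forall>v\<in>Rvec p k n. \<forall>w\<in>Rvec p k n. f (\<lambda>j i m. v j i m + w j i m) = f v + f w) \<and>
      (\<forall>t. \<forall>v\<in>Rvec p k n. f (\<lambda>j i m. t * v j i m) = smul t (f v)) \<and>
      (\<forall>v\<in>Rvec p k n. \<forall>w\<in>Rvec p k n. f v = f w \<longleftrightarrow> cok_rel p k n u M v w))"

fun prod_pow_ideal :: "(nat \<Rightarrow> 'a::comm_ring_1 set) \<Rightarrow> (nat \<Rightarrow> nat) \<Rightarrow> nat \<Rightarrow> 'a set" where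
  "prod_pow_ideal p e 0 = UNIV"
| "prod_pow_ideal p e (Suc i) = ideal_prod (prod_pow_ideal p e i) (ideal_pow (p i) (e i))"

definition module_auts :: "('a::comm_ring_1 \<Rightarrow> 'n::ab_group_add \<Rightarrow> 'n) \<Rightarrow> ('n \<Rightarrow> 'n) set" where
  "module_auts smul = {f. bij f \<and> module_hom smul smul f}"

end

theory Submission
  imports Defs "HOL-Library.Function_Algebras"
begin

text \<open>
  Let \<open>E\<close> be so large that \<open>Q E = \<Inter>\<^sub>i p\<^sub>i\<^sup>E\<close> kills \<open>N\<close>. An isomorphism \<open>cok(M) \<otimes> R \<cong> N\<close> is the same as a surjection
  \<open>F\<^sub>g : T\<^sup>n \<rightarrow> N\<close>, given by \<open>g \<in> N\<^sup>n\<close>, whose kernel \<open>K\<^sub>g\<close> contains the columns of \<open>M\<close> and equals their span modulo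
  \<open>p\<^sub>i K\<^sub>g\<close> for every \<open>i\<close> (Nakayama and successive approximation). If there is such a \<open>g\<close> then there are exactly \<open>|Aut N|\<close>,
  so it suffices to sum over \<open>g\<close> the probability that \<open>g\<close> presents \<open>M\<close>.

  Fix \<open>s\<close> and condition on the first \<open>n - s\<close> columns. Up to probability \<open>O(2^(-s))\<close> they are linearly independent modulo each
  \<open>p\<^sub>i\<close>, and every linear form modulo \<open>p\<^sub>i\<close> vanishing on them has linearly many nonzero coefficients (union bounds). In this
  case about \<open>|N|\<^sup>s\<close> surjections \<open>F\<^sub>g\<close> kill these columns, and each of the last \<open>s + u\<close> columns is almost
  uniformly distributed modulo the finite-index submodule \<open>K\<^sub>g \<inter> \<Inter>\<^sub>i (span + p\<^sub>i K\<^sub>g)\<close>, which decides whether \<open>g\<close>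
  presents \<open>M\<close>. Counting generating tuples of the quotients, which are \<open>s\<close>-dimensional over \<open>T/p\<^sub>i\<close>, gives
  \<open>|N|\<^sup>s \<cdot> |N|^(-s-u) \<cdot> \<Prod>\<^sub>i \<Prod>j<s. (1 - q\<^sub>i^(-u-j-1))\<close>; let first \<open>n\<close> and then \<open>s\<close> tend to infinity.
\<close>

section \<open>Subgroups, transversals and module operations\<close>

text \<open>Neither characters nor moments occur. Counting exactly |Aut N| presentations replaces
  the moment problem, and near-uniformity of a column comes from a growth argument for sets of
  cosets of non-negligible mass. This suits a hypothesis that bounds additive cosets only over
  ideals with elementary abelian quotient, whereas entries matter modulo \<open>Q (Suc E)\<close>.

  The parameter s resolves a conflict. The submodule deciding the presentation has an index that
  grows with the number of missing columns; this number must stay bounded while n grows, so that the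
  mixing error, whose rate depends on the index, dies out. But the bound for dependence of n - s
  columns of length n modulo p_i does not improve with n, hence s must grow afterwards.

  The exponent E + 1 appears because K contains Q E T^n, so Q (E + 1) T^n already lies in p_i K.
  Kernels stay inside T^n; the completion enters only as compatible sequences, and [K : p_i K] =
  [T^n : p_i T^n] is proved with a local generator of p_i.\<close>

definition subgrp :: "'v::ab_group_add set \<Rightarrow> bool" where
  "subgrp H \<longleftrightarrow> 0 \<in> H \<and> (\<forall>a\<in>H. \<forall>b\<in>H. a - b \<in> H)"

definition transv :: "'v::ab_group_add set \<Rightarrow> 'v set \<Rightarrow> 'v set \<Rightarrow> bool" where
  "transv K H R \<longleftrightarrow> R \<subseteq> K \<and> (\<forall>x\<in>K. \<exists>!r. r \<in> R \<and> x - r \<in> H)"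

text \<open>A relation rather than a number, so that finiteness of the index is part of the
  assertion.\<close>

definition has_index :: "'v::ab_group_add set \<Rightarrow> 'v set \<Rightarrow> nat \<Rightarrow> bool" where
  "has_index K H n \<longleftrightarrow> (\<exists>R. finite R \<and> card R = n \<and> transv K H R)"

lemma subgrp_zero: "subgrp H \<Longrightarrow> 0 \<in> H"
  and subgrp_diff: "subgrp H \<Longrightarrow> a \<in> H \<Longrightarrow> b \<in> H \<Longrightarrow> a - b \<in> H"
  by (auto simp: subgrp_def)

lemma subgrp_neg: "subgrp H \<Longrightarrow> a \<in> H \<Longrightarrow> - a \<in> H"
  using subgrp_diff[of H 0 a] subgrp_zero[of H] by simp

lemma subgrp_add: "subgrp H \<Longrightarrow> a \<in> H \<Longrightarrow> b \<in> H \<Longrightarrow> a + b \<in> H"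
  using subgrp_diff[of H a "- b"] subgrp_neg[of H b] by simp

lemma subgrp_diff_commute: "subgrp H \<Longrightarrow> a - b \<in> H \<longleftrightarrow> b - a \<in> H"
  using subgrp_neg[of H "a - b"] subgrp_neg[of H "b - a"] by auto

lemma subgrp_diff_trans: "subgrp H \<Longrightarrow> a - b \<in> H \<Longrightarrow> b - c \<in> H \<Longrightarrow> a - c \<in> H"
  using subgrp_add[of H "a - b" "b - c"] by simp

lemma transv_bij_classifier:
  assumes "transv K H R" and f: "\<And>x y. x \<in> K \<Longrightarrow> y \<in> K \<Longrightarrow> f x = f y \<longleftrightarrow> x - y \<in> H"
  shows "bij_betw f R (f ` K)"
proof (rule bij_betw_imageI)
  have RK: "R \<subseteq> K" and ex: "\<And>x. x \<in> K \<Longrightarrow> \<exists>!r. r \<in> R \<and> x - r \<in> H"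
    using assms(1) by (auto simp: transv_def)
  show "inj_on f R"
  proof (rule inj_onI)
    fix x y assume xy: "x \<in> R" "y \<in> R" "f x = f y"
    have "x - y \<in> H" "x - x \<in> H" "x \<in> K" using f[of x y] f[of x x] xy RK by auto
    thus "x = y" using ex[of x] xy by blast
  qed
  show "f ` R = f ` K"
  proof
    show "f ` K \<subseteq> f ` R"
    proof
      fix z assume "z \<in> f ` K"
      then obtain x where x: "x \<in> K" "z = f x" by auto
      then obtain r where "r \<in> R" "x - r \<in> H" using ex[of x] by auto
      thus "z \<in> f ` R" using f[of x r] x RK by auto
    qed
  qed (use RK in auto)
qed

lemma ex_transv_of_classifier:
  assumes f: "\<And>x y. x \<in> K \<Longrightarrow> y \<in> K \<Longrightarrow> f x = f y \<longleftrightarrow> x - y \<in> H"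
  shows "\<exists>R. transv K H R"
proof -
  define R where "R = inv_into K f ` (f ` K)"
  have "transv K H R"
    unfolding transv_def
  proof (intro conjI ballI)
    show "R \<subseteq> K" by (auto simp: R_def inv_into_into)
    fix x assume x: "x \<in> K"
    show "\<exists>!r. r \<in> R \<and> x - r \<in> H"
    proof (rule ex1I[of _ "inv_into K f (f x)"])
      show "inv_into K f (f x) \<in> R \<and> x - inv_into K f (f x) \<in> H"
        using x f[of x "inv_into K f (f x)"] by (auto simp: R_def f_inv_into_f inv_into_into)
    next
      fix r assume r: "r \<in> R \<and> x - r \<in> H"
      then obtain y where y: "y \<in> K" "r = inv_into K f (f y)" by (auto simp: R_def)
      have "f r = f y" "r \<in> K" using y by (auto simp: f_inv_into_f inv_into_into)
      moreover have "f x = f r" using f[of x r] r x \<open>r \<in> K\<close> by auto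
      ultimately show "r = inv_into K f (f x)" using y by simp
    qed
  qed
  thus ?thesis ..
qed

text \<open>Indices are computed through a complete invariant of cosets: \<open>f\<close> may be a
  linear map with kernel \<open>H\<close>, a tuple of residues, or the coset itself.\<close>

lemma has_index_classifier:
  assumes "\<And>x y. x \<in> K \<Longrightarrow> y \<in> K \<Longrightarrow> f x = f y \<longleftrightarrow> x - y \<in> H"
  shows "has_index K H n \<longleftrightarrow> finite (f ` K) \<and> card (f ` K) = n"
proof
  assume "has_index K H n"
  then obtain R where "finite R" "card R = n" "transv K H R" by (auto simp: has_index_def)
  thus "finite (f ` K) \<and> card (f ` K) = n"
    using transv_bij_classifier[of K H R f] assms bij_betw_finite[of f R "f ` K"]
      bij_betw_same_card[of f R "f ` K"] by auto
next
  assume n: "finite (f ` K) \<and> card (f ` K) = n"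
  obtain R where R: "transv K H R" using ex_transv_of_classifier[OF assms] by blast
  thus "has_index K H n" unfolding has_index_def
    using transv_bij_classifier[OF R assms] n bij_betw_finite bij_betw_same_card by metis
qed

lemma coset_classifier:
  assumes "subgrp H"
  shows "(+) x ` H = (+) y ` H \<longleftrightarrow> x - y \<in> H"
proof
  assume "(+) x ` H = (+) y ` H"
  hence "x + 0 \<in> (+) y ` H" using subgrp_zero[OF assms] by blast
  thus "x - y \<in> H" by auto
next
  assume xy: "x - y \<in> H"
  have "(+) x ` H \<subseteq> (+) y ` H" if "x - y \<in> H" for x y
  proof
    fix z assume "z \<in> (+) x ` H"
    then obtain h where "h \<in> H" "z = x + h" by auto
    moreover have "z = y + ((x - y) + h)" using \<open>z = x + h\<close> by simp
    ultimately show "z \<in> (+) y ` H" using subgrp_add[OF assms that] by blast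
  qed
  thus "(+) x ` H = (+) y ` H" using xy subgrp_diff_commute[OF assms] by blast
qed

lemma has_index_iff:
  "subgrp H \<Longrightarrow> has_index K H n \<longleftrightarrow> finite ((\<lambda>x. (+) x ` H) ` K) \<and> card ((\<lambda>x. (+) x ` H) ` K) = n"
  by (rule has_index_classifier) (rule coset_classifier)

lemma has_index_unique: "subgrp H \<Longrightarrow> has_index K H n \<Longrightarrow> has_index K H n' \<Longrightarrow> n = n'"
  by (simp add: has_index_iff)

lemma card_transv: "subgrp H \<Longrightarrow> has_index K H n \<Longrightarrow> transv K H R \<Longrightarrow> finite R \<and> card R = n"
  using transv_bij_classifier[of K H R "\<lambda>x. (+) x ` H"] coset_classifier[of H]
    has_index_iff[of H K n] bij_betw_finite[of "\<lambda>x. (+) x ` H" R] bij_betw_same_card[of "\<lambda>x. (+) x ` H" R]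
  by auto

lemma has_index_mult:
  assumes "subgrp K" "subgrp L" "subgrp H" "H \<subseteq> L" "L \<subseteq> K" "has_index K L a" "has_index L H b"
  shows "has_index K H (a * b)"
proof -
  obtain R where R: "finite R" "card R = a" "transv K L R" using assms by (auto simp: has_index_def)
  obtain S where S: "finite S" "card S = b" "transv L H S" using assms by (auto simp: has_index_def)
  have RK: "R \<subseteq> K" and R1: "\<And>x. x \<in> K \<Longrightarrow> \<exists>!r. r \<in> R \<and> x - r \<in> L" using R by (auto simp: transv_def)
  have SL: "S \<subseteq> L" and S1: "\<And>x. x \<in> L \<Longrightarrow> \<exists>!r. r \<in> S \<and> x - r \<in> H" using S by (auto simp: transv_def)
  let ?f = "\<lambda>(r, s). r + s"
  have uniq: "r = r' \<and> s = s'" if "r \<in> R" "r' \<in> R" "s \<in> S" "s' \<in> S" "(r + s) - (r' + s') \<in> H" for r r' s s'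
  proof -
    have "(r + s) - (r' + s') \<in> L" using that assms by auto
    hence "(r + s) - (r' + s') - (s - s') \<in> L" using that SL subgrp_diff[OF assms(2)] by (meson subsetD)
    hence "r - r' \<in> L" by (simp add: algebra_simps)
    moreover have "r - r \<in> L" using subgrp_zero[OF assms(2)] by simp
    ultimately have rr: "r = r'" using R1[of r] that RK by blast
    hence "s - s' \<in> H" using that by simp
    moreover have "s - s \<in> H" using subgrp_zero[OF assms(3)] by simp
    ultimately show ?thesis using S1[of s] that SL rr by blast
  qed
  have inj: "inj_on ?f (R \<times> S)"
    using uniq subgrp_zero[OF assms(3)] by (fastforce simp: inj_on_def)
  have "transv K H (?f ` (R \<times> S))"
    unfolding transv_def
  proof (intro conjI ballI)
    show "?f ` (R \<times> S) \<subseteq> K" using RK SL assms(5) by (auto intro!: subgrp_add[OF assms(1)])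
    fix x assume x: "x \<in> K"
    obtain r where r: "r \<in> R" "x - r \<in> L" using R1[OF x] by auto
    obtain s where s: "s \<in> S" "x - r - s \<in> H" using S1[OF r(2)] by auto
    show "\<exists>!y. y \<in> ?f ` (R \<times> S) \<and> x - y \<in> H"
    proof (rule ex1I[of _ "r + s"])
      show "r + s \<in> ?f ` (R \<times> S) \<and> x - (r + s) \<in> H" using r s by (auto simp: algebra_simps)
      fix y assume y: "y \<in> ?f ` (R \<times> S) \<and> x - y \<in> H"
      then obtain r' s' where y': "r' \<in> R" "s' \<in> S" "y = r' + s'" by auto
      have "(x - y) - (x - r - s) \<in> H" using y s subgrp_diff[OF assms(3)] by blast
      hence "(r + s) - (r' + s') \<in> H" using y' by (simp add: algebra_simps)
      thus "y = r + s" using uniq[OF r(1) y'(1) s(1) y'(2)] y' by simp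
    qed
  qed
  thus ?thesis unfolding has_index_def using inj R S
    by (intro exI[of _ "?f ` (R \<times> S)"]) (simp add: card_image card_cartesian_product)
qed

lemma has_index_mono:
  assumes "subgrp L" "subgrp H" "H \<subseteq> L" "has_index K H n"
  shows "\<exists>a. has_index K L a"
proof -
  obtain R where R: "finite R" "transv K H R" using assms by (auto simp: has_index_def)
  have "(\<lambda>x. (+) x ` L) ` K \<subseteq> (\<lambda>x. (+) x ` L) ` R"
    using R(2) assms(3) coset_classifier[OF assms(1)] unfolding transv_def by blast
  thus ?thesis using R has_index_iff[OF assms(1)] finite_subset finite_imageI by metis
qed

lemma has_index_subset:
  assumes "subgrp H" "L \<subseteq> K" "has_index K H n"
  shows "\<exists>a. has_index L H a"
  using assms has_index_iff[OF assms(1)] finite_subset image_mono by metis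

lemma has_index_factor:
  assumes "subgrp K" "subgrp L" "subgrp H" "H \<subseteq> L" "L \<subseteq> K" "has_index K H n"
  obtains a b where "has_index K L a" "has_index L H b" "n = a * b"
  using has_index_mono[OF assms(2,3,4,6)] has_index_subset[OF assms(3,5,6)]
    has_index_mult[OF assms(1-5)] has_index_unique[OF assms(3,6)] by metis

lemma has_index_pos: "subgrp K \<Longrightarrow> has_index K H n \<Longrightarrow> n > 0"
proof -
  assume K: "subgrp K" and "has_index K H n"
  then obtain R where "finite R" "card R = n" "transv K H R" by (auto simp: has_index_def)
  moreover have "R \<noteq> {}" using \<open>transv K H R\<close> subgrp_zero[OF K] by (auto simp: transv_def)
  ultimately show "n > 0" by auto
qed

lemma has_index_singleton_zero: "finite K \<Longrightarrow> has_index K {0} (card K)"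
  using has_index_classifier[of K id "{0}"] by auto

lemma card_eq_index_mult:
  assumes "finite K" "subgrp K" "subgrp H" "H \<subseteq> K" "has_index K H n"
  shows "card K = n * card H"
proof -
  have "subgrp {0::'a}" by (auto simp: subgrp_def)
  moreover have "finite H" using assms finite_subset by blast
  ultimately show ?thesis
    using has_index_mult[OF assms(2,3) _ _ assms(4,5) has_index_singleton_zero[OF \<open>finite H\<close>]]
      has_index_singleton_zero[OF assms(1)] has_index_unique subgrp_zero[OF assms(3)] by blast
qed

lemma has_index_one: "subgrp K \<Longrightarrow> has_index K H 1 \<Longrightarrow> subgrp H \<Longrightarrow> H \<subseteq> K \<Longrightarrow> H = K"
proof
  assume K: "subgrp K" "has_index K H 1" and H: "subgrp H" "H \<subseteq> K"
  then obtain r where r: "transv K H {r}" by (auto simp: has_index_def card_1_singleton_iff)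
  show "K \<subseteq> H"
  proof
    fix x assume "x \<in> K"
    hence "x - r \<in> H" "0 - r \<in> H" using r subgrp_zero[OF K(1)] by (auto simp: transv_def)
    hence "(x - r) - (0 - r) \<in> H" using subgrp_diff[OF H(1)] by blast
    thus "x \<in> H" by simp
  qed
qed

lemma has_index_refl: "subgrp K \<Longrightarrow> has_index K K 1"
proof -
  assume K: "subgrp K"
  have "transv K K {0}" using K by (auto simp: transv_def subgrp_zero)
  thus ?thesis unfolding has_index_def by (intro exI[of _ "{0}"]) auto
qed

lemma subgrp_not_UNIV_index: "subgrp K \<Longrightarrow> subgrp H \<Longrightarrow> H \<subseteq> K \<Longrightarrow> H \<noteq> K \<Longrightarrow> has_index K H n \<Longrightarrow> n \<ge> 2"
  using has_index_pos[of K H n] has_index_one[of K H] by (cases "n = 1") auto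

section \<open>Sums of subgroups and products of an ideal with a submodule\<close>

definition msum :: "'v::ab_group_add set \<Rightarrow> 'v set \<Rightarrow> 'v set" where
  "msum A B = {a + b | a b. a \<in> A \<and> b \<in> B}"

lemma msumI: "a \<in> A \<Longrightarrow> b \<in> B \<Longrightarrow> a + b \<in> msum A B"
  by (auto simp: msum_def)

lemma msumE:
  assumes "x \<in> msum A B" obtains a b where "a \<in> A" "b \<in> B" "x = a + b"
  using assms by (auto simp: msum_def)

lemma msum_superset1: "0 \<in> B \<Longrightarrow> A \<subseteq> msum A B"
  and msum_superset2: "0 \<in> A \<Longrightarrow> B \<subseteq> msum A B"
  by (auto simp: msum_def, (metis add.right_neutral), (metis add.left_neutral))

lemma msum_mono: "A \<subseteq> A' \<Longrightarrow> B \<subseteq> B' \<Longrightarrow> msum A B \<subseteq> msum A' B'"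
  by (auto simp: msum_def)

lemma msum_least: "subgrp K \<Longrightarrow> A \<subseteq> K \<Longrightarrow> B \<subseteq> K \<Longrightarrow> msum A B \<subseteq> K"
  by (auto simp: msum_def intro: subgrp_add)

lemma subgrp_msum:
  assumes "subgrp A" "subgrp B" shows "subgrp (msum A B)"
  unfolding subgrp_def
proof (intro conjI ballI)
  show "0 \<in> msum A B" using msumI[of 0 A 0 B] assms by (simp add: subgrp_zero)
  fix x y assume "x \<in> msum A B" "y \<in> msum A B"
  then obtain a b a' b' where *: "a \<in> A" "b \<in> B" "x = a + b" "a' \<in> A" "b' \<in> B" "y = a' + b'"
    by (auto elim!: msumE)
  have "x - y = (a - a') + (b - b')" using * by simp
  thus "x - y \<in> msum A B" using msumI[of "a - a'" A "b - b'" B] * assms by (metis subgrp_diff)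
qed

text \<open>The submodule IK. The action is a parameter because the same facts serve T^n and powers
  of N.\<close>

definition imul :: "('a::comm_ring_1 \<Rightarrow> 'v::ab_group_add \<Rightarrow> 'v) \<Rightarrow> 'a set \<Rightarrow> 'v set \<Rightarrow> 'v set" where
  "imul sc I K = module.span sc {sc a v | a v. a \<in> I \<and> v \<in> K}"

context module
begin

lemma subspace_subgrp: "subspace K \<Longrightarrow> subgrp K"
  by (auto simp: subgrp_def subspace_0 subspace_diff)

lemma subspace_msum: "subspace A \<Longrightarrow> subspace B \<Longrightarrow> subspace (msum A B)"
proof (rule subspaceI)
  assume A: "subspace A" "subspace B"
  show "0 \<in> msum A B" using msumI[of 0 A 0 B] A by (simp add: subspace_0)
  show "x + y \<in> msum A B" if "x \<in> msum A B" "y \<in> msum A B" for x y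
    using subgrp_add[OF subgrp_msum that] A subspace_subgrp by blast
  show "scale c x \<in> msum A B" if "x \<in> msum A B" for c x
    using that by (elim msumE) (auto simp: scale_right_distrib A subspace_scale intro!: msumI)
qed

lemma subspace_imul: "subspace (imul scale I K)"
  unfolding imul_def by (rule subspace_span)

lemma imulI: "a \<in> I \<Longrightarrow> v \<in> K \<Longrightarrow> scale a v \<in> imul scale I K"
  unfolding imul_def by (rule span_base) auto

lemma imul_least: "subspace L \<Longrightarrow> (\<And>a v. a \<in> I \<Longrightarrow> v \<in> K \<Longrightarrow> scale a v \<in> L) \<Longrightarrow> imul scale I K \<subseteq> L"
  unfolding imul_def by (rule span_minimal) auto

lemma imul_subset: "subspace K \<Longrightarrow> imul scale I K \<subseteq> K"
  by (rule imul_least) (auto simp: subspace_scale)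

lemma imul_mono: "I \<subseteq> J \<Longrightarrow> K \<subseteq> L \<Longrightarrow> imul scale I K \<subseteq> imul scale J L"
  by (rule imul_least[OF subspace_imul]) (auto intro: imulI)

end

section \<open>Ideals and finitely many maximal ideals\<close>

lemma idealD:
  assumes "ideal I"
  shows ideal_zero: "0 \<in> I" and ideal_add: "a \<in> I \<Longrightarrow> b \<in> I \<Longrightarrow> a + b \<in> I"
    and ideal_mult_left: "a \<in> I \<Longrightarrow> r * a \<in> I" and ideal_mult_right: "a \<in> I \<Longrightarrow> a * r \<in> I"
    and ideal_neg: "a \<in> I \<Longrightarrow> - a \<in> I" and ideal_diff: "a \<in> I \<Longrightarrow> b \<in> I \<Longrightarrow> a - b \<in> I"
proof -
  have *: "0 \<in> I" "\<And>a b. a \<in> I \<Longrightarrow> b \<in> I \<Longrightarrow> a + b \<in> I" "\<And>a r. a \<in> I \<Longrightarrow> r * a \<in> I"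
    using assms by (auto simp: ideal_def)
  have neg: "- a \<in> I" if "a \<in> I" for a using *(3)[of a "- 1"] that by simp
  show "0 \<in> I" "a \<in> I \<Longrightarrow> b \<in> I \<Longrightarrow> a + b \<in> I" "a \<in> I \<Longrightarrow> r * a \<in> I" "a \<in> I \<Longrightarrow> - a \<in> I"
    using * neg by auto
  show "a \<in> I \<Longrightarrow> a * r \<in> I" using *(3)[of a r] by (simp add: mult.commute)
  show "a \<in> I \<Longrightarrow> b \<in> I \<Longrightarrow> a - b \<in> I" using *(2)[of a "- b"] neg[of b] by simp
qed

lemma ideal_sum: "ideal I \<Longrightarrow> (\<And>x. x \<in> A \<Longrightarrow> f x \<in> I) \<Longrightarrow> sum f A \<in> I"
  by (induct A rule: infinite_finite_induct) (auto simp: ideal_zero ideal_add)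

lemma ideal_subgrp: "ideal I \<Longrightarrow> subgrp I"
  by (auto simp: subgrp_def ideal_zero ideal_diff)

lemma module_mult: "module ((*) :: 'a::comm_ring_1 \<Rightarrow> 'a \<Rightarrow> 'a)"
  by standard (simp_all add: algebra_simps)

lemma ideal_iff_subspace: "ideal I \<longleftrightarrow> module.subspace (*) I"
  unfolding ideal_def module.subspace_def[OF module_mult] by blast

lemma ideal_msum: "ideal A \<Longrightarrow> ideal B \<Longrightarrow> ideal (msum A B)"
  unfolding ideal_iff_subspace by (rule module.subspace_msum[OF module_mult])

lemma ideal_principal: "ideal (range (\<lambda>a. a * v))"
  unfolding ideal_def
proof (intro conjI ballI allI)
  show "0 \<in> range (\<lambda>a. a * v)" by (rule range_eqI[of _ _ 0]) simp
  fix x y assume "x \<in> range (\<lambda>a. a * v)" "y \<in> range (\<lambda>a. a * v)"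
  then obtain a b where "x = a * v" "y = b * v" by blast
  thus "x + y \<in> range (\<lambda>a. a * v)" by (intro range_eqI[of _ _ "a + b"]) (simp add: distrib_right)
next
  fix x r assume "x \<in> range (\<lambda>a. a * v)"
  then obtain a where "x = a * v" by blast
  thus "r * x \<in> range (\<lambda>a. a * v)" by (intro range_eqI[of _ _ "r * a"]) (simp add: mult.assoc)
qed

lemma ideal_one:
  assumes "ideal I" shows "1 \<in> I \<longleftrightarrow> I = UNIV"
proof
  assume "1 \<in> I"
  hence "x \<in> I" for x using ideal_mult_left[OF assms, of 1 x] by simp
  thus "I = UNIV" by blast
qed simp

lemma ideal_UNIV: "ideal UNIV"
  by (simp add: ideal_def)

lemma ideal_Inter: "(\<And>i. i \<in> A \<Longrightarrow> ideal (I i)) \<Longrightarrow> ideal (\<Inter>i\<in>A. I i)"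
  by (auto simp: ideal_def)

text \<open>The colon ideal (I : a). Inclusions of ideal products are checked on generators by
  showing that a factor lies in such an ideal.\<close>

lemma ideal_colon:
  assumes "ideal I" shows "ideal {x. a * x \<in> I}"
  unfolding ideal_def mem_Collect_eq
proof (intro conjI ballI allI)
  show "a * 0 \<in> I" using ideal_zero[OF assms] by simp
  show "a * (x + y) \<in> I" if "x \<in> {x. a * x \<in> I}" "y \<in> {x. a * x \<in> I}" for x y
    using that ideal_add[OF assms] by (simp add: distrib_left)
  show "a * (r * x) \<in> I" if "x \<in> {x. a * x \<in> I}" for x r
    using that ideal_mult_left[OF assms, of "a * x" r] by (simp add: mult.left_commute)
qed

lemma ideal_gen_subset: "S \<subseteq> ideal_gen S"
  by (auto simp: ideal_gen_def)

lemma ideal_ideal_gen: "ideal (ideal_gen S)"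
  using ideal_Inter[of "{I. ideal I \<and> S \<subseteq> I}" "\<lambda>I. I"] by (simp add: ideal_gen_def)

lemma ideal_gen_least: "ideal I \<Longrightarrow> S \<subseteq> I \<Longrightarrow> ideal_gen S \<subseteq> I"
  by (auto simp: ideal_gen_def)

lemma ideal_ideal_prod: "ideal (ideal_prod I J)"
  by (simp add: ideal_prod_def ideal_ideal_gen)

lemma ideal_prodI: "a \<in> I \<Longrightarrow> b \<in> J \<Longrightarrow> a * b \<in> ideal_prod I J"
  unfolding ideal_prod_def by (rule subsetD[OF ideal_gen_subset]) blast

lemma ideal_prod_least: "ideal K \<Longrightarrow> (\<And>a b. a \<in> I \<Longrightarrow> b \<in> J \<Longrightarrow> a * b \<in> K) \<Longrightarrow> ideal_prod I J \<subseteq> K"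
  unfolding ideal_prod_def by (rule ideal_gen_least) auto

lemma ideal_prod_subset1: "ideal I \<Longrightarrow> ideal_prod I J \<subseteq> I"
  by (rule ideal_prod_least, assumption, rule ideal_mult_right)

lemma ideal_prod_subset2: "ideal J \<Longrightarrow> ideal_prod I J \<subseteq> J"
  by (rule ideal_prod_least, assumption, rule ideal_mult_left)

lemma ideal_prod_mono: "I \<subseteq> I' \<Longrightarrow> J \<subseteq> J' \<Longrightarrow> ideal_prod I J \<subseteq> ideal_prod I' J'"
  by (rule ideal_prod_least[OF ideal_ideal_prod], rule ideal_prodI) auto

lemma ideal_prod_UNIV: "ideal I \<Longrightarrow> ideal_prod I UNIV = I"
proof
  assume "ideal I"
  show "ideal_prod I UNIV \<subseteq> I" by (rule ideal_prod_subset1) fact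
  show "I \<subseteq> ideal_prod I UNIV" using ideal_prodI[of _ I 1 UNIV] by auto
qed

lemma ideal_prod_assoc_subset: "ideal_prod I (ideal_prod J K) \<subseteq> ideal_prod (ideal_prod I J) K"
proof (rule ideal_prod_least[OF ideal_ideal_prod])
  fix a b assume a: "a \<in> I" and b: "b \<in> ideal_prod J K"
  have "ideal {x. a * x \<in> ideal_prod (ideal_prod I J) K}"
    by (rule ideal_colon[OF ideal_ideal_prod])
  moreover have "a * (x * y) \<in> ideal_prod (ideal_prod I J) K" if "x \<in> J" "y \<in> K" for x y
    using ideal_prodI[OF ideal_prodI[OF a that(1)] that(2)] by (simp add: mult.assoc)
  ultimately have "ideal_prod J K \<subseteq> {x. a * x \<in> ideal_prod (ideal_prod I J) K}"
    by (intro ideal_prod_least) auto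
  thus "a * b \<in> ideal_prod (ideal_prod I J) K" using b by auto
qed

text \<open>The generators \<open>F\<close> are the same for every \<open>x\<close>; only the
  coefficients vary. Infinitely many increments can thus be written over one finite set, which later
  turns a convergent series into a finite sum.\<close>

lemma ideal_prod_gen_sum:
  assumes "finite F" "ideal J" "x \<in> ideal_prod (ideal_gen F) J"
  shows "\<exists>y. (\<forall>b\<in>F. y b \<in> J) \<and> x = (\<Sum>b\<in>F. b * y b)"
proof -
  let ?S = "{x. \<exists>y. (\<forall>b\<in>F. y b \<in> J) \<and> x = (\<Sum>b\<in>F. b * y b)}"
  have S: "ideal ?S"
    unfolding ideal_def
  proof (intro conjI ballI allI)
    show "0 \<in> ?S" using ideal_zero[OF assms(2)] by (auto intro!: exI[of _ "\<lambda>_. 0"])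
    fix a b assume "a \<in> ?S" "b \<in> ?S"
    then obtain y z where "\<forall>b\<in>F. y b \<in> J" "a = (\<Sum>b\<in>F. b * y b)" "\<forall>b\<in>F. z b \<in> J" "b = (\<Sum>b\<in>F. b * z b)"
      by auto
    thus "a + b \<in> ?S"
      by (auto simp: sum.distrib algebra_simps intro!: exI[of _ "\<lambda>b. y b + z b"] ideal_add[OF assms(2)])
  next
    fix a r assume "a \<in> ?S"
    then obtain y where "\<forall>b\<in>F. y b \<in> J" "a = (\<Sum>b\<in>F. b * y b)" by auto
    thus "r * a \<in> ?S"
      by (auto simp: sum_distrib_left algebra_simps intro!: exI[of _ "\<lambda>b. r * y b"] ideal_mult_left[OF assms(2)])
  qed
  have colon: "ideal {a. \<forall>c\<in>J. a * c \<in> S}" if "ideal S" for S :: "'a set"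
  proof -
    have "{a. \<forall>c\<in>J. a * c \<in> S} = (\<Inter>c\<in>J. {a. c * a \<in> S})"
      by (auto simp: mult.commute)
    thus ?thesis using ideal_Inter[of J "\<lambda>c. {a. c * a \<in> S}"] ideal_colon[OF that] by simp
  qed
  note colon[OF S]
  moreover have "b * c \<in> ?S" if "b \<in> F" "c \<in> J" for b c
  proof -
    have "b * c = (\<Sum>b'\<in>F. b' * (if b' = b then c else 0))"
      using that assms(1) by (simp add: if_distrib[of "\<lambda>x. _ * x"] cong: if_cong)
    moreover have "\<forall>b'\<in>F. (if b' = b then c else 0) \<in> J" using that ideal_zero[OF assms(2)] by auto
    ultimately show ?thesis
      by (intro CollectI exI[of _ "\<lambda>b'. if b' = b then c else 0"]) blast
  qed
  ultimately have "ideal_gen F \<subseteq> {a. \<forall>c\<in>J. a * c \<in> ?S}"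
    by (intro ideal_gen_least) auto
  hence "ideal_prod (ideal_gen F) J \<subseteq> ?S"
    by (intro ideal_prod_least[OF S]) auto
  thus ?thesis using assms(3) by auto
qed

lemma ideal_pow_0: "ideal_pow I 0 = UNIV"
  and ideal_pow_Suc: "ideal_pow I (Suc m) = ideal_prod I (ideal_pow I m)"
  by (auto simp: ideal_pow_def)

lemma ideal_ideal_pow: "ideal (ideal_pow I m)"
  by (cases m) (auto simp: ideal_pow_0 ideal_pow_Suc ideal_UNIV ideal_ideal_prod)

lemma ideal_pow_one: "ideal I \<Longrightarrow> ideal_pow I 1 = I"
  by (simp add: ideal_pow_Suc ideal_pow_0 ideal_prod_UNIV)

lemma ideal_pow_antimono: "m \<le> n \<Longrightarrow> ideal_pow I n \<subseteq> ideal_pow I m"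
proof (rule lift_Suc_antimono_le)
  show "ideal_pow I (Suc n) \<subseteq> ideal_pow I n" for n
    unfolding ideal_pow_Suc by (rule ideal_prod_subset2[OF ideal_ideal_pow])
qed

lemma ideal_pow_add: "ideal_pow I (a + b) \<subseteq> ideal_prod (ideal_pow I a) (ideal_pow I b)"
proof (induction a)
  case 0
  have "x \<in> ideal_prod UNIV (ideal_pow I b)" if "x \<in> ideal_pow I b" for x
    using ideal_prodI[OF UNIV_I that, of 1] by simp
  thus ?case by (auto simp: ideal_pow_0)
next
  case (Suc a)
  have "ideal_pow I (Suc a + b) \<subseteq> ideal_prod I (ideal_prod (ideal_pow I a) (ideal_pow I b))"
    using ideal_prod_mono[OF subset_refl Suc, of I] by (simp add: ideal_pow_Suc)
  thus ?case using ideal_prod_assoc_subset unfolding ideal_pow_Suc by blast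
qed

lemma power_in_ideal_pow: "a \<in> I \<Longrightarrow> a ^ m \<in> ideal_pow I m"
  by (induction m) (simp_all add: ideal_pow_0 ideal_pow_Suc ideal_prodI)

lemma power_mult_in_ideal_pow: "a \<in> I \<Longrightarrow> b \<in> ideal_pow I n \<Longrightarrow> a ^ m * b \<in> ideal_pow I (m + n)"
  by (induction m) (simp_all add: ideal_pow_Suc mult.assoc ideal_prodI)

section \<open>Comaximal ideals\<close>

definition comax :: "'a::comm_ring_1 set \<Rightarrow> 'a set \<Rightarrow> bool" where
  "comax A B \<longleftrightarrow> (\<exists>a\<in>A. \<exists>b\<in>B. a + b = 1)"

lemma comax_sym: "comax A B \<Longrightarrow> comax B A"
  unfolding comax_def by (metis add.commute)

lemma comax_prod:
  assumes "ideal A" "comax A B" "comax A C"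
  shows "comax A (ideal_prod B C)"
proof -
  obtain a b where ab: "a \<in> A" "b \<in> B" "a + b = 1" using assms(2) unfolding comax_def by blast
  obtain a' c where ac: "a' \<in> A" "c \<in> C" "a' + c = 1" using assms(3) unfolding comax_def by blast
  note * = ab ac
  \<comment> \<open>This is a + a' - a a' = 1 - (1 - a) (1 - a') with b = 1 - a and c = 1 -
    a'.\<close>
  have "(a + a' - a * a') + b * c = 1"
  proof -
    have b: "b = 1 - a" and c: "c = 1 - a'" using ab(3) ac(3) by (metis add_diff_cancel_left')+
    show ?thesis unfolding b c by (simp add: algebra_simps)
  qed
  moreover have "a + a' - a * a' \<in> A" using * assms by (intro ideal_diff ideal_add ideal_mult_left)
  ultimately show ?thesis using ideal_prodI[OF *(2,5)] unfolding comax_def by blast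
qed

lemma comax_pow: "ideal A \<Longrightarrow> comax A B \<Longrightarrow> comax A (ideal_pow B m)"
proof (induction m)
  case 0
  show ?case unfolding comax_def ideal_pow_0 using ideal_zero[OF 0(1)] by (intro bexI[of _ 0] bexI[of _ 1]) auto
next
  case (Suc m)
  thus ?case unfolding ideal_pow_Suc by (intro comax_prod)
qed

lemma prime_ideal_ideal: "prime_ideal P \<Longrightarrow> ideal P"
  by (simp add: prime_ideal_def)

lemma prime_ideal_one: "prime_ideal P \<Longrightarrow> 1 \<notin> P"
  using ideal_one by (auto simp: prime_ideal_def)

lemma prime_ideal_mult: "prime_ideal P \<Longrightarrow> a * b \<in> P \<longleftrightarrow> a \<in> P \<or> b \<in> P"
  by (auto simp: prime_ideal_def dest: ideal_mult_left ideal_mult_right)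

lemma maximal_comax:
  assumes "maximal_ideal P" "v \<notin> P"
  shows "\<exists>a r. r \<in> P \<and> a * v + r = 1"
proof -
  have P: "ideal P" using assms by (simp add: maximal_ideal_def)
  let ?J = "msum (range (\<lambda>a. a * v)) P"
  have "ideal ?J" by (rule ideal_msum[OF ideal_principal P])
  moreover have "P \<subseteq> ?J" by (rule msum_superset2) (auto intro: range_eqI[of _ _ 0])
  moreover have "v \<in> ?J" using msumI[OF rangeI[of "\<lambda>a. a * v" 1] ideal_zero[OF P]] by simp
  ultimately have "?J = UNIV" using assms unfolding maximal_ideal_def by blast
  hence "1 \<in> ?J" by blast
  thus ?thesis by (elim msumE) (metis rangeE)
qed

section \<open>The Chinese remainder theorem and the ideals \<open>Q m\<close>\<close>

locale dedekind_primes =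
  fixes p :: "nat \<Rightarrow> 'a::idom set" and k :: nat
  assumes dedekind: "dedekind_domain TYPE('a)"
    and fin_quot: "\<And>J::'a set. ideal J \<Longrightarrow> J \<noteq> {0} \<Longrightarrow> J \<noteq> UNIV \<Longrightarrow> finite (quotient_set J)"
    and p_prime: "\<And>i. i < k \<Longrightarrow> prime_ideal (p i) \<and> p i \<noteq> {0}"
    and p_inj: "inj_on p {..<k}"
begin

text \<open>The m-th power of the product of the primes, written as an intersection so that
  membership is tested prime by prime; the comparison with products is made where it is
  needed.\<close>

definition Q :: "nat \<Rightarrow> 'a set" where "Q m = (\<Inter>i<k. ideal_pow (p i) m)"

definition q :: "nat \<Rightarrow> nat" where "q i = card (quotient_set (p i))"

lemma prime: "i < k \<Longrightarrow> prime_ideal (p i)" and ideal_p: "i < k \<Longrightarrow> ideal (p i)"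
  using p_prime by (auto simp: prime_ideal_def)

lemma maximal: "i < k \<Longrightarrow> maximal_ideal (p i)"
  using dedekind p_prime by (auto simp: dedekind_domain_def)

lemma one_notin_p: "i < k \<Longrightarrow> 1 \<notin> p i"
  using prime prime_ideal_one by blast

lemma comax_p:
  assumes "i < k" "j < k" "i \<noteq> j" shows "comax (p i) (p j)"
proof -
  have ne: "p i \<noteq> p j" using p_inj assms by (auto simp: inj_on_def)
  have "\<not> p i \<subseteq> p j"
    using maximal[OF assms(1)] ne ideal_p[OF assms(2)] one_notin_p[OF assms(2)]
    unfolding maximal_ideal_def by blast
  then obtain v where v: "v \<in> p i" "v \<notin> p j" by blast
  obtain a r where "r \<in> p j" "a * v + r = 1" using maximal_comax[OF maximal[OF assms(2)] v(2)] by blast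
  thus ?thesis unfolding comax_def using ideal_mult_left[OF ideal_p[OF assms(1)] v(1)] by blast
qed

text \<open>Approximate idempotents: \<open>c i\<close> is the product, over the j distinct from i,
  of elements that are 1 modulo p_i^m and lie in p_j^m.\<close>

lemma crt_idempotents:
  obtains c where "\<And>i. i < k \<Longrightarrow> 1 - c i \<in> ideal_pow (p i) m"
    "\<And>i j. i < k \<Longrightarrow> j < k \<Longrightarrow> i \<noteq> j \<Longrightarrow> c i \<in> ideal_pow (p j) m"
proof -
  have "\<exists>c. 1 - c \<in> ideal_pow (p i) m \<and> (\<forall>j<k. i \<noteq> j \<longrightarrow> c \<in> ideal_pow (p j) m)" if i: "i < k" for i
  proof -
    have "\<exists>b. b \<in> ideal_pow (p j) m \<and> 1 - b \<in> ideal_pow (p i) m" if "j < k" "i \<noteq> j" for j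
    proof -
      have "comax (ideal_pow (p i) m) (ideal_pow (p j) m)"
        using comax_pow[OF ideal_ideal_pow comax_sym[OF comax_pow[OF ideal_p[OF that(1)] comax_sym[OF comax_p[OF i that]]]]] .
      then obtain a b where ab: "a \<in> ideal_pow (p i) m" "b \<in> ideal_pow (p j) m" "a + b = 1"
        by (auto simp: comax_def)
      moreover have "1 - b = a" using ab by (auto simp: algebra_simps)
      ultimately show ?thesis by blast
    qed
    then obtain b where b: "\<And>j. j < k \<Longrightarrow> i \<noteq> j \<Longrightarrow> b j \<in> ideal_pow (p j) m \<and> 1 - b j \<in> ideal_pow (p i) m"
      by metis
    let ?c = "\<lambda>A. \<Prod>j\<in>A. b j"
    have 1: "1 - ?c A \<in> ideal_pow (p i) m" if "finite A" "A \<subseteq> {..<k} - {i}" for A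
      using that
    proof (induction A rule: finite_induct)
      case empty thus ?case by (simp add: ideal_zero[OF ideal_ideal_pow])
    next
      case (insert j A)
      have eq: "1 - ?c (insert j A) = (1 - ?c A) + (1 - b j) * ?c A" using insert by (simp add: algebra_simps)
      have "1 - b j \<in> ideal_pow (p i) m" using insert b[of j] by auto
      thus ?case unfolding eq using insert
        by (intro ideal_add[OF ideal_ideal_pow] ideal_mult_right[OF ideal_ideal_pow]) auto
    qed
    have 2: "?c ({..<k} - {i}) \<in> ideal_pow (p j) m" if "j < k" "i \<noteq> j" for j
    proof -
      have "?c ({..<k} - {i}) = b j * ?c ({..<k} - {i} - {j})" using that by (subst prod.remove[of _ j]) auto
      thus ?thesis using b[OF that] ideal_mult_right[OF ideal_ideal_pow] by auto
    qed
    show ?thesis using 1[of "{..<k} - {i}"] 2 by blast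
  qed
  then obtain c where "\<And>i. i < k \<Longrightarrow> 1 - c i \<in> ideal_pow (p i) m \<and> (\<forall>j<k. i \<noteq> j \<longrightarrow> c i \<in> ideal_pow (p j) m)"
    by metis
  thus thesis using that by blast
qed

lemma crt:
  obtains y where "\<And>i. i < k \<Longrightarrow> y - r i \<in> ideal_pow (p i) m"
proof -
  obtain c where c: "\<And>i. i < k \<Longrightarrow> 1 - c i \<in> ideal_pow (p i) m"
    "\<And>i j. i < k \<Longrightarrow> j < k \<Longrightarrow> i \<noteq> j \<Longrightarrow> c i \<in> ideal_pow (p j) m"
    using crt_idempotents[of m] by blast
  have "(\<Sum>j<k. c j * r j) - r i \<in> ideal_pow (p i) m" if "i < k" for i
  proof -
    have "(\<Sum>j<k. c j * r j) - r i = (\<Sum>j\<in>{..<k}-{i}. c j * r j) - (1 - c i) * r i"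
      using that by (subst sum.remove[of _ i]) (auto simp: algebra_simps)
    moreover have "(\<Sum>j\<in>{..<k}-{i}. c j * r j) \<in> ideal_pow (p i) m"
      using c(2)[OF _ that] by (intro ideal_sum[OF ideal_ideal_pow] ideal_mult_right[OF ideal_ideal_pow]) auto
    ultimately show ?thesis using c(1)[OF that]
      by (metis ideal_diff ideal_ideal_pow ideal_mult_right)
  qed
  thus thesis using that by blast
qed

lemma ideal_Q: "ideal (Q m)"
  unfolding Q_def by (intro ideal_Inter ideal_ideal_pow)

lemma Q_antimono: "m \<le> n \<Longrightarrow> Q n \<subseteq> Q m"
  unfolding Q_def using ideal_pow_antimono by blast

lemma Q_subset: "i < k \<Longrightarrow> Q m \<subseteq> ideal_pow (p i) m"
  by (auto simp: Q_def)

lemma Q_Suc_subset_p: "i < k \<Longrightarrow> Q (Suc m) \<subseteq> p i"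
  using Q_subset[of i "Suc m"] ideal_pow_antimono[of 1 "Suc m" "p i"] ideal_pow_one[OF ideal_p[of i]] by auto

text \<open>At one prime, p_i^(a+b) lies in p_i^a p_i^b; multiplication by \<open>c i * c i\<close>
  moves the two factors into \<open>Q a\<close> and \<open>Q b\<close>. The sum of these squares is
  1 modulo \<open>Q a\<close>, and the defect times \<open>x\<close> lies in the product since
  \<open>x\<close> is in \<open>Q b\<close>.\<close>

lemma Q_add: "Q (a + b) \<subseteq> ideal_prod (Q a) (Q b)"
proof
  fix x assume x: "x \<in> Q (a + b)"
  let ?m = "a + b"
  let ?P = "ideal_prod (Q a) (Q b)"
  note [simp] = ideal_add[OF ideal_ideal_pow] ideal_diff[OF ideal_ideal_pow]
    ideal_mult_left[OF ideal_ideal_pow] ideal_mult_right[OF ideal_ideal_pow]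
  obtain c where c: "\<And>i. i < k \<Longrightarrow> 1 - c i \<in> ideal_pow (p i) ?m"
    "\<And>i j. i < k \<Longrightarrow> j < k \<Longrightarrow> i \<noteq> j \<Longrightarrow> c i \<in> ideal_pow (p j) ?m"
    using crt_idempotents[of ?m] by blast
  have Qc: "c i * y \<in> Q n" if "i < k" "n \<le> ?m" "y \<in> ideal_pow (p i) n" for i y n
    unfolding Q_def
  proof (intro INT_I)
    fix j assume "j \<in> {..<k}"
    thus "c i * y \<in> ideal_pow (p j) n"
      using that c(2)[of i j] ideal_pow_antimono[OF that(2), of "p j"] by (cases "i = j") auto
  qed
  have "(\<Sum>i<k. c i * c i) - 1 \<in> ideal_pow (p i) ?m" if "i < k" for i
  proof -
    have "(\<Sum>j<k. c j * c j) - 1 = (\<Sum>j\<in>{..<k}-{i}. c j * c j) - (1 - c i) * (1 + c i)"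
      using that by (subst sum.remove[of _ i]) (auto simp: algebra_simps)
    moreover have "(\<Sum>j\<in>{..<k}-{i}. c j * c j) \<in> ideal_pow (p i) ?m"
      using c(2)[OF _ that] by (intro ideal_sum[OF ideal_ideal_pow]) auto
    ultimately show ?thesis using c(1)[OF that] by simp
  qed
  hence "(\<Sum>i<k. c i * c i) - 1 \<in> Q a" using Q_antimono[of a ?m] by (auto simp: Q_def)
  moreover have "x \<in> Q b" using x Q_antimono[of b ?m] by auto
  ultimately have 1: "((\<Sum>i<k. c i * c i) - 1) * x \<in> ?P" by (rule ideal_prodI)
  have 2: "c i * c i * x \<in> ?P" if i: "i < k" for i
  proof -
    have "ideal_prod (ideal_pow (p i) a) (ideal_pow (p i) b) \<subseteq> {z. c i * c i * z \<in> ?P}"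
    proof (rule ideal_prod_least)
      show "ideal {z. c i * c i * z \<in> ?P}"
        by (rule ideal_colon[OF ideal_ideal_prod])
      fix y z assume "y \<in> ideal_pow (p i) a" "z \<in> ideal_pow (p i) b"
      hence "(c i * y) * (c i * z) \<in> ?P" using Qc[OF i] by (intro ideal_prodI) auto
      thus "y * z \<in> {z. c i * c i * z \<in> ?P}" by (simp add: algebra_simps)
    qed
    thus ?thesis using x i ideal_pow_add[of "p i" a b] by (auto simp: Q_def)
  qed
  have "(\<Sum>i<k. c i * c i * x) - ((\<Sum>i<k. c i * c i) - 1) * x \<in> ?P"
    using 1 2 by (intro ideal_diff[OF ideal_ideal_prod] ideal_sum[OF ideal_ideal_prod]) auto
  thus "x \<in> ?P" by (simp add: algebra_simps sum_distrib_right sum_distrib_left)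
qed

text \<open>Split x = c_n x + x (1 - c_n): here \<open>c n\<close> lies in the product over the
  earlier primes and \<open>1 - c n\<close> in the power of p_n.\<close>

lemma Q_subset_prod_pow:
  assumes "\<And>i. i < k \<Longrightarrow> e i \<le> m"
  shows "Q m \<subseteq> prod_pow_ideal p e k"
proof -
  obtain c where c: "\<And>i. i < k \<Longrightarrow> 1 - c i \<in> ideal_pow (p i) m"
    "\<And>i j. i < k \<Longrightarrow> j < k \<Longrightarrow> i \<noteq> j \<Longrightarrow> c i \<in> ideal_pow (p j) m"
    using crt_idempotents[of m] by blast
  have "x \<in> prod_pow_ideal p e n" if "n \<le> k" "\<And>i. i < n \<Longrightarrow> x \<in> ideal_pow (p i) m" for n x
    using that
  proof (induction n arbitrary: x)
    case 0 thus ?case by simp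
  next
    case (Suc n)
    have "c n \<in> prod_pow_ideal p e n" using Suc.prems c(2)[of n] by (intro Suc.IH) auto
    moreover have "x \<in> ideal_pow (p n) (e n)" "1 - c n \<in> ideal_pow (p n) (e n)"
      using Suc.prems assms[of n] ideal_pow_antimono[of "e n" m] c(1)[of n] by auto
    moreover have "x \<in> prod_pow_ideal p e n" using Suc.prems by (intro Suc.IH) auto
    ultimately have "c n * x + x * (1 - c n) \<in> ideal_prod (prod_pow_ideal p e n) (ideal_pow (p n) (e n))"
      by (intro ideal_add[OF ideal_ideal_prod] ideal_prodI) auto
    thus ?case by (simp add: algebra_simps)
  qed
  thus ?thesis by (auto simp: Q_def)
qed

lemma prod_pow_const_subset_Q: "prod_pow_ideal p (\<lambda>_. m) k \<subseteq> Q m"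
proof -
  have id: "ideal (prod_pow_ideal p (\<lambda>_. m) n)" for n
    by (cases n) (auto simp: ideal_UNIV ideal_ideal_prod)
  have "prod_pow_ideal p (\<lambda>_. m) n \<subseteq> (\<Inter>i<n. ideal_pow (p i) m)" for n
  proof (induction n)
    case (Suc n)
    thus ?case
      using ideal_prod_subset1[OF id[of n], of "ideal_pow (p n) m"]
        ideal_prod_subset2[OF ideal_ideal_pow, of "prod_pow_ideal p (\<lambda>_. m) n" "p n" m]
      by (fastforce simp: less_Suc_eq)
  qed auto
  thus ?thesis by (simp add: Q_def)
qed

text \<open>With the finiteness hypothesis this makes T/Q m finite. The witness is the m-th power of
  a product of nonzero elements, one from each prime.\<close>

lemma Q_nonzero: "Q m \<noteq> {0}"
proof -
  obtain a where a: "\<And>i. i < k \<Longrightarrow> a i \<in> p i \<and> a i \<noteq> 0"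
  proof -
    have "\<forall>i. i < k \<longrightarrow> (\<exists>a. a \<in> p i \<and> a \<noteq> 0)"
      using p_prime ideal_p ideal_zero by blast
    thus thesis using that by metis
  qed
  have "(\<Prod>i<k. a i) ^ m \<in> ideal_pow (p i) m" if "i < k" for i
    using that a[OF that] by (intro power_in_ideal_pow, subst prod.remove[of _ i])
      (auto intro: ideal_mult_right[OF ideal_p[OF that]])
  hence "(\<Prod>i<k. a i) ^ m \<in> Q m" by (auto simp: Q_def)
  moreover have "(\<Prod>i<k. a i) ^ m \<noteq> 0" using a by auto
  ultimately show ?thesis by blast
qed

lemma ideal_has_index:
  fixes J :: "'a set"
  assumes "ideal J" "J \<noteq> {0}" shows "has_index UNIV J (card (quotient_set J))"
\<comment> \<open>The finiteness hypothesis speaks of proper ideals; T/T has one element.\<close>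
proof (cases "J = UNIV")
  case True
  have *: "quotient_set (UNIV :: 'a set) = {UNIV}"
    by (auto simp: quotient_set_def intro!: image_eqI[of _ _ "_ - _"])
  have "card (quotient_set J) = card {UNIV :: 'a set}" unfolding True by (rule arg_cong[OF *])
  hence "card (quotient_set J) = 1" by simp
  thus ?thesis using has_index_refl[OF ideal_subgrp[OF ideal_UNIV]] True by metis
next
  case False
  thus ?thesis using has_index_iff[OF ideal_subgrp[OF assms(1)], of UNIV "card (quotient_set J)"]
      fin_quot[OF assms] by (simp add: quotient_set_def)
qed

lemma q_index: "i < k \<Longrightarrow> has_index UNIV (p i) (q i)"
  unfolding q_def using ideal_has_index ideal_p p_prime by blast

lemma q_ge_2: "i < k \<Longrightarrow> q i \<ge> 2"
  using subgrp_not_UNIV_index[OF ideal_subgrp[OF ideal_UNIV] ideal_subgrp[OF ideal_p] _ _ q_index]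
    one_notin_p by blast

end

section \<open>Local generators of the primes\<close>

lemma transv_rep:
  assumes "transv K H R" "x \<in> K" obtains r where "r \<in> R" "x - r \<in> H"
  using assms unfolding transv_def by blast

text \<open>After inverting \<open>t\<close>, the prime P is generated by \<open>\<pi>\<close>. For
  a nonzero \<open>a\<close> in P, the prime P is a colon ideal (a : b), hence x = b / a satisfies
  xP in T while x is not in T. If xP is not inside P, some \<open>\<pi>\<close> in P has x \<pi> = t
  outside P, and then t y = \<pi> (x y). If xP is inside P, then x is integral, against integral
  closedness.\<close>

lemma (in dedekind_primes) local_uniformizer:
  fixes P :: "'a set"
  assumes P: "prime_ideal P" "P \<noteq> {0}"
  obtains \<pi> t where "\<pi> \<in> P" "t \<notin> P" "\<And>y. y \<in> P \<Longrightarrow> \<exists>z. t * y = \<pi> * z"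
proof -
  have idP: "ideal P" using P prime_ideal_ideal by blast
  obtain a where a: "a \<in> P" "a \<noteq> 0" using P ideal_zero[OF idP] by blast
  define aT where "aT = range (\<lambda>x. x * a)"
  have aT: "ideal aT" unfolding aT_def by (rule ideal_principal)
  have a_aT: "a \<in> aT" unfolding aT_def by (rule range_eqI[of _ _ 1]) simp
  have aT_P: "aT \<subseteq> P" unfolding aT_def using ideal_mult_left[OF idP a(1)] by auto
  obtain n where "has_index UNIV aT n" using ideal_has_index[OF aT] a_aT a(2) by blast
  then obtain R where R: "finite R" "transv UNIV aT R" by (auto simp: has_index_def)
  define C where "C b = {t. b * t \<in> aT}" for b
  have idC: "ideal (C b)" for b unfolding C_def by (rule ideal_colon[OF aT])
  have aTC: "aT \<subseteq> C b" for b unfolding C_def using ideal_mult_left[OF aT] by auto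
  have C1: "C 1 \<subseteq> P" using aT_P by (auto simp: C_def)
  \<comment> \<open>Every \<open>C b\<close> contains \<open>aT\<close>, which has finite index, so
    it is determined by its trace on \<open>R\<close>; a largest one inside P exists.\<close>
  have "\<exists>b. C b \<subseteq> P \<and> (\<forall>y. C y \<subseteq> P \<longrightarrow> card (R \<inter> C y) \<le> card (R \<inter> C b))"
    using R(1) C1 by (intro ex_has_greatest_nat[where P = "\<lambda>b. C b \<subseteq> P" and k = 1 and b = "card R + 1"])
      (auto intro!: card_mono le_imp_less_Suc)
  then obtain b where b: "C b \<subseteq> P" "\<And>y. C y \<subseteq> P \<Longrightarrow> card (R \<inter> C y) \<le> card (R \<inter> C b)" by blast
  have Cmax: "C (b * y) = C b" if "C (b * y) \<subseteq> P" for y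
  proof
    show sub: "C b \<subseteq> C (b * y)"
    proof
      fix t assume "t \<in> C b"
      hence "y * (b * t) \<in> aT" unfolding C_def using ideal_mult_left[OF aT] by blast
      thus "t \<in> C (b * y)" by (simp add: C_def ac_simps)
    qed
    have "R \<inter> C b = R \<inter> C (b * y)"
      using sub R(1) b(2)[OF that] by (intro card_seteq) auto
    hence eq: "r \<in> C b" if "r \<in> R" "r \<in> C (b * y)" for r using that by blast
    show "C (b * y) \<subseteq> C b"
    proof
      fix x assume x: "x \<in> C (b * y)"
      obtain r where r: "r \<in> R" "x - r \<in> aT" using transv_rep[OF R(2)] by blast
      have "x - (x - r) \<in> C (b * y)" by (rule ideal_diff[OF idC x]) (use r aTC in blast)
      hence "r \<in> C b" using eq r by simp
      hence "(x - r) + r \<in> C b" using r aTC by (intro ideal_add[OF idC]) auto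
      thus "x \<in> C b" by simp
    qed
  qed
  \<comment> \<open>If x y is in \<open>C b\<close> but neither factor is, then
    \<open>C (b * x)\<close> is strictly larger and so leaves P. This gives \<open>s\<close>, and in
    the same way \<open>s'\<close>, outside P with \<open>s * s'\<close> in \<open>C b\<close>,
    which lies inside P.\<close>
  have "prime_ideal (C b)"
    unfolding prime_ideal_def
  proof (intro conjI allI impI idC)
    show "C b \<noteq> UNIV" using b(1) prime_ideal_one[OF P(1)] by blast
    fix x y assume xy: "x * y \<in> C b"
    show "x \<in> C b \<or> y \<in> C b"
    proof (rule ccontr)
      assume n: "\<not> (x \<in> C b \<or> y \<in> C b)"
      have "y \<in> C (b * x)" using xy by (simp add: C_def mult.assoc)
      hence "\<not> C (b * x) \<subseteq> P" using Cmax[of x] n by blast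
      then obtain s where s: "s \<notin> P" "b * x * s \<in> aT" by (auto simp: C_def)
      have "x \<in> C (b * s)" using s by (simp add: C_def ac_simps)
      hence "\<not> C (b * s) \<subseteq> P" using Cmax[of s] n by blast
      then obtain s' where s': "s' \<notin> P" "b * s * s' \<in> aT" by (auto simp: C_def)
      hence "s * s' \<in> P" using b(1) by (auto simp: C_def mult.assoc)
      thus False using s s' prime_ideal_mult[OF P(1)] by blast
    qed
  qed
  moreover have "C b \<noteq> {0}" using aTC a_aT a(2) by blast
  ultimately have "maximal_ideal (C b)" using dedekind by (simp add: dedekind_domain_def)
  hence CP: "C b = P" using b(1) idP P(1) unfolding maximal_ideal_def prime_ideal_def by blast
  have b_aT: "b \<notin> aT"
  proof
    assume "b \<in> aT"
    hence "1 \<in> C b" by (simp add: C_def)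
    thus False using CP prime_ideal_one[OF P(1)] by simp
  qed
  have bP: "\<exists>z. b * y = z * a" if "y \<in> P" for y
    using that CP by (auto simp: C_def aT_def)
  show thesis
  proof (cases "\<exists>\<pi>\<in>P. \<exists>t. b * \<pi> = t * a \<and> t \<notin> P")
    case True
    then obtain \<pi> t where pt: "\<pi> \<in> P" "b * \<pi> = t * a" "t \<notin> P" by blast
    have "\<exists>z. t * y = \<pi> * z" if y: "y \<in> P" for y
    proof -
      obtain z where z: "b * y = z * a" using bP[OF y] by blast
      have "a * (t * y) = (b * \<pi>) * y" using pt(2) by (simp add: ac_simps)
      also have "\<dots> = (b * y) * \<pi>" by (simp add: ac_simps)
      also have "\<dots> = a * (\<pi> * z)" using z by (simp add: ac_simps)
      finally have "t * y = \<pi> * z" using a(2) by simp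
      thus ?thesis ..
    qed
    thus thesis using that pt by blast
  next
    case False
    hence "\<forall>y. \<exists>z. y \<in> P \<longrightarrow> b * y = z * a \<and> z \<in> P" using bP by blast
    \<comment> \<open>Multiplication by x = b / a now maps P to itself; \<open>h\<close> is that map
      and \<open>d n\<close> is x^n a.\<close>
    then obtain h where h: "\<And>y. y \<in> P \<Longrightarrow> b * y = h y * a \<and> h y \<in> P" by metis
    define d where "d n = (h ^^ n) a" for n
    have dP: "d n \<in> P" for n unfolding d_def by (induction n) (use a h in auto)
    have d_Suc: "b * d n = d (Suc n) * a" for n using h[OF dP[of n]] by (simp add: d_def)
    \<comment> \<open>The ascending ideals generated by d 0, ..., d n stabilize, which expresses d
      (n + 1) through its predecessors.\<close>
    define S where "S n = {\<Sum>i\<le>n. r i * d i | r. True}" for n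
    have S_mono: "S n \<subseteq> S (Suc n)" for n
    proof
      fix x assume "x \<in> S n"
      then obtain r where "x = (\<Sum>i\<le>n. r i * d i)" by (auto simp: S_def)
      hence "x = (\<Sum>i\<le>Suc n. (if i \<le> n then r i else 0) * d i)" by simp
      thus "x \<in> S (Suc n)" unfolding S_def
        by (intro CollectI exI[of _ "\<lambda>i. if i \<le> n then r i else 0"]) simp
    qed
    have S_mono': "m \<le> n \<Longrightarrow> S m \<subseteq> S n" for m n by (rule lift_Suc_mono_le[of S]) (rule S_mono)
    have dS: "d n \<in> S n" for n
      unfolding S_def
      by (intro CollectI exI[of _ "\<lambda>i. if i = n then 1 else 0"])
        (simp add: if_distrib[of "\<lambda>x. x * _"] cong: if_cong)
    have Sadd: "x + y \<in> S n" if xy: "x \<in> S n" "y \<in> S n" for x y n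
    proof -
      obtain r s where "x = (\<Sum>i\<le>n. r i * d i)" "y = (\<Sum>i\<le>n. s i * d i)" using xy by (auto simp: S_def)
      thus ?thesis unfolding S_def
        by (intro CollectI exI[of _ "\<lambda>i. r i + s i"]) (simp add: sum.distrib distrib_right)
    qed
    have Smult: "t * x \<in> S n" if x: "x \<in> S n" for x t n
    proof -
      obtain r where "x = (\<Sum>i\<le>n. r i * d i)" using x by (auto simp: S_def)
      thus ?thesis unfolding S_def
        by (intro CollectI exI[of _ "\<lambda>i. t * r i"]) (simp add: sum_distrib_left mult.assoc)
    qed
    have S0: "0 \<in> S n" for n unfolding S_def by (intro CollectI exI[of _ "\<lambda>i. 0"]) simp
    have idS: "ideal (S n)" for n unfolding ideal_def using S0 Sadd Smult by blast
    have "ideal (\<Union>n. S n)"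
      unfolding ideal_def
    proof (intro conjI ballI allI)
      fix x y assume "x \<in> (\<Union>n. S n)" "y \<in> (\<Union>n. S n)"
      then obtain m n where "x \<in> S m" "y \<in> S n" by blast
      hence "x + y \<in> S (max m n)" using S_mono'[of m "max m n"] S_mono'[of n "max m n"] by (intro Sadd) auto
      thus "x + y \<in> (\<Union>n. S n)" by blast
    qed (use S0 Smult in blast)+
    then obtain F where F: "finite F" "(\<Union>n. S n) = ideal_gen F"
      using dedekind unfolding dedekind_domain_def noetherian_ring_def by blast
    have "\<exists>n. F' \<subseteq> S n" if "finite F'" "F' \<subseteq> (\<Union>n. S n)" for F'
      using that
    proof (induction F' rule: finite_induct)
      case (insert f F')
      then obtain m n where "F' \<subseteq> S n" "f \<in> S m" by blast
      hence "insert f F' \<subseteq> S (max m n)" using S_mono'[of m "max m n"] S_mono'[of n "max m n"] by auto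
      thus ?case ..
    qed simp
    then obtain n where n: "F \<subseteq> S n" using F ideal_gen_subset[of F] by metis
    have "d (Suc n) \<in> ideal_gen F" using dS[of "Suc n"] F(2) by blast
    hence "d (Suc n) \<in> S n" using ideal_gen_least[OF idS n] by blast
    then obtain r where r: "d (Suc n) = (\<Sum>i\<le>n. r i * d i)" by (auto simp: S_def)
    define \<iota> where "\<iota> c = Fract c 1" for c :: 'a
    have \<iota>: "\<iota> (x + y) = \<iota> x + \<iota> y" "\<iota> (x * y) = \<iota> x * \<iota> y" "\<iota> 0 = 0" "\<iota> 1 = 1" "\<iota> (- x) = - \<iota> x"
      "\<iota> x = 0 \<longleftrightarrow> x = 0" for x y
      by (auto simp: \<iota>_def Zero_fract_def One_fract_def eq_fract)
    have \<iota>sum: "\<iota> (\<Sum>i\<in>A. f i) = (\<Sum>i\<in>A. \<iota> (f i))" for f and A :: "nat set"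
      by (induction A rule: infinite_finite_induct) (auto simp: \<iota>)
    define x where "x = Fract b a"
    have xd: "x * \<iota> (d i) = \<iota> (d (Suc i))" for i
      unfolding x_def \<iota>_def using a(2) d_Suc[of i] by (simp add: eq_fract)
    have xpow: "x ^ i * \<iota> a = \<iota> (d i)" for i
    proof (induction i)
      case 0 thus ?case by (simp add: d_def)
    next
      case (Suc i) thus ?case using xd[of i] by (simp add: mult.assoc)
    qed
    \<comment> \<open>The monic polynomial g = s + X^(n+1) is read off from that relation; x is a
      root because x^i a = d i and \<open>a\<close> is nonzero.\<close>
    define s where "s = - (\<Sum>i\<le>n. monom (r i) i)"
    define g where "g = s + monom 1 (Suc n)"
    have "degree s \<le> n" unfolding s_def degree_minus
      by (rule degree_sum_le) (auto intro: order_trans[OF degree_monom_le])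
    hence ds: "degree s < degree (monom (1::'a) (Suc n))" by (simp add: degree_monom_eq)
    have lead: "lead_coeff g = 1" and deg: "degree g = Suc n"
      unfolding g_def using lead_coeff_add_le[OF ds] degree_add_eq_right[OF ds] by (simp_all add: degree_monom_eq)
    have cs: "coeff s i = - r i" if "i \<le> n" for i
      using that by (simp add: s_def coeff_sum)
    have "poly (map_poly \<iota> g) x = (\<Sum>i\<le>Suc n. \<iota> (coeff g i) * x ^ i)"
    proof -
      have "degree (map_poly \<iota> g) = Suc n" using deg degree_map_poly[of \<iota> g] \<iota>(6) by simp
      thus ?thesis by (simp add: poly_altdef coeff_map_poly \<iota>(3))
    qed
    also have "\<dots> = x ^ Suc n - (\<Sum>i\<le>n. \<iota> (r i) * x ^ i)"
    proof -
      have "\<iota> (coeff g (Suc n)) = 1" using lead deg \<iota> by simp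
      moreover have "\<iota> (coeff g i) = - \<iota> (r i)" if "i \<le> n" for i
        using that cs[OF that] \<iota>(5) by (simp add: g_def)
      ultimately show ?thesis by (simp add: sum_negf)
    qed
    finally have pg: "poly (map_poly \<iota> g) x = x ^ Suc n - (\<Sum>i\<le>n. \<iota> (r i) * x ^ i)" .
    have "(x ^ Suc n - (\<Sum>i\<le>n. \<iota> (r i) * x ^ i)) * \<iota> a = \<iota> (d (Suc n)) - (\<Sum>i\<le>n. \<iota> (r i * d i))"
      using xpow by (simp only: left_diff_distrib sum_distrib_right mult.assoc \<iota>(2))
    also have "\<dots> = 0" using r by (simp add: \<iota>sum)
    finally have "poly (map_poly \<iota> g) x = 0" using pg \<iota>(6)[of a] a(2) by simp
    hence "x \<in> range \<iota>"
      using dedekind lead unfolding dedekind_domain_def integrally_closed_def \<iota>_def by blast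
    then obtain c where "Fract b a = Fract c 1" by (auto simp: x_def \<iota>_def)
    hence "b = c * a" using a(2) by (simp add: eq_fract)
    thus thesis using b_aT by (auto simp: aT_def)
  qed
qed

text \<open>The Chinese remainder theorem interpolates between a local uniformizer \<open>\<pi>\<^sub>0\<close> at \<open>p i\<close> and \<open>1\<close> at the other primes.\<close>
lemma (in dedekind_primes) uniformizer:
  assumes i: "i < k"
  obtains \<pi> v where "\<pi> \<in> p i" "v \<notin> p i" "\<And>y. y \<in> p i \<Longrightarrow> \<exists>z. v * y = \<pi> * z"
    "\<And>y. y \<in> p i \<Longrightarrow> \<exists>z. y - \<pi> * z \<in> Q m"
proof -
  obtain \<pi>0 t where pt: "\<pi>0 \<in> p i" "t \<notin> p i" "\<And>y. y \<in> p i \<Longrightarrow> \<exists>z. t * y = \<pi>0 * z"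
    using local_uniformizer[OF prime[OF i]] p_prime[OF i] by blast
  note idp = ideal_p[OF i]
  have "\<pi>0 \<noteq> 0"
  proof
    assume "\<pi>0 = 0"
    obtain y where "y \<in> p i" "y \<noteq> 0" using p_prime[OF i] ideal_zero[OF idp] by blast
    thus False using pt(3)[of y] pt(2) \<open>\<pi>0 = 0\<close> ideal_zero[OF idp] by auto
  qed
  \<comment> \<open>An exponent of at least 2 puts 1 - c_i in p_i^2, so that adding it to c_i \<pi>0
    leaves a local generator at p_i; an exponent of at least m gives Q M inside Q m.\<close>
  define M where "M = m + 2"
  obtain c where c: "\<And>i. i < k \<Longrightarrow> 1 - c i \<in> ideal_pow (p i) M"
    "\<And>i j. i < k \<Longrightarrow> j < k \<Longrightarrow> i \<noteq> j \<Longrightarrow> c i \<in> ideal_pow (p j) M"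
    using crt_idempotents[of M] by blast
  define \<pi> where "\<pi> = c i * \<pi>0 + (1 - c i)"
  have c2: "1 - c i \<in> ideal_prod (p i) (p i)"
    using c(1)[OF i] ideal_pow_antimono[of 2 M "p i"] ideal_pow_one[OF idp]
    by (auto simp: M_def numeral_2_eq_2 ideal_pow_Suc)
  hence c1: "1 - c i \<in> p i" using ideal_prod_subset1[OF idp] by blast
  have \<pi>p: "\<pi> \<in> p i" unfolding \<pi>_def using pt(1) c1 by (intro ideal_add[OF idp] ideal_mult_left[OF idp])
  have "ideal_prod (p i) (p i) \<subseteq> {x. \<exists>\<rho>\<in>p i. t * x = \<pi>0 * \<rho>}"
  proof (rule ideal_prod_least)
    show "ideal {x. \<exists>\<rho>\<in>p i. t * x = \<pi>0 * \<rho>}"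
      unfolding ideal_def
    proof (intro conjI ballI allI)
      show "0 \<in> {x. \<exists>\<rho>\<in>p i. t * x = \<pi>0 * \<rho>}" using ideal_zero[OF idp] by force
      fix x y assume "x \<in> {x. \<exists>\<rho>\<in>p i. t * x = \<pi>0 * \<rho>}" "y \<in> {x. \<exists>\<rho>\<in>p i. t * x = \<pi>0 * \<rho>}"
      then obtain \<rho> \<sigma> where "\<rho> \<in> p i" "t * x = \<pi>0 * \<rho>" "\<sigma> \<in> p i" "t * y = \<pi>0 * \<sigma>" by blast
      thus "x + y \<in> {x. \<exists>\<rho>\<in>p i. t * x = \<pi>0 * \<rho>}"
        by (intro CollectI bexI[of _ "\<rho> + \<sigma>"]) (simp_all add: distrib_left ideal_add[OF idp])
    next
      fix x r assume "x \<in> {x. \<exists>\<rho>\<in>p i. t * x = \<pi>0 * \<rho>}"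
      then obtain \<rho> where "\<rho> \<in> p i" "t * x = \<pi>0 * \<rho>" by blast
      thus "r * x \<in> {x. \<exists>\<rho>\<in>p i. t * x = \<pi>0 * \<rho>}"
        by (intro CollectI bexI[of _ "r * \<rho>"]) (simp_all add: mult.left_commute ideal_mult_left[OF idp])
    qed
    fix x y assume x: "x \<in> p i" and y: "y \<in> p i"
    obtain z where "t * x = \<pi>0 * z" using pt(3)[OF x] by blast
    hence "t * (x * y) = \<pi>0 * (z * y)" by (metis mult.assoc)
    thus "x * y \<in> {x. \<exists>\<rho>\<in>p i. t * x = \<pi>0 * \<rho>}" using ideal_mult_left[OF idp y, of z] by blast
  qed
  \<comment> \<open>Since 1 - c_i is in p_i^2, the cofactor \<open>\<rho>\<close> is still in p_i.
    Hence v = c_i t + \<rho> is outside p_i, and t \<pi> = \<pi>0 v compares the new generator with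
    the old one.\<close>
  then obtain \<rho> where \<rho>: "\<rho> \<in> p i" "t * (1 - c i) = \<pi>0 * \<rho>" using c2 by blast
  define v where "v = c i * t + \<rho>"
  have tp: "t * \<pi> = \<pi>0 * v"
  proof -
    have "t * \<pi> = c i * t * \<pi>0 + t * (1 - c i)" by (simp add: \<pi>_def algebra_simps)
    thus ?thesis unfolding \<rho>(2) by (simp add: v_def algebra_simps)
  qed
  have vp: "v \<notin> p i"
  proof
    assume "v \<in> p i"
    hence "v - \<rho> + (1 - c i) * t \<in> p i" using ideal_add[OF idp ideal_diff[OF idp _ \<rho>(1)] ideal_mult_right[OF idp c1]] by blast
    moreover have "v - \<rho> + (1 - c i) * t = t" by (simp add: v_def algebra_simps)
    ultimately show False using pt(2) by simp
  qed
  have v: "\<exists>z. v * y = \<pi> * z" if y: "y \<in> p i" for y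
  proof -
    obtain z where z: "t * y = \<pi>0 * z" using pt(3)[OF y] by blast
    have "\<pi>0 * (v * y) = t * \<pi> * y" by (simp add: tp mult.assoc)
    also have "\<dots> = (t * y) * \<pi>" by (simp add: ac_simps)
    also have "\<dots> = \<pi>0 * (\<pi> * z)" unfolding z by (simp add: ac_simps)
    finally show ?thesis using \<open>\<pi>0 \<noteq> 0\<close> by auto
  qed
  \<comment> \<open>\<open>J\<close> is \<pi> T + Q M. With r in p_i and a v + r = 1, multiplication
    by r fixes p_i modulo \<open>J\<close>, so each z is congruent to w = r^M z in p_i^M. Then c_i w
    lies in Q M, and 1 - c_i = \<pi> - c_i \<pi>0 takes care of the rest of w.\<close>
  define J where "J = msum (range (\<lambda>a. a * \<pi>)) (Q M)"
  have idJ: "ideal J" unfolding J_def by (rule ideal_msum[OF ideal_principal ideal_Q])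
  have piJ: "a * \<pi> \<in> J" for a
    unfolding J_def by (rule subsetD[OF msum_superset1[OF ideal_zero[OF ideal_Q]]]) (rule rangeI)
  have QJ: "x \<in> J" if "x \<in> Q M" for x
    unfolding J_def by (rule subsetD[OF msum_superset2[OF ideal_zero[OF ideal_principal]] that])
  have J: "z \<in> J" if z: "z \<in> p i" for z
  proof -
    obtain a r where ar: "r \<in> p i" "a * v + r = 1" using maximal_comax[OF maximal[OF i] vp] by blast
    have step: "w - r * w \<in> J" if w: "w \<in> p i" for w
    proof -
      obtain z' where z': "v * w = \<pi> * z'" using v[OF w] by blast
      have "w - r * w = (1 - r) * w" by (simp add: algebra_simps)
      also have "1 - r = a * v" using ar(2) by (metis add_diff_cancel_right')
      finally have "w - r * w = (a * z') * \<pi>" using z' by (metis mult.assoc mult.commute)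
      thus ?thesis using piJ by simp
    qed
    have "z - r ^ l * z \<in> J" for l
    proof (induction l)
      case (Suc l)
      have "(z - r ^ l * z) + (r ^ l * z - r * (r ^ l * z)) \<in> J"
        by (intro ideal_add[OF idJ] Suc step ideal_mult_left[OF idp z])
      thus ?case by (simp add: mult.assoc)
    qed (simp add: ideal_zero[OF idJ])
    hence 1: "z - r ^ M * z \<in> J" .
    define w where "w = r ^ M * z"
    have w: "w \<in> ideal_pow (p i) M"
      unfolding w_def using power_mult_in_ideal_pow[OF ar(1), of z 0 M] by (simp add: ideal_pow_0)
    have "c i * w \<in> ideal_pow (p j) M" if "j < k" for j
    proof (cases "i = j")
      case True
      thus ?thesis using ideal_mult_left[OF ideal_ideal_pow w] by simp
    next
      case False
      show ?thesis by (rule ideal_mult_right[OF ideal_ideal_pow c(2)[OF i that False]])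
    qed
    hence cw: "c i * w \<in> J" by (intro QJ) (auto simp: Q_def)
    have "w = w * \<pi> - \<pi>0 * (c i * w) + c i * w" by (simp add: \<pi>_def algebra_simps)
    moreover have "w * \<pi> - \<pi>0 * (c i * w) + c i * w \<in> J"
      by (rule ideal_add[OF idJ ideal_diff[OF idJ piJ ideal_mult_left[OF idJ cw]] cw])
    ultimately have "w \<in> J" by simp
    hence "(z - w) + w \<in> J" using ideal_add[OF idJ 1] unfolding w_def by blast
    thus ?thesis by simp
  qed
  have "\<exists>z. y - \<pi> * z \<in> Q m" if "y \<in> p i" for y
  proof -
    have "y \<in> msum (range (\<lambda>a. a * \<pi>)) (Q M)" using J[OF that] unfolding J_def .
    then obtain a x where "x \<in> Q M" "y = a * \<pi> + x" by (auto elim!: msumE)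
    hence "y - \<pi> * a \<in> Q M" by (simp add: mult.commute)
    thus ?thesis using Q_antimono[of m M] by (auto simp: M_def)
  qed
  thus thesis using that \<pi>p vp v by blast
qed

section \<open>Uniform balancedness\<close>

text \<open>T/I is a finite vector space over F_l. A longest independent family \<open>x\<close> is
  a basis, and \<open>\<phi>\<close> takes coordinates in {0, ..., l - 1}. Independence is phrased
  as injectivity of the combinations with such coefficients, which bounds the length by the
  index.\<close>

lemma elem_abelian_quotI:
  fixes I :: "'a::comm_ring_1 set"
  assumes I: "ideal I" "I \<noteq> UNIV" and l: "prime l" "of_nat l \<in> I" and idx: "has_index UNIV I n"
  shows "elem_abelian_quot I"
proof -
  obtain R where R: "finite R" "transv UNIV I R" using idx by (auto simp: has_index_def)
  define A where "A m = ({..<m} \<rightarrow>\<^sub>E {..<l})" for m :: nat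
  define comb where "comb m x a = (\<Sum>i<m. of_nat (a i) * x i)" for m and x :: "nat \<Rightarrow> 'a" and a :: "nat \<Rightarrow> nat"
  define ind where "ind m x \<longleftrightarrow> (\<forall>a\<in>A m. \<forall>b\<in>A m. comb m x a - comb m x b \<in> I \<longrightarrow> a = b)" for m x
  note idI = ideal_zero[OF I(1)] ideal_add[OF I(1)] ideal_diff[OF I(1)] ideal_mult_left[OF I(1)]
  have l1: "l > 1" using l(1) prime_gt_1_nat by blast
  have modl: "of_nat (z mod l) * x - of_nat z * x \<in> I" for z x
  proof -
    have "of_nat z = (of_nat (z div l) * of_nat l + of_nat (z mod l) :: 'a)"
      by (metis div_mult_mod_eq of_nat_add of_nat_mult)
    hence "of_nat (z mod l) * x - of_nat z * x = (- (of_nat (z div l) * x)) * of_nat l"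
      by (simp add: algebra_simps)
    thus ?thesis using idI(4)[OF l(2), of "- (of_nat (z div l) * x)"] by simp
  qed
  have combmod: "comb m x (\<lambda>i. if i < m then c i mod l else undefined) - comb m x c \<in> I" for m x c
  proof -
    have "comb m x (\<lambda>i. if i < m then c i mod l else undefined) - comb m x c
        = (\<Sum>i<m. of_nat (c i mod l) * x i - of_nat (c i) * x i)"
      by (simp add: comb_def sum_subtractf)
    thus ?thesis using modl by (auto intro: ideal_sum[OF I(1)])
  qed
  have inA: "(\<lambda>i. if i < m then c i mod l else undefined) \<in> A m" for m c
    unfolding A_def using l1 by (auto simp: PiE_iff extensional_def)
  have bound: "m < n + 1" if ind: "\<exists>x. ind m x" for m
  proof -
    obtain x where x: "ind m x" using ind by blast
    have "\<exists>r. r \<in> R \<and> y - r \<in> I" for y using transv_rep[OF R(2), of y] by blast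
    then obtain rep where rep: "\<And>y. rep y \<in> R \<and> y - rep y \<in> I" by metis
    have "inj_on (\<lambda>a. rep (comb m x a)) (A m)"
    proof (rule inj_onI)
      fix a b assume ab: "a \<in> A m" "b \<in> A m" "rep (comb m x a) = rep (comb m x b)"
      have "(comb m x a - rep (comb m x a)) - (comb m x b - rep (comb m x b)) \<in> I"
        by (rule idI(3)[OF conjunct2[OF rep] conjunct2[OF rep]])
      hence "comb m x a - comb m x b \<in> I" using ab by simp
      thus "a = b" using x ab unfolding ind_def by blast
    qed
    hence "card (A m) \<le> card R" using rep R by (intro card_inj_on_le) auto
    moreover have "card (A m) = l ^ m" by (simp add: A_def card_PiE)
    moreover have "card R = n" using card_transv[OF ideal_subgrp[OF I(1)] idx R(2)] by simp
    moreover have "m < l ^ m" using power_gt_expt[of l m] l1 by simp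
    ultimately show ?thesis by linarith
  qed
  have ind0: "\<exists>x. ind 0 x" by (simp add: ind_def A_def)
  obtain m where m: "\<exists>x. ind m x" "\<And>m'. \<exists>x. ind m' x \<Longrightarrow> m' \<le> m"
    using ex_has_greatest_nat[where P = "\<lambda>m. \<exists>x. ind m x" and f = "\<lambda>m. m" and k = 0 and b = "n + 1"] ind0 bound
    by blast
  obtain x where x: "ind m x" using m(1) by blast
  have surj: "\<exists>a\<in>A m. y - comb m x a \<in> I" for y
  proof (rule ccontr)
    assume no: "\<not> (\<exists>a\<in>A m. y - comb m x a \<in> I)"
    define x' where "x' = x(m := y)"
    have comb': "comb (Suc m) x' a = comb m x a + of_nat (a m) * y" for a
      by (simp add: comb_def x'_def)
    have key: False if "a \<in> A (Suc m)" "b \<in> A (Suc m)" "comb (Suc m) x' a - comb (Suc m) x' b \<in> I" "b m < a m" for a b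
    proof -
      define c where "c = a m - b m"
      have al: "a i < l" if "i < Suc m" for i using \<open>a \<in> A (Suc m)\<close> that by (auto simp: A_def PiE_iff)
      have c: "0 < c" "c < l" using \<open>b m < a m\<close> al[of m] by (auto simp: c_def)
      \<comment> \<open>The difference c of the last coefficients is invertible modulo l; its
        inverse c' solves the relation for y, which makes y a combination of the old family.\<close>
      hence "coprime c l" using l(1) by (meson coprime_commute nat_dvd_not_less prime_imp_coprime)
      moreover obtain d c' z where "d dvd c" "d dvd l" "c * c' = l * z + d"
        using bezout_add_strong_nat[of c l] c by blast
      ultimately have "c * c' = l * z + 1" by (metis coprime_common_divisor_nat)
      hence cc: "c * c' mod l = 1" using l1 mod_mult_self2[of 1 l z] by (metis add.commute mod_less)
      have "of_nat (a m) = of_nat (b m) + (of_nat c :: 'a)" using \<open>b m < a m\<close> by (simp add: c_def of_nat_diff)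
      hence e1: "comb m x a - comb m x b + of_nat c * y \<in> I" using that(3) by (simp add: comb' algebra_simps)
      \<comment> \<open>Coefficients are natural numbers, so \<open>l - a i\<close> stands for the
        negative of \<open>a i\<close> modulo l.\<close>
      define e where "e i = c' * (b i + (l - a i))" for i
      have "comb m x e - of_nat c' * (comb m x b - comb m x a) = (\<Sum>i<m. (of_nat c' * x i) * of_nat l)"
      proof -
        have "comb m x e - of_nat c' * (comb m x b - comb m x a) =
           (\<Sum>i<m. of_nat (e i) * x i - of_nat c' * (of_nat (b i) * x i - of_nat (a i) * x i))"
          by (simp add: comb_def sum_subtractf sum_distrib_left right_diff_distrib)
        also have "\<dots> = (\<Sum>i<m. (of_nat c' * x i) * of_nat l)"
        proof (rule sum.cong)
          fix i assume "i \<in> {..<m}"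
          hence "a i \<le> l" using al[of i] by simp
          hence e: "of_nat (e i) = of_nat c' * (of_nat (b i) + (of_nat l - of_nat (a i) :: 'a))"
            unfolding e_def by (simp only: of_nat_mult of_nat_add of_nat_diff)
          show "of_nat (e i) * x i - of_nat c' * (of_nat (b i) * x i - of_nat (a i) * x i) = of_nat c' * x i * of_nat l"
            unfolding e by (simp add: algebra_simps)
        qed simp
        finally show ?thesis .
      qed
      hence e2: "comb m x e - of_nat c' * (comb m x b - comb m x a) \<in> I"
        using idI(4)[OF l(2)] by (auto intro: ideal_sum[OF I(1)])
      have e3: "y - of_nat c' * (of_nat c * y) \<in> I"
        using modl[of "c * c'" y] unfolding cc by (simp add: ac_simps)
      have e4: "of_nat c' * (comb m x a - comb m x b + of_nat c * y) \<in> I" by (rule idI(4)[OF e1])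
      let ?e = "\<lambda>i. if i < m then e i mod l else undefined"
      have "(y - of_nat c' * (of_nat c * y)) + of_nat c' * (comb m x a - comb m x b + of_nat c * y)
          - (comb m x e - of_nat c' * (comb m x b - comb m x a)) - (comb m x ?e - comb m x e) \<in> I"
        by (rule idI(3)[OF idI(3)[OF idI(2)[OF e3 e4] e2] combmod])
      hence "y - comb m x ?e \<in> I" by (simp add: algebra_simps)
      thus False using no inA by blast
    qed
    have "ind (Suc m) x'"
      unfolding ind_def
    proof (intro ballI impI)
      fix a b assume ab: "a \<in> A (Suc m)" "b \<in> A (Suc m)" "comb (Suc m) x' a - comb (Suc m) x' b \<in> I"
      have "comb (Suc m) x' b - comb (Suc m) x' a \<in> I"
        using ab(3) subgrp_diff_commute[OF ideal_subgrp[OF I(1)]] by blast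
      hence eq: "a m = b m" using key[OF ab] key[OF ab(2,1)] by (meson linorder_neqE_nat)
      have r: "restrict a {..<m} \<in> A m" "restrict b {..<m} \<in> A m"
        using ab by (auto simp: A_def PiE_iff)
      have cr: "comb m x (restrict a {..<m}) = comb m x a" for a by (simp add: comb_def)
      have "comb m x (restrict a {..<m}) - comb m x (restrict b {..<m}) \<in> I"
        using ab(3) eq by (simp add: comb' cr)
      hence *: "restrict a {..<m} = restrict b {..<m}" using x r unfolding ind_def by blast
      have "a i = b i" if "i < Suc m" for i
        using that eq fun_cong[OF *, of i] by (auto simp: less_Suc_eq)
      thus "a = b" using ab by (intro PiE_ext[of a "{..<Suc m}" "\<lambda>_. {..<l}"]) (auto simp: A_def)
    qed
    thus False using m(2)[of "Suc m"] by auto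
  qed
  obtain \<phi> where \<phi>: "\<And>y. \<phi> y \<in> A m \<and> y - comb m x (\<phi> y) \<in> I"
    using surj by metis
  have uniq: "\<phi> y = a" if "a \<in> A m" "y - comb m x a \<in> I" for y a
  proof -
    have "(y - comb m x a) - (y - comb m x (\<phi> y)) \<in> I" by (rule idI(3)[OF that(2) conjunct2[OF \<phi>]])
    hence "comb m x (\<phi> y) - comb m x a \<in> I" by simp
    thus ?thesis using x \<phi>[of y] that(1) unfolding ind_def by blast
  qed
  have "m > 0"
  proof (rule ccontr)
    assume "\<not> m > 0"
    hence "y \<in> I" for y using \<phi>[of y] by (simp add: comb_def)
    thus False using I(2) by blast
  qed
  moreover have "\<phi> ` UNIV = ({..<m} \<rightarrow>\<^sub>E {..<l})"
  proof
    show "\<phi> ` UNIV \<subseteq> ({..<m} \<rightarrow>\<^sub>E {..<l})" using \<phi> by (auto simp: A_def)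
    show "({..<m} \<rightarrow>\<^sub>E {..<l}) \<subseteq> \<phi> ` UNIV"
    proof
      fix a assume "a \<in> {..<m} \<rightarrow>\<^sub>E {..<l}"
      hence "\<phi> (comb m x a) = a" using uniq[of a "comb m x a"] idI(1) by (simp add: A_def)
      thus "a \<in> \<phi> ` UNIV" by (metis rangeI)
    qed
  qed
  moreover have "\<phi> (y + z) = (\<lambda>i. if i < m then (\<phi> y i + \<phi> z i) mod l else undefined)" for y z
  proof (rule uniq)
    let ?c = "\<lambda>i. \<phi> y i + \<phi> z i"
    let ?e = "\<lambda>i. if i < m then ?c i mod l else undefined"
    show "?e \<in> A m" by (rule inA)
    have "comb m x ?c = comb m x (\<phi> y) + comb m x (\<phi> z)"
      by (simp add: comb_def sum.distrib distrib_right)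
    moreover have "(y - comb m x (\<phi> y)) + (z - comb m x (\<phi> z)) - (comb m x ?e - comb m x ?c) \<in> I"
      by (rule idI(3)[OF idI(2)[OF conjunct2[OF \<phi>] conjunct2[OF \<phi>]] combmod])
    ultimately show "y + z - comb m x ?e \<in> I" by (simp add: algebra_simps)
  qed
  moreover have "\<phi> y = (\<lambda>i. if i < m then 0 else undefined) \<longleftrightarrow> y \<in> I" for y
  proof -
    let ?z = "\<lambda>i. if i < m then 0 else undefined :: nat"
    have z: "?z \<in> A m" unfolding A_def using l1 by (auto simp: PiE_iff extensional_def)
    have "comb m x ?z = 0" by (simp add: comb_def)
    thus ?thesis using \<phi>[of y] uniq[OF z, of y] by auto
  qed
  ultimately show ?thesis unfolding elem_abelian_quot_def using l(1) by blast
qed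

context dedekind_primes
begin

lemma Q_index: obtains n where "has_index UNIV (Q m) n"
  using ideal_has_index[OF ideal_Q Q_nonzero] by blast

text \<open>Balancedness controls only subgroups over an ideal of \<open>ideals_I\<close>, and H
  need not contain one. Enlarging H to H + lT with a suitable prime l helps, because Q m + lT has a
  quotient killed by l.\<close>

lemma proper_subgroup_elem_abelian:
  assumes H: "subgrp H" "Q m \<subseteq> H" "H \<noteq> UNIV"
  obtains I H' where "I \<in> ideals_I" "Q m \<subseteq> I" "I \<subseteq> H'" "subgrp H'" "H \<subseteq> H'" "H' \<noteq> UNIV"
proof -
  obtain n where n: "has_index UNIV (Q m) n" by (rule Q_index)
  obtain R where R: "finite R" "transv UNIV (Q m) R" using n by (auto simp: has_index_def)
  have "\<exists>r. r \<in> R \<and> y - r \<in> Q m" for y using transv_rep[OF R(2), of y] by blast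
  then obtain rep where rep: "\<And>y. rep y \<in> R \<and> y - rep y \<in> Q m" by metis
  \<comment> \<open>By pigeonhole a positive integer j lies in Q m; then H + jT = H is proper, so
    there is a least positive j with this property.\<close>
  have "\<not> inj_on (\<lambda>j::nat. rep (of_nat j)) UNIV"
    using R(1) rep infinite_UNIV_nat finite_subset[of "range (\<lambda>j::nat. rep (of_nat j))" R]
    by (auto dest: finite_imageD)
  then obtain a b :: nat where "a < b" "rep (of_nat a) = rep (of_nat b)"
    by (metis inj_onI linorder_neqE_nat)
  hence "(of_nat b - rep (of_nat b)) - (of_nat a - rep (of_nat a)) \<in> Q m"
    by (intro ideal_diff[OF ideal_Q conjunct2[OF rep] conjunct2[OF rep]])
  hence N0: "of_nat (b - a) \<in> Q m" "b - a > 0"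
    using \<open>a < b\<close> \<open>rep (of_nat a) = rep (of_nat b)\<close> by (auto simp: of_nat_diff)
  define G where "G j = msum H (range (\<lambda>t. t * of_nat j))" for j :: nat
  define bad where "bad j \<longleftrightarrow> j > 0 \<and> G j \<noteq> UNIV" for j
  have Hmult: "of_nat j * h \<in> H" if "h \<in> H" for j h
    by (induction j) (use that H(1) in \<open>auto simp: distrib_right subgrp_zero subgrp_add\<close>)
  have Gsub: "subgrp (G j)" for j
    unfolding G_def by (rule subgrp_msum[OF H(1) ideal_subgrp[OF ideal_principal]])
  have "G (b - a) \<subseteq> H"
    unfolding G_def using H(2) ideal_mult_left[OF ideal_Q N0(1)] by (intro msum_least[OF H(1)]) auto
  hence "bad (b - a)" using N0(2) H(3) by (auto simp: bad_def)
  define l where "l = (LEAST j. bad j)"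
  have bl: "bad l" unfolding l_def by (rule LeastI) fact
  have less: "G j = UNIV" if "j < l" "j > 0" for j
    using not_less_Least[of j bad] that by (auto simp: l_def bad_def)
  have "G 1 = UNIV" using msum_superset2[OF subgrp_zero[OF H(1)], of UNIV] by (auto simp: G_def)
  hence "l > 1" using bl by (cases "l = 1") (auto simp: bad_def)
  \<comment> \<open>H + cT = T and H + dT = T imply H + cdT = T, as H is stable under multiplication
    by integers. So the least j with H + jT proper is a prime.\<close>
  have Gm: "G (c * d) = UNIV" if "G c = UNIV" "G d = UNIV" for c d
  proof -
    have "x \<in> G (c * d)" for x
    proof -
      have "x \<in> G c" using that by simp
      then obtain h t where h: "h \<in> H" "x = h + t * of_nat c" by (auto simp: G_def elim!: msumE)
      have "t \<in> G d" using that by simp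
      then obtain h' s where h': "h' \<in> H" "t = h' + s * of_nat d" by (auto simp: G_def elim!: msumE)
      have "x = (h + of_nat c * h') + s * of_nat (c * d)" using h h' by (simp add: algebra_simps)
      moreover have "h + of_nat c * h' \<in> H" by (rule subgrp_add[OF H(1) h(1) Hmult[OF h'(1)]])
      ultimately show ?thesis unfolding G_def using msumI[OF _ rangeI[of "\<lambda>t. t * of_nat (c * d)" s]] by metis
    qed
    thus ?thesis by blast
  qed
  have l: "prime l"
  proof (rule ccontr)
    assume "\<not> prime l"
    then obtain c where c: "c dvd l" "c \<noteq> 1" "c \<noteq> l" using \<open>l > 1\<close> by (auto simp: prime_nat_iff)
    then obtain d where d: "l = c * d" by blast
    have "c \<noteq> 0" "d \<noteq> 0" "d \<noteq> 1" using c d \<open>l > 1\<close> by (cases "c = 0 \<or> d = 0"; auto)+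
    hence "0 < c" "c < l" "0 < d" "d < l" using c(2) d by auto
    thus False using Gm[OF less less, of c d] bl d by (auto simp: bad_def)
  qed
  define I where "I = msum (Q m) (range (\<lambda>t. t * of_nat l))"
  have idI: "ideal I" unfolding I_def by (rule ideal_msum[OF ideal_Q ideal_principal])
  have QI: "Q m \<subseteq> I" unfolding I_def by (rule msum_superset1[OF ideal_zero[OF ideal_principal]])
  have IG: "I \<subseteq> G l" unfolding I_def G_def by (rule msum_mono[OF H(2) subset_refl])
  have HG: "H \<subseteq> G l" unfolding G_def by (rule msum_superset1[OF ideal_zero[OF ideal_principal]])
  have "of_nat l \<in> I"
    unfolding I_def by (rule subsetD[OF msum_superset2[OF ideal_zero[OF ideal_Q]]]) (rule range_eqI[of _ _ 1], simp)
  moreover obtain n' where "has_index UNIV I n'"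
    using has_index_mono[OF ideal_subgrp[OF idI] ideal_subgrp[OF ideal_Q] QI n] by blast
  moreover have "I \<noteq> UNIV" using IG bl by (auto simp: bad_def)
  ultimately have "elem_abelian_quot I" using elem_abelian_quotI[OF idI _ l] by blast
  moreover have "I \<noteq> {0}" using QI Q_nonzero[of m] ideal_zero[OF ideal_Q, of m] by blast
  ultimately have "I \<in> ideals_I" using idI by (simp add: ideals_I_def)
  moreover have "G l \<noteq> UNIV" using bl by (simp add: bad_def)
  ultimately show thesis using that QI IG HG Gsub by blast
qed

text \<open>The values of \<epsilon> may accumulate at 0, but only finitely many ideals contain Q m,
  each being determined by its trace on a finite transversal.\<close>

lemma balanced_uniform:
  assumes eps: "\<And>I::'a set. I \<in> ideals_I \<Longrightarrow> \<epsilon> I > (0::real)"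
  obtains \<epsilon>0 where "0 < \<epsilon>0" "\<epsilon>0 < 1"
    "\<And>d H a. balanced \<epsilon> d \<Longrightarrow> subgrp H \<Longrightarrow> Q m \<subseteq> H \<Longrightarrow> H \<noteq> UNIV \<Longrightarrow>
       measure_pmf.prob d {x. x - a \<in> H} \<le> 1 - \<epsilon>0"
proof -
  obtain n where n: "has_index UNIV (Q m) n" by (rule Q_index)
  obtain R where R: "finite R" "transv UNIV (Q m) R" using n by (auto simp: has_index_def)
  define S where "S = {I::'a set. I \<in> ideals_I \<and> Q m \<subseteq> I}"
  have "inj_on (\<lambda>I. R \<inter> I) S"
  proof (rule inj_onI)
    have sub: "I \<subseteq> J" if "I \<in> S" "J \<in> S" "R \<inter> I = R \<inter> J" for I J
    proof
      fix x assume "x \<in> I"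
      have id: "ideal I" "ideal J" "Q m \<subseteq> I" "Q m \<subseteq> J" using that by (auto simp: S_def ideals_I_def)
      obtain r where r: "r \<in> R" "x - r \<in> Q m" using transv_rep[OF R(2)] by blast
      have "x - (x - r) \<in> I" by (rule ideal_diff[OF id(1) \<open>x \<in> I\<close>]) (use r id in blast)
      hence "r \<in> J" using r that by auto
      hence "(x - r) + r \<in> J" using r id by (intro ideal_add) auto
      thus "x \<in> J" by simp
    qed
    fix I J assume "I \<in> S" "J \<in> S" "R \<inter> I = R \<inter> J"
    thus "I = J" using sub[of I J] sub[of J I] by blast
  qed
  moreover have "(\<lambda>I. R \<inter> I) ` S \<subseteq> Pow R" by auto
  ultimately have finS: "finite S" using R(1) by (meson finite_Pow_iff finite_imageD finite_subset)
  \<comment> \<open>The value 1/2 keeps the set nonempty and the constant below 1.\<close>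
  define \<epsilon>0 where "\<epsilon>0 = Min (insert (1/2) (\<epsilon> ` S))"
  have pos: "0 < \<epsilon>0" unfolding \<epsilon>0_def using finS eps by (subst Min_gr_iff) (auto simp: S_def)
  have "\<epsilon>0 \<le> 1/2" unfolding \<epsilon>0_def using finS by (intro Min_le) auto
  hence lt: "\<epsilon>0 < 1" by simp
  have "measure_pmf.prob d {x. x - a \<in> H} \<le> 1 - \<epsilon>0"
    if b: "balanced \<epsilon> d" and H: "subgrp H" "Q m \<subseteq> H" "H \<noteq> UNIV" for d H a
  proof -
    obtain I H' where I: "I \<in> ideals_I" "Q m \<subseteq> I" "I \<subseteq> H'" "subgrp H'" "H \<subseteq> H'" "H' \<noteq> UNIV"
      using proper_subgroup_elem_abelian[OF H] by blast
    have "add_subgroup H'" using I(4) by (simp add: add_subgroup_def subgrp_zero subgrp_add subgrp_neg)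
    hence "measure_pmf.prob d ((\<lambda>h. a + h) ` H') \<le> 1 - \<epsilon> I"
      using b I unfolding balanced_def by blast
    moreover have "{x. x - a \<in> H} \<subseteq> (\<lambda>h. a + h) ` H'"
    proof
      fix x assume "x \<in> {x. x - a \<in> H}"
      thus "x \<in> (\<lambda>h. a + h) ` H'" using I(5) by (intro image_eqI[of _ _ "x - a"]) auto
    qed
    hence "measure_pmf.prob d {x. x - a \<in> H} \<le> measure_pmf.prob d ((\<lambda>h. a + h) ` H')"
      by (intro measure_pmf.finite_measure_mono) auto
    moreover have "\<epsilon>0 \<le> \<epsilon> I" unfolding \<epsilon>0_def using finS I by (intro Min_le) (auto simp: S_def)
    ultimately show ?thesis by linarith
  qed
  thus thesis using that pos lt by blast
qed

end

section \<open>Mixing of sums of independent balanced terms\<close>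

lemma prob_pair_pmf_times:
  "measure_pmf.prob (pair_pmf M N) (A \<times> B) = measure_pmf.prob M A * measure_pmf.prob N B"
proof -
  have "measure_pmf.prob (pair_pmf M N) (A \<times> B) =
      measure_pmf.prob (pair_pmf M N) ((A \<inter> set_pmf M) \<times> (B \<inter> set_pmf N))"
    by (rule measure_prob_cong_0) (auto simp: pmf_eq_0_set_pmf)
  also have "\<dots> = measure_pmf.prob M (A \<inter> set_pmf M) * measure_pmf.prob N (B \<inter> set_pmf N)"
    by (rule measure_pmf_prob_product) auto
  finally show ?thesis by (simp add: measure_Int_set_pmf)
qed

definition depends_on :: "'i set \<Rightarrow> (('i \<Rightarrow> 'a) \<Rightarrow> bool) \<Rightarrow> bool" where
  "depends_on A P \<longleftrightarrow> (\<forall>f g. (\<forall>x\<in>A. f x = g x) \<longrightarrow> P f = P g)"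

lemma prob_Pi_pmf_Un:
  assumes "finite A" "finite B" "A \<inter> B = {}" "depends_on A P" "depends_on B Q"
  shows "measure_pmf.prob (Pi_pmf (A \<union> B) d D) {f. P f \<and> Q f} =
    measure_pmf.prob (Pi_pmf A d D) {f. P f} * measure_pmf.prob (Pi_pmf B d D) {f. Q f}"
proof -
  let ?h = "\<lambda>(f, g) x. if x \<in> A then f x else g x"
  have "Pi_pmf (A \<union> B) d D = map_pmf ?h (pair_pmf (Pi_pmf A d D) (Pi_pmf B d D))"
    using assms by (intro Pi_pmf_union) auto
  hence "measure_pmf.prob (Pi_pmf (A \<union> B) d D) {f. P f \<and> Q f} =
     measure_pmf.prob (pair_pmf (Pi_pmf A d D) (Pi_pmf B d D)) (?h -` {f. P f \<and> Q f})"
    by simp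
  also have "?h -` {f. P f \<and> Q f} = {f. P f} \<times> {f. Q f}"
  proof -
    have "P (?h (f, g)) = P f" "Q (?h (f, g)) = Q g" for f g
    proof -
      have "\<forall>x\<in>A. ?h (f, g) x = f x" "\<forall>x\<in>B. ?h (f, g) x = g x" using assms(3) by auto
      thus "P (?h (f, g)) = P f" "Q (?h (f, g)) = Q g" using assms(4,5) unfolding depends_on_def by blast+
    qed
    thus ?thesis by auto
  qed
  finally show ?thesis by (simp add: prob_pair_pmf_times)
qed

lemma prob_Pi_pmf_blocks:
  assumes "finite C" "\<And>c. c \<in> C \<Longrightarrow> finite (A c)" "disjoint_family_on A C"
    "\<And>c. c \<in> C \<Longrightarrow> depends_on (A c) (P c)"
  shows "measure_pmf.prob (Pi_pmf (\<Union>c\<in>C. A c) d D) {f. \<forall>c\<in>C. P c f} =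
    (\<Prod>c\<in>C. measure_pmf.prob (Pi_pmf (A c) d D) {f. P c f})"
  using assms
proof (induction C rule: finite_induct)
  case empty
  thus ?case by simp
next
  case (insert c C)
  have dis: "A c \<inter> (\<Union>c\<in>C. A c) = {}"
    using insert.hyps insert.prems(2) unfolding disjoint_family_on_def by auto
  have "depends_on (\<Union>c\<in>C. A c) (\<lambda>f. \<forall>c\<in>C. P c f)"
    using insert.prems(3) unfolding depends_on_def by (metis UN_I insertCI)
  hence "measure_pmf.prob (Pi_pmf (A c \<union> (\<Union>c\<in>C. A c)) d D) {f. P c f \<and> (\<forall>c\<in>C. P c f)} =
     measure_pmf.prob (Pi_pmf (A c) d D) {f. P c f} *
     measure_pmf.prob (Pi_pmf (\<Union>c\<in>C. A c) d D) {f. \<forall>c\<in>C. P c f}"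
    using insert dis by (intro prob_Pi_pmf_Un) auto
  moreover have "disjoint_family_on A C"
    using insert.prems(2) by (auto simp: disjoint_family_on_def)
  ultimately show ?case using insert by simp
qed

lemma prob_Pi_pmf_singleton:
  "measure_pmf.prob (Pi_pmf {j} d D) {f. P (f j)} = measure_pmf.prob (D j) {x. P x}"
  by (simp add: Pi_pmf_singleton vimage_def)

text \<open>The law of a sum of x_j e_j with independent x_j, observed in the finite quotient V/L
  represented by \<open>R\<close>. The assumption \<open>bal\<close> speaks of additive subgroups
  because it is applied to stabilizers of sets of cosets, and these need not be submodules.\<close>

locale mixing = module scale for scale :: "'a::comm_ring_1 \<Rightarrow> 'b::ab_group_add \<Rightarrow> 'b" +
  fixes V L R :: "'b set" and D :: "'i \<Rightarrow> 'a pmf" and e :: "'i \<Rightarrow> 'b" and J0 :: "'i set" and \<epsilon>0 :: real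
  assumes V: "subspace V" and L: "subspace L" and LV: "L \<subseteq> V" and finR: "finite R" and R: "transv V L R"
    and finJ: "finite J0" and eV: "\<And>j. j \<in> J0 \<Longrightarrow> e j \<in> V"
    and eps0: "0 < \<epsilon>0" "\<epsilon>0 < 1"
    and bal: "\<And>j H y a. j \<in> J0 \<Longrightarrow> subgrp H \<Longrightarrow> L \<subseteq> H \<Longrightarrow> scale y (e j) \<notin> H \<Longrightarrow>
      measure_pmf.prob (D j) {x. scale x (e j) - a \<in> H} \<le> 1 - \<epsilon>0"
begin

definition lc :: "'i set \<Rightarrow> ('i \<Rightarrow> 'a) \<Rightarrow> 'b" where
  "lc J f = (\<Sum>j\<in>J. scale (f j) (e j))"

definition mass :: "'i set \<Rightarrow> 'b \<Rightarrow> real" where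
  "mass J a = measure_pmf.prob (Pi_pmf J 0 D) {f. lc J f - a \<in> L}"

text \<open>Chosen so that the cosets of mass below \<open>\<eta>\<close> together have mass below
  \<open>\<epsilon>0\<close>.\<close>

definition \<eta> :: real where "\<eta> = \<epsilon>0 / card R"

text \<open>Robust under deletion: without s of the indices the condition still holds with h - s, so
  blocks of indices can be removed one after another.\<close>

definition spread :: "'i set \<Rightarrow> nat \<Rightarrow> bool" where
  "spread J h \<longleftrightarrow> (\<forall>B. subspace B \<and> L \<subseteq> B \<and> B \<subseteq> V \<and> B \<noteq> V \<longrightarrow> h \<le> card {j\<in>J. e j \<notin> B})"

lemma subgrps: "subgrp V" "subgrp L"
  using V L subspace_subgrp by auto

lemma RV: "R \<subseteq> V"
  using R by (simp add: transv_def)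

lemma card_R: "card R > 0"
  using has_index_pos[OF subgrps(1), of L "card R"] R finR unfolding has_index_def by blast

lemma eta: "0 < \<eta>" "\<eta> \<le> 1" "\<eta> * card R = \<epsilon>0"
proof -
  have "real (card R) \<ge> 1" using card_R by linarith
  thus "0 < \<eta>" "\<eta> \<le> 1" "\<eta> * card R = \<epsilon>0" using eps0 by (auto simp: \<eta>_def field_simps)
qed

lemma lc_V: "J \<subseteq> J0 \<Longrightarrow> lc J f \<in> V"
  unfolding lc_def using eV by (intro subspace_sum[OF V] subspace_scale[OF V]) auto

lemma depends_on_lc: "depends_on J (\<lambda>f. P (lc J f))"
proof -
  have "lc J f = lc J g" if "\<forall>x\<in>J. f x = g x" for f g
    unfolding lc_def using that by (intro sum.cong) auto
  thus ?thesis unfolding depends_on_def by metis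
qed

lemma mass_nonneg: "0 \<le> mass J a" and mass_le_1: "mass J a \<le> 1"
  unfolding mass_def by auto

lemma mass_cong: "a - b \<in> L \<Longrightarrow> mass J a = mass J b"
proof -
  assume ab: "a - b \<in> L"
  have "x - a \<in> L \<longleftrightarrow> x - b \<in> L" for x
    using subgrp_diff_trans[OF subgrps(2), of x a b] subgrp_diff_trans[OF subgrps(2), of x b a] ab
      subgrp_diff_commute[OF subgrps(2), of a b] by blast
  thus ?thesis unfolding mass_def by simp
qed

definition rep :: "'b \<Rightarrow> 'b" where "rep x = (THE r. r \<in> R \<and> x - r \<in> L)"

lemma rep: assumes "x \<in> V" shows "rep x \<in> R \<and> x - rep x \<in> L"
proof -
  have "\<exists>!r. r \<in> R \<and> x - r \<in> L" using R assms by (simp add: transv_def)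
  from theI'[OF this] show ?thesis unfolding rep_def .
qed

lemma R_unique:
  assumes "x \<in> V" "r \<in> R" "r' \<in> R" "x - r \<in> L" "x - r' \<in> L" shows "r = r'"
proof -
  have "\<exists>!r. r \<in> R \<and> x - r \<in> L" using R assms by (simp add: transv_def)
  thus ?thesis using assms by blast
qed

lemma rep_unique: "x \<in> V \<Longrightarrow> r \<in> R \<Longrightarrow> x - r \<in> L \<Longrightarrow> rep x = r"
  using R_unique[of x "rep x" r] rep[of x] by simp

lemma rep_eq_iff:
  assumes "x \<in> V" "y \<in> V" shows "rep x = rep y \<longleftrightarrow> x - y \<in> L"
proof
  assume "rep x = rep y"
  hence "x - rep x \<in> L" "rep x - y \<in> L"
    using rep[OF assms(1)] rep[OF assms(2)] subgrp_diff_commute[OF subgrps(2), of y "rep y"] by auto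
  thus "x - y \<in> L" by (rule subgrp_diff_trans[OF subgrps(2)])
next
  assume xy: "x - y \<in> L"
  have "x - rep y \<in> L" using subgrp_diff_trans[OF subgrps(2) xy] rep[OF assms(2)] by blast
  thus "rep x = rep y" using rep_unique[OF assms(1)] rep[OF assms(2)] by blast
qed

lemma mass_sum: "J \<subseteq> J0 \<Longrightarrow> (\<Sum>r\<in>R. mass J r) = 1"
proof -
  assume J: "J \<subseteq> J0"
  have "(\<Sum>r\<in>R. mass J r) = measure_pmf.prob (Pi_pmf J 0 D) (\<Union>r\<in>R. {f. lc J f - r \<in> L})"
    unfolding mass_def
  proof (rule measure_pmf.finite_measure_finite_Union[symmetric])
    show "disjoint_family_on (\<lambda>r. {f. lc J f - r \<in> L}) R"
      unfolding disjoint_family_on_def using R_unique[OF lc_V[OF J]] by blast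
  qed (use finR in auto)
  also have "(\<Union>r\<in>R. {f. lc J f - r \<in> L}) = UNIV"
    using rep[OF lc_V[OF J]] by blast
  finally show ?thesis by simp
qed

lemma sum_reflect:
  assumes a: "a \<in> V" and h: "\<And>x y. x - y \<in> L \<Longrightarrow> h x = h y"
  shows "(\<Sum>r\<in>R. h (a - r)) = (\<Sum>r\<in>R. (h r :: real))"
proof (rule sum.reindex_bij_witness[of _ "\<lambda>r. rep (a - r)" "\<lambda>r. rep (a - r)"])
  have V': "a - r \<in> V" if "r \<in> R" for r using that a RV subspace_diff[OF V] by auto
  show inv: "rep (a - rep (a - r)) = r" if "r \<in> R" for r
  proof (rule rep_unique)
    have "a - r - rep (a - r) \<in> L" using rep[OF V'[OF that]] by simp
    thus "a - rep (a - r) - r \<in> L" by (simp add: algebra_simps)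
  qed (use that V' rep[OF V'[OF that]] in auto)
  thus "rep (a - rep (a - r)) = r" if "r \<in> R" for r using that by simp
  show R': "rep (a - r) \<in> R" if "r \<in> R" for r using rep[OF V'[OF that]] by simp
  thus "rep (a - r) \<in> R" if "r \<in> R" for r using that by simp
  show "h (rep (a - r)) = h (a - r)" if "r \<in> R" for r
    using rep[OF V'[OF that]] h[of "a - r" "rep (a - r)"] by simp
qed

text \<open>Convolution: the sum runs over the coset of the partial sum over
  \<open>J1\<close>.\<close>

lemma mass_Un:
  assumes J: "J1 \<subseteq> J0" "J2 \<subseteq> J0" "J1 \<inter> J2 = {}"
  shows "mass (J1 \<union> J2) a = (\<Sum>r\<in>R. mass J1 r * mass J2 (a - r))"
proof -
  have fin: "finite J1" "finite J2" using finite_subset[OF J(1) finJ] finite_subset[OF J(2) finJ] by auto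
  have eq: "{f. lc (J1 \<union> J2) f - a \<in> L} = (\<Union>r\<in>R. {f. lc J1 f - r \<in> L \<and> lc J2 f - (a - r) \<in> L})"
  proof -
    have lc: "lc (J1 \<union> J2) f = lc J1 f + lc J2 f" for f
      unfolding lc_def by (rule sum.union_disjoint[OF fin J(3)])
    have "lc (J1 \<union> J2) f - a \<in> L \<longleftrightarrow> (\<exists>r\<in>R. lc J1 f - r \<in> L \<and> lc J2 f - (a - r) \<in> L)" for f
    proof
      assume A: "lc (J1 \<union> J2) f - a \<in> L"
      let ?r = "rep (lc J1 f)"
      have r: "?r \<in> R" "lc J1 f - ?r \<in> L" using rep[OF lc_V[OF J(1)]] by auto
      have "(lc (J1 \<union> J2) f - a) - (lc J1 f - ?r) \<in> L" by (rule subgrp_diff[OF subgrps(2) A r(2)])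
      hence "lc J2 f - (a - ?r) \<in> L" by (simp add: lc algebra_simps)
      thus "\<exists>r\<in>R. lc J1 f - r \<in> L \<and> lc J2 f - (a - r) \<in> L" using r by blast
    next
      assume "\<exists>r\<in>R. lc J1 f - r \<in> L \<and> lc J2 f - (a - r) \<in> L"
      then obtain r where r: "lc J1 f - r \<in> L" "lc J2 f - (a - r) \<in> L" by blast
      show "lc (J1 \<union> J2) f - a \<in> L" using subgrp_add[OF subgrps(2) r] by (simp add: lc algebra_simps)
    qed
    thus ?thesis by auto
  qed
  have "mass (J1 \<union> J2) a = (\<Sum>r\<in>R. measure_pmf.prob (Pi_pmf (J1 \<union> J2) 0 D) {f. lc J1 f - r \<in> L \<and> lc J2 f - (a - r) \<in> L})"
    unfolding mass_def eq
  proof (rule measure_pmf.finite_measure_finite_Union)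
    show "disjoint_family_on (\<lambda>r. {f. lc J1 f - r \<in> L \<and> lc J2 f - (a - r) \<in> L}) R"
      unfolding disjoint_family_on_def using R_unique[OF lc_V[OF J(1)]] by blast
  qed (use finR in auto)
  also have "\<dots> = (\<Sum>r\<in>R. mass J1 r * mass J2 (a - r))"
    unfolding mass_def using fin J(3)
    by (intro sum.cong refl prob_Pi_pmf_Un depends_on_lc)
  finally show ?thesis .
qed

text \<open>The threshold is multiplicative in the number of summands, so that a heavy value plus a
  heavy value of one new summand is heavy again.\<close>

definition heavy :: "'i set \<Rightarrow> 'b set" where
  "heavy S = {a\<in>V. \<eta> ^ card S \<le> mass S a}"

lemma heavy_cong: "a - b \<in> L \<Longrightarrow> a \<in> V \<Longrightarrow> b \<in> V \<Longrightarrow> a \<in> heavy S \<longleftrightarrow> b \<in> heavy S"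
  unfolding heavy_def using mass_cong by auto

lemma heavy_insert:
  assumes S: "S \<subseteq> J0" "j \<in> J0" "j \<notin> S" and a: "a \<in> heavy S" and s: "s \<in> heavy {j}"
  shows "a + s \<in> heavy (insert j S)"
proof -
  have aV: "a \<in> V" "s \<in> V" using a s by (auto simp: heavy_def)
  have r: "rep s \<in> R" "s - rep s \<in> L" using rep[OF aV(2)] by auto
  have fin: "finite S" using S finJ finite_subset by blast
  have "\<eta> ^ card (insert j S) = \<eta> * \<eta> ^ card S" using S fin by simp
  also have "\<dots> \<le> mass {j} s * mass S a"
    using a s eta(1) by (intro mult_mono) (auto simp: heavy_def mass_nonneg)
  also have "\<dots> = mass {j} (rep s) * mass S (a + s - rep s)"
  proof -
    have "mass {j} s = mass {j} (rep s)" using r by (intro mass_cong)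
    moreover have "mass S a = mass S (a + s - rep s)"
      using subgrp_neg[OF subgrps(2) r(2)] by (intro mass_cong) (simp add: algebra_simps)
    ultimately show ?thesis by simp
  qed
  also have "\<dots> \<le> (\<Sum>r\<in>R. mass {j} r * mass S (a + s - r))"
    using r finR by (intro member_le_sum) (auto simp: mass_nonneg)
  also have "\<dots> = mass ({j} \<union> S) (a + s)" using S by (intro mass_Un[symmetric]) auto
  finally show ?thesis using aV subspace_add[OF V] by (simp add: heavy_def)
qed

text \<open>If adding \<open>e j\<close> does not enlarge the set of heavy cosets, that set is stable under the differences
  of the heavy values of \<open>x e\<^sub>j\<close>, and balancedness forces \<open>e j\<close> into its stabilizer.\<close>
lemma heavy_grows_or_stable:
  assumes S: "S \<subseteq> J0" "j \<in> J0" "j \<notin> S"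
    and H: "H = {h\<in>V. \<forall>a\<in>heavy S. a + h \<in> heavy S \<and> a - h \<in> heavy S}"
    and y: "scale y (e j) \<notin> H"
  shows "card (R \<inter> heavy S) < card (R \<inter> heavy (insert j S))"
proof (rule ccontr)
  assume le: "\<not> card (R \<inter> heavy S) < card (R \<inter> heavy (insert j S))"
  let ?A = "heavy S" and ?A' = "heavy (insert j S)"
  have AV: "?A \<subseteq> V" "?A' \<subseteq> V" by (auto simp: heavy_def)
  \<comment> \<open>Translation by \<open>s'\<close> injects the heavy cosets of S into those of
    \<open>insert j S\<close>; as the latter are not more numerous, it is onto. So a + s equals r +
    s' modulo L for a heavy r.\<close>
  have shift: "a + (s - s') \<in> ?A" if s: "s \<in> heavy {j}" "s' \<in> heavy {j}" and a: "a \<in> ?A" for s s' a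
  proof -
    have sV: "s \<in> V" "s' \<in> V" "a \<in> V" using s a by (auto simp: heavy_def)
    let ?f = "\<lambda>r. rep (r + s')"
    have fV: "r + s' \<in> V" if "r \<in> R \<inter> ?A" for r using that AV sV subspace_add[OF V] by blast
    have sub: "?f ` (R \<inter> ?A) \<subseteq> R \<inter> ?A'"
    proof
      fix x assume "x \<in> ?f ` (R \<inter> ?A)"
      then obtain r where r: "r \<in> R" "r \<in> ?A" "x = ?f r" by blast
      have h: "r + s' \<in> ?A'" by (rule heavy_insert[OF S r(2) s(2)])
      have "r + s' \<in> V" using h AV by blast
      hence "x \<in> R" "r + s' - x \<in> L" using rep r by auto
      thus "x \<in> R \<inter> ?A'" using heavy_cong[of "r + s'" x] h RV AV by blast
    qed
    have "inj_on ?f (R \<inter> ?A)"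
    proof (rule inj_onI)
      fix r r' assume rr: "r \<in> R \<inter> ?A" "r' \<in> R \<inter> ?A" "?f r = ?f r'"
      have "(r + s') - (r' + s') \<in> L" using rep_eq_iff[OF fV[OF rr(1)] fV[OF rr(2)]] rr(3) by simp
      hence "r - r' \<in> L" by simp
      moreover have "r \<in> V" "r - r \<in> L" using rr RV subgrp_zero[OF subgrps(2)] by auto
      ultimately show "r = r'" using rep_unique[of r r] rep_unique[of r r'] rr by auto
    qed
    hence "card (?f ` (R \<inter> ?A)) = card (R \<inter> ?A)" by (rule card_image)
    hence img: "?f ` (R \<inter> ?A) = R \<inter> ?A'" using sub le finR by (intro card_seteq) auto
    have as: "a + s \<in> ?A'" by (rule heavy_insert[OF S a s(1)])
    hence asV: "a + s \<in> V" using AV by blast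
    have "rep (a + s) \<in> R \<inter> ?A'" using rep[OF asV] heavy_cong[of "a + s" "rep (a + s)"] as asV RV by blast
    then obtain r where r: "r \<in> R" "r \<in> ?A" "rep (a + s) = rep (r + s')" unfolding img[symmetric] by blast
    have "(a + s) - (r + s') \<in> L" using rep_eq_iff[OF asV fV, of r] r by simp
    hence "(a + (s - s')) - r \<in> L" by (simp add: algebra_simps)
    moreover have "a + (s - s') \<in> V" using sV subspace_add[OF V] subspace_diff[OF V] by blast
    ultimately show ?thesis using heavy_cong[of "a + (s - s')" r S] r RV by blast
  qed
  have subH: "subgrp H"
    unfolding subgrp_def
  proof (intro conjI ballI)
    show "0 \<in> H" unfolding H using subspace_0[OF V] by simp
    fix h h' assume hh: "h \<in> H" "h' \<in> H"
    have "a + (h - h') \<in> ?A \<and> a - (h - h') \<in> ?A" if "a \<in> ?A" for a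
    proof -
      have "(a + h) - h' \<in> ?A" "(a - h) + h' \<in> ?A" using hh that unfolding H by blast+
      thus ?thesis by (simp add: algebra_simps)
    qed
    thus "h - h' \<in> H" using hh subspace_diff[OF V] unfolding H by blast
  qed
  have LH: "L \<subseteq> H"
  proof
    fix l assume l: "l \<in> L"
    have "a + l \<in> ?A \<and> a - l \<in> ?A" if "a \<in> ?A" for a
    proof -
      have V': "a \<in> V" "a + l \<in> V" "a - l \<in> V"
        using that AV l LV subspace_add[OF V] subspace_diff[OF V] by blast+
      have "a - (a + l) \<in> L" "a - (a - l) \<in> L" using l subgrp_neg[OF subgrps(2)] by auto
      thus ?thesis using heavy_cong[of a "a + l" S] heavy_cong[of a "a - l" S] V' that by blast
    qed
    thus "l \<in> H" using l LV unfolding H by blast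
  qed
  have jsub: "{j} \<subseteq> J0" using S by simp
  \<comment> \<open>By the choice of \<open>\<eta>\<close> the light cosets weigh less than
    \<open>\<epsilon>0\<close>. The heavy ones, which all lie in s0 + H, then weigh more than 1 -
    \<epsilon>0, against balancedness.\<close>
  have light: "(\<Sum>r\<in>R - heavy {j}. mass {j} r) < \<epsilon>0"
  proof (cases "R - heavy {j} = {}")
    case False
    have "(\<Sum>r\<in>R - heavy {j}. mass {j} r) < (\<Sum>r\<in>R - heavy {j}. \<eta>)"
      using False finR RV by (intro sum_strict_mono) (auto simp: heavy_def)
    also have "\<dots> \<le> (\<Sum>r\<in>R. \<eta>)" using finR eta by (intro sum_mono2) auto
    finally show ?thesis using eta(3) by (simp add: mult.commute)
  next
    case True
    show ?thesis unfolding True using eps0 by simp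
  qed
  have "(\<Sum>r\<in>R. mass {j} r) = (\<Sum>r\<in>R \<inter> heavy {j}. mass {j} r) + (\<Sum>r\<in>R - heavy {j}. mass {j} r)"
    using finR by (rule sum.Int_Diff)
  hence big: "(\<Sum>r\<in>R \<inter> heavy {j}. mass {j} r) > 1 - \<epsilon>0" using mass_sum[OF jsub] light by linarith
  hence "R \<inter> heavy {j} \<noteq> {}" using eps0 by auto
  then obtain s0 where s0: "s0 \<in> heavy {j}" by blast
  have diffH: "s - s0 \<in> H" if "s \<in> heavy {j}" for s
  proof -
    have "a - (s - s0) \<in> ?A" if "a \<in> ?A" for a
      using shift[OF s0 \<open>s \<in> heavy {j}\<close> that] by (simp add: algebra_simps)
    moreover have "s - s0 \<in> V" using that s0 subspace_diff[OF V] by (auto simp: heavy_def)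
    ultimately show ?thesis unfolding H using shift[OF that s0] by blast
  qed
  have "(\<Sum>r\<in>R \<inter> heavy {j}. mass {j} r) =
      measure_pmf.prob (Pi_pmf {j} 0 D) (\<Union>r\<in>R \<inter> heavy {j}. {f. lc {j} f - r \<in> L})"
    unfolding mass_def
  proof (rule measure_pmf.finite_measure_finite_Union[symmetric])
    show "disjoint_family_on (\<lambda>r. {f. lc {j} f - r \<in> L}) (R \<inter> heavy {j})"
      unfolding disjoint_family_on_def using R_unique[OF lc_V[OF jsub]] by blast
  qed (use finR in auto)
  also have "\<dots> \<le> measure_pmf.prob (Pi_pmf {j} 0 D) {f. scale (f j) (e j) - s0 \<in> H}"
  proof (rule measure_pmf.finite_measure_mono)
    show "(\<Union>r\<in>R \<inter> heavy {j}. {f. lc {j} f - r \<in> L}) \<subseteq> {f. scale (f j) (e j) - s0 \<in> H}"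
    proof safe
      fix r f assume "r \<in> heavy {j}" "lc {j} f - r \<in> L"
      hence "lc {j} f - r \<in> H" "r - s0 \<in> H" using LH diffH by auto
      thus "scale (f j) (e j) - s0 \<in> H" using subgrp_diff_trans[OF subH] by (auto simp: lc_def)
    qed
  qed simp
  also have "\<dots> = measure_pmf.prob (D j) {x. scale x (e j) - s0 \<in> H}"
    by (rule prob_Pi_pmf_singleton)
  also have "\<dots> \<le> 1 - \<epsilon>0" by (rule bal[OF S(2) subH LH y])
  finally show False using big by linarith
qed

text \<open>Greedy choice: each added index enlarges the set of heavy cosets, so at most
  \<open>card R\<close> indices suffice. As long as some coset is not heavy, the stabilizer of the
  heavy ones is not V, and \<open>spread\<close> offers a fresh index to which the growth step
  applies.\<close>

lemma ex_heavy_everywhere: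
  assumes J: "J \<subseteq> J0" and sp: "spread J (card R)"
  obtains S where "S \<subseteq> J" "card S \<le> card R" "V \<subseteq> heavy S"
proof -
  have "\<exists>S\<subseteq>J. card S \<le> t \<and> min (Suc t) (card R) \<le> card (R \<inter> heavy S)" if "t < card R" for t
    using that
  proof (induction t)
    case 0
    have "0 \<in> heavy {}" using subspace_0[OF V] subspace_0[OF L] by (simp add: heavy_def mass_def lc_def)
    hence "rep 0 \<in> R \<inter> heavy {}"
      using rep[OF subspace_0[OF V]] heavy_cong[of 0 "rep 0" "{}"] subspace_0[OF V] RV by blast
    hence "R \<inter> heavy {} \<noteq> {}" by blast
    hence "card (R \<inter> heavy {}) > 0" using finR by (simp add: card_gt_0_iff)
    thus ?case by (intro exI[of _ "{}"]) auto
  next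
    case (Suc t)
    then obtain S where S: "S \<subseteq> J" "card S \<le> t" "Suc t \<le> card (R \<inter> heavy S)" by auto
    have fin: "finite S" using S J finJ finite_subset by (meson order_trans)
    show ?case
    proof (cases "Suc (Suc t) \<le> card (R \<inter> heavy S)")
      case True thus ?thesis using S by (intro exI[of _ S]) auto
    next
      case False
      let ?A = "heavy S"
      define H where "H = {h\<in>V. \<forall>a\<in>?A. a + h \<in> ?A \<and> a - h \<in> ?A}"
      \<comment> \<open>The largest submodule inside the stabilizer \<open>H\<close>, which is
        itself only a subgroup; \<open>spread\<close> speaks of submodules.\<close>
      define B where "B = {v\<in>V. \<forall>y. scale y v \<in> H}"
      have AV: "?A \<subseteq> V" by (auto simp: heavy_def)
      have LB: "L \<subseteq> B"
      proof
        fix l assume l: "l \<in> L"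
        have "scale y l \<in> H" for y
        proof -
          have yl: "scale y l \<in> L" using subspace_scale[OF L l] .
          have "a + scale y l \<in> ?A \<and> a - scale y l \<in> ?A" if "a \<in> ?A" for a
          proof -
            have V': "a \<in> V" "a + scale y l \<in> V" "a - scale y l \<in> V"
              using that AV yl LV subspace_add[OF V] subspace_diff[OF V] by blast+
            have "a - (a + scale y l) \<in> L" "a - (a - scale y l) \<in> L"
              using yl subgrp_neg[OF subgrps(2)] by auto
            thus ?thesis using heavy_cong[of a "a + scale y l" S] heavy_cong[of a "a - scale y l" S] V' that by blast
          qed
          thus ?thesis using yl LV unfolding H_def by blast
        qed
        thus "l \<in> B" using l LV by (auto simp: B_def)
      qed
      have Hadd: "h + h' \<in> H" if "h \<in> H" "h' \<in> H" for h h'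
      proof -
        have "a + (h + h') \<in> ?A \<and> a - (h + h') \<in> ?A" if "a \<in> ?A" for a
        proof -
          have "(a + h) + h' \<in> ?A" "(a - h) - h' \<in> ?A" using \<open>h \<in> H\<close> \<open>h' \<in> H\<close> that unfolding H_def by blast+
          thus ?thesis by (simp add: algebra_simps)
        qed
        thus ?thesis using that subspace_add[OF V] unfolding H_def by blast
      qed
      have "subspace B"
      proof (rule subspaceI)
        show "0 \<in> B" using LB subspace_0[OF L] by blast
        show "x + z \<in> B" if "x \<in> B" "z \<in> B" for x z
          using that Hadd subspace_add[OF V] by (auto simp: B_def scale_right_distrib)
        show "scale c x \<in> B" if "x \<in> B" for c x
          using that subspace_scale[OF V] by (auto simp: B_def)
      qed
      moreover have "B \<noteq> V"
      proof
        assume BV: "B = V"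
        have "R \<inter> ?A \<noteq> {}" using S(3) by auto
        then obtain a where a: "a \<in> ?A" by blast
        have "x \<in> ?A" if "x \<in> R" for x
        proof -
          have "x - a \<in> V" using that a RV AV subspace_diff[OF V] by blast
          hence "scale 1 (x - a) \<in> H" using BV unfolding B_def by blast
          hence "a + (x - a) \<in> ?A" using a unfolding H_def by (simp only: scale_one) blast
          thus ?thesis by simp
        qed
        hence "R \<inter> ?A = R" by blast
        thus False using False Suc.prems by simp
      qed
      moreover have "B \<subseteq> V" by (auto simp: B_def)
      ultimately have "card R \<le> card {j\<in>J. e j \<notin> B}" using sp LB unfolding spread_def by blast
      hence "card S < card {j\<in>J. e j \<notin> B}" using S(2) Suc.prems by linarith
      hence "\<not> {j\<in>J. e j \<notin> B} \<subseteq> S" using card_mono[OF fin, of "{j\<in>J. e j \<notin> B}"] by linarith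
      then obtain j where j: "j \<in> J" "e j \<notin> B" "j \<notin> S" by blast
      have jJ: "j \<in> J0" using j J by blast
      obtain y where "scale y (e j) \<notin> H" using j(2) eV[OF jJ] by (auto simp: B_def)
      hence "card (R \<inter> heavy S) < card (R \<inter> heavy (insert j S))"
        using S J j jJ by (intro heavy_grows_or_stable[OF _ _ _ H_def]) auto
      thus ?thesis using S j fin by (intro exI[of _ "insert j S"]) auto
    qed
  qed
  from this[of "card R - 1"] obtain S where S: "S \<subseteq> J" "card S \<le> card R - 1" "card R \<le> card (R \<inter> heavy S)"
    using card_R by auto
  have "R \<inter> heavy S = R" using S(3) finR by (intro card_seteq) auto
  have "x \<in> heavy S" if "x \<in> V" for x
    using rep[OF that] heavy_cong[of x "rep x" S] that RV \<open>R \<inter> heavy S = R\<close> by blast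
  hence "V \<subseteq> heavy S" by blast
  thus thesis using that S by simp
qed

text \<open>All summands except the j-th are conditioned on. The bound is weak, but it asks for a
  single useful index only.\<close>

lemma mass_le:
  assumes J: "J \<subseteq> J0" "j \<in> J" "scale y (e j) \<notin> L" and a: "a \<in> V"
  shows "mass J a \<le> 1 - \<epsilon>0"
proof -
  have jJ: "j \<in> J0" "{j} \<subseteq> J0" "J - {j} \<subseteq> J0" using J by auto
  have "mass J a = mass ({j} \<union> (J - {j})) a" using J by (simp add: insert_absorb)
  also have "\<dots> = (\<Sum>r\<in>R. mass {j} r * mass (J - {j}) (a - r))" by (rule mass_Un[OF jJ(2,3)]) auto
  also have "\<dots> \<le> (\<Sum>r\<in>R. (1 - \<epsilon>0) * mass (J - {j}) (a - r))"
  proof (intro sum_mono mult_right_mono mass_nonneg)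
    fix r
    have "mass {j} r = measure_pmf.prob (Pi_pmf {j} 0 D) {f. scale (f j) (e j) - r \<in> L}"
      by (simp add: mass_def lc_def)
    also have "\<dots> = measure_pmf.prob (D j) {x. scale x (e j) - r \<in> L}" by (rule prob_Pi_pmf_singleton)
    also have "\<dots> \<le> 1 - \<epsilon>0" by (rule bal[OF jJ(1) subgrps(2) subset_refl J(3)])
    finally show "mass {j} r \<le> 1 - \<epsilon>0" .
  qed
  also have "\<dots> = (1 - \<epsilon>0) * (\<Sum>r\<in>R. mass (J - {j}) r)"
    using a mass_cong by (subst sum_reflect[symmetric]) (auto simp: sum_distrib_left)
  finally show ?thesis using mass_sum[OF jJ(3)] by simp
qed

text \<open>A Doeblin constant: a distribution with all masses at least
  \<open>\<eta> ^ card R\<close> contains the uniform one with weight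
  \<open>\<theta>\<close>.\<close>

definition \<theta> :: real where "\<theta> = card R * \<eta> ^ card R"

lemma theta: "0 < \<theta>" "\<theta> \<le> 1"
proof -
  show "0 < \<theta>" using card_R eta by (simp add: \<theta>_def)
  have "\<eta> ^ card R \<le> \<eta> ^ 1" using eta card_R by (intro power_decreasing) auto
  hence "\<theta> \<le> card R * \<eta>" unfolding \<theta>_def using eta by (intro mult_left_mono) auto
  thus "\<theta> \<le> 1" using eta(3) eps0 by (simp add: mult.commute)
qed

text \<open>A block S of at most \<open>card R\<close> indices makes all cosets heavy, and
  convolution with its law contracts the distance to the uniform one by 1 - \<theta>. Removing S
  lowers \<open>spread\<close> by at most \<open>card R\<close>, so t disjoint blocks are
  found.\<close>

theorem mass_near_uniform:
  "J \<subseteq> J0 \<Longrightarrow> spread J (card R * t) \<Longrightarrow> a \<in> V \<Longrightarrow> \<bar>mass J a - 1 / card R\<bar> \<le> (1 - \<theta>) ^ t"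
proof (induction t arbitrary: J a)
  case 0
  have "1 / real (card R) \<le> 1" "0 \<le> 1 / real (card R)" using card_R by auto
  thus ?case unfolding power_0 using mass_nonneg[of J a] mass_le_1[of J a] by (intro abs_leI) linarith+
next
  case (Suc t)
  have "spread J (card R)"
    using Suc.prems(2) unfolding spread_def by (metis le_add1 mult_Suc_right order_trans)
  then obtain S where S: "S \<subseteq> J" "card S \<le> card R" "V \<subseteq> heavy S"
    using ex_heavy_everywhere[OF Suc.prems(1)] by blast
  define J2 where "J2 = J - S"
  have fin: "finite J" using Suc.prems(1) finJ finite_subset by blast
  have J: "J = S \<union> J2" "S \<inter> J2 = {}" "S \<subseteq> J0" "J2 \<subseteq> J0" using S Suc.prems(1) by (auto simp: J2_def)
  have sp2: "spread J2 (card R * t)"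
    unfolding spread_def
  proof (intro allI impI)
    fix B assume "subspace B \<and> L \<subseteq> B \<and> B \<subseteq> V \<and> B \<noteq> V"
    hence "card R * Suc t \<le> card {j\<in>J. e j \<notin> B}" using Suc.prems(2) unfolding spread_def by blast
    also have "\<dots> \<le> card ({j\<in>J2. e j \<notin> B} \<union> S)"
      using fin S by (intro card_mono) (auto simp: J2_def intro: finite_subset)
    also have "\<dots> \<le> card {j\<in>J2. e j \<notin> B} + card S" by (rule card_Un_le)
    finally show "card R * t \<le> card {j\<in>J2. e j \<notin> B}" using S(2) by simp
  qed
  define \<delta> where "\<delta> r = mass J2 r - 1 / card R" for r
  have IH: "\<bar>\<delta> r\<bar> \<le> (1 - \<theta>) ^ t" if "r \<in> V" for r
    unfolding \<delta>_def by (rule Suc.IH[OF J(4) sp2 that])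
  have aV: "a - r \<in> V" if "r \<in> R" for r using that Suc.prems(3) RV subspace_diff[OF V] by blast
  have \<delta>0: "(\<Sum>r\<in>R. \<delta> (a - r)) = 0"
  proof -
    have "(\<Sum>r\<in>R. mass J2 (a - r)) = (\<Sum>r\<in>R. mass J2 r)"
      using Suc.prems(3) mass_cong by (intro sum_reflect) auto
    thus ?thesis using mass_sum[OF J(4)] card_R by (simp add: \<delta>_def sum_subtractf)
  qed
  have low: "\<eta> ^ card R \<le> mass S r" if "r \<in> R" for r
  proof -
    have "\<eta> ^ card R \<le> \<eta> ^ card S" using eta S(2) by (intro power_decreasing) auto
    thus ?thesis using S(3) that RV by (force simp: heavy_def)
  qed
  have "mass J a = (\<Sum>r\<in>R. mass S r * mass J2 (a - r))" unfolding J(1) by (rule mass_Un[OF J(3,4,2)])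
  also have "\<dots> = (\<Sum>r\<in>R. mass S r * \<delta> (a - r)) + (\<Sum>r\<in>R. mass S r) * (1 / card R)"
    by (simp add: \<delta>_def right_diff_distrib sum_subtractf sum_divide_distrib)
  \<comment> \<open>The deviations add up to 0, so the common lower bound may be subtracted from the
    weights; what remains of them has total 1 - \<theta>.\<close>
  also have "(\<Sum>r\<in>R. mass S r * \<delta> (a - r)) = (\<Sum>r\<in>R. (mass S r - \<eta> ^ card R) * \<delta> (a - r))"
    using \<delta>0 by (simp add: left_diff_distrib sum_subtractf sum_distrib_left[symmetric])
  finally have eq: "mass J a - 1 / card R = (\<Sum>r\<in>R. (mass S r - \<eta> ^ card R) * \<delta> (a - r))"
    using mass_sum[OF J(3)] by simp
  have "\<bar>mass J a - 1 / card R\<bar> \<le> (\<Sum>r\<in>R. \<bar>(mass S r - \<eta> ^ card R) * \<delta> (a - r)\<bar>)"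
    unfolding eq by (rule sum_abs)
  also have "\<dots> \<le> (\<Sum>r\<in>R. (mass S r - \<eta> ^ card R) * (1 - \<theta>) ^ t)"
    using low IH aV by (intro sum_mono) (auto simp: abs_mult intro!: mult_mono)
  also have "\<dots> = (1 - \<theta>) * (1 - \<theta>) ^ t"
    using mass_sum[OF J(3)] by (simp add: sum_distrib_right[symmetric] sum_subtractf \<theta>_def)
  finally show ?case by simp
qed

end

section \<open>Linear relations of random matrices\<close>

text \<open>\<open>bal\<close> is an abstract predicate on laws that carries one constant
  \<open>\<epsilon>0\<close> for all proper subgroups over Q (E + 1).\<close>

locale balanced_primes = dedekind_primes p k for p :: "nat \<Rightarrow> 'a::idom set" and k :: nat +
  fixes bal :: "'a pmf \<Rightarrow> bool" and \<epsilon>0 :: real and E :: nat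
  assumes eps0: "0 < \<epsilon>0" "\<epsilon>0 < 1"
    and bal: "\<And>d H a. bal d \<Longrightarrow> subgrp H \<Longrightarrow> Q (Suc E) \<subseteq> H \<Longrightarrow> H \<noteq> UNIV \<Longrightarrow>
       measure_pmf.prob d {x. x - a \<in> H} \<le> 1 - \<epsilon>0"
begin

text \<open>The condition x e_j - a in H confines x to a coset of the subgroup of those x with x e_j
  in H. This subgroup contains Q (E + 1) and is proper as soon as some multiple of e_j is outside
  H.\<close>

lemma mixingI:
  fixes scale :: "'a \<Rightarrow> 'b::ab_group_add \<Rightarrow> 'b" and e :: "'i \<Rightarrow> 'b"
  assumes m: "module scale" and V: "module.subspace scale V" and L: "module.subspace scale L" "L \<subseteq> V"
    and R: "finite R" "transv V L R" and J: "finite J" "\<And>j. j \<in> J \<Longrightarrow> e j \<in> V"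
    and D: "\<And>j. j \<in> J \<Longrightarrow> bal (D j)"
    and QL: "\<And>x v. x \<in> Q (Suc E) \<Longrightarrow> v \<in> V \<Longrightarrow> scale x v \<in> L"
  shows "mixing scale V L R D e J \<epsilon>0"
proof -
  interpret module scale by fact
  have "measure_pmf.prob (D j) {x. scale x (e j) - a \<in> H} \<le> 1 - \<epsilon>0"
    if j: "j \<in> J" and H: "subgrp H" "L \<subseteq> H" and y: "scale y (e j) \<notin> H" for j H y a
  proof (cases "{x. scale x (e j) - a \<in> H} = {}")
    case True
    show ?thesis unfolding True using eps0 by simp
  next
    case False
    then obtain x0 where x0: "scale x0 (e j) - a \<in> H" by blast
    let ?H = "{x. scale x (e j) \<in> H}"
    have sH: "subgrp ?H"
      using H(1) by (simp add: subgrp_def scale_left_diff_distrib)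
    have QH: "Q (Suc E) \<subseteq> ?H" using QL J(2)[OF j] H(2) by blast
    have "{x. scale x (e j) - a \<in> H} = {x. x - x0 \<in> ?H}"
    proof -
      have "scale x (e j) - a \<in> H \<longleftrightarrow> scale (x - x0) (e j) \<in> H" for x
      proof
        assume "scale x (e j) - a \<in> H"
        from subgrp_diff[OF H(1) this x0] show "scale (x - x0) (e j) \<in> H"
          by (simp add: scale_left_diff_distrib)
      next
        assume "scale (x - x0) (e j) \<in> H"
        from subgrp_add[OF H(1) this x0] show "scale x (e j) - a \<in> H"
          by (simp add: scale_left_diff_distrib)
      qed
      thus ?thesis by simp
    qed
    thus ?thesis using bal[OF D[OF j] sH QH, of x0] y by auto
  qed
  thus ?thesis using assms eps0 by unfold_locales auto
qed

lemma ideal_pR: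
  assumes "i < k" obtains R where "finite R" "transv UNIV (p i) R" "card R = q i"
  using q_index[OF assms] unfolding has_index_def by blast

text \<open>The contraction factor 1 - \<theta> of the mixing bound, as a function of the index g of
  L in V.\<close>

definition tau :: "nat \<Rightarrow> real" where "tau g = 1 - g * (\<epsilon>0 / g) ^ g"

text \<open>Mixing in T/p_i. As p_i is maximal, it is the only proper ideal above itself, so
  \<open>spread\<close> merely counts the nonzero residues of c.\<close>

lemma linear_form_prob:
  fixes c :: "'i \<Rightarrow> 'a"
  assumes i: "i < k" and J: "finite J" "\<And>j. j \<in> J \<Longrightarrow> bal (D j)"
  shows "\<exists>j\<in>J. c j \<notin> p i \<Longrightarrow>
      measure_pmf.prob (Pi_pmf J 0 D) {f. (\<Sum>j\<in>J. f j * c j) \<in> p i} \<le> 1 - \<epsilon>0"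
    and "q i * t \<le> card {j\<in>J. c j \<notin> p i} \<Longrightarrow>
      measure_pmf.prob (Pi_pmf J 0 D) {f. (\<Sum>j\<in>J. f j * c j) \<in> p i} \<le> 1 / q i + tau (q i) ^ t"
proof -
  obtain R where R: "finite R" "transv UNIV (p i) R" "card R = q i" by (rule ideal_pR[OF i])
  have sub: "module.subspace (*) (UNIV :: 'a set)" "module.subspace (*) (p i)"
    using ideal_p[OF i] ideal_UNIV by (auto simp: ideal_iff_subspace)
  interpret mx: mixing "(*)" UNIV "p i" R D c J \<epsilon>0
    using Q_Suc_subset_p[OF i] ideal_mult_right[OF ideal_p[OF i]] J R(1,2) sub
    by (intro mixingI) (auto simp: module_mult)
  have mass: "measure_pmf.prob (Pi_pmf J 0 D) {f. (\<Sum>j\<in>J. f j * c j) \<in> p i} = mx.mass J 0"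
    by (simp add: mx.mass_def mx.lc_def)
  show "measure_pmf.prob (Pi_pmf J 0 D) {f. (\<Sum>j\<in>J. f j * c j) \<in> p i} \<le> 1 - \<epsilon>0" if j: "\<exists>j\<in>J. c j \<notin> p i"
  proof -
    obtain j where "j \<in> J" "1 * c j \<notin> p i" using j by auto
    thus ?thesis unfolding mass using mx.mass_le[of J j 1 0] by simp
  qed
  show "measure_pmf.prob (Pi_pmf J 0 D) {f. (\<Sum>j\<in>J. f j * c j) \<in> p i} \<le> 1 / q i + tau (q i) ^ t"
    if w: "q i * t \<le> card {j\<in>J. c j \<notin> p i}"
  proof -
    have "mx.spread J (card R * t)"
      unfolding mx.spread_def
    proof (intro allI impI)
      fix B assume B: "mx.subspace B \<and> p i \<subseteq> B \<and> B \<subseteq> UNIV \<and> B \<noteq> UNIV"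
      hence "B = p i" using maximal[OF i] unfolding maximal_ideal_def ideal_iff_subspace by blast
      thus "card R * t \<le> card {j\<in>J. c j \<notin> B}" using w R(3) by simp
    qed
    from mx.mass_near_uniform[OF subset_refl this, of 0]
    have "\<bar>mx.mass J 0 - 1 / q i\<bar> \<le> (1 - mx.\<theta>) ^ t" by (simp add: R(3))
    moreover have "1 - mx.\<theta> = tau (q i)" by (simp add: tau_def mx.\<theta>_def mx.\<eta>_def R(3))
    ultimately have "\<bar>mx.mass J 0 - 1 / q i\<bar> \<le> tau (q i) ^ t" by simp
    thus ?thesis unfolding mass by linarith
  qed
qed

text \<open>The Hamming weight of c modulo p_i.\<close>

definition wt :: "nat \<Rightarrow> nat \<Rightarrow> (nat \<Rightarrow> 'a) \<Rightarrow> nat" where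
  "wt i B c = card {b. b < B \<and> c b \<notin> p i}"

text \<open>Markov's inequality for the weight generating function: the sum of x^wt over all residue
  vectors factors over the coordinates, each factor being 1 + (q - 1) x.\<close>

lemma low_weight_count:
  fixes x :: real
  assumes i: "i < k" and R: "finite R" "transv UNIV (p i) R" "card R = q i" and x: "0 < x" "x \<le> 1"
  shows "card {c \<in> {..<B} \<rightarrow>\<^sub>E R. wt i B c < h} * x ^ h \<le> (1 + q i * x) ^ B"
proof -
  let ?C = "{..<B} \<rightarrow>\<^sub>E R"
  let ?\<phi> = "\<lambda>r. if r \<in> p i then 1 else x"
  have finC: "finite ?C" using R by (intro finite_PiE) auto
  have prod: "(\<Prod>b<B. ?\<phi> (c b)) = x ^ wt i B c" for c
  proof -
    have "(\<Prod>b<B. ?\<phi> (c b)) = (\<Prod>b\<in>{b. b < B \<and> c b \<notin> p i}. x)"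
      by (rule prod.mono_neutral_cong_right) auto
    thus ?thesis by (simp add: wt_def)
  qed
  have "card {c\<in>?C. wt i B c < h} * x ^ h = (\<Sum>c\<in>{c\<in>?C. wt i B c < h}. x ^ h)" by simp
  also have "\<dots> \<le> (\<Sum>c\<in>{c\<in>?C. wt i B c < h}. x ^ wt i B c)"
    using x by (intro sum_mono power_decreasing) auto
  also have "\<dots> \<le> (\<Sum>c\<in>?C. x ^ wt i B c)" using finC x by (intro sum_mono2) auto
  also have "\<dots> = (\<Sum>c\<in>?C. \<Prod>b<B. ?\<phi> (c b))" by (simp add: prod)
  also have "\<dots> = (\<Prod>b<B. \<Sum>r\<in>R. ?\<phi> r)"
    using R(1) by (subst prod_sum_PiE) auto
  also have "\<dots> = (\<Sum>r\<in>R. ?\<phi> r) ^ B" by simp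
  also have "\<dots> \<le> (1 + q i * x) ^ B"
  proof (rule power_mono)
    \<comment> \<open>\<open>r0\<close> represents p_i itself, so that every other residue
      contributes x.\<close>
    have "\<exists>!r. r \<in> R \<and> 0 - r \<in> p i" using R(2) unfolding transv_def by blast
    then obtain r0 where r0: "r0 \<in> R" "\<And>r. r \<in> R \<Longrightarrow> 0 - r \<in> p i \<Longrightarrow> r = r0" by blast
    have "r = r0" if "r \<in> R" "r \<in> p i" for r using r0(2)[of r] that ideal_neg[OF ideal_p[OF i]] by simp
    hence "(\<Sum>r\<in>R - {r0}. ?\<phi> r) = (\<Sum>r\<in>R - {r0}. x)" by (intro sum.cong) auto
    also have "\<dots> \<le> (\<Sum>r\<in>R. x)" using R x by (intro sum_mono2) auto
    also have "\<dots> = q i * x" using R by simp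
    finally have "(\<Sum>r\<in>R - {r0}. ?\<phi> r) \<le> q i * x" .
    moreover have "(\<Sum>r\<in>R. ?\<phi> r) = ?\<phi> r0 + (\<Sum>r\<in>R - {r0}. ?\<phi> r)" using R r0 by (intro sum.remove) auto
    ultimately show "(\<Sum>r\<in>R. ?\<phi> r) \<le> 1 + q i * x" using x by (auto split: if_splits)
  qed (use x in \<open>auto intro!: sum_nonneg\<close>)
  finally show ?thesis .
qed

text \<open>\<open>g a b\<close> is a matrix position, which allows relations between rows and between columns to be treated
  uniformly; \<open>a\<close> runs over the independent conditions.\<close>
definition relation :: "nat \<Rightarrow> (nat \<Rightarrow> nat \<Rightarrow> nat \<times> nat) \<Rightarrow> nat \<Rightarrow> nat \<Rightarrow> (nat \<times> nat \<Rightarrow> 'a) \<Rightarrow> (nat \<Rightarrow> 'a) \<Rightarrow> bool" where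
  "relation i g A B M c \<longleftrightarrow> (\<forall>a<A. (\<Sum>b<B. M (g a b) * c b) \<in> p i)"

lemma relation_cong:
  assumes i: "i < k" and "\<And>b. b < B \<Longrightarrow> c b - c' b \<in> p i"
  shows "relation i g A B M c \<longleftrightarrow> relation i g A B M c'" and "wt i B c = wt i B c'"
proof -
  note idp = ideal_p[OF i]
  have iff: "x \<in> p i \<longleftrightarrow> y \<in> p i" if "x - y \<in> p i" for x y
    using ideal_add[OF idp that, of y] ideal_diff[OF idp _ that, of x] by auto
  have "(\<Sum>b<B. M (g a b) * c b) - (\<Sum>b<B. M (g a b) * c' b) \<in> p i" for a
    unfolding sum_subtractf[symmetric] right_diff_distrib[symmetric]
    using assms(2) by (intro ideal_sum[OF idp] ideal_mult_left[OF idp]) auto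
  thus "relation i g A B M c \<longleftrightarrow> relation i g A B M c'" unfolding relation_def using iff by blast
  have "{b. b < B \<and> c b \<notin> p i} = {b. b < B \<and> c' b \<notin> p i}" using iff[OF assms(2)] by blast
  thus "wt i B c = wt i B c'" by (simp add: wt_def)
qed

text \<open>Conditions for different a involve disjoint sets of entries, so they are independent and
  the bound for one linear form is raised to the power A.\<close>

lemma relation_prob:
  assumes i: "i < k" and g: "\<And>a b a' b'. g a b = g a' b' \<Longrightarrow> a = a' \<and> b = b'"
    and D: "\<And>a b. a < A \<Longrightarrow> b < B \<Longrightarrow> bal (D (g a b))"
  shows "wt i B c > 0 \<Longrightarrow>
      measure_pmf.prob (Pi_pmf (\<Union>a<A. g a ` {..<B}) 0 D) {M. relation i g A B M c} \<le> (1 - \<epsilon>0) ^ A"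
    and "q i * t \<le> wt i B c \<Longrightarrow>
      measure_pmf.prob (Pi_pmf (\<Union>a<A. g a ` {..<B}) 0 D) {M. relation i g A B M c} \<le> (1 / q i + tau (q i) ^ t) ^ A"
proof -
  let ?P = "\<lambda>a. measure_pmf.prob (Pi_pmf (g a ` {..<B}) 0 D) {M. (\<Sum>b<B. M (g a b) * c b) \<in> p i}"
  have inj: "inj_on (g a) {..<B}" for a using g by (auto simp: inj_on_def)
  have eq: "measure_pmf.prob (Pi_pmf (\<Union>a<A. g a ` {..<B}) 0 D) {M. relation i g A B M c} = (\<Prod>a<A. ?P a)"
  proof -
    have "{M. relation i g A B M c} = {M. \<forall>a\<in>{..<A}. (\<Sum>b<B. M (g a b) * c b) \<in> p i}"
      by (auto simp: relation_def)
    moreover have "depends_on (g a ` {..<B}) (\<lambda>M. (\<Sum>b<B. M (g a b) * c b) \<in> p i)" for a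
    proof -
      have "(\<Sum>b<B. M (g a b) * c b) = (\<Sum>b<B. M' (g a b) * c b)" if "\<forall>x\<in>g a ` {..<B}. M x = M' x" for M M'
        using that by (intro sum.cong) auto
      thus ?thesis unfolding depends_on_def by metis
    qed
    moreover have "disjoint_family_on (\<lambda>a. g a ` {..<B}) {..<A}"
      unfolding disjoint_family_on_def using g by blast
    ultimately show ?thesis by (simp only:) (rule prob_Pi_pmf_blocks, auto)
  qed
  \<comment> \<open>The coefficient of b is attached to the position \<open>g a b\<close>, from
    which b can be recovered, so that the bound for linear forms applies to each block.\<close>
  define c' where "c' x = c (THE b. x \<in> range (\<lambda>a. g a b))" for x
  have c': "c' (g a b) = c b" for a b
  proof -
    have "(THE b'. g a b \<in> range (\<lambda>a. g a b')) = b" using g by (intro the_equality) auto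
    thus ?thesis by (simp add: c'_def)
  qed
  have P: "?P a = measure_pmf.prob (Pi_pmf (g a ` {..<B}) 0 D) {M. (\<Sum>x\<in>g a ` {..<B}. M x * c' x) \<in> p i}" for a
    by (simp add: sum.reindex[OF inj] c')
  have card: "card {x \<in> g a ` {..<B}. c' x \<notin> p i} = wt i B c" for a
  proof -
    have "{x \<in> g a ` {..<B}. c' x \<notin> p i} = g a ` {b. b < B \<and> c b \<notin> p i}" by (auto simp: c')
    thus ?thesis using inj[of a] by (simp add: wt_def card_image inj_on_def)
  qed
  have bal': "bal (D x)" if "a < A" "x \<in> g a ` {..<B}" for a x using that D by auto
  have "?P a \<le> 1 - \<epsilon>0" if a: "a < A" and w: "wt i B c > 0" for a
  proof -
    have "{x \<in> g a ` {..<B}. c' x \<notin> p i} \<noteq> {}" using card[of a] w by (metis card.empty less_irrefl)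
    thus ?thesis unfolding P using bal'[OF a] by (intro linear_form_prob(1)[OF i]) auto
  qed
  thus "measure_pmf.prob (Pi_pmf (\<Union>a<A. g a ` {..<B}) 0 D) {M. relation i g A B M c} \<le> (1 - \<epsilon>0) ^ A"
    if w: "wt i B c > 0" unfolding eq
    using prod_mono[of "{..<A}" ?P "\<lambda>_. 1 - \<epsilon>0"] w by simp
  have "?P a \<le> 1 / q i + tau (q i) ^ t" if a: "a < A" and w: "q i * t \<le> wt i B c" for a
    unfolding P using bal'[OF a] card[of a] w by (intro linear_form_prob(2)[OF i]) auto
  thus "measure_pmf.prob (Pi_pmf (\<Union>a<A. g a ` {..<B}) 0 D) {M. relation i g A B M c} \<le> (1 / q i + tau (q i) ^ t) ^ A"
    if w: "q i * t \<le> wt i B c" unfolding eq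
    using prod_mono[of "{..<A}" ?P "\<lambda>_. 1 / q i + tau (q i) ^ t"] w by simp
qed

text \<open>A union bound over vectors of residues. Vectors of low weight are few, so the crude
  factor 1 - \<epsilon>0 per condition wins; the others are numerous, but each condition has
  probability at most slightly above 1/q_i.\<close>

lemma relation_union_bound:
  fixes x :: real
  assumes i: "i < k" and g: "\<And>a b a' b'. g a b = g a' b' \<Longrightarrow> a = a' \<and> b = b'"
    and D: "\<And>a b. a < A \<Longrightarrow> b < B \<Longrightarrow> bal (D (g a b))" and x: "0 < x" "x \<le> 1"
  shows "measure_pmf.prob (Pi_pmf (\<Union>a<A. g a ` {..<B}) 0 D)
       {M. \<exists>c. 0 < wt i B c \<and> wt i B c < h \<and> relation i g A B M c} \<le> (1 + q i * x) ^ B / x ^ h * (1 - \<epsilon>0) ^ A" (is ?low)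
    and "measure_pmf.prob (Pi_pmf (\<Union>a<A. g a ` {..<B}) 0 D)
       {M. \<exists>c. h \<le> wt i B c \<and> relation i g A B M c} \<le> q i ^ B * (1 / q i + tau (q i) ^ (h div q i)) ^ A" (is ?high)
proof -
  obtain R where R: "finite R" "transv UNIV (p i) R" "card R = q i" by (rule ideal_pR[OF i])
  let ?C = "{..<B} \<rightarrow>\<^sub>E R" and ?P = "Pi_pmf (\<Union>a<A. g a ` {..<B}) 0 D"
  have finC: "finite ?C" using R by (intro finite_PiE) auto
  have red: "\<exists>c'\<in>?C. wt i B c' = wt i B c \<and> relation i g A B M c'" if c: "relation i g A B M c" for c M
  proof -
    have "\<exists>r. r \<in> R \<and> c b - r \<in> p i" for b using transv_rep[OF R(2), of "c b"] by blast
    then obtain r where r: "\<And>b. r b \<in> R \<and> c b - r b \<in> p i" by metis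
    have C: "restrict r {..<B} \<in> ?C" using r by auto
    have d: "c b - restrict r {..<B} b \<in> p i" if "b < B" for b using r that by simp
    have rel: "relation i g A B M c \<longleftrightarrow> relation i g A B M (restrict r {..<B})"
      by (rule relation_cong(1)[OF i]) (rule d)
    have w: "wt i B c = wt i B (restrict r {..<B})" by (rule relation_cong(2)[OF i]) (rule d)
    show ?thesis using C rel w c by metis
  qed
  have ub: "measure_pmf.prob ?P {M. \<exists>c. Z (wt i B c) \<and> relation i g A B M c} \<le> card {c\<in>?C. Z (wt i B c)} * \<beta>"
    if \<beta>: "\<And>c. Z (wt i B c) \<Longrightarrow> measure_pmf.prob ?P {M. relation i g A B M c} \<le> \<beta>" for Z and \<beta> :: real
  proof -
    have "{M. \<exists>c. Z (wt i B c) \<and> relation i g A B M c} \<subseteq> (\<Union>c\<in>{c\<in>?C. Z (wt i B c)}. {M. relation i g A B M c})"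
    proof
      fix M assume "M \<in> {M. \<exists>c. Z (wt i B c) \<and> relation i g A B M c}"
      then obtain c where c: "Z (wt i B c)" "relation i g A B M c" by blast
      obtain c' where "c' \<in> ?C" "wt i B c' = wt i B c" "relation i g A B M c'" using red[OF c(2)] by blast
      thus "M \<in> (\<Union>c\<in>{c\<in>?C. Z (wt i B c)}. {M. relation i g A B M c})" using c(1) by auto
    qed
    hence "measure_pmf.prob ?P {M. \<exists>c. Z (wt i B c) \<and> relation i g A B M c} \<le>
        measure_pmf.prob ?P (\<Union>c\<in>{c\<in>?C. Z (wt i B c)}. {M. relation i g A B M c})"
      by (intro measure_pmf.finite_measure_mono) auto
    also have "\<dots> \<le> (\<Sum>c\<in>{c\<in>?C. Z (wt i B c)}. measure_pmf.prob ?P {M. relation i g A B M c})"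
      using finC by (intro measure_pmf.finite_measure_subadditive_finite) auto
    also have "\<dots> \<le> (\<Sum>c\<in>{c\<in>?C. Z (wt i B c)}. \<beta>)" using \<beta> by (intro sum_mono) auto
    finally show ?thesis by simp
  qed
  have "measure_pmf.prob ?P {M. \<exists>c. (0 < wt i B c \<and> wt i B c < h) \<and> relation i g A B M c} \<le>
     card {c\<in>?C. 0 < wt i B c \<and> wt i B c < h} * (1 - \<epsilon>0) ^ A"
    by (rule ub[where Z = "\<lambda>w. 0 < w \<and> w < h"]) (use relation_prob(1)[where g = g and A = A and B = B and D = D, OF i g D] in auto)
  also have "\<dots> \<le> card {c\<in>?C. wt i B c < h} * (1 - \<epsilon>0) ^ A"
    using finC eps0 by (intro mult_right_mono of_nat_mono card_mono) auto
  also have "\<dots> \<le> (1 + q i * x) ^ B / x ^ h * (1 - \<epsilon>0) ^ A"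
    using low_weight_count[OF i R x, of B h] x eps0 by (intro mult_right_mono) (auto simp: pos_le_divide_eq)
  finally show ?low by (simp add: conj_assoc)
  have "measure_pmf.prob ?P {M. \<exists>c. h \<le> wt i B c \<and> relation i g A B M c} \<le>
     card {c\<in>?C. h \<le> wt i B c} * (1 / q i + tau (q i) ^ (h div q i)) ^ A"
  proof (rule ub[where Z = "\<lambda>w. h \<le> w"])
    fix c assume "h \<le> wt i B c"
    hence "q i * (h div q i) \<le> wt i B c" by (meson times_div_less_eq_dividend le_trans)
    thus "measure_pmf.prob ?P {M. relation i g A B M c} \<le> (1 / q i + tau (q i) ^ (h div q i)) ^ A"
      using relation_prob(2)[where g = g and A = A and B = B and D = D and t = "h div q i", OF i g D] by auto
  qed
  also have "\<dots> \<le> q i ^ B * (1 / q i + tau (q i) ^ (h div q i)) ^ A"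
  proof (intro mult_right_mono)
    have "card {c\<in>?C. h \<le> wt i B c} \<le> card ?C" using finC by (intro card_mono) auto
    also have "\<dots> = q i ^ B" using R by (simp add: card_PiE)
    finally show "real (card {c\<in>?C. h \<le> wt i B c}) \<le> real (q i ^ B)" by (rule of_nat_mono)
    have "0 \<le> tau (q i)"
    proof -
      have q: "real (q i) \<ge> 1" using q_ge_2[OF i] by linarith
      have "(\<epsilon>0 / q i) ^ q i \<le> (\<epsilon>0 / q i) ^ 1"
        using eps0 q q_ge_2[OF i] by (intro power_decreasing) (auto simp: divide_le_eq_1)
      hence "q i * (\<epsilon>0 / q i) ^ q i \<le> q i * (\<epsilon>0 / q i)" by (intro mult_left_mono) auto
      thus ?thesis using eps0 q by (simp add: tau_def)
    qed
    thus "0 \<le> (1 / q i + tau (q i) ^ (h div q i)) ^ A" by simp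
  qed
  finally show ?high by simp
qed

section \<open>The exceptional event and its probability\<close>

lemma tau_bounds: "g > 0 \<Longrightarrow> 0 \<le> tau g" "g > 0 \<Longrightarrow> tau g < 1"
proof -
  assume g: "g > 0"
  hence g1: "real g \<ge> 1" by linarith
  have "(\<epsilon>0 / g) ^ g \<le> (\<epsilon>0 / g) ^ 1"
    using eps0 g g1 by (intro power_decreasing) (auto simp: divide_le_eq_1)
  hence "g * (\<epsilon>0 / g) ^ g \<le> g * (\<epsilon>0 / g)" by (intro mult_left_mono) auto
  thus "0 \<le> tau g" using eps0 g by (simp add: tau_def)
  show "tau g < 1" using eps0 g by (simp add: tau_def)
qed

text \<open>The two halves differ by necessity: n - s columns of length n can be independent,
  whereas for s > 0 the n rows of length n - s always satisfy relations, so there only those of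
  weight below h can be excluded.\<close>

definition bad :: "nat \<Rightarrow> nat \<Rightarrow> nat \<Rightarrow> (nat \<times> nat \<Rightarrow> 'a) \<Rightarrow> nat \<Rightarrow> bool" where
  "bad s n h M i \<longleftrightarrow> (\<exists>c. 0 < wt i (n - s) c \<and> relation i (\<lambda>j l. (j, l)) n (n - s) M c) \<or>
     (\<exists>f. 0 < wt i n f \<and> wt i n f < h \<and> relation i (\<lambda>l j. (j, l)) (n - s) n M f)"

lemma times_power_div_tendsto_0:
  assumes K: "K > (0::nat)" and \<tau>: "0 \<le> \<tau>" "\<tau> < (1::real)"
  shows "(\<lambda>n. real n * \<tau> ^ (n div K)) \<longlonglongrightarrow> 0"
proof (rule tendsto_sandwich[where f = "\<lambda>_. 0" and h = "\<lambda>n. K * (real (n div K + 1) * \<tau> ^ (n div K))"])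
  have "(\<lambda>t. of_nat t * \<tau> ^ t + \<tau> ^ t) \<longlonglongrightarrow> 0 + 0"
    using \<tau> by (intro tendsto_add powser_times_n_limit_0 LIMSEQ_power_zero) auto
  hence "(\<lambda>t. real K * (of_nat t * \<tau> ^ t + \<tau> ^ t)) \<longlonglongrightarrow> real K * (0 + 0)" by (intro tendsto_mult tendsto_const)
  hence lim: "(\<lambda>t. K * (real (t + 1) * \<tau> ^ t)) \<longlonglongrightarrow> 0" by (simp add: algebra_simps)
  have "filterlim (\<lambda>n. n div K) at_top sequentially"
    unfolding filterlim_at_top
  proof
    fix Z
    show "eventually (\<lambda>n. Z \<le> n div K) sequentially"
      using eventually_ge_at_top[of "Z * K"] by eventually_elim (use K in \<open>auto simp: less_eq_div_iff_mult_less_eq\<close>)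
  qed
  from filterlim_compose[OF lim this]
  show "(\<lambda>n. K * (real (n div K + 1) * \<tau> ^ (n div K))) \<longlonglongrightarrow> 0" .
  show "eventually (\<lambda>n. real n * \<tau> ^ (n div K) \<le> K * (real (n div K + 1) * \<tau> ^ (n div K))) sequentially"
  proof (intro always_eventually allI)
    fix n
    have "n \<le> K * (n div K + 1)" using K
      by (metis add.commute add_mult_distrib2 dividend_less_div_times less_imp_le mult.commute mult.right_neutral)
    hence "real n \<le> real K * real (n div K + 1)" by (simp only: of_nat_le_iff flip: of_nat_mult)
    hence "real n * \<tau> ^ (n div K) \<le> real K * real (n div K + 1) * \<tau> ^ (n div K)"
      using \<tau> by (intro mult_right_mono) auto
    thus "real n * \<tau> ^ (n div K) \<le> K * (real (n div K + 1) * \<tau> ^ (n div K))" by (simp only: mult.assoc)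
  qed
qed (use \<tau> in auto)

text \<open>For each prime the contributions are 1/4, 1/4 and 3/2 times 2^(-s): column relations of
  low weight, row relations of low weight, and column relations of high weight. The last bound does
  not improve with n, since about q^(n-s) vectors face n conditions of probability about 1/q.
  Uniformity in \<open>D\<close> matters because the laws may change with n.\<close>

lemma bad_prob:
  obtains \<kappa> where "\<kappa> > 0" "\<And>s. eventually (\<lambda>n. \<forall>D. (\<forall>j<n. \<forall>l<n - s. bal (D (j, l))) \<longrightarrow>
     measure_pmf.prob (Pi_pmf ({..<n} \<times> {..<n - s}) 0 D) {M. \<exists>i<k. bad s n (n div \<kappa>) M i} \<le> 2 * k * (1/2) ^ s) sequentially"
proof -
  \<comment> \<open>Of the three factors \<open>\<rho>\<close> in 1 - \<epsilon>0, one pays for (1 +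
    q x)^B, one for x^(-h), and the third makes the bound tend to 0.\<close>
  define \<rho> where "\<rho> = root 3 (1 - \<epsilon>0)"
  have \<rho>: "0 < \<rho>" "\<rho> < 1" "\<rho> ^ 3 = 1 - \<epsilon>0" using eps0 by (auto simp: \<rho>_def)
  \<comment> \<open>The summand 1 keeps \<open>qm\<close> positive also when k = 0.\<close>
  define qm where "qm = real (\<Sum>i<k. q i) + 1"
  have qm: "qm > 0" "q i \<le> qm" if "i < k" for i
  proof -
    have "q i \<le> (\<Sum>i<k. q i)" using that by (intro member_le_sum) auto
    hence "real (q i) \<le> real (\<Sum>i<k. q i)" by (rule of_nat_mono)
    thus "qm > 0" "q i \<le> qm" unfolding qm_def by linarith+
  qed
  have "qm > 0" unfolding qm_def by (rule add_nonneg_pos) (rule of_nat_0_le_iff, simp)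
  define x where "x = min 1 ((1 / \<rho> - 1) / qm)"
  have x: "0 < x" "x \<le> 1" using \<rho> \<open>qm > 0\<close> by (auto simp: x_def)
  have qx: "1 + q i * x \<le> 1 / \<rho>" if "i < k" for i
  proof -
    have "q i * x \<le> qm * ((1 / \<rho> - 1) / qm)"
      using qm[OF that] x by (intro mult_mono) (auto simp: x_def)
    thus ?thesis using \<open>qm > 0\<close> by simp
  qed
  \<comment> \<open>\<open>\<kappa>\<close> fixes the weight bound h = n div \<kappa>: from
    \<rho>^\<kappa> \<le> x follows \<rho>^n \<le> x^h.\<close>
  obtain \<kappa>0 where \<kappa>0: "\<rho> ^ \<kappa>0 < x" using real_arch_pow_inv[OF x(1) \<rho>(2)] by blast
  define \<kappa> where "\<kappa> = Suc \<kappa>0"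
  have "\<rho> ^ \<kappa> \<le> \<rho> ^ \<kappa>0" using \<rho> unfolding \<kappa>_def by (intro power_decreasing) auto
  hence \<kappa>: "\<kappa> > 0" "\<rho> ^ \<kappa> \<le> x" using \<kappa>0 unfolding \<kappa>_def by linarith+
  have xh: "\<rho> ^ n \<le> x ^ (n div \<kappa>)" for n
  proof -
    have "\<rho> ^ n \<le> \<rho> ^ (\<kappa> * (n div \<kappa>))" using \<rho> by (intro power_decreasing) auto
    also have "\<dots> \<le> x ^ (n div \<kappa>)" unfolding power_mult using \<kappa> \<rho> by (intro power_mono) auto
    finally show ?thesis .
  qed
  have low: "(1 + q i * x) ^ B / x ^ (n div \<kappa>) * (1 - \<epsilon>0) ^ A \<le> \<rho> ^ (n - 3 * s)"
    if i: "i < k" and n: "3 * s \<le> n" and AB: "B \<le> n" "n - s \<le> A" for i n s A B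
  proof -
    have 1: "(1 + q i * x) ^ B \<le> (1 / \<rho>) ^ n"
    proof -
      have "(1 + q i * x) ^ B \<le> (1 + q i * x) ^ n" using x AB by (intro power_increasing) auto
      also have "\<dots> \<le> (1 / \<rho>) ^ n" using qx[OF i] x by (intro power_mono) auto
      finally show ?thesis .
    qed
    have 2: "(1 - \<epsilon>0) ^ A \<le> \<rho> ^ (3 * (n - s))"
      unfolding \<rho>(3)[symmetric] power_mult[symmetric] using \<rho> AB by (intro power_decreasing) auto
    have "(1 + q i * x) ^ B / x ^ (n div \<kappa>) * (1 - \<epsilon>0) ^ A \<le> (1 / \<rho>) ^ n / \<rho> ^ n * \<rho> ^ (3 * (n - s))"
      using 1 2 xh[of n] x \<rho> eps0 by (intro mult_mono frac_le) auto
    also have "\<dots> = \<rho> ^ (n - 3 * s)"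
    proof -
      have "3 * (n - s) = (n - 3 * s) + (n + n)" using n by simp
      hence "\<rho> ^ (3 * (n - s)) = \<rho> ^ (n - 3 * s) * (\<rho> ^ n * \<rho> ^ n)" by (simp only: power_add)
      thus ?thesis using \<rho>(1) by (simp add: power_one_over)
    qed
    finally show ?thesis .
  qed
  have "eventually (\<lambda>n. \<forall>D. (\<forall>j<n. \<forall>l<n - s. bal (D (j, l))) \<longrightarrow>
     measure_pmf.prob (Pi_pmf ({..<n} \<times> {..<n - s}) 0 D) {M. \<exists>i<k. bad s n (n div \<kappa>) M i} \<le> 2 * k * (1/2) ^ s) sequentially" for s
  proof -
    have e1: "eventually (\<lambda>n. \<rho> ^ (n - 3 * s) \<le> (1/4) * (1/2) ^ s) sequentially"
    proof -
      have "(\<lambda>n. \<rho> ^ n) \<longlonglongrightarrow> 0" using \<rho> by (intro LIMSEQ_power_zero) auto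
      hence "(\<lambda>n. \<rho> ^ (n - 3 * s)) \<longlonglongrightarrow> 0"
        by (rule filterlim_compose) (rule filterlim_minus_const_nat_at_top)
      hence "eventually (\<lambda>n. \<rho> ^ (n - 3 * s) < (1/4) * (1/2) ^ s) sequentially"
        by (rule order_tendstoD) simp
      thus ?thesis by eventually_elim simp
    qed
    \<comment> \<open>High weight leaves the factor (1 + q tau^(h div q))^n, at most exp (q n tau^(h
      div q)), which tends to 1; the number 3/2 gives it room.\<close>
    have e2: "eventually (\<lambda>n. \<forall>i<k. exp (q i * (real n * tau (q i) ^ (n div \<kappa> div q i))) \<le> 3/2) sequentially"
    proof -
      have "eventually (\<lambda>n. exp (q i * (real n * tau (q i) ^ (n div \<kappa> div q i))) < 3/2) sequentially" if "i < k" for i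
      proof -
        have "q i > 0" using q_ge_2[OF that] by simp
        hence "(\<lambda>n. real n * tau (q i) ^ (n div (\<kappa> * q i))) \<longlonglongrightarrow> 0"
          using \<kappa> tau_bounds by (intro times_power_div_tendsto_0) auto
        hence "(\<lambda>n. exp (q i * (real n * tau (q i) ^ (n div (\<kappa> * q i))))) \<longlonglongrightarrow> exp (real (q i) * 0)"
          by (intro tendsto_intros)
        hence "eventually (\<lambda>n. exp (q i * (real n * tau (q i) ^ (n div (\<kappa> * q i)))) < 3/2) sequentially"
          by (rule order_tendstoD) simp
        thus ?thesis by (simp add: div_mult2_eq)
      qed
      hence "eventually (\<lambda>n. \<forall>i\<in>{..<k}. exp (q i * (real n * tau (q i) ^ (n div \<kappa> div q i))) < 3/2) sequentially"
        by (intro eventually_ball_finite) auto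
      thus ?thesis by eventually_elim (auto intro: less_imp_le)
    qed
    show ?thesis
      using e1 e2 eventually_ge_at_top[of "3 * s"]
    proof (eventually_elim, intro allI impI)
      fix n D
      assume n1: "\<rho> ^ (n - 3 * s) \<le> (1/4) * (1/2) ^ s"
        and n2: "\<forall>i<k. exp (q i * (real n * tau (q i) ^ (n div \<kappa> div q i))) \<le> 3/2" and n3: "3 * s \<le> n"
        and D: "\<forall>j<n. \<forall>l<n - s. bal (D (j, l))"
      let ?P = "Pi_pmf ({..<n} \<times> {..<n - s}) 0 D" and ?h = "n div \<kappa>" and ?m = "n - s"
      let ?A = "\<lambda>i. {M. \<exists>c. 0 < wt i ?m c \<and> wt i ?m c < ?h \<and> relation i (\<lambda>j l. (j, l)) n ?m M c}"
      let ?B = "\<lambda>i. {M. \<exists>c. ?h \<le> wt i ?m c \<and> relation i (\<lambda>j l. (j, l)) n ?m M c}"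
      let ?C = "\<lambda>i. {M. \<exists>f. 0 < wt i n f \<and> wt i n f < ?h \<and> relation i (\<lambda>l j. (j, l)) ?m n M f}"
      have r: "{..<n} \<times> {..<?m} = (\<Union>a<n. (\<lambda>l. (a, l)) ` {..<?m})"
        and c: "{..<n} \<times> {..<?m} = (\<Union>a<?m. (\<lambda>j. (j, a)) ` {..<n})" by auto
      have main: "measure_pmf.prob ?P {M. bad s n ?h M i} \<le> 2 * (1/2) ^ s" if i: "i < k" for i
      proof -
        have qi: "real (q i) \<ge> 2" using q_ge_2[OF i] by linarith
        have A: "measure_pmf.prob ?P (?A i) \<le> (1/4) * (1/2) ^ s"
          using relation_union_bound(1)[OF i _ _ x, of "\<lambda>j l. (j, l)" n ?m D ?h] D
            low[OF i n3, of ?m n] n1 unfolding r by auto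
        have C: "measure_pmf.prob ?P (?C i) \<le> (1/4) * (1/2) ^ s"
          using relation_union_bound(1)[OF i _ _ x, of "\<lambda>l j. (j, l)" ?m n D ?h] D
            low[OF i n3, of n ?m] n1 unfolding c by auto
        have "measure_pmf.prob ?P (?B i) \<le> q i ^ ?m * (1 / q i + tau (q i) ^ (?h div q i)) ^ n"
          using relation_union_bound(2)[OF i _ _ x, of "\<lambda>j l. (j, l)" n ?m D ?h] D unfolding r by auto
        also have "\<dots> = (1 / q i) ^ s * (1 + q i * tau (q i) ^ (?h div q i)) ^ n"
        proof -
          have "1 / q i + tau (q i) ^ (?h div q i) = (1 / q i) * (1 + q i * tau (q i) ^ (?h div q i))"
            using qi by (simp add: field_simps)
          moreover have "real (q i) ^ ?m * (1 / q i) ^ n = (1 / q i) ^ s"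
          proof -
            have "(1 / real (q i)) ^ n = (1 / q i) ^ ?m * (1 / q i) ^ s" using n3 by (simp flip: power_add)
            thus ?thesis using qi by (simp add: power_one_over)
          qed
          ultimately show ?thesis by (simp only: power_mult_distrib) (simp add: mult.assoc[symmetric])
        qed
        also have "\<dots> \<le> (1 / 2) ^ s * (3 / 2)"
        proof (rule mult_mono)
          show "(1 / real (q i)) ^ s \<le> (1 / 2) ^ s" using qi by (intro power_mono frac_le) auto
          have t0: "0 \<le> tau (q i)" using tau_bounds(1) qi by simp
          have "(1 + q i * tau (q i) ^ (?h div q i)) ^ n \<le> exp (q i * tau (q i) ^ (?h div q i)) ^ n"
            using t0 by (intro power_mono exp_ge_add_one_self) auto
          also have "\<dots> = exp (q i * (real n * tau (q i) ^ (?h div q i)))"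
            by (simp flip: exp_of_nat_mult add: ac_simps)
          finally show "(1 + q i * tau (q i) ^ (?h div q i)) ^ n \<le> 3 / 2" using n2 i by force
          show "0 \<le> (1 + q i * tau (q i) ^ (?h div q i)) ^ n" using t0 by simp
        qed simp
        finally have B: "measure_pmf.prob ?P (?B i) \<le> (1 / 2) ^ s * (3 / 2)" .
        have "{M. bad s n ?h M i} \<subseteq> (?A i \<union> ?B i) \<union> ?C i"
        proof
          fix M assume "M \<in> {M. bad s n ?h M i}"
          hence "(\<exists>c. 0 < wt i ?m c \<and> relation i (\<lambda>j l. (j, l)) n ?m M c) \<or> M \<in> ?C i" by (simp add: bad_def)
          thus "M \<in> (?A i \<union> ?B i) \<union> ?C i"
          proof
            assume "\<exists>c. 0 < wt i ?m c \<and> relation i (\<lambda>j l. (j, l)) n ?m M c"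
            then obtain c where c: "0 < wt i ?m c" "relation i (\<lambda>j l. (j, l)) n ?m M c" by blast
            show ?thesis
            proof (cases "wt i ?m c < ?h")
              case True
              hence "M \<in> ?A i" using c by blast
              thus ?thesis by blast
            next
              case False
              hence "?h \<le> wt i ?m c" by simp
              hence "M \<in> ?B i" using c by blast
              thus ?thesis by blast
            qed
          qed blast
        qed
        hence "measure_pmf.prob ?P {M. bad s n ?h M i} \<le> measure_pmf.prob ?P ((?A i \<union> ?B i) \<union> ?C i)"
          by (intro measure_pmf.finite_measure_mono) auto
        also have "\<dots> \<le> measure_pmf.prob ?P (?A i \<union> ?B i) + measure_pmf.prob ?P (?C i)"
          by (intro measure_Un_le) auto
        also have "measure_pmf.prob ?P (?A i \<union> ?B i) \<le> measure_pmf.prob ?P (?A i) + measure_pmf.prob ?P (?B i)"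
          by (intro measure_Un_le) auto
        finally show ?thesis using A B C by linarith
      qed
      have "measure_pmf.prob ?P {M. \<exists>i<k. bad s n ?h M i} = measure_pmf.prob ?P (\<Union>i<k. {M. bad s n ?h M i})"
        by (rule arg_cong[where f = "measure_pmf.prob ?P"]) auto
      also have "\<dots> \<le> (\<Sum>i<k. measure_pmf.prob ?P {M. bad s n ?h M i})"
        by (intro measure_pmf.finite_measure_subadditive_finite) auto
      also have "\<dots> \<le> (\<Sum>i<k. 2 * (1/2) ^ s)" using main by (intro sum_mono) auto
      finally show "measure_pmf.prob ?P {M. \<exists>i<k. bad s n ?h M i} \<le> 2 * k * (1/2) ^ s" by simp
    qed
  qed
  thus thesis using that \<kappa>(1) by blast
qed

end

section \<open>Nakayama and generating tuples\<close>

text \<open>The entries are coset representatives, so that tuples in a finite quotient are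
  counted.\<close>

definition span_tuples ::
  "('a::comm_ring_1 \<Rightarrow> 'b::ab_group_add \<Rightarrow> 'b) \<Rightarrow> nat \<Rightarrow> 'b set \<Rightarrow> 'b set \<Rightarrow> 'b set \<Rightarrow> (nat \<Rightarrow> 'b) set" where
  "span_tuples sc r R K L = {\<sigma> \<in> {..<r} \<rightarrow>\<^sub>E R. msum (module.span sc (\<sigma> ` {..<r})) L = K}"

text \<open>The probability that r uniform vectors span a d-dimensional space over F_q, with factors
  1 - q^(j - r). For positive q and r < d it vanishes, through the factor j = r.\<close>

definition gprob :: "nat \<Rightarrow> nat \<Rightarrow> nat \<Rightarrow> real" where
  "gprob q r d = (\<Prod>j<d. 1 - real q ^ j / real q ^ r)"

text \<open>Conditioning on one vector: with probability q^(-(d+1)) it is zero and does not help,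
  otherwise the dimension still to be spanned drops by one.\<close>

lemma gprob_Suc:
  assumes q: "q > 0"
  shows "gprob q (Suc r) (Suc d) = gprob q r (Suc d) / q ^ Suc d + (1 - 1 / q ^ Suc d) * gprob q r d"
proof -
  have "gprob q (Suc r) (Suc d) = (1 - 1 / q ^ Suc r) * (\<Prod>j<d. 1 - real q ^ Suc j / real q ^ Suc r)"
    unfolding gprob_def by (subst prod.lessThan_Suc_shift) simp
  also have "(\<Prod>j<d. 1 - real q ^ Suc j / real q ^ Suc r) = gprob q r d"
    unfolding gprob_def using q by (intro prod.cong) auto
  finally have 1: "gprob q (Suc r) (Suc d) = (1 - 1 / q ^ Suc r) * gprob q r d" .
  have 2: "gprob q r (Suc d) = gprob q r d * (1 - real q ^ d / real q ^ r)"
    by (simp add: gprob_def)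
  show ?thesis unfolding 1 2 using q by (simp add: field_simps)
qed

lemma msum_assoc: "msum (msum A B) C = msum A (msum B C)"
proof (intro subset_antisym subsetI)
  fix x assume "x \<in> msum (msum A B) C"
  then obtain a b c where "a \<in> A" "b \<in> B" "c \<in> C" "x = a + (b + c)" by (auto elim!: msumE simp: add.assoc)
  thus "x \<in> msum A (msum B C)" by (auto intro!: msumI)
next
  fix x assume "x \<in> msum A (msum B C)"
  then obtain a b c where *: "a \<in> A" "b \<in> B" "c \<in> C" "x = a + (b + c)" by (auto elim!: msumE)
  hence "x = (a + b) + c" by (simp add: add.assoc)
  thus "x \<in> msum (msum A B) C" using msumI[OF msumI[OF *(1,2)] *(3)] by simp
qed

context module
begin

lemma subspace_imul_colon:
  assumes "subspace X" shows "subspace {z. scale a z \<in> X}"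
  by (rule subspaceI) (auto simp: subspace_0[OF assms] scale_right_distrib subspace_add[OF assms]
      scale_left_commute[of a] simp del: scale_scale intro: subspace_scale[OF assms])

text \<open>Multiplying K \<subseteq> W + BK by A gives AK \<subseteq> W + ABK, which is inserted in
  K \<subseteq> W + AK. After iteration the ideal is a product of high powers of the primes, which
  acts as zero or sends K into a submodule already under control.\<close>

lemma nakayama_prod:
  assumes W: "subspace W" and K: "K \<subseteq> msum W (imul scale A K)" "K \<subseteq> msum W (imul scale B K)"
  shows "K \<subseteq> msum W (imul scale (ideal_prod A B) K)"
proof -
  let ?X = "imul scale (ideal_prod A B) K"
  have sX: "subspace ?X" by (rule subspace_imul)
  have sM: "subspace (msum W ?X)" by (rule subspace_msum[OF W sX])
  have "imul scale A K \<subseteq> msum W ?X"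
  proof (rule imul_least[OF sM])
    fix a v assume a: "a \<in> A" and v: "v \<in> K"
    obtain w z where wz: "w \<in> W" "z \<in> imul scale B K" "v = w + z" using K(2) v by (auto elim!: msumE)
    have "imul scale B K \<subseteq> {z. scale a z \<in> ?X}"
    proof (rule imul_least[OF subspace_imul_colon[OF sX]])
      fix b u assume "b \<in> B" "u \<in> K"
      thus "scale b u \<in> {z. scale a z \<in> ?X}" using imulI[OF ideal_prodI[OF a]] by simp
    qed
    hence "scale a z \<in> ?X" using wz by blast
    thus "scale a v \<in> msum W ?X"
      unfolding wz(3) scale_right_distrib using subspace_scale[OF W wz(1)] by (intro msumI)
  qed
  hence "msum W (imul scale A K) \<subseteq> msum W ?X"
    using msum_superset1[OF subspace_0[OF sX], of W] by (intro msum_least[OF subspace_subgrp[OF sM]])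
  thus ?thesis using K(1) by blast
qed

lemma nakayama_UNIV: "0 \<in> W \<Longrightarrow> K \<subseteq> msum W (imul scale UNIV K)"
  using imulI[of 1 UNIV _ K] msumI[of 0 W _ "imul scale UNIV K"] by auto

lemma nakayama_pow:
  assumes W: "subspace W" and K: "K \<subseteq> msum W (imul scale A K)"
  shows "K \<subseteq> msum W (imul scale (ideal_pow A m) K)"
proof (induction m)
  case 0 thus ?case unfolding ideal_pow_0 using nakayama_UNIV[OF subspace_0[OF W]] .
next
  case (Suc m) thus ?case unfolding ideal_pow_Suc using nakayama_prod[OF W K] by blast
qed

lemma nakayama_prod_pow:
  assumes W: "subspace W" and K: "\<And>i. i < n \<Longrightarrow> K \<subseteq> msum W (imul scale (p i) K)"
  shows "K \<subseteq> msum W (imul scale (prod_pow_ideal p e n) K)"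
  using K
proof (induction n)
  case 0 thus ?case using nakayama_UNIV[OF subspace_0[OF W]] by simp
next
  case (Suc n)
  have "K \<subseteq> msum W (imul scale (prod_pow_ideal p e n) K)" "K \<subseteq> msum W (imul scale (ideal_pow (p n) (e n)) K)"
    using Suc nakayama_pow[OF W] by auto
  thus ?case by (simp add: nakayama_prod[OF W])
qed

lemma msum_span_insert:
  assumes "subspace L"
  shows "msum (span (insert x S)) L = msum (span S) (msum (span {x}) L)"
proof -
  have "span (insert x S) = msum (span S) (span {x})"
    using span_Un[of S "{x}"] by (simp add: msum_def)
  thus ?thesis by (simp add: msum_assoc)
qed

lemma msum_absorb: "subspace L \<Longrightarrow> A \<subseteq> L \<Longrightarrow> 0 \<in> A \<Longrightarrow> msum A L = L"
  using msum_least[OF subspace_subgrp, of L A L] msum_superset2[of A L] by blast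

text \<open>The tuple is split at its last entry x, which is absorbed in L.\<close>

lemma card_span_tuples_Suc:
  assumes R: "finite R" and L: "subspace L"
  shows "card (span_tuples scale (Suc r) R K L) = (\<Sum>x\<in>R. card (span_tuples scale r R K (msum (span {x}) L)))"
proof -
  let ?S = "SIGMA x:R. span_tuples scale r R K (msum (span {x}) L)"
  have fin: "finite (span_tuples scale r R K L')" for r L'
    unfolding span_tuples_def using R by (intro finite_subset[OF _ finite_PiE[of "{..<r}" "\<lambda>_. R"]]) auto
  have "bij_betw (\<lambda>(x, \<sigma>). \<sigma>(r := x)) ?S (span_tuples scale (Suc r) R K L)"
  proof (rule bij_betw_byWitness[where f' = "\<lambda>\<sigma>. (\<sigma> r, \<sigma>(r := undefined))"])
    show "\<forall>a\<in>?S. (\<lambda>\<sigma>. (\<sigma> r, \<sigma>(r := undefined))) ((\<lambda>(x, \<sigma>). \<sigma>(r := x)) a) = a"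
      by (auto simp: span_tuples_def fun_eq_iff PiE_iff extensional_def)
    show "\<forall>\<sigma>\<in>span_tuples scale (Suc r) R K L. (\<lambda>(x, \<sigma>). \<sigma>(r := x)) (\<sigma> r, \<sigma>(r := undefined)) = \<sigma>" by auto
    have img: "(\<sigma>(r := x)) ` {..<Suc r} = insert x (\<sigma> ` {..<r})" for \<sigma> :: "nat \<Rightarrow> 'b" and x
      by (auto simp: lessThan_Suc)
    show "(\<lambda>(x, \<sigma>). \<sigma>(r := x)) ` ?S \<subseteq> span_tuples scale (Suc r) R K L"
    proof safe
      fix x \<sigma> assume x: "x \<in> R" and \<sigma>: "\<sigma> \<in> span_tuples scale r R K (msum (span {x}) L)"
      have 1: "\<sigma> \<in> {..<r} \<rightarrow>\<^sub>E R" and 2: "msum (span (\<sigma> ` {..<r})) (msum (span {x}) L) = K"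
        using \<sigma> unfolding span_tuples_def by blast+
      have "\<sigma>(r := x) \<in> {..<Suc r} \<rightarrow>\<^sub>E R" using 1 x by (auto simp: PiE_iff extensional_def less_Suc_eq)
      thus "\<sigma>(r := x) \<in> span_tuples scale (Suc r) R K L"
        unfolding span_tuples_def mem_Collect_eq img msum_span_insert[OF L, of x "\<sigma> ` {..<r}"] using 2 by blast
    qed
    show "(\<lambda>\<sigma>. (\<sigma> r, \<sigma>(r := undefined))) ` span_tuples scale (Suc r) R K L \<subseteq> ?S"
    proof safe
      fix \<sigma> assume \<sigma>: "\<sigma> \<in> span_tuples scale (Suc r) R K L"
      thus "\<sigma> r \<in> R" by (auto simp: span_tuples_def)
      have "\<sigma> = (\<sigma>(r := undefined))(r := \<sigma> r)" by simp
      hence i: "\<sigma> ` {..<Suc r} = insert (\<sigma> r) ((\<sigma>(r := undefined)) ` {..<r})" by (metis img)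
      have 1: "\<sigma> \<in> {..<Suc r} \<rightarrow>\<^sub>E R"
        and 2: "msum (span ((\<sigma>(r := undefined)) ` {..<r})) (msum (span {\<sigma> r}) L) = K"
        using \<sigma> unfolding span_tuples_def mem_Collect_eq i
            msum_span_insert[OF L, of "\<sigma> r" "(\<sigma>(r := undefined)) ` {..<r}"] by blast+
      have "\<sigma>(r := undefined) \<in> {..<r} \<rightarrow>\<^sub>E R" using 1 by (auto simp: PiE_iff extensional_def less_Suc_eq)
      thus "\<sigma>(r := undefined) \<in> span_tuples scale r R K (msum (span {\<sigma> r}) L)"
        unfolding span_tuples_def using 2 by blast
    qed
  qed
  hence "card (span_tuples scale (Suc r) R K L) = card ?S" by (simp add: bij_betw_same_card)
  also have "\<dots> = (\<Sum>x\<in>R. card (span_tuples scale r R K (msum (span {x}) L)))"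
    using R fin by (intro card_SigmaI) auto
  finally show ?thesis .
qed

text \<open>Exposing the vectors one at a time, a vector outside the current span \<open>L\<close> divides the index by \<open>q\<close>.\<close>
lemma card_span_tuples:
  assumes P: "maximal_ideal P" "has_index UNIV P q" and sub: "subspace K" "subspace L0" "L0 \<subseteq> K"
    and PK: "imul scale P K \<subseteq> L0"
    and R: "finite R" "transv K L0 R" "card R = q ^ s"
    and L: "subspace L" "L0 \<subseteq> L" "L \<subseteq> K" "has_index K L (q ^ d)"
  shows "real (card (span_tuples scale r R K L)) = (real q ^ s) ^ r * gprob q r d"
  using L
proof (induction r arbitrary: L d)
  case 0
  have idP: "ideal P" "P \<noteq> UNIV" using P by (auto simp: maximal_ideal_def)
  have q2: "q \<ge> 2" using subgrp_not_UNIV_index[OF ideal_subgrp[OF ideal_UNIV] ideal_subgrp[OF idP(1)] _ idP(2) P(2)] by simp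
  have eq: "span_tuples scale 0 R K L = (if L = K then {\<lambda>_. undefined} else {})"
    using msum_absorb[OF 0(1), of "{0}"] subspace_0[OF 0(1)] by (auto simp: span_tuples_def)
  show ?case
  proof (cases d)
    case 0
    hence "L = K" using has_index_one[OF subspace_subgrp[OF sub(1)] _ subspace_subgrp] "0.prems" by simp
    thus ?thesis using eq 0 by (simp add: gprob_def)
  next
    case (Suc d')
    have "L \<noteq> K"
    proof
      assume "L = K"
      hence "q ^ d = 1" using has_index_unique[OF subspace_subgrp[OF sub(1)], of K "q ^ d" 1]
          has_index_refl[OF subspace_subgrp[OF sub(1)]] "0.prems" by simp
      thus False using q2 Suc by simp
    qed
    moreover have "gprob q 0 d = 0" unfolding gprob_def Suc prod.lessThan_Suc_shift by simp
    ultimately show ?thesis using eq by simp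
  qed
next
  case (Suc r)
  have idP: "ideal P" "P \<noteq> UNIV" using P by (auto simp: maximal_ideal_def)
  have q2: "q \<ge> 2" using subgrp_not_UNIV_index[OF ideal_subgrp[OF ideal_UNIV] ideal_subgrp[OF idP(1)] _ idP(2) P(2)] by simp
  note sg = subspace_subgrp[OF sub(1)] subspace_subgrp[OF Suc.prems(1)] subspace_subgrp[OF sub(2)]
  let ?n = "(real q ^ s) ^ r"
  have RK: "R \<subseteq> K" using R by (simp add: transv_def)
  have "has_index K L0 (q ^ s)" using R unfolding has_index_def by blast
  then obtain a b where ab: "has_index K L a" "has_index L L0 b" "q ^ s = a * b"
    using has_index_factor[OF sg Suc.prems(2,3)] by blast
  have a: "a = q ^ d" using has_index_unique[OF sg(2) ab(1) Suc.prems(4)] .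
  have RL: "transv L L0 (R \<inter> L)"
    unfolding transv_def
  proof (intro conjI ballI)
    fix x assume x: "x \<in> L"
    have ex: "\<exists>!r. r \<in> R \<and> x - r \<in> L0" using R(2) x Suc.prems(3) unfolding transv_def by blast
    have "r \<in> L" if "x - r \<in> L0" for r
    proof -
      have "x - r \<in> L" using that Suc.prems(2) by blast
      hence "x - (x - r) \<in> L" by (rule subspace_diff[OF Suc.prems(1) x])
      thus ?thesis by simp
    qed
    thus "\<exists>!r. r \<in> R \<inter> L \<and> x - r \<in> L0" using ex by blast
  qed simp
  have cardRL: "card (R \<inter> L) = b" using card_transv[OF sg(3) ab(2) RL] by simp
  have in_L: "card (span_tuples scale r R K (msum (span {x}) L)) = ?n * gprob q r d" if "x \<in> R \<inter> L" for x
  proof -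
    have "span {x} \<subseteq> L" using that by (intro span_minimal Suc.prems(1)) auto
    hence "msum (span {x}) L = L" using span_zero by (intro msum_absorb Suc.prems(1))
    thus ?thesis using Suc.IH[OF Suc.prems] by simp
  qed
  have out_L: "d > 0 \<and> card (span_tuples scale r R K (msum (span {x}) L)) = ?n * gprob q r (d - 1)" if x: "x \<in> R - L" for x
  proof -
    let ?L2 = "msum (span {x}) L"
    have xK: "x \<in> K" using x RK by blast
    have sL2: "subspace ?L2" by (rule subspace_msum[OF subspace_span Suc.prems(1)])
    have LL2: "L \<subseteq> ?L2" by (rule msum_superset2[OF span_zero])
    have xL2: "x \<in> ?L2" using msum_superset1[OF subspace_0[OF Suc.prems(1)]] span_base[of x "{x}"] by blast
    have L2K: "?L2 \<subseteq> K"
      using xK span_minimal[of "{x}" K, OF _ sub(1)] Suc.prems(3) by (intro msum_least[OF sg(1)]) auto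
    \<comment> \<open>As PK lies in L, the elements of P multiply x into L; no others do, because P
      is maximal and x is not in L. Hence adjoining x enlarges L by the index q exactly.\<close>
    have tx: "scale t x \<in> L \<longleftrightarrow> t \<in> P" for t
    proof
      assume t: "scale t x \<in> L"
      show "t \<in> P"
      proof (rule ccontr)
        assume "t \<notin> P"
        then obtain c e where ce: "e \<in> P" "c * t + e = 1" using maximal_comax[OF P(1)] by blast
        have "scale c (scale t x) + scale e x \<in> L"
        proof (rule subspace_add[OF Suc.prems(1)])
          show "scale c (scale t x) \<in> L" by (rule subspace_scale[OF Suc.prems(1) t])
          show "scale e x \<in> L" using imulI[OF ce(1) xK] PK Suc.prems(2) by blast
        qed
        hence "scale (c * t + e) x \<in> L" by (simp add: scale_left_distrib)
        thus False using ce x by simp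
      qed
    next
      assume "t \<in> P" thus "scale t x \<in> L" using imulI[OF _ xK] PK Suc.prems(2) by blast
    qed
    obtain RP where RP: "finite RP" "card RP = q" "transv UNIV P RP" using P(2) by (auto simp: has_index_def)
    have inj: "inj_on (\<lambda>t. scale t x) RP"
    proof (rule inj_onI)
      fix t t' assume t: "t \<in> RP" "t' \<in> RP" "scale t x = scale t' x"
      have "scale (t - t') x \<in> L" using t subspace_0[OF Suc.prems(1)] by (simp add: scale_left_diff_distrib)
      hence "t - t' \<in> P" "t - t \<in> P" using tx ideal_zero[OF idP(1)] by auto
      thus "t = t'" using RP(3) t unfolding transv_def by blast
    qed
    have "transv ?L2 L ((\<lambda>t. scale t x) ` RP)"
      unfolding transv_def
    proof (intro conjI ballI)
      show "(\<lambda>t. scale t x) ` RP \<subseteq> ?L2" using subspace_scale[OF sL2 xL2] by auto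
      fix y assume "y \<in> ?L2"
      then obtain t l where y: "y = scale t x + l" "l \<in> L" by (auto simp: span_singleton elim!: msumE)
      have key: "y - scale t' x \<in> L \<longleftrightarrow> t - t' \<in> P" for t'
      proof -
        have e: "y - scale t' x = scale (t - t') x + l" using y by (simp add: scale_left_diff_distrib)
        show ?thesis unfolding e tx[symmetric]
          using subspace_add[OF Suc.prems(1) _ y(2)] subspace_diff[OF Suc.prems(1) _ y(2)]
          by (metis add_diff_cancel_right')
      qed
      have "\<exists>!t'. t' \<in> RP \<and> t - t' \<in> P" using RP(3) unfolding transv_def by blast
      then obtain t' where t': "t' \<in> RP" "t - t' \<in> P" "\<And>u. u \<in> RP \<Longrightarrow> t - u \<in> P \<Longrightarrow> u = t'" by blast
      show "\<exists>!z. z \<in> (\<lambda>t. scale t x) ` RP \<and> y - z \<in> L"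
      proof (rule ex1I[of _ "scale t' x"])
        show "scale t' x \<in> (\<lambda>t. scale t x) ` RP \<and> y - scale t' x \<in> L" using t' key by blast
        fix z assume "z \<in> (\<lambda>t. scale t x) ` RP \<and> y - z \<in> L"
        thus "z = scale t' x" using t'(3) key by blast
      qed
    qed
    hence i2: "has_index ?L2 L q" unfolding has_index_def using RP inj by (metis card_image finite_imageI)
    obtain a' b' where ab': "has_index K ?L2 a'" "has_index ?L2 L b'" "q ^ d = a' * b'"
      using has_index_factor[OF sg(1) subspace_subgrp[OF sL2] sg(2) LL2 L2K Suc.prems(4)] by blast
    have b': "b' = q" using has_index_unique[OF sg(2) ab'(2) i2] .
    have d: "d > 0"
    proof (rule ccontr)
      assume "\<not> d > 0"
      hence "a' * q = 1" using ab'(3) b' by simp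
      thus False using q2 by simp
    qed
    hence "q ^ d = q ^ (d - 1) * q" by (simp flip: power_Suc2)
    hence "a' = q ^ (d - 1)" using ab'(3) b' q2 by simp
    thus ?thesis using Suc.IH[OF sL2 _ L2K, of "d - 1"] ab'(1) LL2 Suc.prems(2) d by auto
  qed
  have "real (card (span_tuples scale (Suc r) R K L)) = (\<Sum>x\<in>R. real (card (span_tuples scale r R K (msum (span {x}) L))))"
    unfolding card_span_tuples_Suc[OF R(1) Suc.prems(1)] by simp
  also have "\<dots> = (\<Sum>x\<in>R \<inter> L. real (card (span_tuples scale r R K (msum (span {x}) L)))) +
      (\<Sum>x\<in>R - L. real (card (span_tuples scale r R K (msum (span {x}) L))))"
    using R(1) by (rule sum.Int_Diff)
  also have "\<dots> = (\<Sum>x\<in>R \<inter> L. ?n * gprob q r d) + (\<Sum>x\<in>R - L. ?n * gprob q r (d - 1))"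
    using in_L out_L by (intro arg_cong2[of _ _ _ _ "(+)"] sum.cong) auto
  \<comment> \<open>Of the q^s representatives, b = q^(s - d) lie in L; this is the probability
    q^(-d) in the recursion for \<open>gprob\<close>.\<close>
  also have "\<dots> = b * (?n * gprob q r d) + (real q ^ s - b) * (?n * gprob q r (d - 1))"
  proof -
    have "card (R - L) = card R - card (R \<inter> L)" by (rule card_Diff_subset_Int) (use R in auto)
    moreover have "card (R \<inter> L) \<le> card R" using R by (intro card_mono) auto
    ultimately have "real (card (R - L)) = real q ^ s - b" using R(3) cardRL by (simp add: of_nat_diff)
    thus ?thesis using cardRL by simp
  qed
  also have "\<dots> = (real q ^ s) ^ Suc r * gprob q (Suc r) d"
  proof -
    have qd: "real b = real q ^ s / real q ^ d"
    proof -
      have "real q ^ s = real q ^ d * real b" using ab(3) a by (metis of_nat_mult of_nat_power)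
      thus ?thesis using q2 by simp
    qed
    show ?thesis
    proof (cases d)
      case 0
      thus ?thesis using qd by (simp add: gprob_def)
    next
      case (Suc d')
      have "q > 0" using q2 by simp
      show ?thesis unfolding qd Suc gprob_Suc[OF \<open>q > 0\<close>] by (simp add: algebra_simps)
    qed
  qed
  finally show ?case .
qed

end

section \<open>Kernels of surjections onto the finite module\<close>

lemma transv_repfun:
  assumes R: "transv K H R" and H: "subgrp H"
  shows "\<exists>\<rho>. (\<forall>x\<in>K. \<rho> x \<in> R \<and> x - \<rho> x \<in> H) \<and> (\<forall>x\<in>K. \<forall>y\<in>K. \<rho> x = \<rho> y \<longleftrightarrow> x - y \<in> H) \<and>
    (\<forall>r\<in>R. \<rho> r = r)"
proof -
  have RK: "R \<subseteq> K" and R1: "\<And>x. x \<in> K \<Longrightarrow> \<exists>!r. r \<in> R \<and> x - r \<in> H" using R by (auto simp: transv_def)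
  have "\<forall>x. \<exists>r. x \<in> K \<longrightarrow> r \<in> R \<and> x - r \<in> H" using R1 by blast
  then obtain \<rho> where \<rho>: "\<And>x. x \<in> K \<Longrightarrow> \<rho> x \<in> R \<and> x - \<rho> x \<in> H" by metis
  have u: "r = r'" if "x \<in> K" "r \<in> R" "r' \<in> R" "x - r \<in> H" "x - r' \<in> H" for x r r'
    using R1[OF that(1)] that by blast
  have "\<rho> x = \<rho> y \<longleftrightarrow> x - y \<in> H" if xy: "x \<in> K" "y \<in> K" for x y
  proof
    assume e: "\<rho> x = \<rho> y"
    have "x - \<rho> x \<in> H" "\<rho> x - y \<in> H" using \<rho>[OF xy(1)] \<rho>[OF xy(2)] subgrp_diff_commute[OF H, of y "\<rho> y"] e by auto
    thus "x - y \<in> H" by (rule subgrp_diff_trans[OF H])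
  next
    assume "x - y \<in> H"
    hence "x - \<rho> y \<in> H" using subgrp_diff_trans[OF H, of x y "\<rho> y"] \<rho>[OF xy(2)] by blast
    thus "\<rho> x = \<rho> y" using u[OF xy(1)] \<rho>[OF xy(1)] \<rho>[OF xy(2)] by blast
  qed
  moreover have "\<rho> r = r" if "r \<in> R" for r
    using u[of r "\<rho> r" r] \<rho>[of r] that RK subgrp_zero[OF H] by auto
  ultimately show ?thesis using \<rho> by (intro exI[of _ \<rho>]) blast
qed

section \<open>Coordinate vectors and maps to the finite module\<close>

definition pw :: "('a \<Rightarrow> 'b \<Rightarrow> 'b) \<Rightarrow> 'a \<Rightarrow> (nat \<Rightarrow> 'b) \<Rightarrow> nat \<Rightarrow> 'b" where
  "pw sc c v = (\<lambda>j. sc c (v j))"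

lemma pw_apply [simp]: "pw sc c v j = sc c (v j)"
  by (simp add: pw_def)

lemma module_pw: "module sc \<Longrightarrow> module (pw sc)"
  by (simp add: module_def fun_eq_iff)

lemma sum_fun_apply: "(\<Sum>a\<in>A. f a) x = (\<Sum>a\<in>A. f a x)" for f :: "'c \<Rightarrow> 'd \<Rightarrow> 'e::comm_monoid_add"
  by (induction A rule: infinite_finite_induct) auto

text \<open>T^n consists of the functions that vanish from n on, so that one type holds all sizes;
  powers of N are encoded in the same way.\<close>

definition vecs :: "nat \<Rightarrow> (nat \<Rightarrow> 'b::zero) set" where
  "vecs n = {v. \<forall>j\<ge>n. v j = 0}"

lemma vecs_out: "v \<in> vecs n \<Longrightarrow> j \<ge> n \<Longrightarrow> v j = 0"
  by (simp add: vecs_def)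

definition uvec :: "nat \<Rightarrow> nat \<Rightarrow> 'b::zero_neq_one" where
  "uvec j = (\<lambda>i. if i = j then 1 else 0)"

lemma uvec_vecs: "j < n \<Longrightarrow> uvec j \<in> vecs n"
  by (auto simp: vecs_def uvec_def)

lemma subspace_vecs: "module sc \<Longrightarrow> module.subspace (pw sc) (vecs n)"
proof -
  assume m: "module sc"
  interpret module sc by fact
  show ?thesis by (rule module.subspaceI[OF module_pw[OF m]]) (auto simp: vecs_def)
qed

lemma vec_decomp:
  fixes v :: "nat \<Rightarrow> 'a::comm_ring_1"
  assumes "v \<in> vecs n" shows "v = (\<Sum>j<n. pw (*) (v j) (uvec j))"
proof
  fix i
  have "(\<Sum>j<n. pw (*) (v j) (uvec j)) i = (\<Sum>j<n. if j = i then v i else 0)"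
    unfolding sum_fun_apply by (intro sum.cong) (auto simp: uvec_def)
  also have "\<dots> = v i" using vecs_out[OF assms, of i] by auto
  finally show "v i = (\<Sum>j<n. pw (*) (v j) (uvec j)) i" by simp
qed

lemma (in module) span_family:
  assumes "finite A"
  shows "x \<in> span (w ` A) \<longleftrightarrow> (\<exists>c. x = (\<Sum>l\<in>A. scale (c l) (w l)))"
proof
  assume "x \<in> span (w ` A)"
  thus "\<exists>c. x = (\<Sum>l\<in>A. scale (c l) (w l))"
  proof (induction rule: span_induct_alt)
    case base
    show ?case by (rule exI[of _ "\<lambda>_. 0"]) simp
  next
    case (step c x y)
    then obtain l d where l: "l \<in> A" "x = w l" "y = (\<Sum>l\<in>A. scale (d l) (w l))" by blast
    have "scale c x + y = (\<Sum>l'\<in>A. scale ((if l' = l then c else 0) + d l') (w l'))"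
      using l assms by (simp add: scale_left_distrib sum.distrib if_distrib[of "\<lambda>t. scale t _"] cong: if_cong)
    thus ?case by (rule exI[of _ "\<lambda>l'. (if l' = l then c else 0) + d l'"])
  qed
next
  assume "\<exists>c. x = (\<Sum>l\<in>A. scale (c l) (w l))"
  then obtain c where c: "x = (\<Sum>l\<in>A. scale (c l) (w l))" by blast
  show "x \<in> span (w ` A)" unfolding c by (intro span_sum span_scale span_base imageI)
qed

locale finite_module = balanced_primes p k bal \<epsilon>0 E
  for p :: "nat \<Rightarrow> 'a::idom set" and k bal \<epsilon>0 E +
  fixes smul :: "'a \<Rightarrow> 'n::ab_group_add \<Rightarrow> 'n"
  assumes module_N: "module smul" and finN: "finite (UNIV :: 'n set)"
    and QE: "\<And>a x. a \<in> Q E \<Longrightarrow> smul a x = 0"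
begin

sublocale N: module smul by (rule module_N)
sublocale V: module "pw (*) :: 'a \<Rightarrow> (nat \<Rightarrow> 'a) \<Rightarrow> nat \<Rightarrow> 'a" by (rule module_pw[OF module_mult])

lemma sub_vecs: "V.subspace (vecs n)"
  by (rule subspace_vecs[OF module_mult])

definition F :: "nat \<Rightarrow> (nat \<Rightarrow> 'n) \<Rightarrow> (nat \<Rightarrow> 'a) \<Rightarrow> 'n" where
  "F n g v = (\<Sum>j<n. smul (v j) (g j))"

definition Ker :: "nat \<Rightarrow> (nat \<Rightarrow> 'n) \<Rightarrow> (nat \<Rightarrow> 'a) set" where
  "Ker n g = {v \<in> vecs n. F n g v = 0}"

definition onto :: "nat \<Rightarrow> (nat \<Rightarrow> 'n) \<Rightarrow> bool" where
  "onto n g \<longleftrightarrow> F n g ` vecs n = UNIV"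

lemma F_add: "F n g (v + w) = F n g v + F n g w"
  and F_diff: "F n g (v - w) = F n g v - F n g w"
  and F_scale: "F n g (pw (*) c v) = smul c (F n g v)"
  and F_zero: "F n g 0 = 0"
  by (simp_all add: F_def N.scale_left_distrib N.scale_left_diff_distrib sum.distrib sum_subtractf N.scale_sum_right)

lemma F_sum: "F n g (\<Sum>l\<in>A. f l) = (\<Sum>l\<in>A. F n g (f l))"
  by (induction A rule: infinite_finite_induct)
    (simp_all only: sum.infinite sum.empty sum.insert F_zero F_add not_False_eq_True)

lemma F_uvec: "j < n \<Longrightarrow> F n g (uvec j) = g j"
proof -
  assume "j < n"
  have "F n g (uvec j) = (\<Sum>i<n. if i = j then g j else 0)"
    unfolding F_def by (intro sum.cong) (auto simp: uvec_def)
  thus ?thesis using \<open>j < n\<close> by simp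
qed

lemma sub_Ker: "V.subspace (Ker n g)"
  by (rule V.subspaceI) (auto simp: Ker_def F_add F_zero F_scale V.subspace_0[OF sub_vecs] V.subspace_add[OF sub_vecs]
      V.subspace_scale[OF sub_vecs])

lemma Ker_vecs: "Ker n g \<subseteq> vecs n"
  by (auto simp: Ker_def)

lemma Ker_index:
  assumes "onto n g" shows "has_index (vecs n) (Ker n g) CARD('n)"
proof -
  have "F n g x = F n g y \<longleftrightarrow> x - y \<in> Ker n g" if "x \<in> vecs n" "y \<in> vecs n" for x y
    using that by (simp add: Ker_def F_diff V.subspace_diff[OF sub_vecs])
  hence "has_index (vecs n) (Ker n g) CARD('n) \<longleftrightarrow> finite (F n g ` vecs n) \<and> card (F n g ` vecs n) = CARD('n)"
    by (rule has_index_classifier)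
  thus ?thesis using assms finN by (simp add: onto_def)
qed

definition vecs_in :: "'a set \<Rightarrow> nat \<Rightarrow> (nat \<Rightarrow> 'a) set" where
  "vecs_in P n = {v \<in> vecs n. \<forall>j. v j \<in> P}"

lemma sub_vecs_in: "ideal P \<Longrightarrow> V.subspace (vecs_in P n)"
  by (rule V.subspaceI) (auto simp: vecs_in_def ideal_zero ideal_add ideal_mult_left V.subspace_0[OF sub_vecs]
      V.subspace_add[OF sub_vecs] V.subspace_scale[OF sub_vecs])

lemma vecs_in_index:
  assumes i: "i < k" shows "has_index (vecs n) (vecs_in (p i) n) (q i ^ n)"
proof -
  obtain R where R: "finite R" "transv UNIV (p i) R" "card R = q i" by (rule ideal_pR[OF i])
  note sp = ideal_subgrp[OF ideal_p[OF i]]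
  obtain \<rho> where "\<forall>x\<in>UNIV. \<rho> x \<in> R \<and> x - \<rho> x \<in> p i"
    "\<forall>x\<in>UNIV. \<forall>y\<in>UNIV. \<rho> x = \<rho> y \<longleftrightarrow> x - y \<in> p i" "\<forall>r\<in>R. \<rho> r = r"
    using transv_repfun[OF R(2) sp] by blast
  hence \<rho>: "\<rho> x \<in> R \<and> x - \<rho> x \<in> p i" "\<rho> x = \<rho> y \<longleftrightarrow> x - y \<in> p i" "r \<in> R \<Longrightarrow> \<rho> r = r" for x y r by auto
  let ?f = "\<lambda>v. restrict (\<lambda>j. \<rho> (v j)) {..<n}"
  have cl: "?f x = ?f y \<longleftrightarrow> x - y \<in> vecs_in (p i) n" if "x \<in> vecs n" "y \<in> vecs n" for x y
  proof -
    have "?f x = ?f y \<longleftrightarrow> (\<forall>j<n. x j - y j \<in> p i)"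
      using \<rho>(2) by (auto simp: restrict_def fun_eq_iff)
    also have "\<dots> \<longleftrightarrow> (\<forall>j. x j - y j \<in> p i)"
      using vecs_out[OF that(1)] vecs_out[OF that(2)] ideal_zero[OF ideal_p[OF i]] by (metis diff_zero not_le)
    also have "\<dots> \<longleftrightarrow> x - y \<in> vecs_in (p i) n"
      using that by (simp add: vecs_in_def V.subspace_diff[OF sub_vecs])
    finally show ?thesis .
  qed
  have "?f ` vecs n = {..<n} \<rightarrow>\<^sub>E R"
  proof
    show "?f ` vecs n \<subseteq> {..<n} \<rightarrow>\<^sub>E R" by (intro image_subsetI) (simp only: restrict_PiE_iff, simp add: \<rho>(1))
    show "{..<n} \<rightarrow>\<^sub>E R \<subseteq> ?f ` vecs n"
    proof
      fix r assume r: "r \<in> {..<n} \<rightarrow>\<^sub>E R"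
      let ?v = "\<lambda>j. if j < n then r j else 0"
      have "?f ?v = r"
      proof
        fix j show "?f ?v j = r j" using r \<rho>(3)[of "r j"] by (cases "j < n") (auto simp: PiE_iff extensional_def)
      qed
      moreover have "?v \<in> vecs n" by (simp add: vecs_def)
      ultimately show "r \<in> ?f ` vecs n" by (intro image_eqI[of r ?f ?v]) (rule sym)
    qed
  qed
  moreover have "has_index (vecs n) (vecs_in (p i) n) (q i ^ n) \<longleftrightarrow> finite (?f ` vecs n) \<and> card (?f ` vecs n) = q i ^ n"
    using cl by (rule has_index_classifier)
  ultimately show ?thesis using R by (simp only:) (simp add: finite_PiE card_PiE)
qed

text \<open>By \<open>Q_add\<close>, Q (E + 1) lies in p_i Q E, and Q E T^n is killed by
  \<open>F n g\<close>.\<close>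

lemma Q_vec_pKer:
  assumes i: "i < k" and v: "v \<in> vecs_in (Q (Suc E)) n"
  shows "v \<in> imul (pw (*)) (p i) (Ker n g)"
proof -
  let ?X = "imul (pw (*)) (p i) (Ker n g)"
  have sX: "V.subspace ?X" by (rule V.subspace_imul)
  have "pw (*) x (uvec j) \<in> ?X" if x: "x \<in> Q (Suc E)" and j: "j < n" for x j
  proof -
    have id: "ideal {x. pw (*) x (uvec j) \<in> ?X}"
      unfolding ideal_def
    proof (intro conjI ballI allI)
      show "0 \<in> {x. pw (*) x (uvec j) \<in> ?X}" using V.subspace_0[OF sX] by simp
      show "a + b \<in> {x. pw (*) x (uvec j) \<in> ?X}" if "a \<in> {x. pw (*) x (uvec j) \<in> ?X}" "b \<in> {x. pw (*) x (uvec j) \<in> ?X}" for a b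
        using that V.subspace_add[OF sX] by (simp add: V.scale_left_distrib)
      show "r * a \<in> {x. pw (*) x (uvec j) \<in> ?X}" if "a \<in> {x. pw (*) x (uvec j) \<in> ?X}" for a r
        using that V.subspace_scale[OF sX, of "pw (*) a (uvec j)" r] by simp
    qed
    have "ideal_prod (p i) (Q E) \<subseteq> {x. pw (*) x (uvec j) \<in> ?X}"
    proof (rule ideal_prod_least[OF id])
      fix a b assume a: "a \<in> p i" and b: "b \<in> Q E"
      have "pw (*) b (uvec j) \<in> Ker n g"
        using QE[OF b] V.subspace_scale[OF sub_vecs uvec_vecs[OF j]] by (simp add: Ker_def F_scale)
      from V.imulI[OF a this] show "a * b \<in> {x. pw (*) x (uvec j) \<in> ?X}" by simp
    qed
    moreover have "x \<in> ideal_prod (Q 1) (Q E)" using Q_add[of 1 E] x by auto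
    hence "x \<in> ideal_prod (p i) (Q E)"
      using ideal_prod_mono[OF Q_Suc_subset_p[OF i, of 0] subset_refl, of "Q E"] by auto
    ultimately show ?thesis by blast
  qed
  moreover have "v \<in> vecs n" "\<And>j. v j \<in> Q (Suc E)" using v by (auto simp: vecs_in_def)
  ultimately have "(\<Sum>j<n. pw (*) (v j) (uvec j)) \<in> ?X" by (intro V.subspace_sum[OF sX]) auto
  thus ?thesis using vec_decomp[OF \<open>v \<in> vecs n\<close>] by simp
qed

lemma pKer_subset: "i < k \<Longrightarrow> imul (pw (*)) (p i) (Ker n g) \<subseteq> vecs_in (p i) n"
  by (intro V.imul_least sub_vecs_in ideal_p)
    (auto simp: vecs_in_def Ker_def V.subspace_scale[OF sub_vecs] ideal_mult_right[OF ideal_p])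

text \<open>Multiplication by a uniformizer identifies \<open>T\<^sup>n/K\<close> with \<open>pT\<^sup>n/pK\<close>, so \<open>[K : pK] = [T\<^sup>n : pT\<^sup>n]\<close>.\<close>
lemma pKer_index:
  assumes i: "i < k" and g: "onto n g"
  shows "has_index (Ker n g) (imul (pw (*)) (p i) (Ker n g)) (q i ^ n)"
proof -
  let ?K = "Ker n g" and ?P = "vecs_in (p i) n"
  let ?X = "imul (pw (*)) (p i) ?K"
  have sX: "V.subspace ?X" by (rule V.subspace_imul)
  have sP: "V.subspace ?P" by (rule sub_vecs_in[OF ideal_p[OF i]])
  have XK: "?X \<subseteq> ?K" by (rule V.imul_subset[OF sub_Ker])
  have XP: "?X \<subseteq> ?P" by (rule pKer_subset[OF i])
  obtain \<pi> v where pv: "\<pi> \<in> p i" "v \<notin> p i" "\<And>y. y \<in> p i \<Longrightarrow> \<exists>z. v * y = \<pi> * z"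
    "\<And>y. y \<in> p i \<Longrightarrow> \<exists>z. y - \<pi> * z \<in> Q (Suc E)"
    using uniformizer[OF i] by blast
  have pi0: "\<pi> \<noteq> 0"
  proof
    assume "\<pi> = 0"
    obtain y where "y \<in> p i" "y \<noteq> 0" using p_prime[OF i] ideal_zero[OF ideal_p[OF i]] by blast
    thus False using pv(3)[of y] pv(2) \<open>\<pi> = 0\<close> ideal_zero[OF ideal_p[OF i]] by auto
  qed
  \<comment> \<open>After multiplication by \<open>v\<close>, every element of pK is \<pi> times an
    element of K: this holds for the generators a u, and the z with this property form a
    submodule.\<close>
  have div: "\<exists>w\<in>?K. pw (*) v z = pw (*) \<pi> w" if z: "z \<in> ?X" for z
  proof -
    have "V.subspace {z. \<exists>w\<in>?K. pw (*) v z = pw (*) \<pi> w}"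
    proof (rule V.subspaceI)
      show "0 \<in> {z. \<exists>w\<in>?K. pw (*) v z = pw (*) \<pi> w}"
        using V.subspace_0[OF sub_Ker] by (intro CollectI bexI[of _ 0]) auto
      fix x y assume "x \<in> {z. \<exists>w\<in>?K. pw (*) v z = pw (*) \<pi> w}" "y \<in> {z. \<exists>w\<in>?K. pw (*) v z = pw (*) \<pi> w}"
      then obtain a b where "a \<in> ?K" "pw (*) v x = pw (*) \<pi> a" "b \<in> ?K" "pw (*) v y = pw (*) \<pi> b" by blast
      thus "x + y \<in> {z. \<exists>w\<in>?K. pw (*) v z = pw (*) \<pi> w}"
        using V.subspace_add[OF sub_Ker] by (intro CollectI bexI[of _ "a + b"]) (simp_all add: V.scale_right_distrib)
    next
      fix c x assume "x \<in> {z. \<exists>w\<in>?K. pw (*) v z = pw (*) \<pi> w}"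
      then obtain a where a: "a \<in> ?K" "pw (*) v x = pw (*) \<pi> a" by blast
      have "pw (*) v (pw (*) c x) = pw (*) c (pw (*) v x)" by (rule V.scale_left_commute)
      also have "\<dots> = pw (*) \<pi> (pw (*) c a)" unfolding a(2) by (rule V.scale_left_commute)
      finally show "pw (*) c x \<in> {z. \<exists>w\<in>?K. pw (*) v z = pw (*) \<pi> w}"
        using V.subspace_scale[OF sub_Ker a(1)] by blast
    qed
    moreover have "pw (*) a u \<in> {z. \<exists>w\<in>?K. pw (*) v z = pw (*) \<pi> w}" if au: "a \<in> p i" "u \<in> ?K" for a u
    proof -
      obtain z where z: "v * a = \<pi> * z" using pv(3)[OF au(1)] by blast
      have "pw (*) v (pw (*) a u) = pw (*) \<pi> (pw (*) z u)" by (simp add: z)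
      thus ?thesis using V.subspace_scale[OF sub_Ker au(2)] by blast
    qed
    ultimately have "?X \<subseteq> {z. \<exists>w\<in>?K. pw (*) v z = pw (*) \<pi> w}" by (rule V.imul_least)
    thus ?thesis using z by blast
  qed
  \<comment> \<open>Injectivity of T^n/K -> pT^n/pK: both v x and all a x with a in p_i lie in K,
    and \<open>v\<close> and p_i are comaximal. For a x one uses that a is \<pi> z modulo Q (E +
    1).\<close>
  have cancel: "x \<in> ?K" if x: "x \<in> vecs n" and px: "pw (*) \<pi> x \<in> ?X" for x
  proof -
    obtain w where w: "w \<in> ?K" "pw (*) v (pw (*) \<pi> x) = pw (*) \<pi> w" using div[OF px] by blast
    have "pw (*) v x = w"
    proof
      fix j
      have "v * (\<pi> * x j) = \<pi> * w j" using fun_cong[OF w(2), of j] by simp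
      hence "\<pi> * (v * x j) = \<pi> * w j" by (simp add: mult.left_commute)
      thus "pw (*) v x j = w j" using pi0 by simp
    qed
    hence vx: "pw (*) v x \<in> ?K" using w by simp
    have ax: "pw (*) a x \<in> ?K" if a: "a \<in> p i" for a
    proof -
      obtain z where z: "a - \<pi> * z \<in> Q (Suc E)" using pv(4)[OF a] by blast
      hence "smul (a - \<pi> * z) (F n g x) = 0" using QE Q_antimono[of E "Suc E"] by auto
      hence 1: "pw (*) (a - \<pi> * z) x \<in> ?K" using V.subspace_scale[OF sub_vecs x] by (simp add: Ker_def F_scale)
      have 2: "pw (*) z (pw (*) \<pi> x) \<in> ?K" using V.subspace_scale[OF sub_Ker] px XK by blast
      have "pw (*) a x = pw (*) (a - \<pi> * z) x + pw (*) z (pw (*) \<pi> x)"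
        by (rule ext) (simp add: algebra_simps)
      thus ?thesis using V.subspace_add[OF sub_Ker 1 2] by simp
    qed
    obtain c e where ce: "e \<in> p i" "c * v + e = 1" using maximal_comax[OF maximal[OF i] pv(2)] by blast
    have "pw (*) c (pw (*) v x) + pw (*) e x \<in> ?K"
      by (rule V.subspace_add[OF sub_Ker V.subspace_scale[OF sub_Ker vx] ax[OF ce(1)]])
    moreover have "pw (*) c (pw (*) v x) + pw (*) e x = pw (*) (c * v + e) x"
      by (simp add: V.scale_left_distrib)
    ultimately show ?thesis using ce(2) by simp
  qed
  obtain R where R: "finite R" "card R = CARD('n)" "transv (vecs n) ?K R"
    using Ker_index[OF g] unfolding has_index_def by blast
  have RV: "R \<subseteq> vecs n" using R(3) by (simp add: transv_def)
  have R1: "r = r'" if "r \<in> R" "r' \<in> R" "r - r' \<in> ?K" for r r'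
  proof -
    have "r - r \<in> ?K" using V.subspace_0[OF sub_Ker] by simp
    moreover have "\<exists>!z. z \<in> R \<and> r - z \<in> ?K" using R(3) RV that unfolding transv_def by blast
    ultimately show ?thesis using that by blast
  qed
  have R2: "r = r'" if "r \<in> R" "r' \<in> R" "pw (*) \<pi> r - pw (*) \<pi> r' \<in> ?X" for r r'
  proof -
    have "pw (*) \<pi> (r - r') \<in> ?X" using that(3) by (simp add: V.scale_right_diff_distrib)
    hence "r - r' \<in> ?K" using that RV by (intro cancel V.subspace_diff[OF sub_vecs]) auto
    thus ?thesis by (rule R1[OF that(1,2)])
  qed
  have "transv ?P ?X (pw (*) \<pi> ` R)"
    unfolding transv_def
  proof (intro conjI ballI)
    show "pw (*) \<pi> ` R \<subseteq> ?P"
      using RV ideal_mult_right[OF ideal_p[OF i] pv(1)] V.subspace_scale[OF sub_vecs] by (auto simp: vecs_in_def)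
    fix y assume y: "y \<in> ?P"
    \<comment> \<open>Surjectivity: coordinatewise y is congruent to \<pi> z modulo Q (E + 1), and
      such an error lies in pK.\<close>
    have "\<forall>j. \<exists>z. y j - \<pi> * z \<in> Q (Suc E)" using y pv(4) by (simp add: vecs_in_def)
    then obtain z0 where z0: "\<And>j. y j - \<pi> * z0 j \<in> Q (Suc E)" by metis
    define z where "z = (\<lambda>j. if j < n then z0 j else 0)"
    have zV: "z \<in> vecs n" by (simp add: z_def vecs_def)
    have yV: "y \<in> vecs n" using y by (simp add: vecs_in_def)
    have "y - pw (*) \<pi> z \<in> vecs_in (Q (Suc E)) n"
      using z0 vecs_out[OF yV] V.subspace_diff[OF sub_vecs yV V.subspace_scale[OF sub_vecs zV]] ideal_zero[OF ideal_Q]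
      by (auto simp: vecs_in_def z_def not_less)
    hence 1: "y - pw (*) \<pi> z \<in> ?X" by (rule Q_vec_pKer[OF i])
    obtain r where r: "r \<in> R" "z - r \<in> ?K" by (rule transv_rep[OF R(3) zV])
    have 2: "pw (*) \<pi> z - pw (*) \<pi> r \<in> ?X"
      using V.imulI[OF pv(1) r(2)] by (simp add: V.scale_right_diff_distrib)
    have 3: "y - pw (*) \<pi> r \<in> ?X" by (rule subgrp_diff_trans[OF V.subspace_subgrp[OF sX] 1 2])
    show "\<exists>!x. x \<in> pw (*) \<pi> ` R \<and> y - x \<in> ?X"
    proof (rule ex1I[of _ "pw (*) \<pi> r"])
      show "pw (*) \<pi> r \<in> pw (*) \<pi> ` R \<and> y - pw (*) \<pi> r \<in> ?X" using r 3 by blast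
      fix x assume "x \<in> pw (*) \<pi> ` R \<and> y - x \<in> ?X"
      then obtain r' where r': "r' \<in> R" "x = pw (*) \<pi> r'" "y - pw (*) \<pi> r' \<in> ?X" by blast
      have "pw (*) \<pi> r' - y \<in> ?X" using r'(3) subgrp_diff_commute[OF V.subspace_subgrp[OF sX]] by blast
      hence "pw (*) \<pi> r' - pw (*) \<pi> r \<in> ?X" using 3 by (rule subgrp_diff_trans[OF V.subspace_subgrp[OF sX]])
      thus "x = pw (*) \<pi> r" using R2[OF r'(1) r(1)] r'(2) by blast
    qed
  qed
  moreover have "inj_on (pw (*) \<pi>) R" using R2 V.subspace_0[OF sX] by (auto simp: inj_on_def)
  ultimately have PX: "has_index ?P ?X CARD('n)" unfolding has_index_def using R by (metis card_image finite_imageI)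
  note sg = V.subspace_subgrp[OF sub_vecs] V.subspace_subgrp[OF sP] V.subspace_subgrp[OF sX] V.subspace_subgrp[OF sub_Ker]
  have "?P \<subseteq> vecs n" by (auto simp: vecs_in_def)
  \<comment> \<open>The index of pK in T^n is computed once through pT^n and once through K; the
    factor |N| cancels.\<close>
  hence "has_index (vecs n) ?X (q i ^ n * CARD('n))"
    by (rule has_index_mult[OF sg(1,2,3) XP _ vecs_in_index[OF i] PX])
  then obtain a b where ab: "has_index (vecs n) ?K a" "has_index ?K ?X b" "q i ^ n * CARD('n) = a * b"
    using has_index_factor[OF sg(1,4,3) XK Ker_vecs] by blast
  have "a = CARD('n)" using has_index_unique[OF sg(4) ab(1) Ker_index[OF g]] .
  moreover have "CARD('n) > 0" using finN by (simp add: card_gt_0_iff)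
  ultimately show ?thesis using ab by simp
qed

section \<open>The part of the kernel generated by the known columns\<close>

definition indep :: "nat \<Rightarrow> nat \<Rightarrow> (nat \<Rightarrow> nat \<Rightarrow> 'a) \<Rightarrow> bool" where
  "indep i m w \<longleftrightarrow> (\<forall>c. (\<forall>j. (\<Sum>l<m. c l * w l j) \<in> p i) \<longrightarrow> (\<forall>l<m. c l \<in> p i))"

definition Lsub :: "nat \<Rightarrow> nat \<Rightarrow> (nat \<Rightarrow> 'n) \<Rightarrow> nat \<Rightarrow> (nat \<Rightarrow> nat \<Rightarrow> 'a) \<Rightarrow> (nat \<Rightarrow> 'a) set" where
  "Lsub i n g m w = msum (V.span (w ` {..<m})) (imul (pw (*)) (p i) (Ker n g))"

lemma sub_Lsub: "V.subspace (Lsub i n g m w)"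
  unfolding Lsub_def by (intro V.subspace_msum V.subspace_span V.subspace_imul)

lemma pKer_Lsub: "imul (pw (*)) (p i) (Ker n g) \<subseteq> Lsub i n g m w"
  unfolding Lsub_def by (rule msum_superset2[OF V.span_zero])

lemma Lsub_Ker: "(\<And>l. l < m \<Longrightarrow> w l \<in> Ker n g) \<Longrightarrow> Lsub i n g m w \<subseteq> Ker n g"
  unfolding Lsub_def
  by (intro msum_least V.subspace_subgrp sub_Ker V.span_minimal V.imul_subset) auto

text \<open>Since pK lies in pT^n, columns that are independent modulo p stay independent modulo pK.
  So they account for q^m of the q^n cosets of pK in K.\<close>

lemma Lsub_index:
  assumes i: "i < k" and g: "onto n g" and w: "\<And>l. l < m \<Longrightarrow> w l \<in> Ker n g" and ind: "indep i m w" and m: "m \<le> n"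
  shows "has_index (Ker n g) (Lsub i n g m w) (q i ^ (n - m))"
proof -
  let ?K = "Ker n g" and ?L = "Lsub i n g m w"
  let ?X = "imul (pw (*)) (p i) ?K"
  have sX: "V.subspace ?X" by (rule V.subspace_imul)
  note sg = V.subspace_subgrp[OF sub_Ker] V.subspace_subgrp[OF sub_Lsub] V.subspace_subgrp[OF sX]
  obtain R where R: "finite R" "transv UNIV (p i) R" "card R = q i" by (rule ideal_pR[OF i])
  have "\<exists>r. r \<in> R \<and> x - r \<in> p i" for x using transv_rep[OF R(2), of x] by blast
  then obtain \<rho> where \<rho>: "\<And>x. \<rho> x \<in> R \<and> x - \<rho> x \<in> p i" by metis
  have LK: "?L \<subseteq> ?K" by (rule Lsub_Ker) (rule w)
  let ?s = "\<lambda>r. \<Sum>l<m. pw (*) (r l) (w l)"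
  have uniq: "r = r'" if r: "r \<in> {..<m} \<rightarrow>\<^sub>E R" "r' \<in> {..<m} \<rightarrow>\<^sub>E R" and d: "?s r - ?s r' \<in> ?X" for r r'
  proof -
    have e: "(?s r - ?s r') j = (\<Sum>l<m. (r l - r' l) * w l j)" for j
      by (simp add: sum_fun_apply sum_subtractf left_diff_distrib)
    have "(\<Sum>l<m. (r l - r' l) * w l j) \<in> p i" for j
      using d pKer_subset[OF i] unfolding e[symmetric] vecs_in_def by blast
    hence "\<forall>j. (\<Sum>l<m. (r l - r' l) * w l j) \<in> p i" by blast
    hence dl: "r l - r' l \<in> p i" if "l < m" for l
      using ind[unfolded indep_def, THEN spec[of _ "\<lambda>l. r l - r' l"]] that by simp
    have "r l = r' l" if l: "l < m" for l
    proof -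
      have "\<exists>!z. z \<in> R \<and> r l - z \<in> p i" using R(2) unfolding transv_def by blast
      moreover have "r l \<in> R" "r' l \<in> R" "r l - r l \<in> p i" using r l ideal_zero[OF ideal_p[OF i]] by auto
      ultimately show ?thesis using dl[OF l] by blast
    qed
    thus ?thesis using r by (intro PiE_ext[OF r]) auto
  qed
  have span: "?s r \<in> V.span (w ` {..<m})" for r
    by (intro V.span_sum V.span_scale V.span_base) auto
  have "transv ?L ?X (?s ` ({..<m} \<rightarrow>\<^sub>E R))"
    unfolding transv_def
  proof (intro conjI ballI)
    show "?s ` ({..<m} \<rightarrow>\<^sub>E R) \<subseteq> ?L"
      unfolding Lsub_def using msum_superset1[OF V.subspace_0[OF sX]] span by blast
    fix x assume "x \<in> ?L"
    then obtain y z where yz: "y \<in> V.span (w ` {..<m})" "z \<in> ?X" "x = y + z" unfolding Lsub_def by (rule msumE)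
    obtain c where c: "y = ?s c" using yz(1) V.span_family[of "{..<m}"] by auto
    let ?r = "restrict (\<lambda>l. \<rho> (c l)) {..<m}"
    have r: "?r \<in> {..<m} \<rightarrow>\<^sub>E R" using \<rho> by auto
    have "?s c - ?s ?r = (\<Sum>l<m. pw (*) (c l - \<rho> (c l)) (w l))"
      unfolding sum_subtractf[symmetric] by (intro sum.cong) (auto simp: V.scale_left_diff_distrib)
    also have "\<dots> \<in> ?X" using \<rho> w by (intro V.subspace_sum[OF sX] V.imulI) auto
    finally have "(?s c - ?s ?r) + z \<in> ?X" using yz(2) V.subspace_add[OF sX] by blast
    hence 1: "x - ?s ?r \<in> ?X" using yz(3) c by (simp add: algebra_simps)
    show "\<exists>!z. z \<in> ?s ` ({..<m} \<rightarrow>\<^sub>E R) \<and> x - z \<in> ?X"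
    proof (rule ex1I[of _ "?s ?r"])
      show "?s ?r \<in> ?s ` ({..<m} \<rightarrow>\<^sub>E R) \<and> x - ?s ?r \<in> ?X" using r 1 by blast
      fix z assume "z \<in> ?s ` ({..<m} \<rightarrow>\<^sub>E R) \<and> x - z \<in> ?X"
      then obtain r' where r': "r' \<in> {..<m} \<rightarrow>\<^sub>E R" "z = ?s r'" "x - ?s r' \<in> ?X" by blast
      have "?s r' - x \<in> ?X" using r'(3) subgrp_diff_commute[OF sg(3)] by blast
      hence "?s r' - ?s ?r \<in> ?X" using 1 by (rule subgrp_diff_trans[OF sg(3)])
      thus "z = ?s ?r" using uniq[OF r'(1) r] r'(2) by blast
    qed
  qed
  moreover have "inj_on ?s ({..<m} \<rightarrow>\<^sub>E R)" using uniq V.subspace_0[OF sX] by (auto simp: inj_on_def)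
  moreover have "finite ({..<m} \<rightarrow>\<^sub>E R)" "card ({..<m} \<rightarrow>\<^sub>E R) = q i ^ m" using R by (auto simp: finite_PiE card_PiE)
  ultimately have LX: "has_index ?L ?X (q i ^ m)" unfolding has_index_def
    by (intro exI[of _ "?s ` ({..<m} \<rightarrow>\<^sub>E R)"]) (simp add: card_image)
  obtain a b where ab: "has_index ?K ?L a" "has_index ?L ?X b" "q i ^ n = a * b"
    by (rule has_index_factor[OF sg pKer_Lsub LK pKer_index[OF i g]])
  have b: "b = q i ^ m" using has_index_unique[OF sg(3) ab(2) LX] .
  have q: "q i > 0" using q_ge_2[OF i] by simp
  have "q i ^ n = q i ^ (n - m) * q i ^ m" using m by (simp flip: power_add)
  hence "a * q i ^ m = q i ^ (n - m) * q i ^ m" using ab(3) b by simp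
  hence "a = q i ^ (n - m)" using q by (metis mult_right_cancel power_eq_0_iff gr_implies_not0)
  thus ?thesis using ab(1) by simp
qed

end

lemma (in module) msum_span_cong:
  assumes L: "subspace L" and d: "\<And>l. l \<in> A \<Longrightarrow> v l - w l \<in> L"
  shows "msum (span (v ` A)) L = msum (span (w ` A)) L"
proof -
  have sub: "msum (span (v ` A)) L \<subseteq> msum (span (w ` A)) L" if d: "\<And>l. l \<in> A \<Longrightarrow> v l - w l \<in> L" for v w
  proof -
    have s: "subspace (msum (span (w ` A)) L)" by (rule subspace_msum[OF subspace_span L])
    have "span (v ` A) \<subseteq> msum (span (w ` A)) L"
    proof (rule span_minimal[OF _ s], safe)
      fix l assume "l \<in> A"
      hence "w l + (v l - w l) \<in> msum (span (w ` A)) L" using d by (intro msumI span_base) auto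
      thus "v l \<in> msum (span (w ` A)) L" by simp
    qed
    moreover have "L \<subseteq> msum (span (w ` A)) L" by (rule msum_superset2[OF span_zero])
    ultimately show ?thesis by (intro msum_least subspace_subgrp[OF s])
  qed
  have "w l - v l \<in> L" if "l \<in> A" for l using subspace_neg[OF L d[OF that]] by simp
  thus ?thesis using sub[of v w] sub[of w v] d by blast
qed

context finite_module
begin

text \<open>Both conditions of \<open>generates\<close>, membership in K and generation at each p_i,
  depend on the vectors only modulo this submodule.\<close>

definition Ks :: "nat \<Rightarrow> (nat \<Rightarrow> 'n) \<Rightarrow> nat \<Rightarrow> (nat \<Rightarrow> nat \<Rightarrow> 'a) \<Rightarrow> (nat \<Rightarrow> 'a) set" where
  "Ks n g m w = Ker n g \<inter> (\<Inter>i<k. Lsub i n g m w)"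

definition generates :: "nat \<Rightarrow> (nat \<Rightarrow> 'n) \<Rightarrow> nat \<Rightarrow> (nat \<Rightarrow> nat \<Rightarrow> 'a) \<Rightarrow> nat \<Rightarrow> (nat \<Rightarrow> nat \<Rightarrow> 'a) \<Rightarrow> bool" where
  "generates n g m w r v \<longleftrightarrow> (\<forall>l<r. v l \<in> Ker n g) \<and>
     (\<forall>i<k. msum (V.span (v ` {..<r})) (Lsub i n g m w) = Ker n g)"

lemma sub_Ks: "V.subspace (Ks n g m w)"
  unfolding Ks_def by (intro V.subspace_inter sub_Ker V.subspace_Int sub_Lsub)

lemma generates_cong:
  assumes "\<And>l. l < r \<Longrightarrow> v l - v' l \<in> Ks n g m w"
  shows "generates n g m w r v \<longleftrightarrow> generates n g m w r v'"
proof -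
  have "v l \<in> Ker n g \<longleftrightarrow> v' l \<in> Ker n g" if "l < r" for l
  proof -
    have d: "v l - v' l \<in> Ker n g" using assms[OF that] by (simp add: Ks_def)
    show ?thesis
      using V.subspace_add[OF sub_Ker d, of "v' l"] V.subspace_diff[OF sub_Ker _ d, of "v l"] by auto
  qed
  moreover have "msum (V.span (v ` {..<r})) (Lsub i n g m w) = msum (V.span (v' ` {..<r})) (Lsub i n g m w)" if "i < k" for i
    using assms that by (intro V.msum_span_cong sub_Lsub) (auto simp: Ks_def)
  ultimately show ?thesis unfolding generates_def by auto
qed

context
  fixes n m :: nat and g :: "nat \<Rightarrow> 'n" and w :: "nat \<Rightarrow> nat \<Rightarrow> 'a"
  assumes g: "onto n g" and w: "\<And>l. l < m \<Longrightarrow> w l \<in> Ker n g" and ind: "\<And>i. i < k \<Longrightarrow> indep i m w" and m: "m \<le> n"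
begin

text \<open>K maps onto the product of the quotients by the \<open>Lsub i\<close>, because each of
  these contains p_i K. Hence K modulo \<open>Ks\<close> is that product.\<close>

lemma crt_Ker:
  assumes x: "\<And>i. i < k \<Longrightarrow> x i \<in> Ker n g"
  shows "\<exists>y\<in>Ker n g. \<forall>i<k. y - x i \<in> Lsub i n g m w"
proof -
  obtain c where c: "\<And>i. i < k \<Longrightarrow> 1 - c i \<in> ideal_pow (p i) 1"
    "\<And>i j. i < k \<Longrightarrow> j < k \<Longrightarrow> i \<noteq> j \<Longrightarrow> c i \<in> ideal_pow (p j) 1"
    using crt_idempotents[of 1] by blast
  let ?y = "\<Sum>j<k. pw (*) (c j) (x j)"
  have "?y - x i \<in> imul (pw (*)) (p i) (Ker n g)" if i: "i < k" for i
  proof -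
    let ?X = "imul (pw (*)) (p i) (Ker n g)"
    have 1: "(\<Sum>j\<in>{..<k}-{i}. pw (*) (c j) (x j)) \<in> ?X"
      using c(2)[OF _ i] x ideal_pow_one[OF ideal_p[OF i]] by (intro V.subspace_sum V.subspace_imul V.imulI) auto
    have 2: "pw (*) (1 - c i) (x i) \<in> ?X"
      using c(1)[OF i] x[OF i] ideal_pow_one[OF ideal_p[OF i]] by (intro V.imulI) auto
    have "?y = pw (*) (c i) (x i) + (\<Sum>j\<in>{..<k}-{i}. pw (*) (c j) (x j))"
      using i by (subst sum.remove[of _ i]) auto
    hence "?y - x i = (\<Sum>j\<in>{..<k}-{i}. pw (*) (c j) (x j)) - pw (*) (1 - c i) (x i)"
      by (simp add: V.scale_left_diff_distrib)
    thus ?thesis using V.subspace_diff[OF V.subspace_imul 1 2] by simp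
  qed
  moreover have "?y \<in> Ker n g" using x by (intro V.subspace_sum sub_Ker V.subspace_scale) auto
  ultimately show ?thesis using pKer_Lsub by blast
qed

lemma Lsub_repfun:
  obtains R \<rho> where "\<And>i. i < k \<Longrightarrow> finite (R i)" "\<And>i. i < k \<Longrightarrow> card (R i) = q i ^ (n - m)"
    "\<And>i. i < k \<Longrightarrow> transv (Ker n g) (Lsub i n g m w) (R i)"
    "\<And>i x. i < k \<Longrightarrow> x \<in> Ker n g \<Longrightarrow> \<rho> i x \<in> R i \<and> x - \<rho> i x \<in> Lsub i n g m w"
    "\<And>i x y. i < k \<Longrightarrow> x \<in> Ker n g \<Longrightarrow> y \<in> Ker n g \<Longrightarrow> \<rho> i x = \<rho> i y \<longleftrightarrow> x - y \<in> Lsub i n g m w"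
    "\<And>i r. i < k \<Longrightarrow> r \<in> R i \<Longrightarrow> \<rho> i r = r"
proof -
  have "\<forall>i. \<exists>R. i < k \<longrightarrow> finite R \<and> card R = q i ^ (n - m) \<and> transv (Ker n g) (Lsub i n g m w) R"
    using Lsub_index[OF _ g w ind m] unfolding has_index_def by blast
  then obtain R where R: "\<And>i. i < k \<Longrightarrow> finite (R i) \<and> card (R i) = q i ^ (n - m) \<and> transv (Ker n g) (Lsub i n g m w) (R i)"
    by metis
  have "\<forall>i. \<exists>\<rho>. i < k \<longrightarrow> (\<forall>x\<in>Ker n g. \<rho> x \<in> R i \<and> x - \<rho> x \<in> Lsub i n g m w) \<and>
      (\<forall>x\<in>Ker n g. \<forall>y\<in>Ker n g. \<rho> x = \<rho> y \<longleftrightarrow> x - y \<in> Lsub i n g m w) \<and> (\<forall>r\<in>R i. \<rho> r = r)"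
    using transv_repfun[OF _ V.subspace_subgrp[OF sub_Lsub]] R by blast
  from choice[OF this] obtain \<rho> where \<rho>: "\<forall>i. i < k \<longrightarrow> (\<forall>x\<in>Ker n g. \<rho> i x \<in> R i \<and> x - \<rho> i x \<in> Lsub i n g m w) \<and>
      (\<forall>x\<in>Ker n g. \<forall>y\<in>Ker n g. \<rho> i x = \<rho> i y \<longleftrightarrow> x - y \<in> Lsub i n g m w) \<and> (\<forall>r\<in>R i. \<rho> i r = r)"
    by blast
  show thesis by (rule that[of R \<rho>]) (use R \<rho> in auto)
qed

lemma Ks_index: "has_index (Ker n g) (Ks n g m w) (\<Prod>i<k. q i ^ (n - m))"
    "has_index (vecs n) (Ks n g m w) (CARD('n) * (\<Prod>i<k. q i ^ (n - m)))"
proof -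
  obtain R \<rho> where R: "\<And>i. i < k \<Longrightarrow> finite (R i)" "\<And>i. i < k \<Longrightarrow> card (R i) = q i ^ (n - m)"
    "\<And>i. i < k \<Longrightarrow> transv (Ker n g) (Lsub i n g m w) (R i)"
    and \<rho>: "\<And>i x. i < k \<Longrightarrow> x \<in> Ker n g \<Longrightarrow> \<rho> i x \<in> R i \<and> x - \<rho> i x \<in> Lsub i n g m w"
    "\<And>i x y. i < k \<Longrightarrow> x \<in> Ker n g \<Longrightarrow> y \<in> Ker n g \<Longrightarrow> \<rho> i x = \<rho> i y \<longleftrightarrow> x - y \<in> Lsub i n g m w"
    "\<And>i r. i < k \<Longrightarrow> r \<in> R i \<Longrightarrow> \<rho> i r = r"
    by (rule Lsub_repfun) blast
  let ?f = "\<lambda>x. restrict (\<lambda>i. \<rho> i x) {..<k}"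
  have cl: "?f x = ?f y \<longleftrightarrow> x - y \<in> Ks n g m w" if "x \<in> Ker n g" "y \<in> Ker n g" for x y
  proof -
    have "?f x = ?f y \<longleftrightarrow> (\<forall>i<k. \<rho> i x = \<rho> i y)" by (auto simp: fun_eq_iff restrict_def)
    also have "\<dots> \<longleftrightarrow> x - y \<in> Ks n g m w"
      using \<rho>(2)[OF _ that] V.subspace_diff[OF sub_Ker that] by (auto simp: Ks_def)
    finally show ?thesis .
  qed
  have img: "?f ` Ker n g = (\<Pi>\<^sub>E i\<in>{..<k}. R i)"
  proof
    show "?f ` Ker n g \<subseteq> (\<Pi>\<^sub>E i\<in>{..<k}. R i)"
      by (intro image_subsetI) (simp only: restrict_PiE_iff, use \<rho>(1) in blast)
    show "(\<Pi>\<^sub>E i\<in>{..<k}. R i) \<subseteq> ?f ` Ker n g"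
    proof
      fix x assume x: "x \<in> (\<Pi>\<^sub>E i\<in>{..<k}. R i)"
      have xK: "x i \<in> Ker n g" "x i \<in> R i" if "i < k" for i using x that R(3)[OF that] by (auto simp: transv_def)
      obtain y where y: "y \<in> Ker n g" "\<And>i. i < k \<Longrightarrow> y - x i \<in> Lsub i n g m w" using crt_Ker[of x] xK by blast
      have "?f y = x"
      proof
        fix i show "?f y i = x i"
          using x y \<rho>(2)[of i y "x i"] \<rho>(3)[of i "x i"] xK[of i] by (cases "i < k") (auto simp: PiE_iff extensional_def)
      qed
      thus "x \<in> ?f ` Ker n g" using y(1) by (intro image_eqI[of x ?f y]) (rule sym)
    qed
  qed
  have "has_index (Ker n g) (Ks n g m w) (\<Prod>i<k. q i ^ (n - m)) \<longleftrightarrow>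
      finite (?f ` Ker n g) \<and> card (?f ` Ker n g) = (\<Prod>i<k. q i ^ (n - m))"
    using cl by (rule has_index_classifier)
  thus *: "has_index (Ker n g) (Ks n g m w) (\<Prod>i<k. q i ^ (n - m))"
    unfolding img using R finite_PiE[of "{..<k}" R] by (simp add: card_PiE)
  have "Ks n g m w \<subseteq> Ker n g" by (auto simp: Ks_def)
  thus "has_index (vecs n) (Ks n g m w) (CARD('n) * (\<Prod>i<k. q i ^ (n - m)))"
    by (rule has_index_mult[OF V.subspace_subgrp[OF sub_vecs] V.subspace_subgrp[OF sub_Ker] V.subspace_subgrp[OF sub_Ks]
          _ Ker_vecs Ker_index[OF g] *])
qed

text \<open>By the Chinese remainder theorem a tuple in K modulo \<open>Ks\<close> is a family of
  tuples, one modulo \<open>Lsub i\<close> for each i, and generation is tested on each member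
  separately. \<open>R'\<close> represents all of T^n, but generating tuples have their entries in
  K.\<close>

lemma card_generates:
  assumes R': "transv (vecs n) (Ks n g m w) R'"
  shows "real (card {\<tau> \<in> {..<r} \<rightarrow>\<^sub>E R'. generates n g m w r \<tau>}) =
    (\<Prod>i<k. (real (q i) ^ (n - m)) ^ r * gprob (q i) r (n - m))"
proof -
  obtain R \<rho> where R: "\<And>i. i < k \<Longrightarrow> finite (R i)" "\<And>i. i < k \<Longrightarrow> card (R i) = q i ^ (n - m)"
    "\<And>i. i < k \<Longrightarrow> transv (Ker n g) (Lsub i n g m w) (R i)"
    and \<rho>: "\<And>i x. i < k \<Longrightarrow> x \<in> Ker n g \<Longrightarrow> \<rho> i x \<in> R i \<and> x - \<rho> i x \<in> Lsub i n g m w"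
    "\<And>i x y. i < k \<Longrightarrow> x \<in> Ker n g \<Longrightarrow> y \<in> Ker n g \<Longrightarrow> \<rho> i x = \<rho> i y \<longleftrightarrow> x - y \<in> Lsub i n g m w"
    "\<And>i r. i < k \<Longrightarrow> r \<in> R i \<Longrightarrow> \<rho> i r = r"
    by (rule Lsub_repfun) blast
  have RK: "x \<in> Ker n g" if "x \<in> R i" "i < k" for x i using R(3)[OF that(2)] that(1) by (auto simp: transv_def)
  have KsL: "Ks n g m w \<subseteq> Lsub i n g m w" if "i < k" for i using that by (auto simp: Ks_def)
  have KsK: "Ks n g m w \<subseteq> Ker n g" by (auto simp: Ks_def)
  let ?S = "{\<tau> \<in> {..<r} \<rightarrow>\<^sub>E R'. generates n g m w r \<tau>}"
  let ?B = "\<lambda>i. span_tuples (pw (*)) r (R i) (Ker n g) (Lsub i n g m w)"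
  let ?h = "\<lambda>\<tau>. restrict (\<lambda>i. restrict (\<lambda>l. \<rho> i (\<tau> l)) {..<r}) {..<k}"
  have cond: "msum (V.span ((restrict (\<lambda>l. \<rho> i (\<tau> l)) {..<r}) ` {..<r})) (Lsub i n g m w)
     = msum (V.span (\<tau> ` {..<r})) (Lsub i n g m w)" if i: "i < k" and \<tau>: "\<And>l. l < r \<Longrightarrow> \<tau> l \<in> Ker n g" for i \<tau>
  proof (rule V.msum_span_cong[OF sub_Lsub])
    fix l assume "l \<in> {..<r}"
    hence "\<tau> l - \<rho> i (\<tau> l) \<in> Lsub i n g m w" "l < r" using \<rho>(1)[OF i \<tau>] by auto
    from V.subspace_neg[OF sub_Lsub this(1)] this(2)
    show "restrict (\<lambda>l. \<rho> i (\<tau> l)) {..<r} l - \<tau> l \<in> Lsub i n g m w" by simp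
  qed
  have "bij_betw ?h ?S (\<Pi>\<^sub>E i\<in>{..<k}. ?B i)"
    unfolding bij_betw_def
  proof
    show "inj_on ?h ?S"
    proof (rule inj_onI)
      fix \<tau> \<tau>' assume t: "\<tau> \<in> ?S" "\<tau>' \<in> ?S" "?h \<tau> = ?h \<tau>'"
      have K: "\<tau> l \<in> Ker n g" "\<tau>' l \<in> Ker n g" if "l < r" for l using t that by (auto simp: generates_def)
      have "\<tau> l = \<tau>' l" if l: "l < r" for l
      proof -
        have "\<rho> i (\<tau> l) = \<rho> i (\<tau>' l)" if "i < k" for i
          using fun_cong[OF fun_cong[OF t(3), of i], of l] that l by simp
        hence "\<tau> l - \<tau>' l \<in> Ks n g m w"
          using \<rho>(2)[OF _ K[OF l]] V.subspace_diff[OF sub_Ker K[OF l]] by (auto simp: Ks_def)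
        moreover have "\<tau> l - \<tau> l \<in> Ks n g m w" using V.subspace_0[OF sub_Ks] by simp
        moreover have "\<tau> l \<in> R'" "\<tau>' l \<in> R'" using t l by auto
        moreover have "\<exists>!z. z \<in> R' \<and> \<tau> l - z \<in> Ks n g m w" using R' K[OF l] Ker_vecs unfolding transv_def by blast
        ultimately show ?thesis by blast
      qed
      thus "\<tau> = \<tau>'" using t by (intro PiE_ext[of \<tau> "{..<r}" "\<lambda>_. R'" \<tau>']) auto
    qed
    show "?h ` ?S = (\<Pi>\<^sub>E i\<in>{..<k}. ?B i)"
    proof (intro subset_antisym image_subsetI)
      fix \<tau> assume t: "\<tau> \<in> ?S"
      have K: "\<And>l. l < r \<Longrightarrow> \<tau> l \<in> Ker n g" using t by (auto simp: generates_def)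
      have "restrict (\<lambda>l. \<rho> i (\<tau> l)) {..<r} \<in> ?B i" if i: "i < k" for i
        unfolding span_tuples_def mem_Collect_eq
      proof (intro conjI)
        show "restrict (\<lambda>l. \<rho> i (\<tau> l)) {..<r} \<in> {..<r} \<rightarrow>\<^sub>E R i"
          unfolding restrict_PiE_iff using \<rho>(1)[OF i K] by blast
        show "msum (V.span (restrict (\<lambda>l. \<rho> i (\<tau> l)) {..<r} ` {..<r})) (Lsub i n g m w) = Ker n g"
          using cond[OF i K] t i by (simp add: generates_def)
      qed
      thus "?h \<tau> \<in> (\<Pi>\<^sub>E i\<in>{..<k}. ?B i)" unfolding restrict_PiE_iff by blast
    next
      show "(\<Pi>\<^sub>E i\<in>{..<k}. ?B i) \<subseteq> ?h ` ?S"
      proof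
        fix \<sigma> assume s: "\<sigma> \<in> (\<Pi>\<^sub>E i\<in>{..<k}. ?B i)"
        have s1: "\<sigma> i \<in> {..<r} \<rightarrow>\<^sub>E R i" "msum (V.span (\<sigma> i ` {..<r})) (Lsub i n g m w) = Ker n g" if "i < k" for i
          using PiE_mem[OF s, of i] that unfolding span_tuples_def by auto
        have sR: "\<sigma> i l \<in> R i" if "i < k" "l < r" for i l using s1(1)[OF that(1)] that(2) by auto
        have "\<exists>y\<in>Ker n g. \<forall>i<k. y - \<sigma> i l \<in> Lsub i n g m w" if "l < r" for l
          using sR[OF _ that] RK by (intro crt_Ker) blast
        then obtain y where y: "\<And>l. l < r \<Longrightarrow> y l \<in> Ker n g \<and> (\<forall>i<k. y l - \<sigma> i l \<in> Lsub i n g m w)" by metis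
        have "\<forall>l. \<exists>t. l < r \<longrightarrow> t \<in> R' \<and> y l - t \<in> Ks n g m w"
          using R' y Ker_vecs unfolding transv_def by blast
        then obtain t where t: "\<And>l. l < r \<Longrightarrow> t l \<in> R' \<and> y l - t l \<in> Ks n g m w" by metis
        let ?\<tau> = "restrict t {..<r}"
        have tK: "?\<tau> l \<in> Ker n g" if "l < r" for l
        proof -
          have "y l - (y l - t l) \<in> Ker n g" by (rule V.subspace_diff[OF sub_Ker conjunct1[OF y[OF that]] subsetD[OF KsK conjunct2[OF t[OF that]]]])
          thus ?thesis using that by simp
        qed
        have rt: "\<rho> i (?\<tau> l) = \<sigma> i l" if i: "i < k" and l: "l < r" for i l
        proof -
          have "y l - t l \<in> Lsub i n g m w" using t[OF l] KsL[OF i] by blast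
          hence "t l - y l \<in> Lsub i n g m w" using V.subspace_neg[OF sub_Lsub] by fastforce
          moreover have "y l - \<sigma> i l \<in> Lsub i n g m w" using y[OF l] i by blast
          ultimately have "t l - \<sigma> i l \<in> Lsub i n g m w"
            by (rule subgrp_diff_trans[OF V.subspace_subgrp[OF sub_Lsub]])
          hence "\<rho> i (t l) = \<rho> i (\<sigma> i l)" using \<rho>(2)[OF i _ RK[OF sR[OF i l] i], of "t l"] tK[OF l] l by simp
          thus ?thesis using \<rho>(3)[OF i sR[OF i l]] l by simp
        qed
        have hs: "?h ?\<tau> = \<sigma>"
        proof
          fix i show "?h ?\<tau> i = \<sigma> i"
          proof (cases "i < k")
            case True
            have "restrict (\<lambda>l. \<rho> i (?\<tau> l)) {..<r} = \<sigma> i"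
            proof
              fix l show "restrict (\<lambda>l. \<rho> i (?\<tau> l)) {..<r} l = \<sigma> i l"
                using rt[OF True, of l] s1(1)[OF True] by (cases "l < r") (auto simp: PiE_iff extensional_def)
            qed
            thus ?thesis using True by simp
          next
            case False thus ?thesis using s by (auto simp: PiE_iff extensional_def)
          qed
        qed
        have "generates n g m w r ?\<tau>"
          unfolding generates_def
        proof (intro conjI allI impI tK)
          fix i assume i: "i < k"
          have e: "restrict (\<lambda>l. \<rho> i (?\<tau> l)) {..<r} = \<sigma> i" using fun_cong[OF hs, of i] i by simp
          have "msum (V.span ((restrict (\<lambda>l. \<rho> i (?\<tau> l)) {..<r}) ` {..<r})) (Lsub i n g m w) =
              msum (V.span (?\<tau> ` {..<r})) (Lsub i n g m w)"
            by (rule cond[OF i]) (rule tK)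
          thus "msum (V.span (?\<tau> ` {..<r})) (Lsub i n g m w) = Ker n g"
            unfolding e s1(2)[OF i] by (rule sym)
        qed
        moreover have "?\<tau> \<in> {..<r} \<rightarrow>\<^sub>E R'" unfolding restrict_PiE_iff using t by blast
        ultimately show "\<sigma> \<in> ?h ` ?S" by (intro image_eqI[of \<sigma> ?h ?\<tau>, OF hs[symmetric]]) blast
      qed
    qed
  qed
  hence "card ?S = card (\<Pi>\<^sub>E i\<in>{..<k}. ?B i)" by (rule bij_betw_same_card)
  also have "\<dots> = (\<Prod>i<k. card (?B i))" by (simp add: card_PiE)
  finally have "real (card ?S) = (\<Prod>i<k. real (card (?B i)))" by simp
  also have "\<dots> = (\<Prod>i<k. (real (q i) ^ (n - m)) ^ r * gprob (q i) r (n - m))"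
  proof (rule prod.cong)
    fix i assume "i \<in> {..<k}"
    hence i: "i < k" by simp
    have LK: "Lsub i n g m w \<subseteq> Ker n g" by (rule Lsub_Ker) (rule w)
    have idx: "has_index (Ker n g) (Lsub i n g m w) (q i ^ (n - m))" by (rule Lsub_index[OF i g w ind[OF i] m])
    show "real (card (?B i)) = (real (q i) ^ (n - m)) ^ r * gprob (q i) r (n - m)"
      by (rule V.card_span_tuples[OF maximal[OF i] q_index[OF i] sub_Ker sub_Lsub LK pKer_Lsub R(1)[OF i] R(3)[OF i] R(2)[OF i]
            sub_Lsub subset_refl LK idx])
  qed simp
  finally show ?thesis .
qed

end

end

section \<open>Counting surjections that kill the known columns\<close>

context finite_module
begin

text \<open>Elimination over the field T/p_i yields linear forms dual to w. Independence makes the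
  last vector, reduced by its components along the earlier ones, nonzero at some coordinate
  j0.\<close>

lemma indep_dual:
  assumes i: "i < k"
  shows "indep i m w \<Longrightarrow> (\<And>l. l < m \<Longrightarrow> w l \<in> vecs n) \<Longrightarrow>
    \<exists>f. \<forall>a<m. \<forall>b<m. (\<Sum>j<n. f a j * w b j) - (if a = b then 1 else 0) \<in> p i"
proof (induction m)
  case 0 thus ?case by simp
next
  case (Suc m)
  note idp = ideal_p[OF i]
  define dot where "dot f w = (\<Sum>j<n. f j * w j)" for f w :: "nat \<Rightarrow> 'a"
  have "indep i m w"
    unfolding indep_def
  proof (intro allI impI)
    fix c l assume c: "\<forall>j. (\<Sum>l<m. c l * w l j) \<in> p i" and l: "l < m"
    have "\<forall>j. (\<Sum>l<Suc m. (c(m := 0)) l * w l j) \<in> p i" using c by simp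
    hence "\<forall>l<Suc m. (c(m := 0)) l \<in> p i" using Suc.prems(1) unfolding indep_def by blast
    thus "c l \<in> p i" using l by (metis fun_upd_other less_SucI nat_neq_iff)
  qed
  then obtain f where f: "\<And>a b. a < m \<Longrightarrow> b < m \<Longrightarrow> dot (f a) (w b) - (if a = b then 1 else 0) \<in> p i"
    using Suc.IH Suc.prems(2) unfolding dot_def by (metis less_SucI)
  define d where "d a = dot (f a) (w m)" for a
  define w' where "w' = (\<lambda>j. w m j - (\<Sum>a<m. d a * w a j))"
  have "\<exists>j<n. w' j \<notin> p i"
  proof (rule ccontr)
    assume no: "\<not> (\<exists>j<n. w' j \<notin> p i)"
    have "(\<Sum>l<Suc m. ((\<lambda>a. - d a)(m := 1)) l * w l j) \<in> p i" for j
    proof -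
      have "(\<Sum>l<Suc m. ((\<lambda>a. - d a)(m := 1)) l * w l j) = w' j" by (simp add: w'_def sum_negf)
      moreover have "w' j \<in> p i"
      proof (cases "j < n")
        case False
        hence "w l j = 0" if "l < Suc m" for l using vecs_out[OF Suc.prems(2)[OF that]] by simp
        thus ?thesis by (simp add: w'_def ideal_zero[OF idp])
      qed (use no in blast)
      ultimately show ?thesis by simp
    qed
    hence "\<forall>l<Suc m. ((\<lambda>a. - d a)(m := 1)) l \<in> p i" using Suc.prems(1) unfolding indep_def by blast
    hence "((\<lambda>a. - d a)(m := 1)) m \<in> p i" by blast
    thus False using one_notin_p[OF i] by simp
  qed
  then obtain j0 where j0: "j0 < n" "w' j0 \<notin> p i" by blast
  obtain r e where re: "e \<in> p i" "r * w' j0 + e = 1" using maximal_comax[OF maximal[OF i] j0(2)] by blast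
  \<comment> \<open>The coordinate j0, scaled to be 1 on the reduced vector and corrected so as to
    vanish on the earlier ones modulo p_i.\<close>
  define h where "h = (\<lambda>j. r * uvec j0 j - (\<Sum>a<m. r * w a j0 * f a j))"
  have doth: "dot h u = r * u j0 - (\<Sum>a<m. r * w a j0 * dot (f a) u)" for u
  proof -
    have "(\<Sum>j<n. r * uvec j0 j * u j) = (\<Sum>j<n. if j = j0 then r * u j0 else 0)"
      by (intro sum.cong) (auto simp: uvec_def)
    hence 1: "(\<Sum>j<n. r * uvec j0 j * u j) = r * u j0" using j0(1) by simp
    have "(\<Sum>j<n. (\<Sum>a<m. r * w a j0 * f a j) * u j) = (\<Sum>a<m. r * w a j0 * dot (f a) u)"
      unfolding dot_def sum_distrib_left sum_distrib_right by (subst sum.swap) (simp add: mult.assoc)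
    thus ?thesis unfolding dot_def h_def left_diff_distrib sum_subtractf using 1 by (simp add: dot_def)
  qed
  have hb: "dot h (w b) \<in> p i" if b: "b < m" for b
  proof -
    have "(\<Sum>a<m. r * w a j0 * (if a = b then 1 else 0)) = (\<Sum>a<m. if a = b then r * w b j0 else 0)"
      by (intro sum.cong) auto
    hence "r * w b j0 = (\<Sum>a<m. r * w a j0 * (if a = b then 1 else 0))" using b by simp
    hence "dot h (w b) = - (\<Sum>a<m. r * w a j0 * (dot (f a) (w b) - (if a = b then 1 else 0)))"
      unfolding doth by (simp add: right_diff_distrib sum_subtractf)
    moreover have "(\<Sum>a<m. r * w a j0 * (dot (f a) (w b) - (if a = b then 1 else 0))) \<in> p i"
      using f[OF _ b] by (intro ideal_sum[OF idp] ideal_mult_left[OF idp]) auto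
    ultimately show ?thesis using ideal_neg[OF idp] by simp
  qed
  have hm: "dot h (w m) - 1 \<in> p i"
  proof -
    have "dot h (w m) = r * w' j0"
      unfolding doth w'_def d_def[symmetric] by (simp add: right_diff_distrib sum_distrib_left ac_simps)
    hence "dot h (w m) - 1 = - e" using re(2) by (metis add_diff_cancel_left' diff_minus_eq_add minus_diff_eq)
    thus ?thesis using ideal_neg[OF idp re(1)] by simp
  qed
  define f' where "f' a = (if a = m then h else (\<lambda>j. f a j - d a * h j))" for a
  have dotf': "dot (f' a) u = dot (f a) u - d a * dot h u" if "a \<noteq> m" for a u
    using that by (simp add: f'_def dot_def left_diff_distrib sum_subtractf sum_distrib_left mult.assoc)
  have "dot (f' a) (w b) - (if a = b then 1 else 0) \<in> p i" if ab: "a < Suc m" "b < Suc m" for a b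
  proof (cases "a = m")
    case True
    hence fa: "f' a = h" by (simp add: f'_def)
    show ?thesis
    proof (cases "b = m")
      case True thus ?thesis using hm \<open>a = m\<close> fa by simp
    next
      case False thus ?thesis using hb[of b] ab \<open>a = m\<close> fa by simp
    qed
  next
    case False
    hence am: "a < m" using ab by simp
    show ?thesis
    proof (cases "b = m")
      case True
      have "dot (f' a) (w b) - (if a = b then 1 else 0) = - (d a * (dot h (w m) - 1))"
        using \<open>a \<noteq> m\<close> True by (simp add: dotf' d_def[symmetric] algebra_simps)
      thus ?thesis using ideal_neg[OF idp ideal_mult_left[OF idp hm]] by simp
    next
      case False
      hence bm: "b < m" using ab by simp
      have "dot (f' a) (w b) - (if a = b then 1 else 0) = (dot (f a) (w b) - (if a = b then 1 else 0)) - d a * dot h (w b)"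
        using \<open>a \<noteq> m\<close> by (simp add: dotf')
      thus ?thesis using ideal_diff[OF idp f[OF am bm] ideal_mult_left[OF idp hb[OF bm], of "d a"]] by (simp only:)
    qed
  qed
  thus ?case unfolding dot_def by blast
qed

definition NV :: "nat \<Rightarrow> 'n set \<Rightarrow> (nat \<Rightarrow> 'n) set" where
  "NV n N' = {g \<in> vecs n. \<forall>j. g j \<in> N'}"

lemma module_NV: "module (pw smul)"
  by (rule module_pw[OF module_N])

lemma sub_NV: "N.subspace N' \<Longrightarrow> module.subspace (pw smul) (NV n N')"
  by (rule module.subspaceI[OF module_NV]) (auto simp: NV_def vecs_def N.subspace_0 N.subspace_add N.subspace_scale)

lemma card_NV: "0 \<in> N' \<Longrightarrow> finite (NV n N') \<and> card (NV n N') = card N' ^ n"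
proof -
  assume z: "0 \<in> N'"
  have "(\<forall>j\<ge>n. g j = 0) \<and> (\<forall>j. g j \<in> N') \<longleftrightarrow> (\<forall>x. (x \<in> {..<n} \<longrightarrow> g x \<in> N') \<and> (x \<notin> {..<n} \<longrightarrow> g x = 0))" for g
    using z by (metis lessThan_iff not_less)
  hence "NV n N' = PiE_dflt {..<n} 0 (\<lambda>_. N')"
    unfolding NV_def vecs_def PiE_dflt_def by simp
  thus ?thesis using finite_subset[OF subset_UNIV finN, of N'] by (auto simp: card_PiE_dflt)
qed

lemma F_g_add: "F n (g + g') v = F n g v + F n g' v"
  and F_g_diff: "F n (g - g') v = F n g v - F n g' v"
  and F_g_scale: "F n (pw smul c g) v = smul c (F n g v)"
  and F_g_zero: "F n 0 v = 0"
  by (simp_all add: F_def N.scale_right_distrib N.scale_right_diff_distrib sum.distrib sum_subtractf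
      N.scale_sum_right N.scale_left_commute mult.commute)

definition Sol :: "nat \<Rightarrow> nat \<Rightarrow> (nat \<Rightarrow> nat \<Rightarrow> 'a) \<Rightarrow> 'n set \<Rightarrow> (nat \<Rightarrow> 'n) set" where
  "Sol n m w N' = {g \<in> NV n N'. \<forall>l<m. F n g (w l) = 0}"

lemma card_Sol:
  assumes ind: "\<And>i. i < k \<Longrightarrow> indep i m w" and w: "\<And>l. l < m \<Longrightarrow> w l \<in> vecs n" and N': "N.subspace N'" and m: "m \<le> n"
  shows "card (Sol n m w N') = card N' ^ (n - m)"
proof -
  interpret P: module "pw smul" by (rule module_NV)
  define \<Psi> where "\<Psi> g = (\<lambda>l. if l < m then F n g (w l) else 0)" for g
  let ?K = "NV m N'" and ?W = "\<Psi> ` NV n N'"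
  have FN: "F n g v \<in> N'" if "g \<in> NV n N'" for g v
    unfolding F_def using that by (intro N.subspace_sum[OF N'] N.subspace_scale[OF N']) (auto simp: NV_def)
  have WK: "?W \<subseteq> ?K" using FN N.subspace_0[OF N'] by (auto simp: \<Psi>_def NV_def vecs_def)
  have sK: "P.subspace ?K" by (rule sub_NV[OF N'])
  have \<Psi>_add: "\<Psi> (g + g') = \<Psi> g + \<Psi> g'" and \<Psi>_sc: "\<Psi> (pw smul c g) = pw smul c (\<Psi> g)"
    and \<Psi>_diff: "\<Psi> (g - g') = \<Psi> g - \<Psi> g'" and \<Psi>_0: "\<Psi> 0 = 0" for g g' c
    by (rule ext, simp add: \<Psi>_def F_g_add F_g_scale F_g_diff F_g_zero)+
  have sW: "P.subspace ?W"
  proof (rule P.subspaceI)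
    show "0 \<in> ?W" using imageI[OF P.subspace_0[OF sub_NV[OF N', of n]], of \<Psi>] by (simp only: \<Psi>_0)
    show "x + y \<in> ?W" if "x \<in> ?W" "y \<in> ?W" for x y
      using that P.subspace_add[OF sub_NV[OF N']] by (auto simp: \<Psi>_add[symmetric])
    show "pw smul c x \<in> ?W" if "x \<in> ?W" for c x
      using that P.subspace_scale[OF sub_NV[OF N']] by (auto simp: \<Psi>_sc[symmetric])
  qed
  have "?K \<subseteq> msum ?W (imul (pw smul) (p i) ?K)" if i: "i < k" for i
  proof
    fix y assume y: "y \<in> ?K"
    obtain f where f: "\<And>a b. a < m \<Longrightarrow> b < m \<Longrightarrow> (\<Sum>j<n. f a j * w b j) - (if a = b then 1 else 0) \<in> p i"
      using indep_dual[OF i ind[OF i], of n] w by blast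
    define g where "g = (\<lambda>j. if j < n then \<Sum>a<m. smul (f a j) (y a) else 0)"
    have yN: "y a \<in> N'" for a using y by (simp add: NV_def)
    have gN: "g \<in> NV n N'"
      using yN N.subspace_0[OF N'] unfolding g_def NV_def vecs_def
      by (auto intro!: N.subspace_sum[OF N'] N.subspace_scale[OF N'])
    define \<epsilon>' where "\<epsilon>' a l = (if a = l then 1 else 0) - (\<Sum>j<n. f a j * w l j)" for a l
    have \<epsilon>': "\<epsilon>' a l \<in> p i" if "a < m" "l < m" for a l
      using ideal_neg[OF ideal_p[OF i] f[OF that]] by (simp add: \<epsilon>'_def)
    define un where "un l x = (\<lambda>l'. if l' = l then x else 0)" for l :: nat and x :: 'n
    have un: "un l (y a) \<in> ?K" if "l < m" for l a
      using that yN N.subspace_0[OF N'] by (auto simp: un_def NV_def vecs_def)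
    have "y - \<Psi> g = (\<Sum>l<m. \<Sum>a<m. pw smul (\<epsilon>' a l) (un l (y a)))"
    proof
      fix l'
      have R: "(\<Sum>l<m. \<Sum>a<m. pw smul (\<epsilon>' a l) (un l (y a))) l' =
          (\<Sum>l<m. if l = l' then \<Sum>a<m. smul (\<epsilon>' a l') (y a) else 0)"
        unfolding sum_fun_apply by (intro sum.cong) (auto simp: un_def)
      show "(y - \<Psi> g) l' = (\<Sum>l<m. \<Sum>a<m. pw smul (\<epsilon>' a l) (un l (y a))) l'"
      proof (cases "l' < m")
        case False
        have "y l' = 0" using y False by (simp add: NV_def vecs_def)
        thus ?thesis unfolding R using False by (simp add: \<Psi>_def)
      next
        case True
        have "F n g (w l') = (\<Sum>j<n. \<Sum>a<m. smul (f a j * w l' j) (y a))"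
          unfolding F_def g_def by (intro sum.cong) (auto simp: N.scale_sum_right mult.commute)
        also have "\<dots> = (\<Sum>a<m. smul (\<Sum>j<n. f a j * w l' j) (y a))"
          by (subst sum.swap) (simp add: N.scale_sum_left)
        finally have 1: "F n g (w l') = (\<Sum>a<m. smul (\<Sum>j<n. f a j * w l' j) (y a))" .
        have "(\<Sum>a<m. smul (if a = l' then 1 else 0) (y a)) = (\<Sum>a<m. if a = l' then y l' else 0)"
          by (intro sum.cong) auto
        hence 2: "y l' = (\<Sum>a<m. smul (if a = l' then 1 else 0) (y a))" using True by simp
        have "y l' - F n g (w l') = (\<Sum>a<m. smul (\<epsilon>' a l') (y a))"
          unfolding 1 by (subst 2) (simp only: \<epsilon>'_def N.scale_left_diff_distrib sum_subtractf)
        thus ?thesis unfolding R using True by (simp add: \<Psi>_def)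
      qed
    qed
    also have "\<dots> \<in> imul (pw smul) (p i) ?K"
      using \<epsilon>' un by (intro P.subspace_sum[OF P.subspace_imul] P.imulI) auto
    finally have "\<Psi> g + (y - \<Psi> g) \<in> msum ?W (imul (pw smul) (p i) ?K)" using gN by (intro msumI) auto
    thus "y \<in> msum ?W (imul (pw smul) (p i) ?K)" by simp
  qed
  hence "?K \<subseteq> msum ?W (imul (pw smul) (prod_pow_ideal p (\<lambda>_. E) k) ?K)" by (rule P.nakayama_prod_pow[OF sW])
  moreover have "imul (pw smul) (prod_pow_ideal p (\<lambda>_. E) k) ?K \<subseteq> {0}"
    using QE prod_pow_const_subset_Q[of E] by (intro P.imul_least P.subspace_single_0) (auto simp: fun_eq_iff)
  ultimately have "?K \<subseteq> ?W" by (fastforce elim!: msumE)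
  hence img: "?W = ?K" using WK by blast
  have "\<Psi> x = \<Psi> y \<longleftrightarrow> x - y \<in> Sol n m w N'" if "x \<in> NV n N'" "y \<in> NV n N'" for x y
  proof -
    have "x - y \<in> Sol n m w N' \<longleftrightarrow> \<Psi> (x - y) = 0"
      using P.subspace_diff[OF sub_NV[OF N'] that] by (auto simp: Sol_def \<Psi>_def fun_eq_iff)
    thus ?thesis by (simp add: \<Psi>_diff)
  qed
  hence "has_index (NV n N') (Sol n m w N') (card ?K) \<longleftrightarrow> finite ?W \<and> card ?W = card ?K"
    by (rule has_index_classifier)
  hence idx: "has_index (NV n N') (Sol n m w N') (card N' ^ m)"
    unfolding img using card_NV[OF N.subspace_0[OF N']] by simp
  have "P.subspace (Sol n m w N')"
    using sub_NV[OF N', of n] unfolding Sol_def P.subspace_def by (simp add: F_g_add F_g_scale F_g_zero)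
  moreover have "Sol n m w N' \<subseteq> NV n N'" by (auto simp: Sol_def)
  ultimately have "card (NV n N') = card N' ^ m * card (Sol n m w N')"
    using card_NV[OF N.subspace_0[OF N']] sub_NV[OF N'] idx
    by (intro card_eq_index_mult P.subspace_subgrp) auto
  moreover have "card N' > 0"
    using N.subspace_0[OF N'] finite_subset[OF subset_UNIV finN, of N'] by (auto simp: card_gt_0_iff)
  moreover have "card N' ^ n = card N' ^ m * card N' ^ (n - m)" using m by (simp flip: power_add)
  ultimately show ?thesis using card_NV[OF N.subspace_0[OF N'], of n] by simp
qed

text \<open>If F_g is not onto, then g has its values in a proper submodule N', and |N'| \<le>
  |N|/2. The factor 2^|N| bounds the number of such submodules by that of all subsets.\<close>

lemma card_onto_Sol:
  assumes ind: "\<And>i. i < k \<Longrightarrow> indep i m w" and w: "\<And>l. l < m \<Longrightarrow> w l \<in> vecs n" and m: "m \<le> n"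
  defines "C \<equiv> real (card {g \<in> Sol n m w UNIV. onto n g})"
  shows "C \<le> real CARD('n) ^ (n - m)" "real CARD('n) ^ (n - m) * (1 - 2 ^ CARD('n) / 2 ^ (n - m)) \<le> C"
proof -
  let ?N = "CARD('n)" and ?s = "n - m"
  have cU: "card (Sol n m w UNIV) = ?N ^ ?s" by (rule card_Sol[OF ind w N.subspace_UNIV m])
  have finS: "finite (Sol n m w N')" for N'
    using card_NV[of UNIV n] by (rule_tac finite_subset[of _ "NV n UNIV"]) (auto simp: Sol_def NV_def)
  have "card {g \<in> Sol n m w UNIV. onto n g} \<le> ?N ^ ?s" unfolding cU[symmetric] by (intro card_mono finS) auto
  thus "C \<le> real ?N ^ ?s" unfolding C_def by (simp flip: of_nat_power)
  let ?S = "{N'. N.subspace N' \<and> N' \<noteq> UNIV}"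
  have finPow: "finite (Pow (UNIV :: 'n set))" using finN by (simp only: finite_Pow_iff)
  have finP: "finite ?S" by (rule finite_subset[OF _ finPow]) blast
  have "{g \<in> Sol n m w UNIV. \<not> onto n g} \<subseteq> (\<Union>N'\<in>?S. Sol n m w N')"
  proof
    fix g assume g: "g \<in> {g \<in> Sol n m w UNIV. \<not> onto n g}"
    let ?N' = "F n g ` vecs n"
    have "N.subspace ?N'"
    proof (rule N.subspaceI)
      show "0 \<in> ?N'" using imageI[OF V.subspace_0[OF sub_vecs[of n]], of "F n g"] by (simp only: F_zero)
      show "x + y \<in> ?N'" if "x \<in> ?N'" "y \<in> ?N'" for x y
        using that V.subspace_add[OF sub_vecs] by (auto simp: F_add[symmetric])
      show "smul c x \<in> ?N'" if "x \<in> ?N'" for c x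
        using that V.subspace_scale[OF sub_vecs] by (auto simp: F_scale[symmetric])
    qed
    moreover have "g j \<in> ?N'" for j
    proof (cases "j < n")
      case True show ?thesis using imageI[OF uvec_vecs[OF True], of "F n g"] by (simp only: F_uvec[OF True])
    next
      case False
      hence "g j = 0" using g by (simp add: Sol_def NV_def vecs_def)
      thus ?thesis using N.subspace_0[OF \<open>N.subspace ?N'\<close>] by simp
    qed
    hence "g \<in> Sol n m w ?N'" using g by (simp add: Sol_def NV_def)
    ultimately show "g \<in> (\<Union>N'\<in>?S. Sol n m w N')" using g by (auto simp: onto_def)
  qed
  hence "card {g \<in> Sol n m w UNIV. \<not> onto n g} \<le> card (\<Union>N'\<in>?S. Sol n m w N')"
    using finP finS by (intro card_mono) auto
  also have "\<dots> \<le> (\<Sum>N'\<in>?S. card (Sol n m w N'))" by (rule card_UN_le[OF finP])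
  finally have "real (card {g \<in> Sol n m w UNIV. \<not> onto n g}) \<le> (\<Sum>N'\<in>?S. real (card (Sol n m w N')))"
    by (simp flip: of_nat_sum)
  also have "\<dots> \<le> (\<Sum>N'\<in>?S. (real ?N / 2) ^ ?s)"
  proof (rule sum_mono)
    fix N' assume N': "N' \<in> ?S"
    obtain t where t: "has_index (UNIV :: 'n set) N' t"
      using has_index_mono[of N' "{0}" UNIV ?N] has_index_singleton_zero[OF finN] N' N.subspace_subgrp[of N']
        N.subspace_subgrp[OF N.subspace_single_0] N.subspace_0[of N'] by blast
    have "t \<ge> 2" using N' N.subspace_subgrp[of N'] N.subspace_subgrp[OF N.subspace_UNIV] t
      by (intro subgrp_not_UNIV_index[of UNIV N']) auto
    moreover have "?N = t * card N'"
      using N' t N.subspace_subgrp[of N'] N.subspace_subgrp[OF N.subspace_UNIV] finN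
      by (intro card_eq_index_mult[of UNIV N']) auto
    ultimately have "2 * card N' \<le> ?N" by simp
    hence "real (card N') \<le> real ?N / 2" by linarith
    hence "real (card N') ^ ?s \<le> (real ?N / 2) ^ ?s" by (intro power_mono) auto
    moreover have "card (Sol n m w N') = card N' ^ ?s" using N' by (intro card_Sol[OF ind w _ m]) auto
    ultimately show "real (card (Sol n m w N')) \<le> (real ?N / 2) ^ ?s" by simp
  qed
  also have "\<dots> = card ?S * (real ?N / 2) ^ ?s" by simp
  also have "\<dots> \<le> 2 ^ ?N * (real ?N / 2) ^ ?s"
  proof (intro mult_right_mono)
    have "card ?S \<le> card (Pow (UNIV :: 'n set))" by (rule card_mono[OF finPow]) blast
    also have "\<dots> = 2 ^ ?N" using finN by (rule card_Pow)
    finally show "real (card ?S) \<le> 2 ^ ?N" by (metis of_nat_le_iff of_nat_numeral of_nat_power)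
  qed simp
  finally have b: "real (card {g \<in> Sol n m w UNIV. \<not> onto n g}) \<le> 2 ^ ?N * (real ?N / 2) ^ ?s" .
  have "card (Sol n m w UNIV) = card {g \<in> Sol n m w UNIV. onto n g} + card {g \<in> Sol n m w UNIV. \<not> onto n g}"
  proof -
    have "Sol n m w UNIV = {g \<in> Sol n m w UNIV. onto n g} \<union> {g \<in> Sol n m w UNIV. \<not> onto n g}" by blast
    thus ?thesis using finS[of UNIV] card_Un_disjoint[of "{g \<in> Sol n m w UNIV. onto n g}" "{g \<in> Sol n m w UNIV. \<not> onto n g}"]
      by auto
  qed
  hence "real (card (Sol n m w UNIV)) = C + real (card {g \<in> Sol n m w UNIV. \<not> onto n g})"
    unfolding C_def by (simp only: of_nat_add)
  hence "real ?N ^ ?s = C + real (card {g \<in> Sol n m w UNIV. \<not> onto n g})"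
    unfolding cU of_nat_power .
  moreover have "real ?N ^ ?s * (1 - 2 ^ ?N / 2 ^ ?s) = real ?N ^ ?s - 2 ^ ?N * (real ?N / 2) ^ ?s"
    by (simp add: power_divide right_diff_distrib)
  ultimately show "real ?N ^ ?s * (1 - 2 ^ ?N / 2 ^ ?s) \<le> C" using b by linarith
qed

end

section \<open>Presentations and the completed cokernel\<close>

definition col :: "nat \<Rightarrow> (nat \<times> nat \<Rightarrow> 'a::zero) \<Rightarrow> nat \<Rightarrow> nat \<Rightarrow> 'a" where
  "col n M l = (\<lambda>j. if j < n then M (j, l) else 0)"

text \<open>The constant sequences, that is the map from T^n to the n-th power of the
  completion.\<close>

definition cst :: "(nat \<Rightarrow> 'a) \<Rightarrow> nat \<Rightarrow> nat \<Rightarrow> nat \<Rightarrow> 'a" where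
  "cst v = (\<lambda>j i m. v j)"

context finite_module
begin

text \<open>Generation is demanded modulo p_i K only; by \<open>presents_Q\<close> it then holds
  modulo (Q m) K for every m.\<close>

definition presents :: "nat \<Rightarrow> nat \<Rightarrow> (nat \<times> nat \<Rightarrow> 'a) \<Rightarrow> (nat \<Rightarrow> 'n) \<Rightarrow> bool" where
  "presents n c M g \<longleftrightarrow> g \<in> vecs n \<and> onto n g \<and> (\<forall>l<c. col n M l \<in> Ker n g) \<and>
     (\<forall>i<k. Ker n g \<subseteq> msum (V.span (col n M ` {..<c})) (imul (pw (*)) (p i) (Ker n g)))"

text \<open>\<open>\<rho> m\<close> is one vector over T that approximates the components of v at
  all primes to precision m. It carries elements of the completion back to T^n.\<close>

definition lifts :: "nat \<Rightarrow> (nat \<Rightarrow> nat \<Rightarrow> nat \<Rightarrow> 'a) \<Rightarrow> (nat \<Rightarrow> nat \<Rightarrow> 'a) \<Rightarrow> bool" where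
  "lifts n v \<rho> \<longleftrightarrow> (\<forall>m. \<rho> m \<in> vecs n) \<and> (\<forall>m. \<forall>j<n. \<forall>i<k. \<rho> m j - v j i m \<in> ideal_pow (p i) m)"

lemma col_vecs: "col n M l \<in> vecs n"
  by (simp add: col_def vecs_def)

lemma vecs_inI: "v \<in> vecs n \<Longrightarrow> ideal P \<Longrightarrow> (\<And>j. j < n \<Longrightarrow> v j \<in> P) \<Longrightarrow> v \<in> vecs_in P n"
proof -
  assume v: "v \<in> vecs n" and P: "ideal P" and *: "\<And>j. j < n \<Longrightarrow> v j \<in> P"
  have "v j \<in> P" for j
    using vecs_out[OF v, of j] ideal_zero[OF P] *[of j] by (cases "j < n") auto
  thus ?thesis using v by (simp add: vecs_in_def)
qed

lemma QI: "(\<And>i. i < k \<Longrightarrow> x \<in> ideal_pow (p i) m) \<Longrightarrow> x \<in> Q m"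
  by (auto simp: Q_def)

lemma ideal_pow_diff_trans: "a - b \<in> ideal_pow I m \<Longrightarrow> b - c \<in> ideal_pow I m \<Longrightarrow> a - c \<in> ideal_pow I m"
  by (rule subgrp_diff_trans[OF ideal_subgrp[OF ideal_ideal_pow]])

lemma ideal_pow_diff_commute: "a - b \<in> ideal_pow I m \<Longrightarrow> b - a \<in> ideal_pow I m"
  using subgrp_diff_commute[OF ideal_subgrp[OF ideal_ideal_pow]] by blast

lemma lift_ex: obtains \<rho> where "lifts n v \<rho>"
proof -
  have "\<exists>y. \<forall>i<k. y - v j i m \<in> ideal_pow (p i) m" for j m
    using crt[of "\<lambda>i. v j i m" m] by blast
  then obtain Y where Y: "\<And>j m. \<forall>i<k. Y j m - v j i m \<in> ideal_pow (p i) m" by metis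
  have "lifts n v (\<lambda>m j. if j < n then Y j m else 0)"
    using Y by (auto simp: lifts_def vecs_def)
  thus thesis by (rule that)
qed

lemma lifts_step:
  assumes "lifts n v \<rho>" "v \<in> Rvec p k n" shows "\<rho> (Suc m) - \<rho> m \<in> vecs_in (Q m) n"
proof (rule vecs_inI[OF _ ideal_Q])
  show "\<rho> (Suc m) - \<rho> m \<in> vecs n" using assms V.subspace_diff[OF sub_vecs] by (simp add: lifts_def)
  fix j assume j: "j < n"
  show "(\<rho> (Suc m) - \<rho> m) j \<in> Q m"
  proof (rule QI)
    fix i assume i: "i < k"
    have "\<rho> (Suc m) j - v j i (Suc m) \<in> ideal_pow (p i) m"
      using assms(1) j i ideal_pow_antimono[of m "Suc m" "p i"] by (auto simp: lifts_def)
    moreover have "v j i (Suc m) - v j i m \<in> ideal_pow (p i) m"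
      using assms(2) j i by (auto simp: Rvec_def compat_def)
    moreover have "v j i m - \<rho> m j \<in> ideal_pow (p i) m"
      using assms(1) j i by (auto simp: lifts_def intro: ideal_pow_diff_commute)
    ultimately show "(\<rho> (Suc m) - \<rho> m) j \<in> ideal_pow (p i) m"
      by (simp only: minus_apply fun_diff_def) (metis ideal_pow_diff_trans)
  qed
qed

lemma lifts_mono:
  assumes "lifts n v \<rho>" "v \<in> Rvec p k n" shows "\<rho> (m + t) - \<rho> m \<in> vecs_in (Q m) n"
proof (induction t)
  case 0 thus ?case using V.subspace_0[OF sub_vecs_in[OF ideal_Q]] by (simp only: add_0_right diff_self)
next
  case (Suc t)
  have "\<rho> (Suc (m + t)) - \<rho> (m + t) \<in> vecs_in (Q m) n"
    using lifts_step[OF assms, of "m + t"] Q_antimono[of m "m + t"] by (auto simp: vecs_in_def)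
  thus ?case unfolding add_Suc_right by (rule subgrp_diff_trans[OF V.subspace_subgrp[OF sub_vecs_in[OF ideal_Q]] _ Suc])
qed

lemma F_vecs_in_QE: "x \<in> vecs_in (Q E) n \<Longrightarrow> F n g x = 0"
  unfolding F_def by (intro sum.neutral) (auto simp: vecs_in_def QE)

lemma vecs_in_QE_Ker: "vecs_in (Q E) n \<subseteq> Ker n g"
  using F_vecs_in_QE by (auto simp: Ker_def vecs_in_def)

lemma imul_vecs_in: "ideal P \<Longrightarrow> imul (pw (*)) P (Ker n g) \<subseteq> vecs_in P n"
  by (intro V.imul_least sub_vecs_in)
    (auto simp: vecs_in_def Ker_def V.subspace_scale[OF sub_vecs] ideal_mult_right)

lemma presents_Q:
  assumes "presents n c M g"
  shows "Ker n g \<subseteq> msum (V.span (col n M ` {..<c})) (imul (pw (*)) (Q m) (Ker n g))"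
proof -
  have "Ker n g \<subseteq> msum (V.span (col n M ` {..<c})) (imul (pw (*)) (prod_pow_ideal p (\<lambda>_. m) k) (Ker n g))"
    using assms by (intro V.nakayama_prod_pow V.subspace_span) (auto simp: presents_def)
  also have "\<dots> \<subseteq> msum (V.span (col n M ` {..<c})) (imul (pw (*)) (Q m) (Ker n g))"
    by (intro msum_mono V.imul_mono prod_pow_const_subset_Q subset_refl)
  finally show ?thesis .
qed

text \<open>The right side contains the columns but not g, so all presentations of M have the same
  kernel.\<close>

lemma presents_Ker:
  assumes "presents n c M g"
  shows "Ker n g = msum (V.span (col n M ` {..<c})) (vecs_in (Q E) n)"
proof
  show "Ker n g \<subseteq> msum (V.span (col n M ` {..<c})) (vecs_in (Q E) n)"
    using presents_Q[OF assms, of E] msum_mono[OF subset_refl imul_vecs_in[OF ideal_Q]] by blast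
  show "msum (V.span (col n M ` {..<c})) (vecs_in (Q E) n) \<subseteq> Ker n g"
    using assms by (intro msum_least V.subspace_subgrp sub_Ker V.span_minimal vecs_in_QE_Ker) (auto simp: presents_def)
qed

definition Mx :: "nat \<Rightarrow> nat \<Rightarrow> (nat \<times> nat \<Rightarrow> 'a) \<Rightarrow> (nat \<Rightarrow> 'a) \<Rightarrow> nat \<Rightarrow> 'a" where
  "Mx n c M x = (\<Sum>l<c. pw (*) (x l) (col n M l))"

lemma Mx_apply: "j < n \<Longrightarrow> Mx n c M x j = (\<Sum>l<c. M (j, l) * x l)"
  unfolding Mx_def sum_fun_apply by (simp add: col_def mult.commute)

lemma Mx_vecs: "Mx n c M x \<in> vecs n"
  unfolding Mx_def by (intro V.subspace_sum sub_vecs V.subspace_scale col_vecs)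

lemma Mx_add: "Mx n c M (x + y) = Mx n c M x + Mx n c M y"
  unfolding Mx_def by (simp add: V.scale_left_distrib sum.distrib)

lemma Mx_scale: "Mx n c M (pw (*) a x) = pw (*) a (Mx n c M x)"
  unfolding Mx_def by (simp add: V.scale_sum_right)

lemma Mx_span: "Mx n c M x \<in> V.span (col n M ` {..<c})"
  unfolding Mx_def by (intro V.span_sum V.span_scale V.span_base) auto

lemma span_Mx:
  assumes "z \<in> V.span (col n M ` {..<c})" shows "\<exists>x\<in>vecs c. z = Mx n c M x"
proof -
  obtain x where x: "z = (\<Sum>l<c. pw (*) (x l) (col n M l))" using assms V.span_family[of "{..<c}" z "col n M"] by auto
  have "z = Mx n c M (\<lambda>l. if l < c then x l else 0)" unfolding x Mx_def by (intro sum.cong) auto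
  thus ?thesis by (intro bexI[of _ "\<lambda>l. if l < c then x l else 0"]) (auto simp: vecs_def)
qed

lemma F_Mx: "presents n c M g \<Longrightarrow> F n g (Mx n c M x) = 0"
  unfolding Mx_def by (simp add: F_sum F_scale presents_def Ker_def)

text \<open>Q (t + E) T^n lies in (Q t) K, and K is spanned by the columns up to Q (t + E + 1) T^n.
  The correction \<open>\<xi>\<close> is only in Q t: it lags E steps behind the residual, but it
  still tends to 0.\<close>

lemma lift_residual_step:
  assumes P: "presents n c M g" and z: "z \<in> vecs_in (Q (t + E)) n"
  shows "\<exists>\<xi>\<in>vecs_in (Q t) c. z - Mx n c M \<xi> \<in> vecs_in (Q (Suc t + E)) n"
proof -
  let ?S = "{z. \<exists>\<xi>\<in>vecs_in (Q t) c. z - Mx n c M \<xi> \<in> vecs_in (Q (Suc t + E)) n}"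
  note sQ = sub_vecs_in[OF ideal_Q]
  have sS: "V.subspace ?S"
  proof (rule V.subspaceI)
    have "Mx n c M 0 = 0" by (simp add: Mx_def)
    thus "0 \<in> ?S" using V.subspace_0[OF sQ] by (intro CollectI bexI[of _ 0]) auto
  next
    fix x y assume "x \<in> ?S" "y \<in> ?S"
    then obtain a b where ab: "a \<in> vecs_in (Q t) c" "x - Mx n c M a \<in> vecs_in (Q (Suc t + E)) n"
      "b \<in> vecs_in (Q t) c" "y - Mx n c M b \<in> vecs_in (Q (Suc t + E)) n" by blast
    have e: "(x + y) - Mx n c M (a + b) = (x - Mx n c M a) + (y - Mx n c M b)" by (simp add: Mx_add)
    show "x + y \<in> ?S"
    proof (intro CollectI bexI[of _ "a + b"])
      show "(x + y) - Mx n c M (a + b) \<in> vecs_in (Q (Suc t + E)) n" unfolding e by (rule V.subspace_add[OF sQ ab(2,4)])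
    qed (rule V.subspace_add[OF sQ ab(1,3)])
  next
    fix r x assume "x \<in> ?S"
    then obtain a where a: "a \<in> vecs_in (Q t) c" "x - Mx n c M a \<in> vecs_in (Q (Suc t + E)) n" by blast
    have e: "pw (*) r x - Mx n c M (pw (*) r a) = pw (*) r (x - Mx n c M a)"
      by (simp only: Mx_scale V.scale_right_diff_distrib)
    show "pw (*) r x \<in> ?S"
    proof (intro CollectI bexI[of _ "pw (*) r a"])
      show "pw (*) r x - Mx n c M (pw (*) r a) \<in> vecs_in (Q (Suc t + E)) n" unfolding e by (rule V.subspace_scale[OF sQ a(2)])
    qed (rule V.subspace_scale[OF sQ a(1)])
  qed
  have mem: "pw (*) a \<kappa> \<in> ?S" if a: "a \<in> Q t" and \<kappa>: "\<kappa> \<in> Ker n g" for a \<kappa>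
  proof -
    obtain s \<zeta> where s: "s \<in> V.span (col n M ` {..<c})" "\<zeta> \<in> imul (pw (*)) (Q (Suc t + E)) (Ker n g)" "\<kappa> = s + \<zeta>"
      using presents_Q[OF P, of "Suc t + E"] \<kappa> by (auto elim!: msumE)
    obtain \<eta> where \<eta>: "\<eta> \<in> vecs c" "s = Mx n c M \<eta>" using span_Mx[OF s(1)] by blast
    have "\<zeta> \<in> vecs_in (Q (Suc t + E)) n" using s(2) imul_vecs_in[OF ideal_Q] by blast
    hence 1: "pw (*) a \<zeta> \<in> vecs_in (Q (Suc t + E)) n" by (rule V.subspace_scale[OF sQ])
    have 2: "pw (*) a \<eta> \<in> vecs_in (Q t) c"
      using \<eta>(1) V.subspace_scale[OF sub_vecs \<eta>(1)] ideal_mult_right[OF ideal_Q a] by (simp add: vecs_in_def)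
    have e: "pw (*) a \<kappa> - Mx n c M (pw (*) a \<eta>) = pw (*) a \<zeta>"
      unfolding s(3) \<eta>(2) by (simp only: Mx_scale V.scale_right_distrib add_diff_cancel_left')
    show ?thesis
    proof (intro CollectI bexI[of _ "pw (*) a \<eta>"])
      show "pw (*) a \<kappa> - Mx n c M (pw (*) a \<eta>) \<in> vecs_in (Q (Suc t + E)) n" unfolding e by (rule 1)
    qed (rule 2)
  qed
  have "pw (*) x (uvec j) \<in> ?S" if x: "x \<in> Q (t + E)" and j: "j < n" for x j
  proof -
    have id: "ideal {x. pw (*) x (uvec j) \<in> S}" if S: "V.subspace S" for S
      unfolding ideal_def
    proof (intro conjI ballI allI)
      show "0 \<in> {x. pw (*) x (uvec j) \<in> S}" using V.subspace_0[OF S] by simp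
      show "a + b \<in> {x. pw (*) x (uvec j) \<in> S}" if "a \<in> {x. pw (*) x (uvec j) \<in> S}" "b \<in> {x. pw (*) x (uvec j) \<in> S}" for a b
        using that V.subspace_add[OF S] by (simp add: V.scale_left_distrib)
      show "r * a \<in> {x. pw (*) x (uvec j) \<in> S}" if "a \<in> {x. pw (*) x (uvec j) \<in> S}" for a r
        using that V.subspace_scale[OF S, of "pw (*) a (uvec j)" r] by simp
    qed
    have "ideal_prod (Q t) (Q E) \<subseteq> {x. pw (*) x (uvec j) \<in> ?S}"
    proof (rule ideal_prod_least[OF id[OF sS]])
      fix a b assume a: "a \<in> Q t" and b: "b \<in> Q E"
      have "pw (*) b (uvec j) \<in> Ker n g"
        using QE[OF b] V.subspace_scale[OF sub_vecs uvec_vecs[OF j]] by (simp add: Ker_def F_scale)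
      from mem[OF a this] show "a * b \<in> {x. pw (*) x (uvec j) \<in> ?S}" by simp
    qed
    thus ?thesis using Q_add[of t E] x by blast
  qed
  moreover have zv: "z \<in> vecs n" "\<And>j. z j \<in> Q (t + E)" using z by (auto simp: vecs_in_def)
  ultimately have "(\<Sum>j<n. pw (*) (z j) (uvec j)) \<in> ?S" by (intro V.subspace_sum[OF sS]) auto
  thus ?thesis using vec_decomp[OF zv(1)] by simp
qed

lemma cst_Rvec: "v \<in> vecs n \<Longrightarrow> cst v \<in> Rvec p k n"
  by (simp add: cst_def Rvec_def compat_def vecs_def ideal_zero[OF ideal_ideal_pow])

lemma lifts_cst: "v \<in> vecs n \<Longrightarrow> lifts n (cst v) (\<lambda>_. v)"
  by (simp add: lifts_def cst_def ideal_zero[OF ideal_ideal_pow])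

lemma lifts_unique: "lifts n v \<rho> \<Longrightarrow> lifts n v \<rho>' \<Longrightarrow> \<rho> m - \<rho>' m \<in> vecs_in (Q m) n"
proof (rule vecs_inI[OF _ ideal_Q])
  assume l: "lifts n v \<rho>" "lifts n v \<rho>'"
  show "\<rho> m - \<rho>' m \<in> vecs n" using l V.subspace_diff[OF sub_vecs] by (simp add: lifts_def)
  fix j assume j: "j < n"
  show "(\<rho> m - \<rho>' m) j \<in> Q m"
  proof (rule QI)
    fix i assume i: "i < k"
    have 1: "\<rho> m j - v j i m \<in> ideal_pow (p i) m" and 2: "v j i m - \<rho>' m j \<in> ideal_pow (p i) m"
      using l i j by (auto simp: lifts_def intro: ideal_pow_diff_commute)
    show "(\<rho> m - \<rho>' m) j \<in> ideal_pow (p i) m" using ideal_pow_diff_trans[OF 1 2] by simp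
  qed
qed

lemma lifts_add: "lifts n v \<rho> \<Longrightarrow> lifts n w \<sigma> \<Longrightarrow> lifts n (\<lambda>j i m. v j i m + w j i m) (\<lambda>m. \<rho> m + \<sigma> m)"
proof -
  assume l: "lifts n v \<rho>" "lifts n w \<sigma>"
  have "\<rho> m j + \<sigma> m j - (v j i m + w j i m) \<in> ideal_pow (p i) m" if "j < n" "i < k" for m j i
  proof -
    have "(\<rho> m j - v j i m) + (\<sigma> m j - w j i m) \<in> ideal_pow (p i) m"
      using l that by (intro ideal_add[OF ideal_ideal_pow]) (auto simp: lifts_def)
    thus ?thesis by (simp add: algebra_simps)
  qed
  thus ?thesis using l V.subspace_add[OF sub_vecs] by (simp add: lifts_def)
qed

lemma lifts_scale: "lifts n v \<rho> \<Longrightarrow> lifts n (\<lambda>j i m. t * v j i m) (\<lambda>m. pw (*) t (\<rho> m))"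
proof -
  assume l: "lifts n v \<rho>"
  have "t * \<rho> m j - t * v j i m \<in> ideal_pow (p i) m" if "j < n" "i < k" for m j i
    unfolding right_diff_distrib[symmetric]
    using l that by (intro ideal_mult_left[OF ideal_ideal_pow]) (auto simp: lifts_def)
  thus ?thesis using l V.subspace_scale[OF sub_vecs] by (simp add: lifts_def)
qed

text \<open>Equality in the cokernel over the completion becomes, at each level m, a congruence over
  T modulo Q m.\<close>

lemma cok_rel_lift:
  assumes x: "lifts c x \<xi>" and v: "lifts n v \<rho>" and w: "lifts n w \<sigma>"
    and null: "\<And>j. j < n \<Longrightarrow> null p k (\<lambda>i m. v j i m - w j i m - (\<Sum>l<c. M (j, l) * x l i m))"
  shows "\<rho> m - \<sigma> m - Mx n c M (\<xi> m) \<in> vecs_in (Q m) n"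
proof (rule vecs_inI[OF _ ideal_Q])
  show "\<rho> m - \<sigma> m - Mx n c M (\<xi> m) \<in> vecs n"
    using v w by (intro V.subspace_diff[OF sub_vecs] Mx_vecs) (auto simp: lifts_def)
  fix j assume j: "j < n"
  show "(\<rho> m - \<sigma> m - Mx n c M (\<xi> m)) j \<in> Q m"
  proof (rule QI)
    fix i assume i: "i < k"
    note id = ideal_ideal_pow[of "p i" m]
    have 1: "v j i m - w j i m - (\<Sum>l<c. M (j, l) * x l i m) \<in> ideal_pow (p i) m"
      using null[OF j] i by (simp add: null_def)
    have 2: "(\<rho> m j - v j i m) - (\<sigma> m j - w j i m) \<in> ideal_pow (p i) m"
    proof (rule ideal_diff[OF id])
      show "\<rho> m j - v j i m \<in> ideal_pow (p i) m" using v i j by (auto simp: lifts_def)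
      show "\<sigma> m j - w j i m \<in> ideal_pow (p i) m" using w i j by (auto simp: lifts_def)
    qed
    have 3: "(\<Sum>l<c. M (j, l) * (\<xi> m l - x l i m)) \<in> ideal_pow (p i) m"
      using x i by (intro ideal_sum[OF id] ideal_mult_left[OF id]) (auto simp: lifts_def)
    have "(\<rho> m - \<sigma> m - Mx n c M (\<xi> m)) j =
       (v j i m - w j i m - (\<Sum>l<c. M (j, l) * x l i m)) + ((\<rho> m j - v j i m) - (\<sigma> m j - w j i m)) -
       (\<Sum>l<c. M (j, l) * (\<xi> m l - x l i m))"
      by (simp add: Mx_apply[OF j] right_diff_distrib sum_subtractf)
    thus "(\<rho> m - \<sigma> m - Mx n c M (\<xi> m)) j \<in> ideal_pow (p i) m"
      using ideal_diff[OF id ideal_add[OF id 1 2] 3] by (simp only:)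
  qed
qed

text \<open>A solution modulo all \<open>Q m\<close> simultaneously is obtained by successive approximation.\<close>
lemma presents_cok_rel:
  assumes P: "presents n (n + u) M g" and v: "v \<in> Rvec p k n" "lifts n v \<rho>" and w: "w \<in> Rvec p k n" "lifts n w \<sigma>"
    and eq: "F n g (\<rho> E) = F n g (\<sigma> E)"
  shows "cok_rel p k n u M v w"
proof -
  let ?c = "n + u"
  define y where "y m = \<rho> m - \<sigma> m" for m
  note sQ = sub_vecs_in[OF ideal_Q]
  have yv: "y m \<in> vecs n" for m unfolding y_def using v w by (intro V.subspace_diff[OF sub_vecs]) (auto simp: lifts_def)
  have ym: "y (m + t) - y m \<in> vecs_in (Q m) n" for m t
  proof -
    have "y (m + t) - y m = (\<rho> (m + t) - \<rho> m) - (\<sigma> (m + t) - \<sigma> m)" by (simp add: y_def)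
    thus ?thesis using V.subspace_diff[OF sQ lifts_mono[OF v(2,1), of m t] lifts_mono[OF w(2,1), of m t]] by (simp only:)
  qed
  have "y E \<in> Ker n g" using yv[of E] eq by (simp add: Ker_def F_diff y_def)
  then obtain s \<zeta> where s: "s \<in> V.span (col n M ` {..<?c})" "\<zeta> \<in> imul (pw (*)) (Q E) (Ker n g)" "y E = s + \<zeta>"
    using presents_Q[OF P, of E] by (auto elim!: msumE)
  obtain x0 where x0: "x0 \<in> vecs ?c" "s = Mx n ?c M x0" using span_Mx[OF s(1)] by blast
  have b0: "y E - Mx n ?c M x0 \<in> vecs_in (Q E) n" using s(2,3) x0(2) imul_vecs_in[OF ideal_Q] by auto
  \<comment> \<open>At stage t the vector solves the system modulo Q (t + E); successive solutions
    differ by vectors over Q t, which is the compatibility demanded of an element of the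
    completion.\<close>
  let ?P = "\<lambda>t x. x \<in> vecs ?c \<and> y (t + E) - Mx n ?c M x \<in> vecs_in (Q (t + E)) n"
  have "\<exists>X. \<forall>t. ?P t (X t) \<and> X (Suc t) - X t \<in> vecs_in (Q t) ?c"
  proof (rule dependent_nat_choice)
    show "\<exists>x. ?P 0 x" using x0 b0 by auto
    fix x t assume x: "?P t x"
    have "y (Suc t + E) - y (t + E) \<in> vecs_in (Q (t + E)) n" using ym[of "t + E" 1] by (simp only: add.commute[of "t + E"] plus_1_eq_Suc add_Suc)
    hence "(y (Suc t + E) - y (t + E)) + (y (t + E) - Mx n ?c M x) \<in> vecs_in (Q (t + E)) n"
      using x V.subspace_add[OF sQ] by blast
    hence "y (Suc t + E) - Mx n ?c M x \<in> vecs_in (Q (t + E)) n" by (simp only: add_diff_eq diff_add_cancel)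
    then obtain \<xi> where \<xi>: "\<xi> \<in> vecs_in (Q t) ?c" "y (Suc t + E) - Mx n ?c M x - Mx n ?c M \<xi> \<in> vecs_in (Q (Suc t + E)) n"
      using lift_residual_step[OF P] by blast
    have "x + \<xi> \<in> vecs ?c" using x \<xi>(1) V.subspace_add[OF sub_vecs] by (auto simp: vecs_in_def)
    moreover have "y (Suc t + E) - Mx n ?c M (x + \<xi>) \<in> vecs_in (Q (Suc t + E)) n" using \<xi>(2) by (simp only: Mx_add diff_diff_eq)
    moreover have "(x + \<xi>) - x \<in> vecs_in (Q t) ?c" using \<xi>(1) by (simp only: add_diff_cancel_left')
    ultimately show "\<exists>x'. ?P (Suc t) x' \<and> x' - x \<in> vecs_in (Q t) ?c" by blast
  qed
  then obtain X where X: "\<And>t. X t \<in> vecs ?c" "\<And>t. y (t + E) - Mx n ?c M (X t) \<in> vecs_in (Q (t + E)) n"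
    "\<And>t. X (Suc t) - X t \<in> vecs_in (Q t) ?c" by blast
  \<comment> \<open>The same sequence over T serves every prime.\<close>
  define x where "x = (\<lambda>l (i::nat) m. X m l)"
  have "X (Suc m) l - X m l \<in> ideal_pow (p i) m" if "i < k" for m l i
  proof -
    have "(X (Suc m) - X m) l \<in> Q m" using X(3)[of m] unfolding vecs_in_def by blast
    thus ?thesis using subsetD[OF Q_subset[OF that]] by simp
  qed
  hence "x \<in> Rvec p k ?c" using vecs_out[OF X(1)] by (simp add: x_def Rvec_def compat_def)
  moreover have "null p k (\<lambda>i m. v j i m - w j i m - (\<Sum>l<?c. M (j, l) * x l i m))" if j: "j < n" for j
    unfolding null_def
  proof (intro allI impI)
    fix i m assume i: "i < k"
    note id = ideal_ideal_pow[of "p i" m]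
    have "(y (m + E) - Mx n ?c M (X m)) j \<in> Q m" using X(2)[of m] Q_antimono[of m "m + E"] by (auto simp: vecs_in_def)
    hence 1: "y (m + E) j - (\<Sum>l<?c. M (j, l) * X m l) \<in> ideal_pow (p i) m"
      using Q_subset[OF i, of m] by (auto simp: Mx_apply[OF j])
    have "(y (m + E) - y m) j \<in> Q m" using ym[of m E] by (simp add: vecs_in_def)
    hence 2: "y (m + E) j - y m j \<in> ideal_pow (p i) m" using Q_subset[OF i, of m] by auto
    have 3: "(\<rho> m j - v j i m) - (\<sigma> m j - w j i m) \<in> ideal_pow (p i) m"
    proof (rule ideal_diff[OF id])
      show "\<rho> m j - v j i m \<in> ideal_pow (p i) m" using v i j by (auto simp: lifts_def)
      show "\<sigma> m j - w j i m \<in> ideal_pow (p i) m" using w i j by (auto simp: lifts_def)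
    qed
    have "v j i m - w j i m - (\<Sum>l<?c. M (j, l) * x l i m) =
       (y (m + E) j - (\<Sum>l<?c. M (j, l) * X m l)) - (y (m + E) j - y m j) - ((\<rho> m j - v j i m) - (\<sigma> m j - w j i m))"
      by (simp add: x_def y_def)
    thus "v j i m - w j i m - (\<Sum>l<?c. M (j, l) * x l i m) \<in> ideal_pow (p i) m"
      using ideal_diff[OF id ideal_diff[OF id 1 2] 3] by (simp only:)
  qed
  ultimately show ?thesis unfolding cok_rel_def by blast
qed

text \<open>The isomorphism evaluates F_g at a lift of precision E; the choice of the lift is
  immaterial since Q E kills N.\<close>

lemma presents_imp_cok_iso:
  assumes P: "presents n (n + u) M g" shows "cok_tensor_iso p k n u smul M"
proof -
  have "\<exists>\<rho>. lifts n v \<rho>" for v using lift_ex[of n v] by blast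
  then obtain \<rho> where \<rho>: "\<And>v. lifts n v (\<rho> v)" by metis
  define f where "f v = F n g (\<rho> v E)" for v
  have fl: "f v = F n g (\<sigma> E)" if "lifts n v \<sigma>" for v \<sigma>
  proof -
    have "F n g (\<rho> v E - \<sigma> E) = 0" by (rule F_vecs_in_QE[OF lifts_unique[OF \<rho> that]])
    thus ?thesis by (simp add: f_def F_diff)
  qed
  have surj: "f ` Rvec p k n = UNIV"
  proof -
    have "x \<in> f ` Rvec p k n" for x
    proof -
      have "x \<in> F n g ` vecs n" using P by (simp add: presents_def onto_def)
      then obtain v where v: "v \<in> vecs n" "x = F n g v" by blast
      have "f (cst v) = x" using fl[OF lifts_cst[OF v(1)]] v(2) by simp
      thus ?thesis using cst_Rvec[OF v(1)] by blast
    qed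
    thus ?thesis by blast
  qed
  have add: "f (\<lambda>j i m. v j i m + w j i m) = f v + f w" for v w
    using fl[OF lifts_add[OF \<rho>[of v] \<rho>[of w]]] by (simp add: f_def F_add)
  have sc: "f (\<lambda>j i m. t * v j i m) = smul t (f v)" for t v
    using fl[OF lifts_scale[OF \<rho>[of v]]] by (simp add: f_def F_scale)
  have rel: "f v = f w \<longleftrightarrow> cok_rel p k n u M v w" if vw: "v \<in> Rvec p k n" "w \<in> Rvec p k n" for v w
  proof
    assume "f v = f w"
    thus "cok_rel p k n u M v w" unfolding f_def by (rule presents_cok_rel[OF P vw(1) \<rho> vw(2) \<rho>])
  next
    assume "cok_rel p k n u M v w"
    then obtain x where x: "\<forall>j<n. null p k (\<lambda>i m. v j i m - w j i m - (\<Sum>l<n + u. M (j, l) * x l i m))"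
      unfolding cok_rel_def by blast
    obtain \<xi> where \<xi>: "lifts (n + u) x \<xi>" by (rule lift_ex)
    have "\<rho> v E - \<rho> w E - Mx n (n + u) M (\<xi> E) \<in> vecs_in (Q E) n"
      using x by (intro cok_rel_lift[OF \<xi> \<rho> \<rho>]) blast
    from F_vecs_in_QE[OF this, of g] show "f v = f w" by (simp add: f_def F_diff F_Mx[OF P])
  qed
  show ?thesis unfolding cok_tensor_iso_def using surj add sc rel by (intro exI[of _ f]) blast
qed

text \<open>The obstacle is that f is given as a T-linear map on vectors over the completion, with
  no continuity, while g records its values on T^n only. An element whose approximation at level E
  is 0 turns out to be a finite combination of such vectors with coefficients in Q E, so f kills it,
  and f is determined by T^n.\<close>

lemma cok_iso_imp_presents:
  assumes "cok_tensor_iso p k n u smul M" shows "\<exists>g. presents n (n + u) M g"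
proof -
  let ?c = "n + u"
  obtain f where surj: "f ` Rvec p k n = UNIV"
    and add: "\<And>v w. v \<in> Rvec p k n \<Longrightarrow> w \<in> Rvec p k n \<Longrightarrow> f (\<lambda>j i m. v j i m + w j i m) = f v + f w"
    and sc: "\<And>t v. v \<in> Rvec p k n \<Longrightarrow> f (\<lambda>j i m. t * v j i m) = smul t (f v)"
    and rel: "\<And>v w. v \<in> Rvec p k n \<Longrightarrow> w \<in> Rvec p k n \<Longrightarrow> f v = f w \<longleftrightarrow> cok_rel p k n u M v w"
    using assms unfolding cok_tensor_iso_def by blast
  have z0: "(0 :: nat \<Rightarrow> 'a) \<in> vecs n" for n by (rule V.subspace_0[OF sub_vecs])
  have f_add: "f (cst (v + w)) = f (cst v) + f (cst w)" if "v \<in> vecs n" "w \<in> vecs n" for v w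
    using add[OF cst_Rvec[OF that(1)] cst_Rvec[OF that(2)]] by (simp add: cst_def)
  have f_sc: "f (cst (pw (*) t v)) = smul t (f (cst v))" if "v \<in> vecs n" for t v
    using sc[OF cst_Rvec[OF that], of t] by (simp add: cst_def)
  have f_0: "f (cst 0) = 0" using f_add[OF z0 z0] by (simp only: add_0_right) simp
  define g where "g = (\<lambda>j. if j < n then f (cst (uvec j)) else 0)"
  have fF: "f (cst v) = F n g v" if v: "v \<in> vecs n" for v
  proof -
    have "f (cst (\<Sum>j\<in>J. pw (*) (v j) (uvec j))) = (\<Sum>j\<in>J. smul (v j) (g j))" if "finite J" "J \<subseteq> {..<n}" for J
      using that
    proof (induction J rule: finite_induct)
      case empty
      show ?case by (simp only: sum.empty f_0)
    next
      case (insert j J)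
      have u: "uvec j \<in> vecs n" using insert by (intro uvec_vecs) auto
      have "(\<Sum>j\<in>J. pw (*) (v j) (uvec j)) \<in> vecs n"
        using insert by (intro V.subspace_sum[OF sub_vecs] V.subspace_scale[OF sub_vecs] uvec_vecs) auto
      hence "f (cst (pw (*) (v j) (uvec j) + (\<Sum>j\<in>J. pw (*) (v j) (uvec j)))) =
          f (cst (pw (*) (v j) (uvec j))) + f (cst (\<Sum>j\<in>J. pw (*) (v j) (uvec j)))"
        by (rule f_add[OF V.subspace_scale[OF sub_vecs u]])
      moreover have "f (cst (uvec j)) = g j" using insert by (simp add: g_def)
      moreover have "f (cst (\<Sum>j\<in>J. pw (*) (v j) (uvec j))) = (\<Sum>j\<in>J. smul (v j) (g j))"
        using insert.IH insert.prems by blast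
      ultimately show ?case unfolding sum.insert[OF insert(1,2)] using f_sc[OF u, of "v j"] by (simp only:)
    qed
    from this[of "{..<n}"] show ?thesis unfolding F_def using vec_decomp[OF v, symmetric] by (simp only: finite_lessThan subset_refl)
  qed
  have ker: "v \<in> Ker n g \<longleftrightarrow> cok_rel p k n u M (cst v) (cst 0)" if v: "v \<in> vecs n" for v
    using rel[OF cst_Rvec[OF v] cst_Rvec[OF z0]] f_0 fF[OF v] v by (simp add: Ker_def)
  have colK: "col n M l \<in> Ker n g" if l: "l < ?c" for l
  proof -
    have ul: "uvec l \<in> vecs ?c" by (rule uvec_vecs[OF l])
    have "(\<Sum>l'<?c. M (j, l') * uvec l l') = M (j, l)" for j
    proof -
      have "(\<Sum>l'<?c. M (j, l') * uvec l l') = (\<Sum>l'<?c. if l' = l then M (j, l) else 0)"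
        by (intro sum.cong) (auto simp: uvec_def)
      thus ?thesis using l by simp
    qed
    hence "\<forall>j<n. null p k (\<lambda>i m. cst (col n M l) j i m - cst 0 j i m - (\<Sum>l'<?c. M (j, l') * cst (uvec l) l' i m))"
      by (simp add: null_def cst_def col_def ideal_zero[OF ideal_ideal_pow])
    hence "cok_rel p k n u M (cst (col n M l)) (cst 0)"
      unfolding cok_rel_def using cst_Rvec[OF ul] by blast
    thus ?thesis using ker[OF col_vecs] by blast
  qed
  have gen: "Ker n g \<subseteq> msum (V.span (col n M ` {..<?c})) (imul (pw (*)) (p i) (Ker n g))" if i: "i < k" for i
  proof
    fix v assume vK: "v \<in> Ker n g"
    hence v: "v \<in> vecs n" by (simp add: Ker_def)
    obtain x where x: "\<forall>j<n. null p k (\<lambda>i m. cst v j i m - cst 0 j i m - (\<Sum>l<?c. M (j, l) * x l i m))"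
      using ker[OF v] vK unfolding cok_rel_def by blast
    obtain \<xi> where \<xi>: "lifts ?c x \<xi>" by (rule lift_ex)
    \<comment> \<open>Precision E + 1 leaves an error in p_i K; precision E would only place it in
      K.\<close>
    have "v - 0 - Mx n ?c M (\<xi> (Suc E)) \<in> vecs_in (Q (Suc E)) n"
      using x cok_rel_lift[OF \<xi> lifts_cst[OF v] lifts_cst[OF z0], of M "Suc E"] by blast
    hence "v - Mx n ?c M (\<xi> (Suc E)) \<in> vecs_in (Q (Suc E)) n" by (simp only: diff_zero)
    from msumI[OF Mx_span[of n ?c M "\<xi> (Suc E)"] Q_vec_pKer[OF i this, of g]]
    show "v \<in> msum (V.span (col n M ` {..<?c})) (imul (pw (*)) (p i) (Ker n g))"
      by (simp only: add_diff_eq add_diff_cancel_left')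
  qed
  \<comment> \<open>Each increment of \<open>\<zeta>\<close> beyond level E lies in (Q E)(Q t) and
    is written over the generators \<open>B\<close> of Q E with coefficients in Q t. The coefficient
    series \<open>zb b\<close> therefore converge, and z is the sum of b times \<open>zb b\<close>
    in the cokernel.\<close>
  have small: "f z = 0" if z: "z \<in> Rvec p k n" and l: "lifts n z \<zeta>" and zE: "\<zeta> E = 0" for z \<zeta>
  proof -
    obtain B where B: "finite B" "Q E = ideal_gen B"
      using dedekind ideal_Q unfolding dedekind_domain_def noetherian_ring_def by blast
    have "\<exists>y. (\<forall>b\<in>B. y b \<in> Q t) \<and> \<zeta> (E + Suc t) j - \<zeta> (E + t) j = (\<Sum>b\<in>B. b * y b)" for t j
    proof -
      have "(\<zeta> (Suc (E + t)) - \<zeta> (E + t)) j \<in> Q (E + t)" using lifts_step[OF l z] unfolding vecs_in_def by blast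
      hence "\<zeta> (E + Suc t) j - \<zeta> (E + t) j \<in> ideal_prod (ideal_gen B) (Q t)"
        using Q_add[of E t] unfolding B(2)[symmetric] by auto
      thus ?thesis by (rule ideal_prod_gen_sum[OF B(1) ideal_Q])
    qed
    then obtain Y where Y: "\<And>t j. (\<forall>b\<in>B. Y t j b \<in> Q t) \<and> \<zeta> (E + Suc t) j - \<zeta> (E + t) j = (\<Sum>b\<in>B. b * Y t j b)"
      by metis
    define zb where "zb b = (\<lambda>j (i::nat) m. if j < n then \<Sum>t<m. Y t j b else 0)" for b
    have zbR: "zb b \<in> Rvec p k n" if "b \<in> B" for b
    proof -
      have "Y m j b \<in> ideal_pow (p i) m" if "i < k" for m j i using Y[of m j] \<open>b \<in> B\<close> Q_subset[OF that, of m] by blast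
      thus ?thesis by (simp add: zb_def Rvec_def compat_def)
    qed
    have sumz: "(\<Sum>b\<in>B. b * (\<Sum>t<m. Y t j b)) = \<zeta> (E + m) j" for m j
    proof (induction m)
      case 0 thus ?case by (simp add: zE)
    next
      case (Suc m)
      have "(\<Sum>b\<in>B. b * (\<Sum>t<Suc m. Y t j b)) = (\<Sum>b\<in>B. b * (\<Sum>t<m. Y t j b)) + (\<Sum>b\<in>B. b * Y m j b)"
        by (simp add: distrib_left sum.distrib)
      also have "\<dots> = \<zeta> (E + m) j + (\<zeta> (E + Suc m) j - \<zeta> (E + m) j)" unfolding Suc using Y[of m j] by simp
      finally show ?case by simp
    qed
    have fs: "(\<lambda>j i m. \<Sum>b\<in>B'. b * zb b j i m) \<in> Rvec p k n \<and> f (\<lambda>j i m. \<Sum>b\<in>B'. b * zb b j i m) = (\<Sum>b\<in>B'. smul b (f (zb b)))"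
      if "finite B'" "B' \<subseteq> B" for B'
      using that
    proof (induction B' rule: finite_induct)
      case empty
      have "cst 0 = (\<lambda>j i m. (0::'a))" by (simp add: cst_def fun_eq_iff)
      thus ?case using f_0 cst_Rvec[OF z0] by simp
    next
      case (insert b B')
      have zR: "zb b \<in> Rvec p k n" using insert zbR by blast
      have bR: "(\<lambda>j i m. b * zb b j i m) \<in> Rvec p k n"
      proof -
        have "b * zb b j i (Suc m) - b * zb b j i m \<in> ideal_pow (p i) m" if "j < n" "i < k" for j i m
          unfolding right_diff_distrib[symmetric] using zR that
          by (intro ideal_mult_left[OF ideal_ideal_pow]) (auto simp: Rvec_def compat_def)
        thus ?thesis using zR by (simp add: Rvec_def compat_def)
      qed
      have IH: "(\<lambda>j i m. \<Sum>b\<in>B'. b * zb b j i m) \<in> Rvec p k n"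
        "f (\<lambda>j i m. \<Sum>b\<in>B'. b * zb b j i m) = (\<Sum>b\<in>B'. smul b (f (zb b)))" using insert by auto
      have "(\<lambda>j i m. b * zb b j i m + (\<Sum>b\<in>B'. b * zb b j i m)) \<in> Rvec p k n"
      proof -
        have "b * zb b j i (Suc m) + (\<Sum>b\<in>B'. b * zb b j i (Suc m)) - (b * zb b j i m + (\<Sum>b\<in>B'. b * zb b j i m)) \<in> ideal_pow (p i) m"
          if "j < n" "i < k" for j i m
        proof -
          have "(b * zb b j i (Suc m) - b * zb b j i m) + ((\<Sum>b\<in>B'. b * zb b j i (Suc m)) - (\<Sum>b\<in>B'. b * zb b j i m)) \<in> ideal_pow (p i) m"
          proof (rule ideal_add[OF ideal_ideal_pow])
            show "b * zb b j i (Suc m) - b * zb b j i m \<in> ideal_pow (p i) m" using bR that by (auto simp: Rvec_def compat_def)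
            show "(\<Sum>b\<in>B'. b * zb b j i (Suc m)) - (\<Sum>b\<in>B'. b * zb b j i m) \<in> ideal_pow (p i) m"
              using IH(1) that by (auto simp: Rvec_def compat_def)
          qed
          thus ?thesis by (simp add: algebra_simps)
        qed
        thus ?thesis using bR IH(1) by (simp add: Rvec_def compat_def)
      qed
      moreover have "f (\<lambda>j i m. b * zb b j i m + (\<Sum>b\<in>B'. b * zb b j i m)) = smul b (f (zb b)) + (\<Sum>b\<in>B'. smul b (f (zb b)))"
        using add[OF bR IH(1)] sc[OF zR, of b] IH(2) by simp
      ultimately show ?case unfolding sum.insert[OF insert(1,2)] by blast
    qed
    let ?z = "\<lambda>j i m. \<Sum>b\<in>B. b * zb b j i m"
    have "cok_rel p k n u M z ?z"
      unfolding cok_rel_def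
    proof (intro bexI[of _ "cst 0"] allI impI)
      show "cst 0 \<in> Rvec p k ?c" by (rule cst_Rvec[OF z0])
      fix j assume j: "j < n"
      have "z j i m - (\<Sum>b\<in>B. b * zb b j i m) \<in> ideal_pow (p i) m" if i: "i < k" for i m
      proof -
        have 1: "z j i m - \<zeta> m j \<in> ideal_pow (p i) m"
          using l i j by (auto simp: lifts_def intro: ideal_pow_diff_commute)
        have "(\<zeta> (m + E) - \<zeta> m) j \<in> Q m" using lifts_mono[OF l z, of m E] unfolding vecs_in_def by blast
        hence "\<zeta> (m + E) j - \<zeta> m j \<in> ideal_pow (p i) m" using subsetD[OF Q_subset[OF i]] by simp
        hence 2: "\<zeta> m j - \<zeta> (E + m) j \<in> ideal_pow (p i) m" by (simp only: add.commute) (rule ideal_pow_diff_commute)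
        have "(\<Sum>b\<in>B. b * zb b j i m) = \<zeta> (E + m) j" using sumz[of j m] j by (simp add: zb_def)
        thus ?thesis using ideal_pow_diff_trans[OF 1 2] by simp
      qed
      thus "null p k (\<lambda>i m. z j i m - (\<Sum>b\<in>B. b * zb b j i m) - (\<Sum>l<?c. M (j, l) * cst 0 l i m))"
        by (simp add: null_def cst_def)
    qed
    hence "f z = f ?z" using rel[OF z] fs[OF B(1) subset_refl] by blast
    also have "\<dots> = (\<Sum>b\<in>B. smul b (f (zb b)))" using fs[OF B(1) subset_refl] by blast
    also have "\<dots> = 0" using B(2) ideal_gen_subset[of B] by (intro sum.neutral) (auto intro!: QE)
    finally show ?thesis .
  qed
  have "onto n g"
    unfolding onto_def
  proof (intro subset_antisym subset_UNIV subsetI)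
    fix x :: 'n
    have "x \<in> f ` Rvec p k n" using surj by simp
    then obtain v where v: "v \<in> Rvec p k n" "x = f v" by blast
    obtain \<rho> where \<rho>: "lifts n v \<rho>" by (rule lift_ex)
    have \<rho>E: "\<rho> E \<in> vecs n" using \<rho> by (simp add: lifts_def)
    \<comment> \<open>The difference of v and its approximation at level E; the factor -1 fits the
      scaling rule for lifts.\<close>
    define z where "z = (\<lambda>j i m. v j i m + (- 1) * cst (\<rho> E) j i m)"
    have zR: "z \<in> Rvec p k n"
      using v(1) cst_Rvec[OF \<rho>E] by (simp add: z_def Rvec_def compat_def cst_def)
    have "lifts n z (\<lambda>m. \<rho> m + pw (*) (- 1) (\<rho> E))"
      unfolding z_def by (rule lifts_add[OF \<rho> lifts_scale[OF lifts_cst[OF \<rho>E]]])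
    moreover have "\<rho> E + pw (*) (- 1) (\<rho> E) = 0" by (rule ext) simp
    ultimately have fz: "f z = 0" using small[OF zR] by blast
    have "(\<lambda>j i m. z j i m + cst (\<rho> E) j i m) = v" by (simp add: z_def fun_eq_iff)
    hence "f v = f z + f (cst (\<rho> E))" using add[OF zR cst_Rvec[OF \<rho>E]] by simp
    hence "x = F n g (\<rho> E)" using fz v(2) fF[OF \<rho>E] by simp
    thus "x \<in> F n g ` vecs n" using \<rho>E by blast
  qed
  moreover have "g \<in> vecs n" by (simp add: g_def vecs_def)
  ultimately have "presents n ?c M g" unfolding presents_def using colK gen by blast
  thus ?thesis by blast
qed

theorem cok_tensor_iso_iff: "cok_tensor_iso p k n u smul M \<longleftrightarrow> (\<exists>g. presents n (n + u) M g)"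
  using presents_imp_cok_iso cok_iso_imp_presents by blast

text \<open>Aut N acts on the presentations by composition: freely because F_g0 is onto, and
  transitively because two presentations have the same kernel.\<close>

lemma card_presents:
  assumes g0: "presents n c M g0"
  shows "card {g. presents n c M g} = card (module_auts smul)"
proof -
  have hom: "\<alpha> (x + y) = \<alpha> x + \<alpha> y" "\<alpha> (smul t x) = smul t (\<alpha> x)" "\<alpha> 0 = 0" if "\<alpha> \<in> module_auts smul" for \<alpha> x y t
  proof -
    interpret module_hom smul smul \<alpha> using that by (simp add: module_auts_def)
    show "\<alpha> (x + y) = \<alpha> x + \<alpha> y" "\<alpha> (smul t x) = smul t (\<alpha> x)" "\<alpha> 0 = 0" by (simp_all add: add scale zero)
  qed
  have F\<alpha>: "F n (\<alpha> \<circ> g) v = \<alpha> (F n g v)" if a: "\<alpha> \<in> module_auts smul" for \<alpha> g v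
  proof -
    have "\<alpha> (sum h A) = (\<Sum>a\<in>A. \<alpha> (h a))" for h and A :: "nat set"
      by (induction A rule: infinite_finite_induct) (simp_all add: hom[OF a])
    thus ?thesis by (simp add: F_def hom[OF a])
  qed
  have bij: "bij \<alpha>" if "\<alpha> \<in> module_auts smul" for \<alpha> using that by (simp add: module_auts_def)
  have pres: "presents n c M (\<alpha> \<circ> g)" if a: "\<alpha> \<in> module_auts smul" and g: "presents n c M g" for \<alpha> g
  proof -
    have "\<alpha> x = 0 \<longleftrightarrow> x = 0" for x using bij[OF a] hom(3)[OF a] by (metis bij_pointE)
    hence K: "Ker n (\<alpha> \<circ> g) = Ker n g" by (simp add: Ker_def F\<alpha>[OF a])
    have "F n (\<alpha> \<circ> g) ` vecs n = \<alpha> ` (F n g ` vecs n)" by (simp add: F\<alpha>[OF a] image_image)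
    hence "onto n (\<alpha> \<circ> g)" using g bij[OF a] by (simp add: presents_def onto_def bij_is_surj)
    moreover have "\<alpha> \<circ> g \<in> vecs n" using g hom(3)[OF a] by (simp add: presents_def vecs_def)
    ultimately show ?thesis using g by (simp add: presents_def K)
  qed
  have "bij_betw (\<lambda>\<alpha>. \<alpha> \<circ> g0) (module_auts smul) {g. presents n c M g}"
    unfolding bij_betw_def
  proof
    show "inj_on (\<lambda>\<alpha>. \<alpha> \<circ> g0) (module_auts smul)"
    proof (rule inj_onI)
      fix \<alpha> \<beta> assume ab: "\<alpha> \<in> module_auts smul" "\<beta> \<in> module_auts smul" "\<alpha> \<circ> g0 = \<beta> \<circ> g0"
      show "\<alpha> = \<beta>"
      proof
        fix x
        have "x \<in> F n g0 ` vecs n" using g0 by (simp add: presents_def onto_def)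
        then obtain v where "x = F n g0 v" by blast
        thus "\<alpha> x = \<beta> x" using F\<alpha>[OF ab(1), of g0 v] F\<alpha>[OF ab(2), of g0 v] ab(3) by simp
      qed
    qed
    show "(\<lambda>\<alpha>. \<alpha> \<circ> g0) ` module_auts smul = {g. presents n c M g}"
    proof (intro subset_antisym image_subsetI)
      show "\<alpha> \<circ> g0 \<in> {g. presents n c M g}" if "\<alpha> \<in> module_auts smul" for \<alpha> using pres[OF that g0] by simp
      show "{g. presents n c M g} \<subseteq> (\<lambda>\<alpha>. \<alpha> \<circ> g0) ` module_auts smul"
      proof
        fix g assume "g \<in> {g. presents n c M g}"
        hence g: "presents n c M g" by simp
        have K: "Ker n g = Ker n g0" using presents_Ker[OF g] presents_Ker[OF g0] by simp
        have "\<exists>v. v \<in> vecs n \<and> F n g0 v = x" for x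
        proof -
          have "x \<in> F n g0 ` vecs n" using g0 by (simp add: presents_def onto_def)
          thus ?thesis by blast
        qed
        then obtain s where s: "\<And>x. s x \<in> vecs n" "\<And>x. F n g0 (s x) = x" by metis
        define \<alpha> where "\<alpha> x = F n g (s x)" for x
        have eqK: "F n g v = F n g w \<longleftrightarrow> F n g0 v = F n g0 w" if "v \<in> vecs n" "w \<in> vecs n" for v w
        proof -
          have "v - w \<in> Ker n g \<longleftrightarrow> v - w \<in> Ker n g0" by (simp only: K)
          thus ?thesis using V.subspace_diff[OF sub_vecs that] by (simp add: Ker_def F_diff)
        qed
        have \<alpha>F: "\<alpha> (F n g0 v) = F n g v" if "v \<in> vecs n" for v
          unfolding \<alpha>_def using eqK[OF s(1)[of "F n g0 v"] that] s(2) by blast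
        have "inj \<alpha>"
        proof (rule injI)
          fix x y assume "\<alpha> x = \<alpha> y"
          thus "x = y" unfolding \<alpha>_def using eqK[OF s(1) s(1)] s(2) by simp
        qed
        moreover have "surj \<alpha>"
        proof (rule surjI)
          fix x
          have "x \<in> F n g ` vecs n" using g by (simp add: presents_def onto_def)
          hence "\<exists>v. v \<in> vecs n \<and> F n g v = x" by blast
          hence v: "(SOME v. v \<in> vecs n \<and> F n g v = x) \<in> vecs n \<and> F n g (SOME v. v \<in> vecs n \<and> F n g v = x) = x"
            by (rule someI_ex)
          show "\<alpha> (F n g0 (SOME v. v \<in> vecs n \<and> F n g v = x)) = x" using \<alpha>F v by simp
        qed
        moreover have "\<alpha> (x + y) = \<alpha> x + \<alpha> y" for x y
          using \<alpha>F[OF V.subspace_add[OF sub_vecs s(1)[of x] s(1)[of y]]] by (simp add: F_add s(2)) (simp add: \<alpha>_def)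
        moreover have "\<alpha> (smul t x) = smul t (\<alpha> x)" for t x
          using \<alpha>F[OF V.subspace_scale[OF sub_vecs s(1)[of x]], of t] by (simp add: F_scale s(2)) (simp add: \<alpha>_def)
        ultimately have \<alpha>: "\<alpha> \<in> module_auts smul"
          by (simp add: module_auts_def bij_def module_hom_iff module_N)
        have "g = \<alpha> \<circ> g0"
        proof
          fix j show "g j = (\<alpha> \<circ> g0) j"
          proof (cases "j < n")
            case True
            thus ?thesis using \<alpha>F[OF uvec_vecs[OF True]] by (simp add: F_uvec)
          next
            case False
            thus ?thesis using g g0 hom(3)[OF \<alpha>] by (simp add: presents_def vecs_def)
          qed
        qed
        thus "g \<in> (\<lambda>\<alpha>. \<alpha> \<circ> g0) ` module_auts smul" using \<alpha> by blast
      qed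
    qed
  qed
  thus ?thesis by (simp add: bij_betw_same_card)
qed

end

section \<open>The limiting probability\<close>

text \<open>Fubini with an exceptional set: the fibres over \<open>Bad\<close> are bounded by
  1.\<close>

lemma prob_pair_le:
  assumes hi: "0 \<le> hi" "\<And>x. x \<notin> Bad \<Longrightarrow> measure_pmf.prob N {y. (x, y) \<in> S} \<le> hi"
  shows "measure_pmf.prob (pair_pmf M N) S \<le> hi + measure_pmf.prob M Bad"
proof -
  have "emeasure (pair_pmf M N) S = (\<integral>\<^sup>+z. indicator S z \<partial>pair_pmf M N)" by simp
  also have "\<dots> = (\<integral>\<^sup>+x. \<integral>\<^sup>+y. indicator S (x, y) \<partial>N \<partial>M)" by (rule nn_integral_pair_pmf')
  also have "\<dots> = (\<integral>\<^sup>+x. emeasure N {y. (x, y) \<in> S} \<partial>M)"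
  proof (intro nn_integral_cong)
    fix x
    have "(\<integral>\<^sup>+y. indicator S (x, y) \<partial>N) = (\<integral>\<^sup>+y. indicator {y. (x, y) \<in> S} y \<partial>N)"
      by (intro nn_integral_cong) (simp add: indicator_def)
    thus "(\<integral>\<^sup>+y. indicator S (x, y) \<partial>N) = emeasure N {y. (x, y) \<in> S}" by simp
  qed
  also have "\<dots> \<le> (\<integral>\<^sup>+x. ennreal hi + indicator Bad x \<partial>M)"
  proof (intro nn_integral_mono)
    fix x
    show "emeasure N {y. (x, y) \<in> S} \<le> ennreal hi + indicator Bad x"
    proof (cases "x \<in> Bad")
      case True
      have "emeasure N {y. (x, y) \<in> S} \<le> 1" by (simp add: measure_pmf.emeasure_eq_measure)
      also have "\<dots> \<le> ennreal hi + indicator Bad x" using True by simp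
      finally show ?thesis .
    next
      case False
      thus ?thesis using hi by (simp add: measure_pmf.emeasure_eq_measure ennreal_leI)
    qed
  qed
  also have "\<dots> = ennreal hi + emeasure M Bad"
    by (subst nn_integral_add) (auto simp: measure_pmf.emeasure_space_1)
  also have "\<dots> = ennreal (hi + measure_pmf.prob M Bad)"
    using hi(1) by (simp add: measure_pmf.emeasure_eq_measure ennreal_plus)
  finally have "ennreal (measure_pmf.prob (pair_pmf M N) S) \<le> ennreal (hi + measure_pmf.prob M Bad)"
    by (simp only: measure_pmf.emeasure_eq_measure)
  thus ?thesis using hi(1) by (subst (asm) ennreal_le_iff) auto
qed

lemma prob_pair_ge:
  assumes lo: "lo \<le> 1" "\<And>x. x \<notin> Bad \<Longrightarrow> lo \<le> measure_pmf.prob N {y. (x, y) \<in> S}"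
  shows "lo - measure_pmf.prob M Bad \<le> measure_pmf.prob (pair_pmf M N) S"
proof -
  have "measure_pmf.prob (pair_pmf M N) (- S) \<le> (1 - lo) + measure_pmf.prob M Bad"
  proof (rule prob_pair_le)
    fix x assume "x \<notin> Bad"
    hence "lo \<le> measure_pmf.prob N {y. (x, y) \<in> S}" by (rule lo(2))
    moreover have "{y. (x, y) \<in> - S} = - {y. (x, y) \<in> S}" by auto
    moreover have "measure_pmf.prob N (- {y. (x, y) \<in> S}) = 1 - measure_pmf.prob N {y. (x, y) \<in> S}"
      using measure_pmf.prob_compl[of "{y. (x, y) \<in> S}" N] by (simp add: Compl_eq_Diff_UNIV)
    ultimately show "measure_pmf.prob N {y. (x, y) \<in> - S} \<le> 1 - lo" by simp
  qed (use lo in simp)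
  moreover have "measure_pmf.prob (pair_pmf M N) (- S) = 1 - measure_pmf.prob (pair_pmf M N) S"
    using measure_pmf.prob_compl[of S "pair_pmf M N"] by (simp add: Compl_eq_Diff_UNIV)
  ultimately show ?thesis by linarith
qed

text \<open>Reversing the factors turns the product into an initial segment of an infinite product
  that does not depend on s.\<close>

lemma gprob_reindex: "q > 0 \<Longrightarrow> gprob q (s + u) s = (\<Prod>j<s. 1 - 1 / real q ^ (u + j + 1))"
proof -
  assume q: "q > 0"
  have "gprob q (s + u) s = (\<Prod>j<s. 1 - real q ^ (s - Suc j) / real q ^ (s + u))"
    unfolding gprob_def by (rule prod.nat_diff_reindex[symmetric])
  also have "\<dots> = (\<Prod>j<s. 1 - 1 / real q ^ (u + j + 1))"
  proof (rule prod.cong)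
    fix j assume "j \<in> {..<s}"
    hence "s + u = (s - Suc j) + (u + j + 1)" by auto
    hence "real q ^ (s + u) = real q ^ (s - Suc j) * real q ^ (u + j + 1)" by (metis power_add)
    thus "1 - real q ^ (s - Suc j) / real q ^ (s + u) = 1 - 1 / real q ^ (u + j + 1)" using q by simp
  qed simp
  finally show ?thesis .
qed

section \<open>The conditional probability given the first columns\<close>

context finite_module
begin

lemma span_uvec: "vecs n \<subseteq> V.span (uvec ` {..<n})"
proof
  fix v :: "nat \<Rightarrow> 'a" assume v: "v \<in> vecs n"
  have "(\<Sum>j<n. pw (*) (v j) (uvec j)) \<in> V.span (uvec ` {..<n})"
    by (intro V.span_sum V.span_scale V.span_base) auto
  thus "v \<in> V.span (uvec ` {..<n})" using vec_decomp[OF v] by simp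
qed

text \<open>By Nakayama a proper submodule over Q (E + 1) T^n stays proper after adding p_i T^n for
  some i, and then a nonzero linear form over the field T/p_i vanishes on it.\<close>

lemma proper_subspace_functional:
  assumes B: "V.subspace B" "B \<subseteq> vecs n" "B \<noteq> vecs n" and QB: "vecs_in (Q (Suc E)) n \<subseteq> B"
  obtains i f where "i < k" "wt i n f > 0" "\<And>v. v \<in> B \<Longrightarrow> (\<Sum>j<n. v j * f j) \<in> p i"
proof -
  have "\<exists>i<k. \<not> vecs n \<subseteq> msum B (imul (pw (*)) (p i) (vecs n))"
  proof (rule ccontr)
    assume "\<not> (\<exists>i<k. \<not> vecs n \<subseteq> msum B (imul (pw (*)) (p i) (vecs n)))"
    hence "vecs n \<subseteq> msum B (imul (pw (*)) (prod_pow_ideal p (\<lambda>_. Suc E) k) (vecs n))"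
      by (intro V.nakayama_prod_pow[OF B(1)]) blast
    moreover have "imul (pw (*)) (prod_pow_ideal p (\<lambda>_. Suc E) k) (vecs n) \<subseteq> vecs_in (Q (Suc E)) n"
      using prod_pow_const_subset_Q[of "Suc E"] ideal_mult_right[OF ideal_Q] V.subspace_scale[OF sub_vecs]
      by (intro V.imul_least sub_vecs_in ideal_Q) (auto simp: vecs_in_def)
    ultimately have "vecs n \<subseteq> B"
      using msum_least[OF V.subspace_subgrp[OF B(1)] subset_refl, of "imul (pw (*)) (prod_pow_ideal p (\<lambda>_. Suc E) k) (vecs n)"] QB
      by blast
    thus False using B by blast
  qed
  then obtain i where i: "i < k" "\<not> vecs n \<subseteq> msum B (imul (pw (*)) (p i) (vecs n))" by blast
  define B1 where "B1 = msum B (imul (pw (*)) (p i) (vecs n))"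
  have sB1: "V.subspace B1" unfolding B1_def by (intro V.subspace_msum B V.subspace_imul)
  have BB1: "B \<subseteq> B1" unfolding B1_def by (rule msum_superset1[OF V.subspace_0[OF V.subspace_imul]])
  have B1v: "B1 \<subseteq> vecs n"
    unfolding B1_def by (intro msum_least V.subspace_subgrp sub_vecs B V.imul_subset)
  have pB1: "pw (*) a v \<in> B1" if "a \<in> p i" "v \<in> vecs n" for a v
    unfolding B1_def by (rule subsetD[OF msum_superset2[OF V.subspace_0[OF B(1)]] V.imulI[OF that]])
  \<comment> \<open>Sets of basis vectors that do not yet generate T^n together with
    \<open>B1\<close>. For a maximal such set the remaining quotient is a line over T/p_i spanned by
    the basis vector j0, and \<open>f j\<close> will be the coordinate of the j-th basis vector on
    it.\<close>
  define A where "A = {S. S \<subseteq> {..<n} \<and> msum (V.span (uvec ` S)) B1 \<noteq> vecs n}"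
  have finA: "finite A" unfolding A_def by (rule finite_subset[of _ "Pow {..<n}"]) auto
  have "msum (V.span (uvec ` {})) B1 = B1"
    unfolding image_empty V.span_empty using V.subspace_0[OF sB1] by (intro V.msum_absorb[OF sB1]) auto
  hence A0: "{} \<in> A" using i(2) unfolding A_def B1_def[symmetric] by auto
  obtain S where S: "S \<in> A" "\<And>S'. S' \<in> A \<Longrightarrow> S \<subseteq> S' \<Longrightarrow> S = S'"
    using finite_has_maximal[OF finA] A0 by blast
  have S1: "S \<subseteq> {..<n}" "msum (V.span (uvec ` S)) B1 \<noteq> vecs n" using S(1) by (auto simp: A_def)
  define B2 where "B2 = msum (V.span (uvec ` S)) B1"
  have sB2: "V.subspace B2" unfolding B2_def by (intro V.subspace_msum V.subspace_span sB1)
  have B12: "B1 \<subseteq> B2" unfolding B2_def by (rule msum_superset2[OF V.span_zero])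
  have span_v: "V.span (uvec ` S') \<subseteq> vecs n" if "S' \<subseteq> {..<n}" for S'
    using that by (intro V.span_minimal sub_vecs) (auto intro: uvec_vecs)
  have B2v: "B2 \<subseteq> vecs n" "B2 \<noteq> vecs n"
    unfolding B2_def by (intro msum_least V.subspace_subgrp sub_vecs span_v S1(1) B1v) (rule S1(2))
  have "S \<noteq> {..<n}"
  proof
    assume "S = {..<n}"
    hence "vecs n \<subseteq> B2"
      unfolding B2_def using subset_trans[OF span_uvec msum_superset1[OF V.subspace_0[OF sB1]], of n] by simp
    thus False using B2v by blast
  qed
  then obtain j0 where j0: "j0 < n" "j0 \<notin> S" using S1(1) by blast
  have full: "msum (V.span (uvec ` insert j0 S)) B1 = vecs n"
  proof (rule ccontr)
    assume "msum (V.span (uvec ` insert j0 S)) B1 \<noteq> vecs n"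
    hence "insert j0 S \<in> A" unfolding A_def using S1(1) j0 by blast
    thus False using S(2)[of "insert j0 S"] j0 by blast
  qed
  have ex: "\<exists>t. v - pw (*) t (uvec j0) \<in> B2" if v: "v \<in> vecs n" for v
  proof -
    have "v \<in> msum (V.span (insert (uvec j0) (uvec ` S))) B1" using v full by simp
    then obtain a b where ab: "a \<in> V.span (insert (uvec j0) (uvec ` S))" "b \<in> B1" "v = a + b" by (rule msumE)
    then obtain t where t: "a - pw (*) t (uvec j0) \<in> V.span (uvec ` S)" using V.span_breakdown_eq by blast
    have "v - pw (*) t (uvec j0) = (a - pw (*) t (uvec j0)) + b" using ab(3) by simp
    thus ?thesis unfolding B2_def using msumI[OF t ab(2)] by (metis (no_types))
  qed
  have j0B: "uvec j0 \<notin> B2"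
  proof
    assume u: "uvec j0 \<in> B2"
    have "v \<in> B2" if v: "v \<in> vecs n" for v
    proof -
      obtain t where t: "v - pw (*) t (uvec j0) \<in> B2" using ex[OF v] by blast
      have "(v - pw (*) t (uvec j0)) + pw (*) t (uvec j0) \<in> B2"
        by (rule V.subspace_add[OF sB2 t V.subspace_scale[OF sB2 u]])
      thus ?thesis by (simp only: diff_add_cancel)
    qed
    thus False using B2v by blast
  qed
  have coef: "pw (*) t (uvec j0) \<in> B2 \<Longrightarrow> t \<in> p i" for t
  proof (rule ccontr)
    assume t: "pw (*) t (uvec j0) \<in> B2" "t \<notin> p i"
    obtain a e where ae: "e \<in> p i" "a * t + e = 1" using maximal_comax[OF maximal[OF i(1)] t(2)] by blast
    have "pw (*) a (pw (*) t (uvec j0)) + pw (*) e (uvec j0) \<in> B2"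
      using V.subspace_scale[OF sB2 t(1)] pB1[OF ae(1) uvec_vecs[OF j0(1)]] B12 by (intro V.subspace_add[OF sB2]) auto
    moreover have "pw (*) a (pw (*) t (uvec j0)) + pw (*) e (uvec j0) = pw (*) (a * t + e) (uvec j0)"
      by (simp only: V.scale_left_distrib V.scale_scale)
    ultimately show False using j0B ae(2) by (simp only: V.scale_one)
  qed
  have "\<forall>j. \<exists>t. j < n \<longrightarrow> uvec j - pw (*) t (uvec j0) \<in> B2" using ex uvec_vecs by blast
  then obtain f where f: "\<And>j. j < n \<Longrightarrow> uvec j - pw (*) (f j) (uvec j0) \<in> B2" by metis
  have fn: "(\<Sum>j<n. v j * f j) \<in> p i" if v: "v \<in> B" for v
  proof (rule coef)
    have vv: "v \<in> vecs n" using v B by blast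
    have 1: "(\<Sum>j<n. pw (*) (v j) (uvec j - pw (*) (f j) (uvec j0))) \<in> B2"
      using f by (intro V.subspace_sum[OF sB2] V.subspace_scale[OF sB2]) auto
    have "(\<Sum>j<n. pw (*) (v j) (uvec j - pw (*) (f j) (uvec j0))) =
        (\<Sum>j<n. pw (*) (v j) (uvec j)) - (\<Sum>j<n. pw (*) (v j * f j) (uvec j0))"
      by (simp only: V.scale_right_diff_distrib sum_subtractf V.scale_scale)
    hence "(\<Sum>j<n. pw (*) (v j) (uvec j - pw (*) (f j) (uvec j0))) = v - pw (*) (\<Sum>j<n. v j * f j) (uvec j0)"
      unfolding vec_decomp[OF vv, symmetric] V.scale_sum_left[symmetric] .
    hence 2: "v - pw (*) (\<Sum>j<n. v j * f j) (uvec j0) \<in> B2" using 1 by (simp only:)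
    have "v \<in> B2" using v BB1 B12 by blast
    from V.subspace_diff[OF sB2 this 2] show "pw (*) (\<Sum>j<n. v j * f j) (uvec j0) \<in> B2"
      by (simp only: diff_diff_eq2 add_diff_cancel_left')
  qed
  have "f j0 \<notin> p i"
  proof
    assume a: "f j0 \<in> p i"
    have "pw (*) (f j0) (uvec j0) \<in> B2" using pB1[OF a uvec_vecs[OF j0(1)]] B12 by blast
    from V.subspace_add[OF sB2 f[OF j0(1)] this] have "uvec j0 \<in> B2" by (simp only: diff_add_cancel)
    thus False using j0B by blast
  qed
  hence "wt i n f > 0" unfolding wt_def using j0(1) by (auto simp: card_gt_0_iff)
  thus thesis using that[OF i(1)] fn by blast
qed

lemma lc_col:
  fixes M :: "nat \<times> nat \<Rightarrow> 'a"
  shows "(\<Sum>x\<in>{..<n} \<times> {l}. pw (*) (M x) (uvec (fst x))) = col n M l"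
proof -
  have "inj_on (\<lambda>j. (j, l)) {..<n}" by (auto simp: inj_on_def)
  moreover have "{..<n} \<times> {l} = (\<lambda>j. (j, l)) ` {..<n}" by auto
  ultimately have "(\<Sum>x\<in>{..<n} \<times> {l}. pw (*) (M x) (uvec (fst x))) = (\<Sum>j<n. pw (*) (M (j, l)) (uvec j))"
    by (simp only: sum.reindex o_def fst_conv)
  also have "\<dots> = (\<Sum>j<n. pw (*) (col n M l j) (uvec j))" by (intro sum.cong) (auto simp: col_def)
  also have "\<dots> = col n M l" by (rule vec_decomp[OF col_vecs, symmetric])
  finally show ?thesis .
qed

lemma vecs_in_Ks: "vecs_in (Q (Suc E)) n \<subseteq> Ks n g m w"
proof
  fix v assume v: "v \<in> vecs_in (Q (Suc E)) n"
  hence "v \<in> vecs_in (Q E) n" using Q_antimono[of E "Suc E"] by (auto simp: vecs_in_def)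
  hence "v \<in> Ker n g" by (rule subsetD[OF vecs_in_QE_Ker])
  moreover have "v \<in> Lsub i n g m w" if "i < k" for i
    by (rule subsetD[OF pKer_Lsub Q_vec_pKer[OF that v]])
  ultimately show "v \<in> Ks n g m w" by (simp add: Ks_def)
qed

text \<open>The index of \<open>Ks\<close> in T^n when n - s columns are known. It does not depend
  on n.\<close>

definition \<gamma> :: "nat \<Rightarrow> nat" where "\<gamma> s = CARD('n) * (\<Prod>i<k. q i ^ s)"

text \<open>The probability that s + u uniform vectors generate, at every prime, a quotient of
  dimension s over T/p_i.\<close>

definition G :: "nat \<Rightarrow> nat \<Rightarrow> real" where "G s u = (\<Prod>i<k. gprob (q i) (s + u) s)"

context
  fixes n s u h :: nat and M1 :: "nat \<times> nat \<Rightarrow> 'a" and D :: "nat \<times> nat \<Rightarrow> 'a pmf"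
  assumes s: "s \<le> n" and good: "\<not> (\<exists>i<k. bad s n h M1 i)"
    and D: "\<And>j l. j < n \<Longrightarrow> l < n + u \<Longrightarrow> bal (D (j, l))"
begin

lemma indep_cols: "i < k \<Longrightarrow> indep i (n - s) (col n M1)"
  unfolding indep_def
proof (intro allI impI)
  fix c l assume i: "i < k" and c: "\<forall>j. (\<Sum>l<n - s. c l * col n M1 l j) \<in> p i" and l: "l < n - s"
  have "relation i (\<lambda>j l. (j, l)) n (n - s) M1 c"
    unfolding relation_def
  proof (intro allI impI)
    fix a assume "a < n"
    thus "(\<Sum>b<n - s. M1 (a, b) * c b) \<in> p i" using c[rule_format, of a] by (simp add: col_def mult.commute)
  qed
  hence "bad s n h M1 i" if "0 < wt i (n - s) c"
    unfolding bad_def using that by (intro disjI1 exI[of _ c] conjI)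
  hence "\<not> 0 < wt i (n - s) c" using good i by blast
  thus "c l \<in> p i" using l by (auto simp: wt_def card_gt_0_iff)
qed

text \<open>On a proper submodule over \<open>Ks\<close> a nonzero form modulo some p_i vanishes. It
  kills the known columns, which lie in \<open>Ks\<close>, so outside the exceptional event it has
  at least h nonzero coefficients, and each of them exhibits a basis vector outside the
  submodule.\<close>

lemma col_near_uniform:
  assumes g: "onto n g" and w: "\<And>l. l < n - s \<Longrightarrow> col n M1 l \<in> Ker n g"
    and R: "finite R" "transv (vecs n) (Ks n g (n - s) (col n M1)) R" and t: "card R * t \<le> h"
    and l: "l < n + u" and a: "a \<in> vecs n"
  shows "\<bar>measure_pmf.prob (Pi_pmf ({..<n} \<times> {l}) 0 D) {M. col n M l - a \<in> Ks n g (n - s) (col n M1)} - 1 / card R\<bar>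
     \<le> tau (card R) ^ t"
proof -
  let ?L = "Ks n g (n - s) (col n M1)" and ?J = "{..<n} \<times> {l}"
  have LV: "?L \<subseteq> vecs n" using Ker_vecs by (auto simp: Ks_def)
  interpret mx: mixing "pw (*)" "vecs n" ?L R D "\<lambda>x. uvec (fst x)" ?J \<epsilon>0
  proof (rule mixingI[OF V.module_axioms sub_vecs sub_Ks LV R])
    show "pw (*) x v \<in> ?L" if "x \<in> Q (Suc E)" "v \<in> vecs n" for x v
    proof -
      have "pw (*) x v \<in> vecs_in (Q (Suc E)) n"
        using that V.subspace_scale[OF sub_vecs that(2)] ideal_mult_right[OF ideal_Q] by (simp add: vecs_in_def)
      thus ?thesis using vecs_in_Ks by blast
    qed
    show "finite ?J" by simp
    show "uvec (fst x) \<in> vecs n" "bal (D x)" if "x \<in> ?J" for x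
      using that D[of "fst x" l] l by (auto intro: uvec_vecs)
  qed
  have "mx.spread ?J (card R * t)"
    unfolding mx.spread_def
  proof (intro allI impI)
    fix B assume B: "V.subspace B \<and> ?L \<subseteq> B \<and> B \<subseteq> vecs n \<and> B \<noteq> vecs n"
    hence QB: "vecs_in (Q (Suc E)) n \<subseteq> B" using vecs_in_Ks[of n g "n - s" "col n M1"] by blast
    have B': "V.subspace B" "B \<subseteq> vecs n" "B \<noteq> vecs n" using B by auto
    obtain i f where f: "i < k" "wt i n f > 0" "\<And>v. v \<in> B \<Longrightarrow> (\<Sum>j<n. v j * f j) \<in> p i"
      using proper_subspace_functional[OF B' QB] by blast
    have "relation i (\<lambda>l j. (j, l)) (n - s) n M1 f"
      unfolding relation_def
    proof (intro allI impI)
      fix l assume l: "l < n - s"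
      have "col n M1 l \<in> Lsub i' n g (n - s) (col n M1)" for i'
        unfolding Lsub_def using l
        by (intro subsetD[OF msum_superset1[OF V.subspace_0[OF V.subspace_imul]]] V.span_base) auto
      hence "col n M1 l \<in> ?L" using w[OF l] by (auto simp: Ks_def)
      hence "(\<Sum>j<n. col n M1 l j * f j) \<in> p i" using f(3) B by blast
      thus "(\<Sum>j<n. M1 (j, l) * f j) \<in> p i" by (simp add: col_def)
    qed
    hence "h \<le> wt i n f" using good f unfolding bad_def by (metis not_less)
    also have "\<dots> \<le> card {x \<in> ?J. uvec (fst x) \<notin> B}"
    proof -
      have "(\<lambda>j. (j, l)) ` {j. j < n \<and> f j \<notin> p i} \<subseteq> {x \<in> ?J. uvec (fst x) \<notin> B}"
      proof safe
        fix j assume j: "j < n" "f j \<notin> p i" "uvec (fst (j, l)) \<in> B"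
        have "(\<Sum>j'<n. uvec j j' * f j') = (\<Sum>j'<n. if j' = j then f j else 0)"
          by (intro sum.cong) (auto simp: uvec_def)
        hence "(\<Sum>j'<n. uvec j j' * f j') = f j" using j(1) by simp
        thus False using f(3)[of "uvec j"] j by simp
      qed
      hence "card ((\<lambda>j. (j, l)) ` {j. j < n \<and> f j \<notin> p i}) \<le> card {x \<in> ?J. uvec (fst x) \<notin> B}"
        by (intro card_mono) auto
      moreover have "card ((\<lambda>j. (j, l)) ` {j. j < n \<and> f j \<notin> p i}) = wt i n f"
        unfolding wt_def by (rule card_image) (auto simp: inj_on_def)
      ultimately show ?thesis by simp
    qed
    finally show "card R * t \<le> card {x \<in> ?J. uvec (fst x) \<notin> B}" using t by linarith
  qed
  from mx.mass_near_uniform[OF subset_refl this a]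
  have "\<bar>mx.mass ?J a - 1 / card R\<bar> \<le> (1 - mx.\<theta>) ^ t" .
  moreover have "1 - mx.\<theta> = tau (card R)" by (simp add: tau_def mx.\<theta>_def mx.\<eta>_def)
  moreover have "mx.mass ?J a = measure_pmf.prob (Pi_pmf ?J 0 D) {M. col n M l - a \<in> ?L}"
    unfolding mx.mass_def mx.lc_def lc_col ..
  ultimately show ?thesis by simp
qed

text \<open>\<open>\<delta>\<close> is the relative error in the probability of one residue of a
  column, and it enters once for each of the s + u independent columns. The main term is the number
  of generating tuples divided by the number \<gamma>^(s+u) of all tuples of residues.\<close>

lemma generates_prob:
  assumes g: "onto n g" and w: "\<And>l. l < n - s \<Longrightarrow> col n M1 l \<in> Ker n g" and t: "\<gamma> s * t \<le> h"
    and \<delta>: "\<delta> = \<gamma> s * tau (\<gamma> s) ^ t" "\<delta> \<le> 1"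
  defines "P \<equiv> measure_pmf.prob (Pi_pmf ({..<n} \<times> {n - s..<n + u}) 0 D)
    {M. generates n g (n - s) (col n M1) (s + u) (\<lambda>l. col n M (n - s + l))}"
  shows "(1 - \<delta>) ^ (s + u) * (G s u / CARD('n) ^ (s + u)) \<le> P" "P \<le> (1 + \<delta>) ^ (s + u) * (G s u / CARD('n) ^ (s + u))"
proof -
  let ?m = "n - s" and ?r = "s + u"
  let ?w = "col n M1" and ?P = "Pi_pmf ({..<n} \<times> {?m..<n + u}) 0 D"
  let ?L = "Ks n g ?m ?w"
  have nm: "n - ?m = s" using s by simp
  have idx: "has_index (vecs n) ?L (\<gamma> s)"
    using Ks_index(2)[of n g ?m ?w, OF g w indep_cols] nm by (simp add: \<gamma>_def)
  obtain R where R: "finite R" "card R = \<gamma> s" "transv (vecs n) ?L R" using idx unfolding has_index_def by blast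
  have g0: "\<gamma> s > 0" using has_index_pos[OF V.subspace_subgrp[OF sub_vecs] idx] .
  have RV: "R \<subseteq> vecs n" using R(3) by (simp add: transv_def)
  let ?S = "{\<tau> \<in> {..<?r} \<rightarrow>\<^sub>E R. generates n g ?m ?w ?r \<tau>}"
  let ?E = "\<lambda>\<tau>. {M. \<forall>l\<in>{..<?r}. col n M (?m + l) - \<tau> l \<in> ?L}"
  have finS: "finite ?S" using R(1) by (intro finite_subset[OF _ finite_PiE[of "{..<?r}" "\<lambda>_. R"]]) auto
  have eq: "{M. generates n g ?m ?w ?r (\<lambda>l. col n M (?m + l))} = (\<Union>\<tau>\<in>?S. ?E \<tau>)"
  proof (intro subset_antisym subsetI)
    fix M assume M: "M \<in> {M. generates n g ?m ?w ?r (\<lambda>l. col n M (?m + l))}"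
    have "\<exists>x. x \<in> R \<and> col n M (?m + l) - x \<in> ?L" for l
      using transv_rep[OF R(3) col_vecs, of M "?m + l"] by blast
    then obtain \<tau> where \<tau>: "\<And>l. \<tau> l \<in> R \<and> col n M (?m + l) - \<tau> l \<in> ?L" by metis
    let ?\<tau> = "restrict \<tau> {..<?r}"
    have d: "col n M (?m + l) - ?\<tau> l \<in> ?L" if "l < ?r" for l using \<tau> that by simp
    have "generates n g ?m ?w ?r (\<lambda>l. col n M (?m + l)) = generates n g ?m ?w ?r ?\<tau>"
      by (rule generates_cong) (rule d)
    hence "?\<tau> \<in> ?S" using M \<tau> by auto
    moreover have "M \<in> ?E ?\<tau>" using d by blast
    ultimately show "M \<in> (\<Union>\<tau>\<in>?S. ?E \<tau>)" by blast
  next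
    fix M assume "M \<in> (\<Union>\<tau>\<in>?S. ?E \<tau>)"
    then obtain \<tau> where \<tau>: "\<tau> \<in> ?S" "M \<in> ?E \<tau>" by blast
    have "generates n g ?m ?w ?r (\<lambda>l. col n M (?m + l)) = generates n g ?m ?w ?r \<tau>"
      by (rule generates_cong) (use \<tau>(2) in blast)
    thus "M \<in> {M. generates n g ?m ?w ?r (\<lambda>l. col n M (?m + l))}" using \<tau>(1) by blast
  qed
  have disj: "disjoint_family_on ?E ?S"
    unfolding disjoint_family_on_def
  proof (intro ballI impI)
    fix \<tau> \<tau>' assume t: "\<tau> \<in> ?S" "\<tau>' \<in> ?S" "\<tau> \<noteq> \<tau>'"
    show "?E \<tau> \<inter> ?E \<tau>' = {}"
    proof (rule ccontr)
      assume "?E \<tau> \<inter> ?E \<tau>' \<noteq> {}"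
      then obtain M where M: "\<And>l. l < ?r \<Longrightarrow> col n M (?m + l) - \<tau> l \<in> ?L" "\<And>l. l < ?r \<Longrightarrow> col n M (?m + l) - \<tau>' l \<in> ?L"
        by blast
      have "\<tau> l = \<tau>' l" if l: "l < ?r" for l
      proof -
        have "\<exists>!x. x \<in> R \<and> col n M (?m + l) - x \<in> ?L" using R(3) col_vecs unfolding transv_def by blast
        moreover have "\<tau> l \<in> R" "\<tau>' l \<in> R" using t l by auto
        ultimately show ?thesis using M[OF l] by blast
      qed
      hence "\<tau> = \<tau>'" using t(1,2) by (intro PiE_ext[of \<tau> "{..<?r}" "\<lambda>_. R" \<tau>']) auto
      thus False using t(3) by blast
    qed
  qed
  let ?c = "\<lambda>l a. measure_pmf.prob (Pi_pmf ({..<n} \<times> {?m + l}) 0 D) {M. col n M (?m + l) - a \<in> ?L}"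
  have prE: "measure_pmf.prob ?P (?E \<tau>) = (\<Prod>l<?r. ?c l (\<tau> l))" for \<tau>
  proof -
    have "{..<n} \<times> {?m..<n + u} = (\<Union>l\<in>{..<?r}. {..<n} \<times> {?m + l})"
    proof (intro subset_antisym subsetI)
      fix x assume "x \<in> {..<n} \<times> {?m..<n + u}"
      then obtain j l where x: "x = (j, l)" "j < n" "?m \<le> l" "l < n + u" by auto
      hence "l - ?m < ?r" "l = ?m + (l - ?m)" using s by auto
      thus "x \<in> (\<Union>l\<in>{..<?r}. {..<n} \<times> {?m + l})" using x by blast
    qed (use s in auto)
    moreover have "depends_on ({..<n} \<times> {?m + l}) (\<lambda>M. col n M (?m + l) - a \<in> ?L)" for l a
    proof -
      have "col n M (?m + l) = col n M' (?m + l)" if "\<forall>x\<in>{..<n} \<times> {?m + l}. M x = M' x" for M M' :: "nat \<times> nat \<Rightarrow> 'a"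
        using that by (auto simp: col_def)
      thus ?thesis unfolding depends_on_def by metis
    qed
    moreover have "disjoint_family_on (\<lambda>l. {..<n} \<times> {?m + l}) {..<?r}" by (auto simp: disjoint_family_on_def)
    ultimately show ?thesis by (simp only:) (rule prob_Pi_pmf_blocks, auto)
  qed
  have P: "P = (\<Sum>\<tau>\<in>?S. \<Prod>l<?r. ?c l (\<tau> l))"
    unfolding P_def eq prE[symmetric]
    by (rule measure_pmf.finite_measure_finite_Union[OF finS _ disj]) auto
  have card: "real (card ?S) = real (\<Prod>i<k. q i ^ s) ^ ?r * G s u"
    using card_generates[of n g ?m ?w R ?r, OF g w indep_cols _ R(3)] nm
    by (simp add: G_def prod.distrib prod_power_distrib)
  have near: "\<bar>?c l (\<tau> l) - 1 / \<gamma> s\<bar> \<le> tau (\<gamma> s) ^ t" if "\<tau> \<in> ?S" "l < ?r" for \<tau> l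
    using col_near_uniform[OF g w R(1,3), of t "?m + l" "\<tau> l"] that R(2) t RV s by auto
  have dg: "tau (\<gamma> s) ^ t = \<delta> / \<gamma> s" using \<delta>(1) g0 by simp
  have lo: "((1 - \<delta>) / \<gamma> s) ^ ?r \<le> (\<Prod>l<?r. ?c l (\<tau> l))" if "\<tau> \<in> ?S" for \<tau>
  proof -
    have "(1 - \<delta>) / \<gamma> s \<le> ?c l (\<tau> l)" if "l < ?r" for l
      using near[OF \<open>\<tau> \<in> ?S\<close> that] unfolding dg diff_divide_distrib by linarith
    hence "(\<Prod>l<?r. (1 - \<delta>) / \<gamma> s) \<le> (\<Prod>l<?r. ?c l (\<tau> l))" using \<delta>(2) by (intro prod_mono) auto
    thus ?thesis by simp
  qed
  have hi: "(\<Prod>l<?r. ?c l (\<tau> l)) \<le> ((1 + \<delta>) / \<gamma> s) ^ ?r" if "\<tau> \<in> ?S" for \<tau>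
  proof -
    have "?c l (\<tau> l) \<le> (1 + \<delta>) / \<gamma> s" if "l < ?r" for l
      using near[OF \<open>\<tau> \<in> ?S\<close> that] unfolding dg add_divide_distrib by linarith
    hence "(\<Prod>l<?r. ?c l (\<tau> l)) \<le> (\<Prod>l<?r. (1 + \<delta>) / \<gamma> s)" by (intro prod_mono) auto
    thus ?thesis by simp
  qed
  have tot: "real (card ?S) * (x / \<gamma> s) ^ ?r = x ^ ?r * (G s u / CARD('n) ^ ?r)" for x :: real
  proof -
    define Z where "Z = real (\<Prod>i<k. q i ^ s)"
    have Z: "Z \<noteq> 0" using g0 by (auto simp: \<gamma>_def Z_def)
    have "real (\<gamma> s) ^ ?r = real CARD('n) ^ ?r * Z ^ ?r"
      unfolding \<gamma>_def of_nat_mult power_mult_distrib Z_def ..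
    thus ?thesis unfolding card power_divide Z_def[symmetric] using Z by (simp add: mult.commute)
  qed
  have "(\<Sum>\<tau>\<in>?S. ((1 - \<delta>) / \<gamma> s) ^ ?r) \<le> P" unfolding P using lo by (intro sum_mono)
  thus "(1 - \<delta>) ^ ?r * (G s u / CARD('n) ^ ?r) \<le> P" using tot[of "1 - \<delta>"] by simp
  have "P \<le> (\<Sum>\<tau>\<in>?S. ((1 + \<delta>) / \<gamma> s) ^ ?r)" unfolding P using hi by (intro sum_mono)
  thus "P \<le> (1 + \<delta>) ^ ?r * (G s u / CARD('n) ^ ?r)" using tot[of "1 + \<delta>"] by simp
qed

end

end

section \<open>Averaging over presentations and passage to the limit\<close>

definition merge :: "'i set \<Rightarrow> ('i \<Rightarrow> 'b) \<Rightarrow> ('i \<Rightarrow> 'b) \<Rightarrow> 'i \<Rightarrow> 'b" where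
  "merge A f g = (\<lambda>x. if x \<in> A then f x else g x)"

lemma sum_prob_eq_expectation_card:
  assumes S: "finite S"
  shows "(\<Sum>g\<in>S. measure_pmf.prob P {x. R x g}) = measure_pmf.expectation P (\<lambda>x. real (card {g \<in> S. R x g}))"
proof -
  have "(\<Sum>g\<in>S. measure_pmf.prob P {x. R x g}) = (\<Sum>g\<in>S. measure_pmf.expectation P (indicator {x. R x g}))"
    by simp
  also have "\<dots> = measure_pmf.expectation P (\<lambda>x. \<Sum>g\<in>S. indicator {x. R x g} x)"
    by (rule Bochner_Integration.integral_sum[symmetric])
      (intro integrable_real_indicator; simp add: measure_pmf.emeasure_eq_measure)
  also have "\<dots> = measure_pmf.expectation P (\<lambda>x. real (card {g \<in> S. R x g}))"
  proof (rule Bochner_Integration.integral_cong)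
    fix x
    have "(\<Sum>g\<in>S. indicator {x. R x g} x) = (\<Sum>g\<in>S. if R x g then 1 else (0::real))"
      by (intro sum.cong) (auto simp: indicator_def)
    also have "\<dots> = real (card {g \<in> S. R x g})" using S by (simp add: sum.If_cases Int_def)
    finally show "(\<Sum>g\<in>S. indicator {x. R x g} x) = real (card {g \<in> S. R x g})" .
  qed simp
  finally show ?thesis .
qed

lemma gprob_bounds: "q \<ge> 2 \<Longrightarrow> 0 \<le> gprob q (s + u) s" "q \<ge> 2 \<Longrightarrow> gprob q (s + u) s \<le> 1"
proof -
  assume q: "q \<ge> 2"
  have *: "0 \<le> 1 - 1 / real q ^ (u + j + 1)" "1 - 1 / real q ^ (u + j + 1) \<le> 1" for j
    using q one_le_power[of "real q" "u + j + 1"] by (auto simp: divide_le_eq)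
  have e: "gprob q (s + u) s = (\<Prod>j<s. 1 - 1 / real q ^ (u + j + 1))" by (rule gprob_reindex) (use q in simp)
  show "0 \<le> gprob q (s + u) s" unfolding e by (intro prod_nonneg ballI *)
  show "gprob q (s + u) s \<le> 1" unfolding e by (intro prod_le_1 conjI *)
qed

text \<open>The deviations of the factors from 1 form a geometric series, so the product converges
  absolutely.\<close>

lemma gprob_tendsto:
  assumes q: "q \<ge> 2"
  shows "(\<lambda>s. gprob q (s + u) s) \<longlonglongrightarrow> (\<Prod>j. 1 - 1 / real q ^ (u + j + 1))"
proof -
  let ?f = "\<lambda>j. 1 - 1 / real q ^ (u + j + 1)"
  have "summable (\<lambda>j. (1 / real q) ^ (u + 1) * (1 / real q) ^ j)"
    using q by (intro summable_mult summable_geometric) auto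
  moreover have "norm (?f j - 1) = (1 / real q) ^ (u + 1) * (1 / real q) ^ j" for j
    by (simp add: power_add power_divide)
  ultimately have "abs_convergent_prod ?f" unfolding abs_convergent_prod_conv_summable by simp
  hence "convergent_prod ?f" by (rule abs_convergent_prod_imp_convergent_prod)
  hence "(\<lambda>s. \<Prod>j\<le>s. ?f j) \<longlonglongrightarrow> (\<Prod>j. ?f j)" by (rule convergent_prod_LIMSEQ)
  hence "(\<lambda>s. \<Prod>j<Suc s. ?f j) \<longlonglongrightarrow> (\<Prod>j. ?f j)" by (simp only: lessThan_Suc_atMost)
  hence "(\<lambda>s. \<Prod>j<s. ?f j) \<longlonglongrightarrow> (\<Prod>j. ?f j)" by (rule LIMSEQ_imp_Suc)
  moreover have "gprob q (s + u) s = (\<Prod>j<s. ?f j)" for s by (rule gprob_reindex) (use q in simp)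
  ultimately show ?thesis by (simp only:)
qed

context finite_module
begin

lemma NV_UNIV: "NV n UNIV = vecs n"
  by (auto simp: NV_def)

lemma finite_vecs: "finite (vecs n :: (nat \<Rightarrow> 'n) set)"
  using card_NV[of UNIV n] by (simp add: NV_UNIV)

lemma G_bounds: "0 \<le> G s u" "G s u \<le> 1"
  unfolding G_def using gprob_bounds q_ge_2 by (auto intro!: prod_nonneg prod_le_1)

lemma card_module_auts: "card (module_auts smul) > 0"
proof -
  have "finite (module_auts smul)"
    by (rule finite_subset[OF subset_UNIV]) (simp add: finite_UNIV_fun finN)
  moreover have "id \<in> module_auts smul"
    using module.module_hom_id[OF module_N] by (simp add: module_auts_def)
  ultimately show ?thesis by (auto simp: card_gt_0_iff)
qed

text \<open>The roles of the two blocks are separated: the first decides which g are candidates, the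
  second whether a candidate presents the matrix.\<close>

lemma presents_merge:
  assumes s: "s \<le> n"
  shows "presents n (n + u) (merge ({..<n} \<times> {..<n - s}) M1 M2) g \<longleftrightarrow>
    g \<in> Sol n (n - s) (col n M1) UNIV \<and> onto n g \<and>
    generates n g (n - s) (col n M1) (s + u) (\<lambda>l. col n M2 (n - s + l))"
proof -
  let ?M = "merge ({..<n} \<times> {..<n - s}) M1 M2" and ?v = "\<lambda>l. col n M2 (n - s + l)"
  have c1: "col n ?M l = col n M1 l" if "l < n - s" for l using that by (auto simp: col_def merge_def)
  have c2: "col n ?M (n - s + l) = ?v l" for l by (auto simp: col_def merge_def)
  have split: "{..<n + u} = (\<lambda>l. n - s + l) ` {..<s + u} \<union> {..<n - s}"
  proof (intro subset_antisym subsetI)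
    fix l assume l: "l \<in> {..<n + u}"
    show "l \<in> (\<lambda>l. n - s + l) ` {..<s + u} \<union> {..<n - s}"
    proof (cases "l < n - s")
      case False
      hence "l = n - s + (l - (n - s))" "l - (n - s) \<in> {..<s + u}" using l s by auto
      thus ?thesis by blast
    qed simp
  qed (use s in auto)
  have im: "col n ?M ` {..<n + u} = ?v ` {..<s + u} \<union> col n M1 ` {..<n - s}"
    unfolding split image_Un image_image c2 using c1 by (intro arg_cong2[of _ _ _ _ "(\<union>)"] image_cong) auto
  have ker: "(\<forall>l<n + u. col n ?M l \<in> Ker n g) \<longleftrightarrow>
      (\<forall>l<s + u. ?v l \<in> Ker n g) \<and> (\<forall>l<n - s. col n M1 l \<in> Ker n g)"
  proof -
    have "(\<forall>l<n + u. col n ?M l \<in> Ker n g) \<longleftrightarrow> col n ?M ` {..<n + u} \<subseteq> Ker n g" by blast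
    thus ?thesis unfolding im by blast
  qed
  have "msum (V.span (?v ` {..<s + u} \<union> col n M1 ` {..<n - s})) X =
      msum (V.span (?v ` {..<s + u})) (msum (V.span (col n M1 ` {..<n - s})) X)" for X
    unfolding msum_assoc[symmetric] V.span_Un msum_def[of "V.span (?v ` {..<s + u})"] ..
  hence sp: "msum (V.span (col n ?M ` {..<n + u})) (imul (pw (*)) (p i) (Ker n g)) =
      msum (V.span (?v ` {..<s + u})) (Lsub i n g (n - s) (col n M1))" for i
    unfolding im Lsub_def .
  have eq: "Ker n g \<subseteq> msum (V.span (?v ` {..<s + u})) (Lsub i n g (n - s) (col n M1)) \<longleftrightarrow>
      msum (V.span (?v ` {..<s + u})) (Lsub i n g (n - s) (col n M1)) = Ker n g"
    if v: "\<forall>l<s + u. ?v l \<in> Ker n g" and w: "\<forall>l<n - s. col n M1 l \<in> Ker n g" for i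
  proof -
    have "?v ` {..<s + u} \<subseteq> Ker n g" using v by blast
    moreover have "Lsub i n g (n - s) (col n M1) \<subseteq> Ker n g" by (rule Lsub_Ker) (use w in blast)
    ultimately have "msum (V.span (?v ` {..<s + u})) (Lsub i n g (n - s) (col n M1)) \<subseteq> Ker n g"
      by (intro msum_least V.subspace_subgrp sub_Ker V.span_minimal)
    thus ?thesis by blast
  qed
  have sol: "g \<in> Sol n (n - s) (col n M1) UNIV \<longleftrightarrow> g \<in> vecs n \<and> (\<forall>l<n - s. col n M1 l \<in> Ker n g)"
    unfolding Sol_def NV_UNIV Ker_def using col_vecs by blast
  show ?thesis unfolding presents_def generates_def sol ker sp using eq by blast
qed

text \<open>The number of presentations of a matrix is |Aut N| or 0, so its expectation is |Aut N|
  times the probability that one exists.\<close>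

lemma auts_times_prob:
  "real (card (module_auts smul)) * measure_pmf.prob P {x. \<exists>g. presents n c (f x) g} =
    (\<Sum>g\<in>vecs n. measure_pmf.prob P {x. presents n c (f x) g})"
proof -
  have "{g \<in> vecs n. presents n c (f x) g} = {g. presents n c (f x) g}" for x by (auto simp: presents_def)
  moreover have "real (card {g. presents n c (f x) g}) =
      real (card (module_auts smul)) * indicator {x. \<exists>g. presents n c (f x) g} x" for x
  proof (cases "\<exists>g. presents n c (f x) g")
    case True
    then obtain g where "presents n c (f x) g" ..
    from card_presents[OF this] show ?thesis using True by simp
  qed simp
  ultimately show ?thesis unfolding sum_prob_eq_expectation_card[OF finite_vecs] by simp
qed

text \<open>About |N|^s candidates g, each presenting the matrix with probability about G /
  |N|^(s+u); division by |Aut N| gives \<open>A\<close>.\<close>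

lemma cond_prob_bounds:
  fixes M1 :: "nat \<times> nat \<Rightarrow> 'a" and D :: "nat \<times> nat \<Rightarrow> 'a pmf"
  assumes s: "s \<le> n" and good: "\<not> (\<exists>i<k. bad s n h M1 i)"
    and D: "\<And>j l. j < n \<Longrightarrow> l < n + u \<Longrightarrow> bal (D (j, l))"
    and t: "\<gamma> s * t \<le> h" and \<delta>: "\<delta> = \<gamma> s * tau (\<gamma> s) ^ t" "\<delta> \<le> 1"
  defines "P \<equiv> measure_pmf.prob (Pi_pmf ({..<n} \<times> {n - s..<n + u}) 0 D)
      {M. cok_tensor_iso p k n u smul (merge ({..<n} \<times> {..<n - s}) M1 M)}"
    and "A \<equiv> G s u / (real (card (module_auts smul)) * real CARD('n) ^ u)"
  shows "P \<le> (1 + \<delta>) ^ (s + u) * A" "(1 - 2 ^ CARD('n) / 2 ^ s) * ((1 - \<delta>) ^ (s + u) * A) \<le> P"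
proof -
  let ?B = "Pi_pmf ({..<n} \<times> {n - s..<n + u}) 0 D"
  let ?S = "{g \<in> Sol n (n - s) (col n M1) UNIV. onto n g}"
  let ?g = "\<lambda>g. measure_pmf.prob ?B {M. generates n g (n - s) (col n M1) (s + u) (\<lambda>l. col n M (n - s + l))}"
  let ?a = "real (card (module_auts smul))" and ?c = "real CARD('n)"
  have a: "?a > 0" using card_module_auts by simp
  have c: "?c > 0" using finN by (simp add: card_gt_0_iff)
  have \<gamma>0: "\<gamma> s > 0" using q_ge_2 finN by (auto simp: \<gamma>_def card_gt_0_iff intro!: prod_pos) (metis neq0_conv not_numeral_le_zero)
  have \<delta>0: "0 \<le> \<delta>" using \<delta>(1) tau_bounds(1)[OF \<gamma>0] by simp
  have SV: "?S \<subseteq> vecs n" by (auto simp: Sol_def NV_def)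
  have "?a * P = (\<Sum>g\<in>vecs n. measure_pmf.prob ?B {M. presents n (n + u) (merge ({..<n} \<times> {..<n - s}) M1 M) g})"
    unfolding P_def cok_tensor_iso_iff by (rule auts_times_prob)
  also have "\<dots> = (\<Sum>g\<in>?S. measure_pmf.prob ?B {M. presents n (n + u) (merge ({..<n} \<times> {..<n - s}) M1 M) g})"
  proof (rule sum.mono_neutral_right[OF finite_vecs SV], rule ballI)
    fix g assume "g \<in> vecs n - ?S"
    hence "{M. presents n (n + u) (merge ({..<n} \<times> {..<n - s}) M1 M) g} = {}" unfolding presents_merge[OF s] by blast
    thus "measure_pmf.prob ?B {M. presents n (n + u) (merge ({..<n} \<times> {..<n - s}) M1 M) g} = 0"
      by (simp only: measure_empty)
  qed
  also have "\<dots> = (\<Sum>g\<in>?S. ?g g)"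
    unfolding presents_merge[OF s] by (intro sum.cong refl arg_cong[of _ _ "measure_pmf.prob ?B"]) blast
  finally have aP: "?a * P = (\<Sum>g\<in>?S. ?g g)" .
  have g: "(1 - \<delta>) ^ (s + u) * (G s u / ?c ^ (s + u)) \<le> ?g g" "?g g \<le> (1 + \<delta>) ^ (s + u) * (G s u / ?c ^ (s + u))"
    if "g \<in> ?S" for g
  proof -
    have on: "onto n g" using that by simp
    have w: "col n M1 l \<in> Ker n g" if "l < n - s" for l
      using that \<open>g \<in> ?S\<close> col_vecs by (auto simp: Sol_def Ker_def)
    show "(1 - \<delta>) ^ (s + u) * (G s u / ?c ^ (s + u)) \<le> ?g g"
      using generates_prob(1)[where D = D and n = n and s = s and u = u and h = h and g = g, OF s good D on w t \<delta>] by simp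
    show "?g g \<le> (1 + \<delta>) ^ (s + u) * (G s u / ?c ^ (s + u))"
      using generates_prob(2)[where D = D and n = n and s = s and u = u and h = h and g = g, OF s good D on w t \<delta>] by simp
  qed
  have ns: "n - (n - s) = s" using s by simp
  have ind: "indep i (n - s) (col n M1)" if "i < k" for i
    by (rule indep_cols[where D = D and u = u, OF s good D that])
  have C: "real (card ?S) \<le> ?c ^ s" "?c ^ s * (1 - 2 ^ CARD('n) / 2 ^ s) \<le> real (card ?S)"
    using card_onto_Sol[of "n - s" "col n M1" n, OF ind col_vecs] unfolding ns by auto
  have cs: "?c ^ s * (G s u / ?c ^ (s + u)) = ?a * A"
    using a c by (simp add: A_def power_add)
  have "?a * P \<le> card ?S * ((1 + \<delta>) ^ (s + u) * (G s u / ?c ^ (s + u)))"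
    unfolding aP by (rule sum_bounded_above) (rule g(2))
  also have "\<dots> \<le> ?c ^ s * ((1 + \<delta>) ^ (s + u) * (G s u / ?c ^ (s + u)))"
    using C(1) \<delta>0 G_bounds by (intro mult_right_mono) auto
  also have "\<dots> = ?a * ((1 + \<delta>) ^ (s + u) * A)" unfolding mult.left_commute[of "?c ^ s"] cs by (rule mult.left_commute)
  finally show "P \<le> (1 + \<delta>) ^ (s + u) * A" using a by simp
  have "?a * ((1 - 2 ^ CARD('n) / 2 ^ s) * ((1 - \<delta>) ^ (s + u) * A)) =
      (?c ^ s * (1 - 2 ^ CARD('n) / 2 ^ s)) * ((1 - \<delta>) ^ (s + u) * (G s u / ?c ^ (s + u)))"
    unfolding mult.assoc mult.left_commute[of "?c ^ s"] cs by (simp add: mult_ac)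
  also have "\<dots> \<le> card ?S * ((1 - \<delta>) ^ (s + u) * (G s u / ?c ^ (s + u)))"
    using C(2) \<delta>(2) G_bounds by (intro mult_right_mono) auto
  also have "\<dots> \<le> ?a * P" unfolding aP by (rule sum_bounded_below) (rule g(1))
  finally show "(1 - 2 ^ CARD('n) / 2 ^ s) * ((1 - \<delta>) ^ (s + u) * A) \<le> P" using a by simp
qed

lemma prob_split:
  fixes s n u :: nat
  assumes "s \<le> n"
  shows "measure_pmf.prob (Pi_pmf ({..<n} \<times> {..<n + u}) 0 D) {M. R M} =
    measure_pmf.prob (pair_pmf (Pi_pmf ({..<n} \<times> {..<n - s}) 0 D) (Pi_pmf ({..<n} \<times> {n - s..<n + u}) 0 D))
      {(M1, M2). R (merge ({..<n} \<times> {..<n - s}) M1 M2)}"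
proof -
  have un: "{..<n} \<times> {..<n + u} = {..<n} \<times> {..<n - s} \<union> {..<n} \<times> {n - s..<n + u}" using assms by auto
  have "Pi_pmf ({..<n} \<times> {..<n + u}) 0 D = map_pmf (\<lambda>(f, g). merge ({..<n} \<times> {..<n - s}) f g)
      (pair_pmf (Pi_pmf ({..<n} \<times> {..<n - s}) 0 D) (Pi_pmf ({..<n} \<times> {n - s..<n + u}) 0 D))"
    unfolding merge_def un by (rule Pi_pmf_union) auto
  moreover have "(\<lambda>(f, g). merge ({..<n} \<times> {..<n - s}) f g) -` {M. R M} =
      {(M1, M2). R (merge ({..<n} \<times> {..<n - s}) M1 M2)}" by auto
  ultimately show ?thesis by (simp only: measure_map_pmf)
qed

text \<open>Three errors of order 2^(-s) add up: 2^|N| comes from the maps that are not onto, 1 from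
  the deviation of the last columns for large n, and 2k from the exceptional event.\<close>

lemma cok_prob_approx:
  fixes D :: "nat \<Rightarrow> nat \<times> nat \<Rightarrow> 'a pmf"
  assumes D: "\<And>n j l. j < n \<Longrightarrow> l < n + u \<Longrightarrow> bal (D n (j, l))"
  defines "P \<equiv> \<lambda>n. measure_pmf.prob (Pi_pmf ({..<n} \<times> {..<n + u}) 0 (D n)) {M. cok_tensor_iso p k n u smul M}"
    and "A \<equiv> \<lambda>s. G s u / (real (card (module_auts smul)) * real CARD('n) ^ u)"
  shows "eventually (\<lambda>n. \<bar>P n - A s\<bar> \<le> (2 ^ CARD('n) + 1 + 2 * k) * (1/2) ^ s) sequentially"
proof -
  obtain \<kappa> where \<kappa>: "\<kappa> > 0" "\<And>s. eventually (\<lambda>n. \<forall>D. (\<forall>j<n. \<forall>l<n - s. bal (D (j, l))) \<longrightarrow>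
     measure_pmf.prob (Pi_pmf ({..<n} \<times> {..<n - s}) 0 D) {M. \<exists>i<k. bad s n (n div \<kappa>) M i} \<le> 2 * k * (1/2) ^ s) sequentially"
    by (rule bad_prob, rule that, assumption, simp only:)
  have \<gamma>0: "\<gamma> s > 0" using q_ge_2 finN by (auto simp: \<gamma>_def card_gt_0_iff intro!: prod_pos) (metis neq0_conv not_numeral_le_zero)
  define \<delta> where "\<delta> n = \<gamma> s * tau (\<gamma> s) ^ ((n div \<kappa>) div \<gamma> s)" for n
  have "(\<lambda>n. tau (\<gamma> s) ^ ((n div \<kappa>) div \<gamma> s)) \<longlonglongrightarrow> 0"
  proof (rule tendsto_sandwich[where f = "\<lambda>_. 0" and h = "\<lambda>n. real n * tau (\<gamma> s) ^ (n div (\<kappa> * \<gamma> s))"])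
    show "(\<lambda>n. real n * tau (\<gamma> s) ^ (n div (\<kappa> * \<gamma> s))) \<longlonglongrightarrow> 0"
      using \<kappa>(1) \<gamma>0 tau_bounds[OF \<gamma>0] by (intro times_power_div_tendsto_0) auto
    show "\<forall>\<^sub>F n in sequentially. 0 \<le> tau (\<gamma> s) ^ ((n div \<kappa>) div \<gamma> s)" using tau_bounds[OF \<gamma>0] by simp
    show "\<forall>\<^sub>F n in sequentially. tau (\<gamma> s) ^ ((n div \<kappa>) div \<gamma> s) \<le> real n * tau (\<gamma> s) ^ (n div (\<kappa> * \<gamma> s))"
      using eventually_ge_at_top[of 1]
    proof eventually_elim
      case (elim n)
      have "1 * tau (\<gamma> s) ^ (n div (\<kappa> * \<gamma> s)) \<le> real n * tau (\<gamma> s) ^ (n div (\<kappa> * \<gamma> s))"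
        using elim tau_bounds[OF \<gamma>0] by (intro mult_right_mono) auto
      thus ?case by (simp add: div_mult2_eq)
    qed
  qed simp
  from tendsto_mult_right[OF this, of "real (\<gamma> s)"] have \<delta>lim: "\<delta> \<longlonglongrightarrow> 0" by (simp add: \<delta>_def[abs_def] mult.commute)
  \<comment> \<open>With s fixed, \<open>\<delta>\<close> tends to 0, so the errors of the s + u
    columns together eventually stay below 2^(-s).\<close>
  have "(\<lambda>n. (1 + \<delta> n) ^ (s + u)) \<longlonglongrightarrow> (1 + 0) ^ (s + u)" by (intro tendsto_intros \<delta>lim)
  hence e1: "eventually (\<lambda>n. (1 + \<delta> n) ^ (s + u) < 1 + (1/2) ^ s) sequentially" by (rule order_tendstoD) simp
  have "(\<lambda>n. (1 - \<delta> n) ^ (s + u)) \<longlonglongrightarrow> (1 - 0) ^ (s + u)" by (intro tendsto_intros \<delta>lim)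
  hence e2: "eventually (\<lambda>n. 1 - (1/2) ^ s < (1 - \<delta> n) ^ (s + u)) sequentially" by (rule order_tendstoD) simp
  have e3: "eventually (\<lambda>n. \<delta> n < 1) sequentially" using \<delta>lim by (rule order_tendstoD) simp
  have ac: "1 \<le> real (card (module_auts smul)) * real CARD('n) ^ u"
  proof -
    have "0 < card (module_auts smul) * CARD('n) ^ u" using card_module_auts finN by (simp add: card_gt_0_iff)
    hence "1 \<le> card (module_auts smul) * CARD('n) ^ u" by linarith
    hence "real 1 \<le> real (card (module_auts smul) * CARD('n) ^ u)" by (simp only: of_nat_le_iff)
    thus ?thesis by simp
  qed
  have A: "0 \<le> A s" "A s \<le> 1" using G_bounds[of s u] ac by (auto simp: A_def divide_le_eq)
  show ?thesis
    using e1 e2 e3 \<kappa>(2)[of s] eventually_ge_at_top[of s]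
  proof eventually_elim
    case (elim n)
    let ?B1 = "Pi_pmf ({..<n} \<times> {..<n - s}) 0 (D n)" and ?B2 = "Pi_pmf ({..<n} \<times> {n - s..<n + u}) 0 (D n)"
    let ?Bad = "{M. \<exists>i<k. bad s n (n div \<kappa>) M i}"
    let ?h = "(1/2::real) ^ s" and ?b = "(2::real) ^ CARD('n) / 2 ^ s"
    let ?T = "{(M1, M2). cok_tensor_iso p k n u smul (merge ({..<n} \<times> {..<n - s}) M1 M2)}"
    have bad: "measure_pmf.prob ?B1 ?Bad \<le> 2 * k * ?h" using elim(4) D by auto
    have P: "P n = measure_pmf.prob (pair_pmf ?B1 ?B2) ?T" unfolding P_def by (rule prob_split[OF elim(5)])
    have t: "\<gamma> s * ((n div \<kappa>) div \<gamma> s) \<le> n div \<kappa>" by simp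
    have Dn: "\<And>j l. j < n \<Longrightarrow> l < n + u \<Longrightarrow> bal (D n (j, l))" by (rule D)
    have \<delta>1: "\<delta> n \<le> 1" using elim(3) by simp
    have good: "\<not> (\<exists>i<k. bad s n (n div \<kappa>) M1 i)" if "M1 \<notin> ?Bad" for M1 using that by blast
    have T: "{M2. (M1, M2) \<in> ?T} = {M2. cok_tensor_iso p k n u smul (merge ({..<n} \<times> {..<n - s}) M1 M2)}" for M1
      by simp
    have b: "?b = 2 ^ CARD('n) * ?h" by (simp add: power_divide)
    have "P n \<le> (1 + ?h) * A s + measure_pmf.prob ?B1 ?Bad"
      unfolding P
    proof (rule prob_pair_le)
      show "0 \<le> (1 + ?h) * A s" using A by simp
      fix M1 assume M1: "M1 \<notin> ?Bad"
      have "measure_pmf.prob ?B2 {M2. (M1, M2) \<in> ?T} \<le> (1 + \<delta> n) ^ (s + u) * A s"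
        unfolding T A_def by (rule cond_prob_bounds(1)[where D = "D n" and n = n and u = u, OF elim(5) good[OF M1] Dn t \<delta>_def \<delta>1])
      also have "\<dots> \<le> (1 + ?h) * A s" using elim(1) A by (intro mult_right_mono) auto
      finally show "measure_pmf.prob ?B2 {M2. (M1, M2) \<in> ?T} \<le> (1 + ?h) * A s" .
    qed
    also have "\<dots> \<le> A s + ?h * 1 + 2 * k * ?h"
    proof -
      have "?h * A s \<le> ?h * 1" using A by (intro mult_left_mono) auto
      thus ?thesis using bad unfolding distrib_right by linarith
    qed
    also have "\<dots> \<le> A s + (2 ^ CARD('n) + 1 + 2 * k) * ?h" by (simp add: algebra_simps)
    finally have up: "P n - A s \<le> (2 ^ CARD('n) + 1 + 2 * k) * ?h" by simp
    have P0: "0 \<le> P n" by (simp add: P_def)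
    have lo: "A s - P n \<le> (2 ^ CARD('n) + 1 + 2 * k) * ?h"
    \<comment> \<open>The lower bound can be weakened factor by factor only if 1 - ?b is
      nonnegative. Otherwise ?b exceeds 1 and the claim follows from A s \<le> 1.\<close>
    proof (cases "?b \<le> 1")
      case False
      have "A s - P n \<le> ?b" using A P0 False by linarith
      also have "\<dots> \<le> (2 ^ CARD('n) + 1 + 2 * k) * ?h" unfolding b by (intro mult_right_mono) auto
      finally show ?thesis .
    next
      case True
      have ab: "A s - (?b + ?h) \<le> (1 - ?b) * ((1 - ?h) * A s)"
      proof -
        have "(?b + ?h) * A s \<le> (?b + ?h) * 1" using A by (intro mult_left_mono) auto
        moreover have "0 \<le> ?b * ?h * A s" using A by simp
        ultimately show ?thesis by (simp add: algebra_simps)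
      qed
      have "A s - (?b + ?h) - measure_pmf.prob ?B1 ?Bad \<le> P n"
        unfolding P
      proof (rule prob_pair_ge)
        show "A s - (?b + ?h) \<le> 1" using A by (smt (verit) divide_nonneg_nonneg zero_le_power)
        fix M1 assume M1: "M1 \<notin> ?Bad"
        note ab
        also have "(1 - ?b) * ((1 - ?h) * A s) \<le> (1 - ?b) * ((1 - \<delta> n) ^ (s + u) * A s)"
          using elim(2) A True by (intro mult_left_mono mult_right_mono) auto
        also have "\<dots> \<le> measure_pmf.prob ?B2 {M2. (M1, M2) \<in> ?T}"
          unfolding T A_def by (rule cond_prob_bounds(2)[where D = "D n" and n = n and u = u, OF elim(5) good[OF M1] Dn t \<delta>_def \<delta>1])
        finally show "A s - (?b + ?h) \<le> measure_pmf.prob ?B2 {M2. (M1, M2) \<in> ?T}" .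
      qed
      hence "A s - P n \<le> ?b + ?h + 2 * k * ?h" using bad by linarith
      thus ?thesis unfolding b by (simp add: algebra_simps)
    qed
    show ?case using up lo by linarith
  qed
qed

text \<open>The approximating value \<open>A s\<close> does not depend on n. So s is chosen
  according to the required accuracy, and n is then large in terms of s; no uniformity in s is
  called for.\<close>

theorem cok_prob_tendsto:
  fixes D :: "nat \<Rightarrow> nat \<times> nat \<Rightarrow> 'a pmf"
  assumes D: "\<And>n j l. j < n \<Longrightarrow> l < n + u \<Longrightarrow> bal (D n (j, l))"
  shows "(\<lambda>n. measure_pmf.prob (Pi_pmf ({..<n} \<times> {..<n + u}) 0 (D n)) {M. cok_tensor_iso p k n u smul M})
    \<longlonglongrightarrow> 1 / (real (card (module_auts smul)) * real CARD('n) ^ u) * (\<Prod>i<k. \<Prod>j. 1 - 1 / real (q i) ^ (u + j + 1))"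
    (is "?P \<longlonglongrightarrow> ?L")
proof -
  define A where "A s = G s u / (real (card (module_auts smul)) * real CARD('n) ^ u)" for s
  define C where "C = real (2 ^ CARD('n) + 1 + 2 * k)"
  have approx: "eventually (\<lambda>n. \<bar>?P n - A s\<bar> \<le> C * (1/2) ^ s) sequentially" for s
    using cok_prob_approx[of u D s, OF D] unfolding A_def C_def by simp
  have "(\<lambda>s. 1 / (real (card (module_auts smul)) * real CARD('n) ^ u) * G s u) \<longlonglongrightarrow> ?L"
    unfolding G_def using q_ge_2 by (intro tendsto_mult tendsto_const tendsto_prod gprob_tendsto) auto
  hence Alim: "A \<longlonglongrightarrow> ?L" by (simp add: A_def[abs_def])
  have Clim: "(\<lambda>s. C * (1/2::real) ^ s) \<longlonglongrightarrow> 0"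
    using tendsto_mult_right[OF LIMSEQ_power_zero[of "1/2::real"], of C] by (simp add: mult.commute)
  show ?thesis
  proof (rule tendstoI)
    fix e :: real assume e: "e > 0"
    have "eventually (\<lambda>s. dist (A s) ?L < e / 2) sequentially" using Alim e by (intro tendstoD) auto
    moreover have "eventually (\<lambda>s. C * (1/2::real) ^ s < e / 2) sequentially"
      using Clim e by (intro order_tendstoD) auto
    ultimately have "eventually (\<lambda>s. dist (A s) ?L < e / 2 \<and> C * (1/2::real) ^ s < e / 2) sequentially"
      by (rule eventually_conj)
    then obtain s where s: "dist (A s) ?L < e / 2" "C * (1/2::real) ^ s < e / 2"
      unfolding eventually_sequentially by blast
    show "eventually (\<lambda>n. dist (?P n) ?L < e) sequentially"
      using approx[of s]
    proof eventually_elim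
      case (elim n)
      have "dist (?P n) ?L \<le> dist (?P n) (A s) + dist (A s) ?L" by (rule dist_triangle)
      also have "\<dots> < e / 2 + e / 2" using elim s by (intro add_strict_mono) (auto simp: dist_real_def)
      finally show ?case by simp
    qed
  qed
qed

end

theorem theorem3p2:
  fixes \<epsilon> :: "'a::{idom,countable} set \<Rightarrow> real"
    and p :: "nat \<Rightarrow> 'a set" and k :: nat
    and smul :: "'a \<Rightarrow> 'n::ab_group_add \<Rightarrow> 'n"
    and u :: nat
    and D :: "nat \<Rightarrow> nat \<times> nat \<Rightarrow> 'a pmf"
  assumes dedekind: "dedekind_domain TYPE('a)"
    and fin_quot: "\<And>J::'a set. ideal J \<Longrightarrow> J \<noteq> {0} \<Longrightarrow> J \<noteq> UNIV \<Longrightarrow> finite (quotient_set J)"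
    and eps_pos: "\<And>I. I \<in> ideals_I \<Longrightarrow> \<epsilon> I > 0"
    and p_prime: "\<And>i. i < k \<Longrightarrow> prime_ideal (p i) \<and> p i \<noteq> {0}"
    and p_inj: "inj_on p {..<k}"
    and N_module: "module smul"
    and N_finite: "finite (UNIV :: 'n set)"
    and N_ann: "\<exists>e. \<forall>a\<in>prod_pow_ideal p e k. \<forall>x. smul a x = 0"
    and u_pos: "u > 0"
    and balanced_entries: "\<And>n i j. i < n \<Longrightarrow> j < n + u \<Longrightarrow> balanced \<epsilon> (D n (i, j))"
  shows "(\<lambda>n. measure_pmf.prob (Pi_pmf ({..<n} \<times> {..<n + u}) 0 (D n))
                 {M. cok_tensor_iso p k n u smul M})
         \<longlonglongrightarrow> 1 / (real (card (module_auts smul)) * real (CARD('n)) ^ u)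
             * (\<Prod>i<k. \<Prod>j. 1 - 1 / real (card (quotient_set (p i))) ^ (u + j + 1))"
proof -
  interpret dp: dedekind_primes p k
    by unfold_locales (fact dedekind, erule fin_quot, assumption+, erule p_prime, rule p_inj)
  obtain e where e: "\<And>a x. a \<in> prod_pow_ideal p e k \<Longrightarrow> smul a x = 0" using N_ann by blast
  \<comment> \<open>The sum serves as a common bound for the exponents.\<close>
  define E where "E = (\<Sum>i<k. e i)"
  have "e i \<le> E" if "i < k" for i unfolding E_def using that by (intro member_le_sum) auto
  hence "dp.Q E \<subseteq> prod_pow_ideal p e k" by (rule dp.Q_subset_prod_pow)
  hence QE: "smul a x = 0" if "a \<in> dp.Q E" for a x using that e by blast
  obtain \<epsilon>0 where \<epsilon>0: "0 < \<epsilon>0" "\<epsilon>0 < 1" "\<And>d H a. balanced \<epsilon> d \<Longrightarrow> subgrp H \<Longrightarrow> dp.Q (Suc E) \<subseteq> H \<Longrightarrow> H \<noteq> UNIV \<Longrightarrow>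
       measure_pmf.prob d {x. x - a \<in> H} \<le> 1 - \<epsilon>0"
    by (rule dp.balanced_uniform[of \<epsilon> "Suc E"]) (erule eps_pos, rule that)
  interpret finite_module p k "balanced \<epsilon>" \<epsilon>0 E smul
    by unfold_locales (fact \<epsilon>0(1), fact \<epsilon>0(2), erule (3) \<epsilon>0(3), (rule module.scale_right_distrib[OF N_module]
      module.scale_left_distrib[OF N_module] module.scale_scale[OF N_module] module.scale_one[OF N_module])+, fact N_finite, erule QE)
  show ?thesis using cok_prob_tendsto[of u D, OF balanced_entries] unfolding dp.q_def by simp
qed

end
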